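(* Let $n\ge1$ and $0<\varepsilon<1$. Given a gate $S_x:\ |y\rangle|\phi\rangle\mapsto|y\rangle\,R_{\mathrm z}\!\left(\frac{2\pi x}{2^n}y\right)|\phi\rangle$ for computational basis states $|y\rangle$, $y\in\{0,\dots,2^n-1\}$, and one-qubit states $|\phi\rangle$, where $x\in\mathbb Z_{2^n}$ is unknown, one can determine $x$ with probability at least $1-\varepsilon$ by a quantum circuit with fan-out of constant depth and size $O\!\left(n\log\frac n\varepsilon\right)$ that uses the $S_x$ gate $O\!\left(n\log\frac n\varepsilon\right)$ times.
   Context: $R_{\mathrm z}(\alpha)=|0\rangle\langle0|+e^{i\alpha}|1\rangle\langle1|$. A quantum circuit is a sequence of layers of quantum gates; gates in one layer act on disjoint qubits. The size of a gate is the number of qubits it acts on, the depth of a circuit is its number of layers, and its size is the total size of its gates. A circuit may use ancilla qubits initialised to $|0\rangle$. The (unbounded) fan-out gate maps $|y_1\rangle\cdots|y_k\rangle|x\rangle\mapsto|y_1\oplus x\rangle\cdots|y_k\oplus x\rangle|x\rangle$, for any $k$, and counts as one gate. A quantum circuit with fan-out uses one-qubit gates, controlled-not gates and fan-out gates; here it may in addition use the black-box gate $S_x$, whose uses are counted separately. "Determine $x$" means that measuring the output qubits in the computational basis yields the binary expansion of $x$.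
   Formalization: The bound O(n log(n/ε)) is read as K·n·max(1, log₂(n/ε)) with one constant K for all n ≥ 1, 0 < ε < 1; this differs only for n = 1, ε > 1/2, where log(n/ε) tends to 0 as ε → 1 and the literal bound would allow no gate at all. *)

theory Defs
  imports Complex_Main
begin

text \<open>
  A computational basis state is a bit assignment \<open>b :: nat \<Rightarrow> bool\<close> (qubit \<open>q\<close> is in state \<open>|b q\<rangle>\<close>),
  and a state is given by its amplitudes in this basis. A circuit on \<open>N\<close> qubits only touches the
  qubits below \<open>N\<close>, so that only the \<open>2 ^ N\<close> assignments in \<open>basis N\<close> ever carry amplitude when it
  is started from \<open>zero_state\<close>.
\<close>

type_synonym qstate = "(nat \<Rightarrow> bool) \<Rightarrow> complex"

text \<open>A one-qubit operator: \<open>U r c\<close> is the entry \<open>\<langle>r| U |c\<rangle>\<close>.\<close>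

type_synonym qmat = "bool \<Rightarrow> bool \<Rightarrow> complex"

definition basis :: "nat \<Rightarrow> (nat \<Rightarrow> bool) set" where
  "basis N = {b. \<forall>q\<ge>N. \<not> b q}"

definition zero_state :: qstate where
  "zero_state b = (if b = (\<lambda>_. False) then 1 else 0)"

definition unitary1 :: "qmat \<Rightarrow> bool" where
  "unitary1 U \<longleftrightarrow> (\<forall>c d. (\<Sum>r\<in>UNIV. cnj (U r c) * U r d) = (if c = d then 1 else 0))"

definition rz :: "real \<Rightarrow> qmat" where
  "rz \<alpha> r c = (if r \<noteq> c then 0 else if r then cis \<alpha> else 1)"

text \<open>
  \<open>Black ys p\<close> is a use of the black-box gate, with the integer register \<open>ys\<close> (least significant
  qubit first) and the rotated qubit \<open>p\<close>. In \<open>CNot c t\<close> the target is \<open>t\<close>; in \<open>FanOut T c\<close> the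
  source is \<open>c\<close> and the targets are the qubits in \<open>T\<close>.
\<close>

datatype gate =
    One qmat nat
  | CNot nat nat
  | FanOut "nat set" nat
  | Black "nat list" nat

fun gate_qubits :: "gate \<Rightarrow> nat set" where
  "gate_qubits (One U q) = {q}"
| "gate_qubits (CNot c t) = {c, t}"
| "gate_qubits (FanOut T c) = insert c T"
| "gate_qubits (Black ys p) = insert p (set ys)"

fun gate_ok :: "nat \<Rightarrow> gate \<Rightarrow> bool" where
  "gate_ok n (One U q) \<longleftrightarrow> unitary1 U"
| "gate_ok n (CNot c t) \<longleftrightarrow> c \<noteq> t"
| "gate_ok n (FanOut T c) \<longleftrightarrow> c \<notin> T"
| "gate_ok n (Black ys p) \<longleftrightarrow> length ys = n \<and> distinct ys \<and> p \<notin> set ys"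

fun is_black :: "gate \<Rightarrow> bool" where
  "is_black (Black ys p) \<longleftrightarrow> True"
| "is_black _ \<longleftrightarrow> False"

definition reg_value :: "nat list \<Rightarrow> (nat \<Rightarrow> bool) \<Rightarrow> nat" where
  "reg_value ys b = (\<Sum>i<length ys. of_bool (b (ys ! i)) * 2 ^ i)"

definition apply1 :: "qmat \<Rightarrow> nat \<Rightarrow> qstate \<Rightarrow> qstate" where
  "apply1 U q \<psi> b = (\<Sum>c\<in>UNIV. U (b q) c * \<psi> (b(q := c)))"

text \<open>
  The controlled-not and fan-out gates permute the basis states by an involution \<open>\<pi>\<close>; hence the new
  amplitude at \<open>b\<close> is the old one at \<open>\<pi> b\<close>. The black-box gate applies to \<open>p\<close> the rotation selected
  by the value of \<open>ys\<close>, which does not involve \<open>p\<close>.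
\<close>

fun apply_gate :: "nat \<Rightarrow> nat \<Rightarrow> gate \<Rightarrow> qstate \<Rightarrow> qstate" where
  "apply_gate n x (One U q) \<psi> = apply1 U q \<psi>"
| "apply_gate n x (CNot c t) \<psi> = (\<lambda>b. \<psi> (b(t := (b t \<noteq> b c))))"
| "apply_gate n x (FanOut T c) \<psi> = (\<lambda>b. \<psi> (\<lambda>q. if q \<in> T then b q \<noteq> b c else b q))"
| "apply_gate n x (Black ys p) \<psi> =
     (\<lambda>b. apply1 (rz (2 * pi * real x / 2 ^ n * real (reg_value ys b))) p \<psi> b)"

text \<open>A circuit is its list of layers, the first layer being applied first.\<close>

type_synonym circuit = "gate list list"

definition circuit_ok :: "nat \<Rightarrow> nat \<Rightarrow> circuit \<Rightarrow> bool" where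
  "circuit_ok n N C \<longleftrightarrow>
     (\<forall>L\<in>set C. (\<forall>g\<in>set L. gate_ok n g \<and> gate_qubits g \<subseteq> {..<N})
       \<and> sorted_wrt (\<lambda>g h. gate_qubits g \<inter> gate_qubits h = {}) L)"

abbreviation depth :: "circuit \<Rightarrow> nat" where
  "depth \<equiv> length"

text \<open>Uses of the black-box gate count towards the depth, but not towards the size.\<close>

definition circuit_size :: "circuit \<Rightarrow> nat" where
  "circuit_size C = (\<Sum>g\<leftarrow>filter (\<lambda>g. \<not> is_black g) (concat C). card (gate_qubits g))"

definition black_uses :: "circuit \<Rightarrow> nat" where
  "black_uses C = length (filter is_black (concat C))"

definition run :: "nat \<Rightarrow> nat \<Rightarrow> circuit \<Rightarrow> qstate" where
  "run n x C = fold (apply_gate n x) (concat C) zero_state"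

definition prob_outcome :: "nat \<Rightarrow> nat list \<Rightarrow> bool list \<Rightarrow> qstate \<Rightarrow> real" where
  "prob_outcome N outs v \<psi> = (\<Sum>b\<in>{b \<in> basis N. map b outs = v}. (cmod (\<psi> b))\<^sup>2)"

definition binary_expansion :: "nat \<Rightarrow> nat \<Rightarrow> bool list" where
  "binary_expansion n x = map (bit x) [0..<n]"

text \<open>
  The circuit does not depend on \<open>x\<close>: only the meaning of the black-box gate does.
\<close>

definition determines :: "nat \<Rightarrow> real \<Rightarrow> nat \<Rightarrow> nat list \<Rightarrow> circuit \<Rightarrow> bool" where
  "determines n \<epsilon> N outs C \<longleftrightarrow>
     circuit_ok n N C \<and> length outs = n \<and> distinct outs \<and> set outs \<subseteq> {..<N} \<and>
     (\<forall>x<2 ^ n. prob_outcome N outs (binary_expansion n x) (run n x C) \<ge> 1 - \<epsilon>)"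

end

theory Submission
  imports Defs "HOL-Library.Nat_Bijection" "HOL-Library.Multiset"
begin

text \<open>
  Let \<open>l\<close> be about \<open>log (n / \<epsilon>)\<close>. The phases \<open>2 ^ k * x / 2 ^ n\<close> modulo 1 are treated in about \<open>n / l\<close> windows of \<open>l\<close>
  consecutive \<open>k\<close>, all in parallel. Each of the \<open>O(l)\<close> positions of a window is sampled \<open>s\<close> times, with \<open>s ^ 8\<close> about \<open>l\<close>,
  which makes all of them correct with probability at least 1/2. The phases of the samples are applied through the
  binary sums of the samples in groups of \<open>log s\<close> positions, which takes only \<open>O(l)\<close> uses of the black-box gate. The
  majorities give quarter values, and these give the signed digits of an estimate of the phase. A verification copy,
  rotated back by the estimate, passes with constant probability for a correct estimate and with probability
  \<open>O(\<epsilon> / n)\<close> for a wrong one. A random shift of the phase makes the passing probability independent of \<open>x\<close>, so that an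
  attenuator can set it to exactly 1/4; one step of amplitude amplification then leaves only the passing branch.
  If \<open>n \<le> l\<close>, there is no wrong branch at all, because the phases lie on the grid of the shift.
  The quarter values determine the bits of \<open>x\<close> up to carry chains through even quarter values. These are resolved
  by a search for the nearest odd quarter value in a two-level tree.
\<close>

section \<open>Bit assignments\<close>

text \<open>Every window must succeed with probability \<open>1 - O(\<epsilon> / n)\<close>, and
  constant depth excludes repeating a failed one. About \<open>l\<close> samples per position would
  achieve this directly, but the table lookups used for counting cost more than linearly in the
  number of samples. With few samples all processing may be polynomial in \<open>s\<close>, and
  \<open>s ^ 8 \<le> l\<close> keeps it within \<open>O(l ^ 2)\<close> gates per window.

  The remaining failure is removed by interference. One amplification step turns an amplitude
  \<open>sin a\<close> into \<open>sin (3 * a)\<close>, which is 1 at \<open>a = pi / 6\<close>,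
  that is at probability 1/4; any deviation leaves an error. The obstacle is that the passing
  probability depends on the unknown phase. As a function of the phase it is a trigonometric
  polynomial of known degree, and averaging over a finer grid of shifts keeps only its constant
  term. That term is at least \<open>1/2 * 1/2\<close>, one factor for the majorities and one for
  the verification, so attenuation can lower it to 1/4.

  Boolean work is done by phases: fan-out between Hadamard gates gives parities, and a disjunction
  of \<open>T\<close> bits is a combination of \<open>2 ^ T\<close> parities, which is affordable
  because \<open>T\<close> is the length of a counter.\<close>

definition asg :: "nat set \<Rightarrow> (nat \<Rightarrow> bool) set" where
  "asg S = {b. \<forall>q. b q \<longrightarrow> q \<in> S}"

text \<open>Such a \<open>K\<close> is a constant factor for every gate on \<open>S\<close>; the
  amplitude computations below consist largely in pulling such factors out of a layer.\<close>

definition indep :: "nat set \<Rightarrow> ((nat \<Rightarrow> bool) \<Rightarrow> 'a) \<Rightarrow> bool" where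
  "indep S K \<longleftrightarrow> (\<forall>b q v. q \<in> S \<longrightarrow> K (b(q := v)) = K b)"

lemma basis_eq_asg: "basis N = asg {..<N}"
  unfolding basis_def asg_def set_eq_iff mem_Collect_eq lessThan_iff by (meson not_le)

lemma asg_eq_image: "asg S = (\<lambda>A q. q \<in> A) ` Pow S"
proof
  show "asg S \<subseteq> (\<lambda>A q. q \<in> A) ` Pow S"
  proof
    fix b assume "b \<in> asg S"
    then have "{q. b q} \<in> Pow S" "b = (\<lambda>q. q \<in> {q. b q})" by (auto simp: asg_def)
    then show "b \<in> (\<lambda>A q. q \<in> A) ` Pow S" by blast
  qed
qed (auto simp: asg_def)

lemma finite_asg [simp]: "finite S \<Longrightarrow> finite (asg S)"
  by (simp add: asg_eq_image)

lemma asg_empty [simp]: "asg {} = {\<lambda>_. False}"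
  by (auto simp: asg_def)

lemma sum_asg_Un:
  fixes f :: "(nat \<Rightarrow> bool) \<Rightarrow> 'a::comm_monoid_add"
  assumes "S \<inter> T = {}"
  shows "sum f (asg (S \<union> T)) = (\<Sum>b\<in>asg S. \<Sum>a\<in>asg T. f (\<lambda>q. if q \<in> T then a q else b q))"
proof -
  have "(\<Sum>b\<in>asg S. \<Sum>a\<in>asg T. f (\<lambda>q. if q \<in> T then a q else b q))
      = (\<Sum>(b, a)\<in>asg S \<times> asg T. f (\<lambda>q. if q \<in> T then a q else b q))"
    by (simp add: sum.cartesian_product)
  also have "\<dots> = sum f (asg (S \<union> T))"
  proof (rule sum.reindex_bij_witness[of _ "\<lambda>c. (\<lambda>q. c q \<and> q \<notin> T, \<lambda>q. c q \<and> q \<in> T)"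
          "\<lambda>(b, a) q. if q \<in> T then a q else b q"], goal_cases)
    case (1 ba)
    have "(fst ba q \<and> q \<notin> T) = fst ba q" "(snd ba q \<and> q \<in> T) = snd ba q" for q
      using 1 assms by (auto simp: asg_def)
    then show ?case by (auto simp: split_beta prod_eq_iff fun_eq_iff)
  qed (use assms in \<open>auto simp: asg_def\<close>)
  finally show ?thesis ..
qed

lemma sum_asg_insert:
  fixes f :: "(nat \<Rightarrow> bool) \<Rightarrow> 'a::comm_monoid_add"
  assumes "q \<notin> S" "finite S"
  shows "sum f (asg (insert q S)) = (\<Sum>b\<in>asg S. f b + f (b(q := True)))"
proof -
  have *: "asg {q} = {\<lambda>_. False, (\<lambda>_. False)(q := True)}"
  proof -
    have "Pow {q} = {{}, {q}}" by auto
    moreover have "(\<lambda>p. p \<in> {q}) = (\<lambda>_. False)(q := True)" by (simp add: fun_eq_iff)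
    ultimately show ?thesis by (simp add: asg_eq_image)
  qed
  have ne: "(\<lambda>_. False) \<noteq> (\<lambda>_. False)(q := True)" by (metis fun_upd_same)
  have "sum f (asg (S \<union> {q})) = (\<Sum>b\<in>asg S. \<Sum>a\<in>asg {q}. f (\<lambda>q'. if q' \<in> {q} then a q' else b q'))"
    by (rule sum_asg_Un) (use assms in auto)
  also have "\<dots> = (\<Sum>b\<in>asg S. f b + f (b(q := True)))"
  proof (rule sum.cong[OF refl])
    fix b assume "b \<in> asg S"
    then have "\<not> b q" using assms by (auto simp: asg_def)
    then have 1: "(\<lambda>q'. if q' \<in> {q} then False else b q') = b" by auto
    have 2: "(\<lambda>q'. if q' \<in> {q} then ((\<lambda>_. False)(q := True)) q' else b q') = b(q := True)" by auto
    show "(\<Sum>a\<in>asg {q}. f (\<lambda>q'. if q' \<in> {q} then a q' else b q')) = f b + f (b(q := True))"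
      unfolding * using ne 1 2 by simp
  qed
  finally show ?thesis by simp
qed

text \<open>Distributivity, read as independence: it evaluates expectations of products over
  independently distributed bits.\<close>

lemma sum_asg_prod:
  fixes f :: "nat \<Rightarrow> bool \<Rightarrow> 'a::comm_semiring_1"
  assumes "finite S"
  shows "(\<Sum>a\<in>asg S. \<Prod>q\<in>S. f q (a q)) = (\<Prod>q\<in>S. f q False + f q True)"
  using assms
proof (induction S)
  case (insert p S)
  have "(\<Sum>a\<in>asg (insert p S). \<Prod>q\<in>insert p S. f q (a q))
      = (\<Sum>a\<in>asg S. (f p False + f p True) * (\<Prod>q\<in>S. f q (a q)))"
  proof (subst sum_asg_insert[OF insert(2,1)], rule sum.cong[OF refl])
    fix a assume "a \<in> asg S"
    then have "\<not> a p" using insert by (auto simp: asg_def)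
    moreover have "(\<Prod>q\<in>S. f q ((a(p := True)) q)) = (\<Prod>q\<in>S. f q (a q))"
      by (rule prod.cong) (use insert in auto)
    ultimately show "(\<Prod>q\<in>insert p S. f q (a q)) + (\<Prod>q\<in>insert p S. f q ((a(p := True)) q))
        = (f p False + f p True) * (\<Prod>q\<in>S. f q (a q))"
      using insert by (simp add: distrib_right)
  qed
  then show ?case using insert by (simp add: sum_distrib_left[symmetric])
qed auto

lemma indepD: "indep S K \<Longrightarrow> q \<in> S \<Longrightarrow> K (b(q := v)) = K b"
  by (simp add: indep_def)

text \<open>The coordinates in \<open>S\<close> are changed one at a time, which is where finiteness
  enters.\<close>

lemma indep_agree:
  assumes "indep S K" "finite S" "\<And>q. q \<notin> S \<Longrightarrow> b q = b' q"
  shows "K b = K b'"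
  using assms(2,1,3)
proof (induction S arbitrary: b)
  case empty
  then have "b = b'" by auto
  then show ?case by simp
next
  case (insert p S)
  have "K (b(p := b' p)) = K b'"
  proof (rule insert.IH)
    show "indep S K" using insert.prems(1) by (simp add: indep_def)
    fix q assume "q \<notin> S"
    then show "(b(p := b' p)) q = b' q" using insert.prems(2)[of q] by (cases "q = p") auto
  qed
  then show ?case using insert.prems(1) by (simp add: indep_def)
qed

lemma indep_const: "indep S (\<lambda>b. c)"
  by (simp add: indep_def)

lemma indep_prod: "(\<And>i. i \<in> I \<Longrightarrow> indep S (K i)) \<Longrightarrow> indep S (\<lambda>b. \<Prod>i\<in>I. K i b)"
  by (simp add: indep_def)

section \<open>One-qubit layers\<close>

definition supp :: "nat \<Rightarrow> qstate \<Rightarrow> bool" where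
  "supp M \<psi> \<longleftrightarrow> (\<forall>b. b \<notin> basis M \<longrightarrow> \<psi> b = 0)"

definition hmat :: qmat where
  "hmat r c = (if r \<and> c then - 1 else 1) / complex_of_real (sqrt 2)"

definition xmat :: qmat where
  "xmat r c = (if r = c then 0 else 1)"

definition adj :: "qmat \<Rightarrow> qmat" where
  "adj U r c = cnj (U c r)"

definition ones :: "(nat \<Rightarrow> qmat) \<Rightarrow> nat list \<Rightarrow> qstate \<Rightarrow> qstate" where
  "ones V qs = fold (\<lambda>q. apply1 (V q) q) qs"

lemma sqrt2_sq: "complex_of_real (sqrt 2) * complex_of_real (sqrt 2) = 2"
  by (metis of_real_mult of_real_numeral real_sqrt_mult_self abs_numeral)

text \<open>An opaque name: with \<open>sqrt\<close> hidden, pairs of Hadamard factors are collected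
  by \<open>rsqrt2_sq\<close> alone.\<close>

definition rsqrt2 :: complex where
  "rsqrt2 = 1 / complex_of_real (sqrt 2)"

lemma rsqrt2_sq: "rsqrt2 * (rsqrt2 * z) = z / 2"
proof -
  have "rsqrt2 * (rsqrt2 * z) = z / (complex_of_real (sqrt 2) * complex_of_real (sqrt 2))"
    by (simp add: rsqrt2_def)
  then show ?thesis by (simp only: sqrt2_sq)
qed

lemma hmat_eq: "hmat r c = (if r \<and> c then - rsqrt2 else rsqrt2)"
  by (simp add: hmat_def rsqrt2_def)

lemma apply1_eq:
  "apply1 U q \<psi> b = U (b q) False * \<psi> (b(q := False)) + U (b q) True * \<psi> (b(q := True))"
  by (simp add: apply1_def UNIV_bool add.commute)

lemma apply1_commute:
  "p \<noteq> q \<Longrightarrow> apply1 U p (apply1 V q \<psi>) = apply1 V q (apply1 U p \<psi>)"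
  by (rule ext) (simp add: apply1_eq fun_upd_twist[of p q] algebra_simps)

lemma apply1_indep:
  "indep {q} K \<Longrightarrow> apply1 U q (\<lambda>b. K b * \<psi> b) = (\<lambda>b. K b * apply1 U q \<psi> b)"
  by (rule ext) (simp add: apply1_eq indep_def algebra_simps)

lemma hmat_hmat: "apply1 hmat q (apply1 hmat q \<psi>) = \<psi>"
proof
  fix b
  show "apply1 hmat q (apply1 hmat q \<psi>) b = \<psi> b"
    by (cases "b q")
      (simp_all add: apply1_eq hmat_eq ring_distribs rsqrt2_sq fun_upd_idem)
qed

lemma unitary1_hmat: "unitary1 hmat"
  by (simp add: unitary1_def hmat_def UNIV_bool sqrt2_sq all_bool_eq)

lemma unitary1_xmat: "unitary1 xmat"
  by (simp add: unitary1_def xmat_def UNIV_bool all_bool_eq)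

lemma unitary1_rz: "unitary1 (rz \<alpha>)"
  by (simp add: unitary1_def rz_def UNIV_bool cis_cnj cis_mult all_bool_eq)

lemma unitary1_scalar: "unitary1 (\<lambda>r c. if r = c then cis \<alpha> else 0)"
  by (simp add: unitary1_def UNIV_bool cis_cnj cis_mult all_bool_eq)

lemma apply1_scalar: "apply1 (\<lambda>r c. if r = c then u else 0) q \<psi> = (\<lambda>b. u * \<psi> b)"
  by (rule ext) (auto simp: apply1_eq fun_upd_idem)

lemma apply1_rz: "apply1 (rz \<alpha>) q \<psi> = (\<lambda>b. cis (\<alpha> * of_bool (b q)) * \<psi> b)"
  by (rule ext) (auto simp: apply1_eq rz_def fun_upd_idem)

lemma apply1_xmat: "apply1 xmat q \<psi> = (\<lambda>b. \<psi> (b(q := \<not> b q)))"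
  by (rule ext) (auto simp: apply1_eq xmat_def)

lemma ones_Nil [simp]: "ones V [] \<psi> = \<psi>"
  by (simp add: ones_def)

lemma ones_Cons [simp]: "ones V (q # qs) \<psi> = ones V qs (apply1 (V q) q \<psi>)"
  by (simp add: ones_def)

lemma ones_apply1:
  "p \<notin> set qs \<Longrightarrow> ones V qs (apply1 U p \<psi>) = apply1 U p (ones V qs \<psi>)"
proof (induction qs arbitrary: \<psi>)
  case (Cons q qs)
  then have "p \<noteq> q" by auto
  then show ?case using Cons by (simp add: apply1_commute[of p q, symmetric])
qed auto

lemma ones_indep:
  "indep (set qs) K \<Longrightarrow> ones V qs (\<lambda>b. K b * \<psi> b) = (\<lambda>b. K b * ones V qs \<psi> b)"
proof (induction qs arbitrary: \<psi>)
  case (Cons q qs)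
  have "indep {q} K" "indep (set qs) K" using Cons.prems by (auto simp: indep_def)
  then show ?case using Cons.IH by (simp add: apply1_indep)
qed auto

lemma ones_hmat_hmat:
  "distinct qs \<Longrightarrow> ones (\<lambda>_. hmat) qs (ones (\<lambda>_. hmat) qs \<psi>) = \<psi>"
  by (induction qs arbitrary: \<psi>) (auto simp: ones_apply1 hmat_hmat)

text \<open>Here \<open>f q b u\<close> is the amplitude of the value \<open>u\<close> at
  \<open>q\<close>, given the qubits outside \<open>qs\<close>. A parallel layer acts on each factor
  of such a conditional product separately, because the other factors are constants for the gate at
  \<open>q\<close>.\<close>

lemma ones_prod:
  assumes "distinct qs" "indep (set qs) K" "\<And>q v. q \<in> set qs \<Longrightarrow> indep (set qs) (\<lambda>b. f q b v)"
  shows "ones V qs (\<lambda>b. K b * (\<Prod>q\<in>set qs. f q b (b q)))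
       = (\<lambda>b. K b * (\<Prod>q\<in>set qs. V q (b q) False * f q b False + V q (b q) True * f q b True))"
  using assms
proof (induction qs arbitrary: K)
  case (Cons q qs)
  define K' where "K' = (\<lambda>b. K b * (V q (b q) False * f q b False + V q (b q) True * f q b True))"
  have q: "q \<notin> set qs" using Cons.prems by simp
  have i1: "indep {q} (\<lambda>b. K b * (\<Prod>p\<in>set qs. f p b (b p)))"
    unfolding indep_def
  proof (intro allI impI)
    fix b p v assume "p \<in> {q}"
    then have p: "p = q" by simp
    have "(\<Prod>p\<in>set qs. f p (b(q := v)) ((b(q := v)) p)) = (\<Prod>p\<in>set qs. f p b (b p))"
    proof (rule prod.cong[OF refl])
      fix p assume "p \<in> set qs"
      then show "f p (b(q := v)) ((b(q := v)) p) = f p b (b p)"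
        using q Cons.prems(3)[of p "b p"] by (auto simp: indep_def)
    qed
    then show "K (b(p := v)) * (\<Prod>pa\<in>set qs. f pa (b(p := v)) ((b(p := v)) pa))
        = K b * (\<Prod>p\<in>set qs. f p b (b p))"
      using Cons.prems(2) p by (simp add: indep_def)
  qed
  have "apply1 (V q) q (\<lambda>b. K b * (\<Prod>p\<in>set (q # qs). f p b (b p)))
      = apply1 (V q) q (\<lambda>b. (K b * (\<Prod>p\<in>set qs. f p b (b p))) * f q b (b q))"
    using q by (simp add: mult_ac)
  also have "\<dots> = (\<lambda>b. (K b * (\<Prod>p\<in>set qs. f p b (b p))) * apply1 (V q) q (\<lambda>b. f q b (b q)) b)"
    by (rule apply1_indep[OF i1])
  also have "\<dots> = (\<lambda>b. K' b * (\<Prod>p\<in>set qs. f p b (b p)))"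
  proof
    fix b
    have "f q (b(q := v)) v' = f q b v'" for v v'
      using Cons.prems(3)[of q v'] by (auto simp: indep_def)
    then show "K b * (\<Prod>p\<in>set qs. f p b (b p)) * apply1 (V q) q (\<lambda>b. f q b (b q)) b
        = K' b * (\<Prod>p\<in>set qs. f p b (b p))"
      by (simp add: apply1_eq K'_def mult_ac)
  qed
  finally have 1: "apply1 (V q) q (\<lambda>b. K b * (\<Prod>p\<in>set (q # qs). f p b (b p)))
      = (\<lambda>b. K' b * (\<Prod>p\<in>set qs. f p b (b p)))" .
  have "ones V qs (\<lambda>b. K' b * (\<Prod>p\<in>set qs. f p b (b p)))
      = (\<lambda>b. K' b * (\<Prod>q\<in>set qs. V q (b q) False * f q b False + V q (b q) True * f q b True))"
  proof (rule Cons.IH)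
    show "distinct qs" using Cons.prems by simp
    show "indep (set qs) K'"
      using Cons.prems(2) Cons.prems(3)[of q] q by (auto simp: K'_def indep_def)
    show "indep (set qs) (\<lambda>b. f p b v)" if "p \<in> set qs" for p v
      using Cons.prems(3)[of p v] that by (auto simp: indep_def)
  qed
  then show ?case using 1 q by (simp add: K'_def mult_ac)
qed auto

text \<open>\<open>HZH = X\<close> in controlled form: a sign conditioned on \<open>t\<close> and
  \<open>f t\<close>, placed between Hadamard gates on \<open>t\<close>, flips \<open>t\<close> when
  \<open>f t\<close> holds. This converts phases into computed bits. All targets are served at once
  because no \<open>f t\<close> reads a target.\<close>

lemma ones_hmat_phase:
  assumes "distinct ts" "\<And>t. t \<in> set ts \<Longrightarrow> indep (set ts) (f t)"
  shows "ones (\<lambda>_. hmat) ts (\<lambda>b. cis (\<Sum>t\<in>set ts. pi * of_bool (b t \<and> f t b)) * ones (\<lambda>_. hmat) ts \<psi> b)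
       = (\<lambda>b. \<psi> (\<lambda>q. if q \<in> set ts then b q \<noteq> f q b else b q))"
  using assms
proof (induction ts arbitrary: \<psi>)
  case (Cons t ts)
  define X where "X = (\<lambda>\<chi>::qstate. \<lambda>b. \<chi> (b(t := (b t \<noteq> f t b))))"
  have t: "t \<notin> set ts" and d: "distinct ts" using Cons.prems by auto
  have ft: "f t (b(q := v)) = f t b" if "q = t \<or> q \<in> set ts" for b q v
    using Cons.prems(2)[of t] that by (auto simp: indep_def)
  have H: "apply1 hmat t (\<lambda>b. cis (pi * of_bool (b t \<and> f t b)) * apply1 hmat t \<chi> b) = X \<chi>" for \<chi>
  proof
    fix b
    have f1: "f t (b(t := v)) = f t b" for v by (rule ft) simp
    show "apply1 hmat t (\<lambda>b. cis (pi * of_bool (b t \<and> f t b)) * apply1 hmat t \<chi> b) b = X \<chi> b"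
      by (cases "b t"; cases "f t b")
        (simp_all add: apply1_eq hmat_eq X_def f1 ring_distribs rsqrt2_sq fun_upd_idem)
  qed
  have XC: "X (apply1 hmat q \<chi>) = apply1 hmat q (X \<chi>)" if "q \<in> set ts" for q \<chi>
  proof
    fix b
    have "q \<noteq> t" using that t by auto
    then show "X (apply1 hmat q \<chi>) b = apply1 hmat q (X \<chi>) b"
      using that by (simp add: X_def apply1_eq ft fun_upd_twist[of t q])
  qed
  have XO: "set qs \<subseteq> set ts \<Longrightarrow> X (ones (\<lambda>_. hmat) qs \<chi>) = ones (\<lambda>_. hmat) qs (X \<chi>)" for qs \<chi>
    by (induction qs arbitrary: \<chi>) (auto simp: XC)
  define P where "P = (\<lambda>b. cis (\<Sum>s\<in>set ts. pi * of_bool (b s \<and> f s b)))"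
  have iP: "indep {t} P"
    unfolding indep_def P_def
  proof (intro allI impI arg_cong[of _ _ cis] sum.cong refl)
    fix b q v s assume "q \<in> {t}" and s: "s \<in> set ts"
    then have "f s (b(q := v)) = f s b" "(b(q := v)) s = b s"
      using Cons.prems(2)[of s] t by (auto simp: indep_def)
    then show "pi * of_bool ((b(q := v)) s \<and> f s (b(q := v))) = pi * of_bool (b s \<and> f s b)" by simp
  qed
  have "cis (\<Sum>s\<in>set (t # ts). pi * of_bool (b s \<and> f s b)) * ones (\<lambda>_. hmat) (t # ts) \<psi> b
      = P b * (cis (pi * of_bool (b t \<and> f t b)) * apply1 hmat t (ones (\<lambda>_. hmat) ts \<psi>) b)" for b
  proof -
    have "(\<Sum>s\<in>set (t # ts). pi * of_bool (b s \<and> f s b))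
        = (\<Sum>s\<in>set ts. pi * of_bool (b s \<and> f s b)) + pi * of_bool (b t \<and> f t b)"
      using t by (simp only: list.set sum.insert[OF finite_set t] add.commute)
    then show ?thesis
      by (simp only: P_def cis_mult[symmetric] ones_Cons ones_apply1[OF t] mult.assoc)
  qed
  then have "ones (\<lambda>_. hmat) (t # ts) (\<lambda>b. cis (\<Sum>s\<in>set (t # ts). pi * of_bool (b s \<and> f s b)) *
      ones (\<lambda>_. hmat) (t # ts) \<psi> b)
    = ones (\<lambda>_. hmat) ts (\<lambda>b. P b * X (ones (\<lambda>_. hmat) ts \<psi>) b)"
    by (simp add: apply1_indep[OF iP] H)
  also have "\<dots> = ones (\<lambda>_. hmat) ts (\<lambda>b. P b * ones (\<lambda>_. hmat) ts (X \<psi>) b)"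
    by (simp add: XO)
  also have "\<dots> = (\<lambda>b. X \<psi> (\<lambda>q. if q \<in> set ts then b q \<noteq> f q b else b q))"
    unfolding P_def by (rule Cons.IH[OF d]) (use Cons.prems(2) in \<open>auto simp: indep_def\<close>)
  also have "\<dots> = (\<lambda>b. \<psi> (\<lambda>q. if q \<in> set (t # ts) then b q \<noteq> f q b else b q))"
  proof
    fix b
    have "f t (\<lambda>q. if q \<in> set ts then b q \<noteq> f q b else b q) = f t b"
      by (rule indep_agree[OF Cons.prems(2)[of t]]) auto
    then show "X \<psi> (\<lambda>q. if q \<in> set ts then b q \<noteq> f q b else b q)
      = \<psi> (\<lambda>q. if q \<in> set (t # ts) then b q \<noteq> f q b else b q)"
      using t unfolding X_def by (intro arg_cong[of _ _ \<psi>]) (auto simp: fun_eq_iff)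
  qed
  finally show ?case .
qed auto

section \<open>Circuits that implement operators\<close>

text \<open>The qubits below \<open>M\<close> are visible, those from \<open>M\<close> to
  \<open>N\<close> are ancillas: they start at zero and, since \<open>F x \<psi>\<close> is again
  supported on \<open>M\<close> qubits, end at zero. The circuit is chosen before \<open>x\<close>,
  so \<open>F\<close> may depend on \<open>x\<close> only through the black-box gate.\<close>

definition impl :: "nat \<Rightarrow> nat \<Rightarrow> nat \<Rightarrow> nat \<Rightarrow> nat \<Rightarrow> (nat \<Rightarrow> qstate \<Rightarrow> qstate) \<Rightarrow> bool" where
  "impl n M d sz bk F \<longleftrightarrow> (\<exists>N C. M \<le> N \<and> circuit_ok n N C \<and> depth C \<le> d \<and> circuit_size C \<le> sz
     \<and> black_uses C \<le> bk
     \<and> (\<forall>x \<psi>. supp M \<psi> \<longrightarrow> fold (apply_gate n x) (concat C) \<psi> = F x \<psi> \<and> supp M (F x \<psi>)))"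

lemma circuit_ok_mono:
  assumes "circuit_ok n N C" "N \<le> N'"
  shows "circuit_ok n N' C"
  unfolding circuit_ok_def
proof (intro ballI conjI)
  fix L g assume "L \<in> set C" "g \<in> set L"
  then have "gate_ok n g" "gate_qubits g \<subseteq> {..<N}" using assms(1) by (auto simp: circuit_ok_def)
  then show "gate_ok n g" "gate_qubits g \<subseteq> {..<N'}" using assms(2) by auto
qed (use assms(1) in \<open>auto simp: circuit_ok_def\<close>)

lemma circuit_ok_append: "circuit_ok n N C \<Longrightarrow> circuit_ok n N D \<Longrightarrow> circuit_ok n N (C @ D)"
  unfolding circuit_ok_def by auto

lemma circuit_size_append: "circuit_size (C @ D) = circuit_size C + circuit_size D"
  by (simp add: circuit_size_def)

lemma black_uses_append: "black_uses (C @ D) = black_uses C + black_uses D"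
  by (simp add: black_uses_def)

text \<open>Ancillas are returned clean, so both circuits may use the same ones; hence the maximum
  of the two widths.\<close>

lemma impl_comp:
  assumes "impl n M d1 s1 k1 F" "impl n M d2 s2 k2 G"
  shows "impl n M (d1 + d2) (s1 + s2) (k1 + k2) (\<lambda>x \<psi>. G x (F x \<psi>))"
proof -
  obtain N1 C1 where 1: "M \<le> N1" "circuit_ok n N1 C1" "depth C1 \<le> d1" "circuit_size C1 \<le> s1"
    "black_uses C1 \<le> k1"
    "\<And>x \<psi>. supp M \<psi> \<Longrightarrow> fold (apply_gate n x) (concat C1) \<psi> = F x \<psi> \<and> supp M (F x \<psi>)"
    using assms(1) unfolding impl_def by blast
  obtain N2 C2 where 2: "M \<le> N2" "circuit_ok n N2 C2" "depth C2 \<le> d2" "circuit_size C2 \<le> s2"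
    "black_uses C2 \<le> k2"
    "\<And>x \<psi>. supp M \<psi> \<Longrightarrow> fold (apply_gate n x) (concat C2) \<psi> = G x \<psi> \<and> supp M (G x \<psi>)"
    using assms(2) unfolding impl_def by blast
  have "circuit_ok n (max N1 N2) (C1 @ C2)"
    by (intro circuit_ok_append circuit_ok_mono[OF 1(2)] circuit_ok_mono[OF 2(2)]) auto
  then show ?thesis unfolding impl_def
  proof (intro exI conjI allI impI)
    show "M \<le> max N1 N2" using 1(1) by linarith
    show "depth (C1 @ C2) \<le> d1 + d2" using 1(3) 2(3) by simp
    show "circuit_size (C1 @ C2) \<le> s1 + s2" using 1(4) 2(4) by (simp add: circuit_size_append)
    show "black_uses (C1 @ C2) \<le> k1 + k2" using 1(5) 2(5) by (simp add: black_uses_append)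
    fix x \<psi> assume "supp M \<psi>"
    note a = 1(6)[OF this, of x]
    note b = 2(6)[OF conjunct2[OF a], of x]
    show "fold (apply_gate n x) (concat (C1 @ C2)) \<psi> = G x (F x \<psi>)" using a b by simp
    show "supp M (G x (F x \<psi>))" using b by simp
  qed
qed

lemma impl_weaken:
  assumes "impl n M d sz bk F" "d \<le> d'" "sz \<le> sz'" "bk \<le> bk'"
    "\<And>x \<psi>. supp M \<psi> \<Longrightarrow> F x \<psi> = F' x \<psi>"
  shows "impl n M d' sz' bk' F'"
proof -
  obtain N C where 1: "M \<le> N" "circuit_ok n N C" "depth C \<le> d" "circuit_size C \<le> sz"
    "black_uses C \<le> bk"
    "\<And>x \<psi>. supp M \<psi> \<Longrightarrow> fold (apply_gate n x) (concat C) \<psi> = F x \<psi> \<and> supp M (F x \<psi>)"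
    using assms(1) unfolding impl_def by blast
  show ?thesis unfolding impl_def
  proof (intro exI conjI allI impI)
    show "depth C \<le> d'" "circuit_size C \<le> sz'" "black_uses C \<le> bk'"
      using 1 assms(2-4) by linarith+
    show "fold (apply_gate n x) (concat C) \<psi> = F' x \<psi>" "supp M (F' x \<psi>)" if "supp M \<psi>" for x \<psi>
      using 1(6)[OF that] assms(5)[OF that] by simp_all
  qed (use 1 in auto)
qed

lemma supp_mono: "supp M \<psi> \<Longrightarrow> M \<le> N \<Longrightarrow> supp N \<psi>"
  unfolding supp_def basis_def mem_Collect_eq by (meson order_trans)

text \<open>Declares the qubits from \<open>M\<close> to \<open>N\<close> to be ancillas. Every
  construction with explicit work qubits ends with this step.\<close>

lemma impl_restrict:
  assumes "impl n N d sz bk F" "M \<le> N"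
    "\<And>x \<psi>. supp M \<psi> \<Longrightarrow> F x \<psi> = F' x \<psi>" "\<And>x \<psi>. supp M \<psi> \<Longrightarrow> supp M (F' x \<psi>)"
  shows "impl n M d sz bk F'"
proof -
  obtain N1 C1 where 1: "N \<le> N1" "circuit_ok n N1 C1" "depth C1 \<le> d" "circuit_size C1 \<le> sz"
    "black_uses C1 \<le> bk"
    "\<And>x \<psi>. supp N \<psi> \<Longrightarrow> fold (apply_gate n x) (concat C1) \<psi> = F x \<psi> \<and> supp N (F x \<psi>)"
    using assms(1) unfolding impl_def by blast
  show ?thesis unfolding impl_def
  proof (intro exI conjI allI impI)
    show "M \<le> N1" using 1 assms(2) by linarith
    show "fold (apply_gate n x) (concat C1) \<psi> = F' x \<psi>" "supp M (F' x \<psi>)" if "supp M \<psi>" for x \<psi>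
      using 1(6)[OF supp_mono[OF that assms(2)]] assms(3,4)[OF that] by simp_all
  qed (use 1 in auto)
qed

lemma impl_id: "impl n M 0 0 0 (\<lambda>x \<psi>. \<psi>)"
  unfolding impl_def
  by (intro exI[of _ M] exI[of _ "[]"]) (auto simp: circuit_ok_def circuit_size_def black_uses_def)

lemma not_basis_iff: "b \<notin> basis M \<longleftrightarrow> (\<exists>q\<ge>M. b q)"
  by (auto simp: basis_def)

lemma supp_apply1: "supp M \<psi> \<Longrightarrow> q < M \<Longrightarrow> supp M (apply1 U q \<psi>)"
  unfolding supp_def not_basis_iff
proof (intro allI impI)
  fix b :: "nat \<Rightarrow> bool"
  assume a: "\<forall>b. (\<exists>q\<ge>M. b q) \<longrightarrow> \<psi> b = 0" "q < M" "\<exists>q\<ge>M. b q"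
  then obtain p where "p \<ge> M" "b p" by blast
  then have "(b(q := v)) p" for v using a(2) by auto
  then have "\<psi> (b(q := v)) = 0" for v using a(1) \<open>p \<ge> M\<close> by blast
  then show "apply1 U q \<psi> b = 0" by (simp add: apply1_eq)
qed

lemma supp_relabel: "supp M \<psi> \<Longrightarrow> (\<And>b q. q \<ge> M \<Longrightarrow> f b q = b q) \<Longrightarrow> supp M (\<lambda>b. \<psi> (f b))"
  unfolding supp_def not_basis_iff by metis

lemma supp_mult: "supp M \<psi> \<Longrightarrow> supp M (\<lambda>b. u b * \<psi> b)"
  unfolding supp_def by simp

lemma supp_apply_gate:
  assumes "supp M \<psi>" "gate_qubits g \<subseteq> {..<M}"
  shows "supp M (apply_gate n x g \<psi>)"
proof (cases g)
  case (One U q)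
  then show ?thesis using assms supp_apply1[of M \<psi> q U] by simp
next
  case (CNot c t)
  then show ?thesis using assms(2)
    by (auto simp: nat_less_le intro!: supp_relabel[OF assms(1)])
next
  case (FanOut T c)
  then show ?thesis using assms(2)
    by (auto intro!: supp_relabel[OF assms(1)])
next
  case (Black ys p)
  have "(apply_gate n x g \<psi>) b = 0" if "b \<notin> basis M" for b
    using supp_apply1[OF assms(1), of p] Black assms(2) that by (auto simp: supp_def)
  then show ?thesis by (simp add: supp_def)
qed

lemma supp_fold_gates:
  assumes "supp M \<psi>" "\<And>g. g \<in> set L \<Longrightarrow> gate_qubits g \<subseteq> {..<M}"
  shows "supp M (fold (apply_gate n x) L \<psi>)"
  using assms
proof (induction L arbitrary: \<psi>)
  case (Cons g L)
  then have "supp M (apply_gate n x g \<psi>)" by (intro supp_apply_gate) auto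
  then show ?case using Cons.IH Cons.prems(2) by simp
qed simp

lemma impl_layer:
  assumes "\<And>g. g \<in> set L \<Longrightarrow> gate_ok n g \<and> gate_qubits g \<subseteq> {..<M}"
    "sorted_wrt (\<lambda>g h. gate_qubits g \<inter> gate_qubits h = {}) L"
    "\<And>x \<psi>. supp M \<psi> \<Longrightarrow> fold (apply_gate n x) L \<psi> = F x \<psi>"
    "(\<Sum>g\<leftarrow>filter (\<lambda>g. \<not> is_black g) L. card (gate_qubits g)) \<le> sz"
    "length (filter is_black L) \<le> bk"
  shows "impl n M 1 sz bk F"
  unfolding impl_def
  by (intro exI[of _ M] exI[of _ "[L]"])
    (use assms supp_fold_gates[of M _ L n] in
      \<open>auto simp: circuit_ok_def circuit_size_def black_uses_def\<close>)

lemma sorted_wrt_distinct: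
  assumes "distinct xs" "\<And>x y. x \<in> set xs \<Longrightarrow> y \<in> set xs \<Longrightarrow> x \<noteq> y \<Longrightarrow> R x y"
  shows "sorted_wrt R xs"
  using assms by (induction xs) auto

lemma filter_False_id: "(\<And>x. x \<in> set xs \<Longrightarrow> P x) \<Longrightarrow> filter P xs = xs"
  by (simp add: filter_id_conv)

lemma impl_ones:
  assumes "distinct qs" "set qs \<subseteq> {..<M}" "\<And>q. q \<in> set qs \<Longrightarrow> unitary1 (V q)"
  shows "impl n M 1 (length qs) 0 (\<lambda>x. ones V qs)"
proof (rule impl_layer[where L = "map (\<lambda>q. One (V q) q) qs"])
  show "sorted_wrt (\<lambda>g h. gate_qubits g \<inter> gate_qubits h = {}) (map (\<lambda>q. One (V q) q) qs)"
    unfolding sorted_wrt_map by (rule sorted_wrt_distinct[OF assms(1)]) auto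
  show "fold (apply_gate n x) (map (\<lambda>q. One (V q) q) qs) \<psi> = ones V qs \<psi>" for x \<psi>
    by (simp add: ones_def fold_map comp_def apply_gate.simps(1)[abs_def])
  have "filter (\<lambda>g. \<not> is_black g) (map (\<lambda>q. One (V q) q) qs) = map (\<lambda>q. One (V q) q) qs"
    by (rule filter_False_id) auto
  then show "(\<Sum>g\<leftarrow>filter (\<lambda>g. \<not> is_black g) (map (\<lambda>q. One (V q) q) qs). card (gate_qubits g))
      \<le> length qs"
    by (simp add: comp_def sum_list_triv)
  show "length (filter is_black (map (\<lambda>q. One (V q) q) qs)) \<le> 0"
    by (simp add: filter_empty_conv)
qed (use assms in auto)

section \<open>Layers of fan-out gates\<close>

definition fan1 :: "nat set \<Rightarrow> nat \<Rightarrow> qstate \<Rightarrow> qstate" where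
  "fan1 T c \<psi> = (\<lambda>b. \<psi> (\<lambda>q. if q \<in> T then b q \<noteq> b c else b q))"

definition fans :: "(nat set \<times> nat) list \<Rightarrow> qstate \<Rightarrow> qstate" where
  "fans gs = fold (\<lambda>g. fan1 (fst g) (snd g)) gs"

definition fan_disj :: "(nat set \<times> nat) list \<Rightarrow> bool" where
  "fan_disj gs \<longleftrightarrow> (\<forall>g\<in>set gs. snd g \<notin> fst g) \<and>
     sorted_wrt (\<lambda>g h. insert (snd g) (fst g) \<inter> insert (snd h) (fst h) = {}) gs"

lemma impl_fans:
  assumes "fan_disj gs" "\<And>g. g \<in> set gs \<Longrightarrow> finite (fst g) \<and> insert (snd g) (fst g) \<subseteq> {..<M}"
  shows "impl n M 1 (\<Sum>g\<leftarrow>gs. card (fst g) + 1) 0 (\<lambda>x. fans gs)"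
proof (rule impl_layer[where L = "map (\<lambda>g. FanOut (fst g) (snd g)) gs"])
  show "gate_ok n g \<and> gate_qubits g \<subseteq> {..<M}"
    if "g \<in> set (map (\<lambda>g. FanOut (fst g) (snd g)) gs)" for g
    using that assms by (fastforce simp: fan_disj_def)
  show "sorted_wrt (\<lambda>g h. gate_qubits g \<inter> gate_qubits h = {}) (map (\<lambda>g. FanOut (fst g) (snd g)) gs)"
    using assms(1) unfolding sorted_wrt_map fan_disj_def gate_qubits.simps by blast
  show "fold (apply_gate n x) (map (\<lambda>g. FanOut (fst g) (snd g)) gs) \<psi> = fans gs \<psi>" for x \<psi>
    unfolding fans_def fold_map by (rule fold_cong) (auto simp: fan1_def fun_eq_iff)
  have "filter (\<lambda>g. \<not> is_black g) (map (\<lambda>g. FanOut (fst g) (snd g)) gs)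
      = map (\<lambda>g. FanOut (fst g) (snd g)) gs"
    by (rule filter_False_id) auto
  moreover have "(\<Sum>g\<leftarrow>gs. card (gate_qubits (FanOut (fst g) (snd g)))) \<le> (\<Sum>g\<leftarrow>gs. card (fst g) + 1)"
    by (rule sum_list_mono) (use assms in \<open>auto simp: fan_disj_def\<close>)
  ultimately show "(\<Sum>g\<leftarrow>filter (\<lambda>g. \<not> is_black g) (map (\<lambda>g. FanOut (fst g) (snd g)) gs). card (gate_qubits g))
      \<le> (\<Sum>g\<leftarrow>gs. card (fst g) + 1)"
    by (simp only: map_map comp_def)
  show "length (filter is_black (map (\<lambda>g. FanOut (fst g) (snd g)) gs)) \<le> 0"
    by (auto simp: filter_empty_conv)
qed

text \<open>The gates are disjoint and no source is a target, so every gate reads an original value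
  and each qubit is changed by at most one gate.\<close>

lemma fans_relabel:
  assumes "fan_disj gs"
  shows "fans gs \<psi> = (\<lambda>b. \<psi> (\<lambda>q. b q \<noteq> (\<exists>g\<in>set gs. q \<in> fst g \<and> b (snd g))))"
  using assms
proof (induction gs arbitrary: \<psi>)
  case (Cons g gs)
  obtain T c where g: "g = (T, c)" by (cases g)
  have dis: "insert c T \<inter> insert (snd h) (fst h) = {}" if "h \<in> set gs" for h
    using Cons.prems that by (auto simp: g fan_disj_def)
  have IH: "fans gs \<chi> = (\<lambda>b. \<chi> (\<lambda>q. b q \<noteq> (\<exists>g\<in>set gs. q \<in> fst g \<and> b (snd g))))" for \<chi>
    by (rule Cons.IH) (use Cons.prems in \<open>simp add: fan_disj_def\<close>)
  show ?case
  proof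
    fix b
    let ?b = "\<lambda>q. b q \<noteq> (\<exists>g\<in>set gs. q \<in> fst g \<and> b (snd g))"
    have 1: "\<not> (\<exists>g\<in>set gs. q \<in> fst g \<and> b (snd g))" if "q \<in> insert c T" for q
      using dis that by blast
    then have c: "?b c = b c" by blast
    have eq: "(\<lambda>q. if q \<in> T then ?b q \<noteq> ?b c else ?b q)
        = (\<lambda>q. b q \<noteq> (\<exists>g\<in>set (g # gs). q \<in> fst g \<and> b (snd g)))" (is "?l = ?r")
    proof
      fix q show "?l q = ?r q"
      proof (cases "q \<in> T")
        case True
        then have "\<not> (\<exists>g\<in>set gs. q \<in> fst g \<and> b (snd g))" using 1 by blast
        then show ?thesis using True c by (simp add: g)
      qed (simp add: g)
    qed
    have "fans (g # gs) \<psi> b = fan1 T c \<psi> ?b" by (simp add: fans_def g IH[unfolded fans_def])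
    also have "\<dots> = \<psi> (\<lambda>q. if q \<in> T then ?b q \<noteq> ?b c else ?b q)" by (simp only: fan1_def)
    finally show "fans (g # gs) \<psi> b = \<psi> (\<lambda>q. b q \<noteq> (\<exists>g\<in>set (g # gs). q \<in> fst g \<and> b (snd g)))"
      by (simp only: eq)
  qed
qed (simp add: fans_def)

definition cnot :: "nat \<Rightarrow> nat \<Rightarrow> qstate \<Rightarrow> qstate" where
  "cnot c t \<psi> = (\<lambda>b. \<psi> (b(t := (b t \<noteq> b c))))"

lemma fan1_cnots:
  "distinct ts \<Longrightarrow> c \<notin> set ts \<Longrightarrow> fan1 (set ts) c \<psi> = fold (cnot c) ts \<psi>"
proof (induction ts arbitrary: \<psi>)
  case (Cons t ts)
  have "fold (cnot c) ts (cnot c t \<psi>) = fan1 (set ts) c (cnot c t \<psi>)"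
    using Cons by auto
  also have "\<dots> = fan1 (set (t # ts)) c \<psi>"
    unfolding fan1_def cnot_def
    by (rule ext, rule arg_cong[of _ _ \<psi>]) (use Cons.prems in \<open>auto simp: fun_eq_iff\<close>)
  finally show ?case by simp
qed (simp add: fan1_def)

text \<open>A controlled-not is a linear map over the field with two elements, and the Hadamard
  transform replaces it by its inverse transpose: control and target change places.\<close>

lemma hcnot:
  assumes "c \<noteq> t"
  shows "apply1 hmat c (apply1 hmat t (cnot c t (apply1 hmat t (apply1 hmat c \<psi>)))) = cnot t c \<psi>"
proof
  fix b :: "nat \<Rightarrow> bool"
  have e: "b(t := u, c := v) = b(c := v, t := u)" for u v
    using assms by (simp add: fun_upd_twist)
  have f: "rsqrt2 * (rsqrt2 * (rsqrt2 * (rsqrt2 * z))) = z / 4" for z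
    by (simp add: rsqrt2_sq)
  have i1: "b(c := b c) = b" "b(t := b t) = b" by auto
  show "apply1 hmat c (apply1 hmat t (cnot c t (apply1 hmat t (apply1 hmat c \<psi>)))) b = cnot t c \<psi> b"
    using assms assms[symmetric]
    by (cases "b c"; cases "b t")
      (simp_all add: apply1_eq hmat_eq cnot_def e f ring_distribs fun_upd_idem)
qed

lemma ones_hmat_cnot:
  assumes "distinct qs" "c \<in> set qs" "t \<in> set qs" "c \<noteq> t"
  shows "ones (\<lambda>_. hmat) qs (cnot c t (ones (\<lambda>_. hmat) qs \<psi>)) = cnot t c \<psi>"
proof -
  define H where "H = ones (\<lambda>_. hmat)"
  define rs where "rs = remove1 t (remove1 c qs)"
  have comm: "apply1 hmat p \<circ> apply1 hmat q = apply1 hmat q \<circ> apply1 hmat p" for p q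
    by (cases "p = q") (auto simp: fun_eq_iff apply1_commute[of p q hmat hmat])
  have 1: "H qs \<chi> = H rs (apply1 hmat t (apply1 hmat c \<chi>))" for \<chi>
  proof -
    have "H qs = H (remove1 c qs) \<circ> apply1 hmat c"
      unfolding H_def ones_def by (rule fold_remove1_split) (use assms comm in auto)
    moreover have "H (remove1 c qs) = H rs \<circ> apply1 hmat t"
      unfolding H_def ones_def rs_def by (rule fold_remove1_split) (use assms comm in auto)
    ultimately show ?thesis by simp
  qed
  have nrs: "c \<notin> set rs" "t \<notin> set rs" "distinct rs" using assms by (auto simp: rs_def)
  have 2: "H rs (apply1 hmat p \<chi>) = apply1 hmat p (H rs \<chi>)" if "p \<notin> set rs" for p \<chi>
    using that unfolding H_def by (rule ones_apply1)
  have 3: "H rs' (cnot c t \<chi>) = cnot c t (H rs' \<chi>)" if "c \<notin> set rs'" "t \<notin> set rs'" for rs' \<chi>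
    using that unfolding H_def
  proof (induction rs' arbitrary: \<chi>)
    case (Cons r rs')
    have "apply1 hmat r (cnot c t \<chi>) = cnot c t (apply1 hmat r \<chi>)" for \<chi>
      using Cons.prems by (auto simp: cnot_def apply1_eq fun_eq_iff fun_upd_twist[of t r])
    then show ?case using Cons by simp
  qed simp
  have "H qs (cnot c t (H qs \<psi>))
      = apply1 hmat t (apply1 hmat c (H rs (cnot c t (H rs (apply1 hmat t (apply1 hmat c \<psi>))))))"
    by (simp only: 1 2 nrs not_False_eq_True)
  also have "\<dots> = apply1 hmat t (apply1 hmat c (cnot c t (H rs (H rs (apply1 hmat t (apply1 hmat c \<psi>))))))"
    using 3 nrs by simp
  also have "\<dots> = apply1 hmat c (apply1 hmat t (cnot c t (apply1 hmat t (apply1 hmat c \<psi>))))"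
    using ones_hmat_hmat[OF nrs(3)] apply1_commute[OF assms(4)] by (simp add: H_def)
  also have "\<dots> = cnot t c \<psi>" by (rule hcnot[OF assms(4)])
  finally show ?thesis by (simp add: H_def)
qed

lemma ones_hmat_cnots:
  assumes "distinct qs" "\<And>c t. (c, t) \<in> set ps \<Longrightarrow> c \<in> set qs \<and> t \<in> set qs \<and> c \<noteq> t"
  shows "ones (\<lambda>_. hmat) qs (fold (\<lambda>(c, t). cnot c t) ps (ones (\<lambda>_. hmat) qs \<psi>))
       = fold (\<lambda>(c, t). cnot t c) ps \<psi>"
  using assms(2)
proof (induction ps arbitrary: \<psi>)
  case Nil
  then show ?case by (simp add: ones_hmat_hmat[OF assms(1)])
next
  case (Cons p ps)
  obtain c t where p: "p = (c, t)" by (cases p)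
  have "cnot c t (ones (\<lambda>_. hmat) qs \<psi>)
      = ones (\<lambda>_. hmat) qs (ones (\<lambda>_. hmat) qs (cnot c t (ones (\<lambda>_. hmat) qs \<psi>)))"
    by (simp add: ones_hmat_hmat[OF assms(1)])
  also have "\<dots> = ones (\<lambda>_. hmat) qs (cnot t c \<psi>)"
    using ones_hmat_cnot[OF assms(1)] Cons.prems[of c t] p by simp
  finally have "ones (\<lambda>_. hmat) qs (fold (\<lambda>(c, t). cnot c t) (p # ps) (ones (\<lambda>_. hmat) qs \<psi>))
      = ones (\<lambda>_. hmat) qs (fold (\<lambda>(c, t). cnot c t) ps (ones (\<lambda>_. hmat) qs (cnot t c \<psi>)))"
    by (simp add: p)
  also have "\<dots> = fold (\<lambda>(c, t). cnot t c) ps (cnot t c \<psi>)"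
    by (rule Cons.IH) (use Cons.prems in auto)
  finally show ?case by (simp add: p)
qed

text \<open>For a pair \<open>(c, t)\<close> the gate reads \<open>t\<close> and changes
  \<open>c\<close>. The hypothesis separates the qubits that are read from those that are changed,
  so each \<open>c\<close> collects the parity of original values.\<close>

lemma cnots_relabel:
  assumes "\<And>c t c' t'. (c, t) \<in> set ps \<Longrightarrow> (c', t') \<in> set ps \<Longrightarrow> t \<noteq> c'"
  shows "fold (\<lambda>(c, t). cnot t c) ps \<psi> = (\<lambda>b. \<psi> (\<lambda>q. b q \<noteq> odd (length (filter (\<lambda>(c, t). c = q \<and> b t) ps))))"
  using assms
proof (induction ps arbitrary: \<psi>)
  case (Cons p ps)
  obtain c t where p: "p = (c, t)" by (cases p)
  have IH: "fold (\<lambda>(c, t). cnot t c) ps \<chi> = (\<lambda>b. \<chi> (\<lambda>q. b q \<noteq> odd (length (filter (\<lambda>(c, t). c = q \<and> b t) ps))))" for \<chi>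
    by (rule Cons.IH) (use Cons.prems in auto)
  show ?case
  proof
    fix b
    let ?f = "\<lambda>b q. odd (length (filter (\<lambda>(c, t). c = q \<and> b t) ps))"
    have t: "\<not> ?f b t"
    proof -
      have "filter (\<lambda>(c', t'). c' = t \<and> b t') ps = []"
        using Cons.prems[of c t] p by (fastforce simp: filter_empty_conv)
      then show ?thesis by simp
    qed
    have "(\<lambda>q. b q \<noteq> ?f b q)(c := (b c \<noteq> ?f b c) \<noteq> (b t \<noteq> ?f b t))
        = (\<lambda>q. b q \<noteq> odd (length (filter (\<lambda>(c, t). c = q \<and> b t) (p # ps))))"
      using t by (auto simp: p fun_eq_iff)
    then show "fold (\<lambda>(c, t). cnot t c) (p # ps) \<psi> b
        = \<psi> (\<lambda>q. b q \<noteq> odd (length (filter (\<lambda>(c, t). c = q \<and> b t) (p # ps))))"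
      by (simp add: p IH cnot_def)
  qed
qed simp

section \<open>Parity phases\<close>

definition parity_on :: "nat set \<Rightarrow> (nat \<Rightarrow> bool) \<Rightarrow> bool" where
  "parity_on S b \<longleftrightarrow> odd (card {q \<in> S. b q})"

definition pphase :: "(real \<times> nat set) list \<Rightarrow> (nat \<Rightarrow> bool) \<Rightarrow> real" where
  "pphase its b = (\<Sum>(\<alpha>, S)\<leftarrow>its. \<alpha> * of_bool (parity_on S b))"

definition psize :: "(real \<times> nat set) list \<Rightarrow> nat" where
  "psize its = (\<Sum>(\<alpha>, S)\<leftarrow>its. card S)"

lemma sum_list_nth: "(\<Sum>x\<leftarrow>xs. f x) = (\<Sum>i<length xs. f (xs ! i))" for f :: "'a \<Rightarrow> 'b::comm_monoid_add"
  by (simp add: sum_list_sum_nth lessThan_atLeast0)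

lemma length_filter_concat_map:
  "length (filter P (concat (map f is))) = (\<Sum>i\<leftarrow>is. length (filter P (f i)))"
  by (induction "is") auto

lemma fold_cnots_concat:
  assumes "\<And>i. i \<in> set is \<Longrightarrow> finite (T i) \<and> c i \<notin> T i"
  shows "fold (\<lambda>(c, t). cnot c t) (concat (map (\<lambda>i. map (\<lambda>t. (c i, t)) (sorted_list_of_set (T i))) is)) \<psi>
    = fans (map (\<lambda>i. (T i, c i)) is) \<psi>"
  using assms
proof (induction "is" arbitrary: \<psi>)
  case (Cons i js)
  have "fan1 (T i) (c i) \<psi> = fold (cnot (c i)) (sorted_list_of_set (T i)) \<psi>"
    using fan1_cnots[of "sorted_list_of_set (T i)" "c i"] Cons.prems[of i] by simp
  moreover have "fold (\<lambda>(c, t). cnot c t) (map (\<lambda>t. (c i, t)) xs) \<psi> = fold (cnot (c i)) xs \<psi>" for xs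
    by (simp add: fold_map comp_def)
  ultimately show ?case using Cons by (simp add: fans_def)
qed (simp add: fans_def)

lemma ones_rz:
  assumes "distinct qs"
  shows "ones (\<lambda>q. rz (\<alpha> q)) qs \<psi> = (\<lambda>b. cis (\<Sum>q\<in>set qs. \<alpha> q * of_bool (b q)) * \<psi> b)"
  using assms
proof (induction qs arbitrary: \<psi>)
  case (Cons q qs)
  then have "ones (\<lambda>q. rz (\<alpha> q)) (q # qs) \<psi>
      = (\<lambda>b. cis (\<Sum>q\<in>set qs. \<alpha> q * of_bool (b q)) * (cis (\<alpha> q * of_bool (b q)) * \<psi> b))"
    by (simp add: apply1_rz)
  also have "\<dots> = (\<lambda>b. cis (\<Sum>q\<in>set (q # qs). \<alpha> q * of_bool (b q)) * \<psi> b)"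
  proof
    fix b
    have "(\<Sum>q\<in>set (q # qs). \<alpha> q * of_bool (b q)) = (\<Sum>q\<in>set qs. \<alpha> q * of_bool (b q)) + \<alpha> q * of_bool (b q)"
    proof -
      have "q \<notin> set qs" using Cons.prems by simp
      then show ?thesis unfolding list.set sum.insert[OF finite_set \<open>q \<notin> set qs\<close>] by (simp only: add.commute)
    qed
    then show "cis (\<Sum>q\<in>set qs. \<alpha> q * of_bool (b q)) * (cis (\<alpha> q * of_bool (b q)) * \<psi> b)
        = cis (\<Sum>q\<in>set (q # qs). \<alpha> q * of_bool (b q)) * \<psi> b"
      by (simp only: cis_mult[symmetric] mult.assoc)
  qed
  finally show ?case .
qed simp

text \<open>Every parity is computed into one of its copies by a fan-out gate conjugated with Hadamard
  gates, which exchange source and targets.\<close>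

lemma impl_parity_phase:
  assumes its: "\<And>\<alpha> S. (\<alpha>, S) \<in> set its \<Longrightarrow> S \<noteq> {} \<and> S \<subseteq> {..<M}"
  shows "impl n M 9 (11 * psize its) 0 (\<lambda>x \<psi> b. cis (pphase its b) * \<psi> b)"
proof -
  define K where "K = length its"
  define S where "S i = snd (its ! i)" for i
  define \<alpha> where "\<alpha> i = fst (its ! i)" for i
  define q0 where "q0 i = Min (S i)" for i
  \<comment> \<open>Each set gets its own copies \<open>a i q\<close> of its members, so that sets
    sharing qubits can be processed in one layer. The pairing function keeps the names
    apart.\<close>
  define a where "a i q = M + prod_encode (i, q)" for i q
  define CS where "CS = (\<Union>i<K. a i ` S i)"
  define U where "U = (\<Union>i<K. S i)"
  have SM: "S i \<noteq> {}" "S i \<subseteq> {..<M}" "finite (S i)" if "i < K" for i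
    using its[of "fst (its ! i)" "S i"] that finite_subset[of "S i" "{..<M}"]
    by (auto simp: S_def K_def)
  have q0: "q0 i \<in> S i" if "i < K" for i using SM[OF that] by (simp add: q0_def)
  have a_inj: "a i q = a j p \<longleftrightarrow> i = j \<and> q = p" for i j q p by (simp add: a_def)
  have a_ge: "a i q \<ge> M" for i q by (simp add: a_def)
  have finCS: "finite CS" using SM by (simp add: CS_def)
  have finU: "finite U" using SM by (simp add: U_def)
  have UM: "U \<subseteq> {..<M}" using SM by (auto simp: U_def)
  obtain N' where N': "\<forall>c\<in>CS. c < N'" using finCS finite_nat_set_iff_bounded by blast
  define N where "N = max M N'"
  have NM: "M \<le> N" by (simp add: N_def)
  have CSN: "CS \<subseteq> {..<N}" using N' by (auto simp: N_def)
  have ps: "psize its = (\<Sum>i<K. card (S i))"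
    by (simp add: psize_def sum_list_nth case_prod_beta K_def S_def)
  have cardCS: "card CS = psize its"
  proof -
    have "card CS = (\<Sum>i<K. card (a i ` S i))"
      unfolding CS_def by (rule card_UN_disjoint) (use SM in \<open>auto simp: a_inj\<close>)
    also have "\<dots> = (\<Sum>i<K. card (S i))"
      by (intro sum.cong refl card_image inj_onI) (simp add: a_inj)
    finally show ?thesis using ps by simp
  qed
  define T1 where "T1 q = {c \<in> CS. \<exists>i<K. c = a i q}" for q
  define gs1 where "gs1 = map (\<lambda>q. (T1 q, q)) (sorted_list_of_set U)"
  define T2 where "T2 i = a i ` (S i - {q0 i})" for i
  define gs2 where "gs2 = map (\<lambda>i. (T2 i, a i (q0 i))) [0..<K]"
  define Hl where "Hl = sorted_list_of_set CS"
  define Dl where "Dl = map (\<lambda>i. a i (q0 i)) [0..<K]"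
  define V where "V c = rz (\<alpha> (fst (prod_decode (c - M))))" for c
  have T1M: "c \<ge> M" if "c \<in> T1 q" for c q using that a_ge by (auto simp: T1_def)
  have T1CS: "T1 q \<subseteq> CS" for q by (auto simp: T1_def)
  have dis1: "T1 q \<inter> T1 p = {}" if "q \<noteq> p" for q p using that by (auto simp: T1_def a_inj)
  have T2CS: "insert (a i (q0 i)) (T2 i) \<subseteq> CS" if "i < K" for i
    using q0[OF that] that by (auto simp: T2_def CS_def)
  have dis2: "insert (a i (q0 i)) (T2 i) \<inter> insert (a j (q0 j)) (T2 j) = {}" if "i \<noteq> j" for i j
    using that by (auto simp: T2_def a_inj)
  have fd1: "fan_disj gs1"
  proof -
    have "sorted_wrt (\<lambda>q p. insert q (T1 q) \<inter> insert p (T1 p) = {}) (sorted_list_of_set U)"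
    proof (rule sorted_wrt_distinct)
      fix q p assume "q \<in> set (sorted_list_of_set U)" "p \<in> set (sorted_list_of_set U)" "q \<noteq> p"
      moreover from this have "q < M" "p < M" using UM finU by auto
      ultimately show "insert q (T1 q) \<inter> insert p (T1 p) = {}"
        using dis1[of q p] T1M by fastforce
    qed simp
    moreover have "q \<notin> T1 q" if "q \<in> U" for q using that UM T1M[of q q] by auto
    ultimately show ?thesis using finU by (auto simp: fan_disj_def gs1_def sorted_wrt_map)
  qed
  have fd2: "fan_disj gs2"
  proof -
    have "sorted_wrt (\<lambda>i j. insert (a i (q0 i)) (T2 i) \<inter> insert (a j (q0 j)) (T2 j) = {}) [0..<K]"
      by (rule sorted_wrt_distinct) (use dis2 in auto)
    then show ?thesis by (auto simp: fan_disj_def gs2_def sorted_wrt_map T2_def a_inj)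
  qed
  have finT1: "finite (T1 q)" for q using finite_subset[OF T1CS finCS] .
  have finT2: "finite (T2 i)" if "i < K" for i using SM(3)[OF that] by (simp add: T2_def)
  \<comment> \<open>A fan-out gate costs one more than its number of copies. Every \<open>q\<close>
    in \<open>U\<close> has at least one copy, so this at most doubles the total.\<close>
  have s1: "(\<Sum>g\<leftarrow>gs1. card (fst g) + 1) \<le> 2 * psize its"
  proof -
    have "(\<Sum>g\<leftarrow>gs1. card (fst g) + 1) = (\<Sum>q\<in>U. card (T1 q) + 1)"
      unfolding gs1_def using finU by (simp add: comp_def sum_list_distinct_conv_sum_set del: sum_list_Suc)
    also have "\<dots> \<le> (\<Sum>q\<in>U. 2 * card (T1 q))"
    proof (rule sum_mono)
      fix q assume "q \<in> U"
      then obtain i where "i < K" "q \<in> S i" by (auto simp: U_def)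
      then have "a i q \<in> T1 q" by (auto simp: T1_def CS_def)
      then have "card (T1 q) > 0" using finT1 by (auto simp: card_gt_0_iff)
      then show "card (T1 q) + 1 \<le> 2 * card (T1 q)" by simp
    qed
    also have "\<dots> = 2 * card (\<Union>q\<in>U. T1 q)"
      by (subst card_UN_disjoint) (use finU finT1 dis1 in \<open>auto simp: sum_distrib_left\<close>)
    also have "\<dots> \<le> 2 * card CS"
      by (intro mult_left_mono card_mono finCS) (use T1CS in auto)
    finally show ?thesis using cardCS by simp
  qed
  have s2: "(\<Sum>g\<leftarrow>gs2. card (fst g) + 1) \<le> psize its"
  proof -
    have "(\<Sum>g\<leftarrow>gs2. card (fst g) + 1) = (\<Sum>i<K. card (T2 i) + 1)"
      unfolding gs2_def by (simp add: comp_def interv_sum_list_conv_sum_set_nat atLeast0LessThan del: sum_list_Suc)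
    also have "\<dots> \<le> (\<Sum>i<K. card (S i))"
    proof (rule sum_mono)
      fix i assume "i \<in> {..<K}"
      then have i: "i < K" by simp
      have "card (T2 i) \<le> card (S i - {q0 i})" unfolding T2_def by (rule card_image_le) (use SM(3)[OF i] in simp)
      also have "\<dots> = card (S i) - 1" using q0[OF i] by simp
      finally show "card (T2 i) + 1 \<le> card (S i)" using SM[OF i] by (simp add: card_gt_0_iff Suc_le_eq le_diff_conv[symmetric] less_eq_Suc_le[symmetric])
           (metis Suc_pred card_gt_0_iff le_imp_less_Suc)
    qed
    finally show ?thesis using ps by simp
  qed
  have T1N: "c < N" if "c \<in> T1 q" for c q using that T1CS CSN by blast
  have UN: "q < N" if "q \<in> U" for q using that UM NM by auto
  have T2N: "insert (a i (q0 i)) (T2 i) \<subseteq> {..<N}" if "i < K" for i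
    using T2CS[OF that] CSN by blast
  have T2N': "a i (q0 i) < N" "c \<in> T2 i \<Longrightarrow> c < N" if "i < K" for i c
    using T2N[OF that] by auto
  have i1: "impl n N 1 (2 * psize its) 0 (\<lambda>x. fans gs1)"
    by (rule impl_weaken[OF impl_fans[OF fd1, of N]])
      (use s1 finT1 finU UN T1N in \<open>auto simp: gs1_def\<close>)
  have i2: "impl n N 1 (psize its) 0 (\<lambda>x. ones (\<lambda>_. hmat) Hl)"
    by (rule impl_weaken[OF impl_ones[of Hl N]])
      (use finCS CSN cardCS unitary1_hmat in \<open>auto simp: Hl_def\<close>)
  have i3: "impl n N 1 (psize its) 0 (\<lambda>x. fans gs2)"
    by (rule impl_weaken[OF impl_fans[OF fd2, of N]])
      (use s2 finT2 T2N' in \<open>auto simp: gs2_def\<close>)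
  have dDl: "distinct Dl" by (auto simp: Dl_def distinct_map inj_on_def a_inj)
  have i4: "impl n N 1 (psize its) 0 (\<lambda>x. ones V Dl)"
  proof (rule impl_weaken[OF impl_ones[OF dDl, of N V]])
    show "set Dl \<subseteq> {..<N}" using T2N by (auto simp: Dl_def)
    have "length Dl = (\<Sum>i<K. 1)" by (simp add: Dl_def)
    also have "\<dots> \<le> (\<Sum>i<K. card (S i))"
      by (rule sum_mono) (use SM in \<open>auto simp: card_gt_0_iff Suc_le_eq\<close>)
    finally show "length Dl \<le> psize its" using ps by simp
  qed (auto simp: V_def unitary1_rz)
  \<comment> \<open>The Hadamard layers reverse the fan-out from \<open>a i (q0 i)\<close>, so this
    one copy receives the sum of all copies of \<open>S i\<close>.\<close>
  define P where "P = (\<lambda>\<psi>. ones (\<lambda>_. hmat) Hl (fans gs2 (ones (\<lambda>_. hmat) Hl \<psi>)))"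
  have iP: "impl n N 3 (3 * psize its) 0 (\<lambda>x. P)"
    by (rule impl_weaken[OF impl_comp[OF impl_comp[OF i2 i3] i2]]) (auto simp: P_def)
  \<comment> \<open>Copy, form parities, rotate, undo the parities, undo the copies: depth
    \<open>1 + 3 + 1 + 3 + 1\<close>, size factors \<open>2 + 3 + 1 + 3 + 2\<close>.\<close>
  have iall: "impl n N 9 (11 * psize its) 0 (\<lambda>x \<psi>. fans gs1 (P (ones V Dl (P (fans gs1 \<psi>)))))"
    by (rule impl_weaken[OF impl_comp[OF impl_comp[OF impl_comp[OF impl_comp[OF i1 iP] i4] iP] i1]]) auto
  define f where "f b q = (b q \<noteq> (\<exists>g\<in>set gs1. q \<in> fst g \<and> b (snd g)))" for b :: "nat \<Rightarrow> bool" and q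
  define prs where "prs = concat (map (\<lambda>i. map (\<lambda>t. (a i (q0 i), t)) (sorted_list_of_set (T2 i))) [0..<K])"
  define p where "p b q = (b q \<noteq> odd (length (filter (\<lambda>(c, t). c = q \<and> b t) prs)))" for b :: "nat \<Rightarrow> bool" and q
  have Ff: "fans gs1 \<psi> = (\<lambda>b. \<psi> (f b))" for \<psi>
    unfolding f_def by (rule fans_relabel[OF fd1])
  have prs: "(c, t) \<in> set prs \<longleftrightarrow> (\<exists>i<K. c = a i (q0 i) \<and> t \<in> T2 i)" for c t
    using finT2 by (auto simp: prs_def)
  have Pp: "P \<psi> = (\<lambda>b. \<psi> (p b))" for \<psi>
  proof -
    have "P \<psi> = ones (\<lambda>_. hmat) Hl (fold (\<lambda>(c, t). cnot c t) prs (ones (\<lambda>_. hmat) Hl \<psi>))"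
      unfolding P_def prs_def gs2_def
      by (subst fold_cnots_concat) (use finT2 in \<open>auto simp: T2_def a_inj\<close>)
    also have "\<dots> = fold (\<lambda>(c, t). cnot t c) prs \<psi>"
    proof (rule ones_hmat_cnots)
      fix c t assume "(c, t) \<in> set prs"
      then obtain i where "i < K" "c = a i (q0 i)" "t \<in> T2 i" using prs by blast
      then show "c \<in> set Hl \<and> t \<in> set Hl \<and> c \<noteq> t"
        using T2CS[of i] finCS by (auto simp: Hl_def T2_def a_inj)
    qed (simp add: Hl_def)
    also have "\<dots> = (\<lambda>b. \<psi> (p b))"
      unfolding p_def
    proof (rule cnots_relabel)
      fix c t c' t' assume "(c, t) \<in> set prs" "(c', t') \<in> set prs"
      then show "t \<noteq> c'" using prs by (auto simp: T2_def a_inj)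
    qed
    finally show ?thesis .
  qed
  have fU: "f b q = b q" if "q < M" for b q
    using that T1M by (fastforce simp: f_def gs1_def)
  have fC: "f b (a i q) = (b (a i q) \<noteq> b q)" if "i < K" "q \<in> S i" for b i q
  proof -
    have "(\<exists>g\<in>set gs1. a i q \<in> fst g \<and> b (snd g)) \<longleftrightarrow> b q"
    proof
      assume "b q"
      then show "\<exists>g\<in>set gs1. a i q \<in> fst g \<and> b (snd g)"
        using that finU by (auto simp: gs1_def T1_def CS_def U_def)
    next
      assume "\<exists>g\<in>set gs1. a i q \<in> fst g \<and> b (snd g)"
      then show "b q" by (auto simp: gs1_def T1_def a_inj)
    qed
    then show ?thesis by (simp add: f_def)
  qed
  have ff: "f (f b) = b" for b
  proof
    fix q
    have "(\<exists>g\<in>set gs1. q \<in> fst g \<and> f b (snd g)) \<longleftrightarrow> (\<exists>g\<in>set gs1. q \<in> fst g \<and> b (snd g))"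
      using fU UM finU by (auto simp: gs1_def subset_eq)
    then show "f (f b) q = b q" by (auto simp: f_def[of "f b" q] f_def[of b q])
  qed
  have pT: "p b (a i q) = b (a i q)" if "q \<noteq> q0 i" for b i q
  proof -
    have "filter (\<lambda>(c, t). c = a i q \<and> b t) prs = []"
      using that prs by (auto simp: filter_empty_conv a_inj)
    then show ?thesis by (simp add: p_def)
  qed
  have pC: "p b (a i (q0 i)) = (b (a i (q0 i)) \<noteq> odd (card {t \<in> T2 i. b t}))" if "i < K" for b i
  proof -
    have "length (filter (\<lambda>(c, t). c = a i (q0 i) \<and> b t) prs)
        = (\<Sum>j<K. length (filter (\<lambda>t. a j (q0 j) = a i (q0 i) \<and> b t) (sorted_list_of_set (T2 j))))"
      unfolding prs_def length_filter_concat_map filter_map length_map comp_def case_prod_conv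
      by (simp add: interv_sum_list_conv_sum_set_nat atLeast0LessThan)
    also have "\<dots> = (\<Sum>j<K. if j = i then length (filter b (sorted_list_of_set (T2 i))) else 0)"
      by (rule sum.cong) (auto simp: a_inj)
    also have "\<dots> = length (filter b (sorted_list_of_set (T2 i)))" using that by simp
    also have "\<dots> = card {t \<in> T2 i. b t}"
      using finT2[OF that] by (simp add: distinct_length_filter Int_def conj_commute)
    finally show ?thesis by (simp add: p_def)
  qed
  have pp: "p (p b) = b" for b
  proof
    fix c
    have "filter (\<lambda>(c', t). c' = c \<and> p b t) prs = filter (\<lambda>(c', t). c' = c \<and> b t) prs"
    proof (rule filter_cong[OF refl])
      fix x assume x: "x \<in> set prs"
      obtain c' t where ct: "x = (c', t)" by (cases x)
      then obtain i q where "t = a i q" "q \<noteq> q0 i" using x prs by (auto simp: T2_def)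
      then have "p b t = b t" using pT by simp
      then show "(case x of (c', t) \<Rightarrow> c' = c \<and> p b t) = (case x of (c', t) \<Rightarrow> c' = c \<and> b t)"
        by (simp add: ct)
    qed
    then show "p (p b) c = b c" by (auto simp: p_def[of "p b" c] p_def[of b c])
  qed
  show ?thesis
  proof (rule impl_restrict[OF iall NM])
    fix \<psi> assume sM: "supp M \<psi>"
    have V: "ones V Dl \<chi> = (\<lambda>b. cis (\<Sum>i<K. \<alpha> i * of_bool (b (a i (q0 i)))) * \<chi> b)" for \<chi>
    proof -
      have "V = (\<lambda>c. rz (\<alpha> (fst (prod_decode (c - M)))))" by (simp add: V_def fun_eq_iff)
      then have "ones V Dl \<chi> = (\<lambda>b. cis (\<Sum>c\<in>set Dl. \<alpha> (fst (prod_decode (c - M))) * of_bool (b c)) * \<chi> b)"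
        using ones_rz[OF dDl] by simp
      moreover have "(\<Sum>c\<in>set Dl. \<alpha> (fst (prod_decode (c - M))) * of_bool (b c))
          = (\<Sum>i<K. \<alpha> i * of_bool (b (a i (q0 i))))" for b
        unfolding Dl_def set_map set_upt
        by (subst sum.reindex) (auto simp: inj_on_def a_inj a_def atLeast0LessThan)
      ultimately show ?thesis by simp
    qed
    show "fans gs1 (P (ones V Dl (P (fans gs1 \<psi>)))) = (\<lambda>b. cis (pphase its b) * \<psi> b)"
    proof
      fix b
      have "fans gs1 (P (ones V Dl (P (fans gs1 \<psi>)))) b
        = cis (\<Sum>i<K. \<alpha> i * of_bool (p (f b) (a i (q0 i)))) * \<psi> b"
        by (simp add: Ff Pp V ff pp)
      also have "\<dots> = cis (pphase its b) * \<psi> b"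
      proof (cases "b \<in> basis M")
        case True
        then have bM: "\<not> b (a i q)" for i q using a_ge[of i q] by (simp add: basis_def)
        have "p (f b) (a i (q0 i)) = parity_on (S i) b" if i: "i < K" for i
        proof -
          have "{t \<in> T2 i. f b t} = a i ` {q \<in> S i - {q0 i}. b q}"
            using fC[OF i] bM by (auto simp: T2_def)
          then have "card {t \<in> T2 i. f b t} = card {q \<in> S i - {q0 i}. b q}"
            by (simp add: card_image inj_on_def a_inj)
          moreover have "{q \<in> S i. b q} = (if b (q0 i) then insert (q0 i) {q \<in> S i - {q0 i}. b q}
              else {q \<in> S i - {q0 i}. b q})"
            using q0[OF i] by auto
          then have "card {q \<in> S i. b q} = of_bool (b (q0 i)) + card {q \<in> S i - {q0 i}. b q}"
            using SM(3)[OF i] by simp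
          ultimately show ?thesis using pC[OF i] fC[OF i q0[OF i]] bM by (auto simp: parity_on_def)
        qed
        then have "(\<Sum>i<K. \<alpha> i * of_bool (p (f b) (a i (q0 i)))) = pphase its b"
          by (simp add: pphase_def sum_list_nth case_prod_beta K_def \<alpha>_def S_def)
        then show ?thesis by simp
      next
        case False
        then show ?thesis using sM by (simp add: supp_def)
      qed
      finally show "fans gs1 (P (ones V Dl (P (fans gs1 \<psi>)))) b = cis (pphase its b) * \<psi> b" .
    qed
  qed (simp add: supp_mult)
qed

lemma impl_global_phase:
  assumes "M > 0"
  shows "impl n M 1 1 0 (\<lambda>x \<psi> b. cis \<kappa> * \<psi> b)"
  by (rule impl_weaken[OF impl_ones[of "[0]" M "\<lambda>_ r c. if r = c then cis \<kappa> else 0"]])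
    (use assms in \<open>auto simp: unitary1_scalar apply1_scalar\<close>)

section \<open>Phases controlled by congruences of weighted sums\<close>

text \<open>Weights, a value and an exponent, standing for a congruence modulo \<open>2 ^ T\<close>.
  The modulus is a power of two because a nonzero residue has a lowest set bit, and a single-qubit
  phase estimate at that bit is free of error. Zero tests, table lookup and conjunctions with a bit
  all fit this format.\<close>

type_synonym test = "(nat \<times> int) list \<times> int \<times> nat"

definition wsum :: "(nat \<times> int) list \<Rightarrow> (nat \<Rightarrow> bool) \<Rightarrow> int" where
  "wsum ws b = (\<Sum>(q, w)\<leftarrow>ws. w * of_bool (b q))"

fun holds :: "test \<Rightarrow> (nat \<Rightarrow> bool) \<Rightarrow> bool" where
  "holds (ws, v, T) b \<longleftrightarrow> 2 ^ T dvd (wsum ws b - v)"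

fun test_qubits :: "test \<Rightarrow> nat set" where
  "test_qubits (ws, v, T) = fst ` set ws"

text \<open>The first summand pays for the phases controlled by the \<open>T\<close> work qubits,
  the second for one parity phase on each subset of them.\<close>

fun test_cost :: "test \<Rightarrow> nat" where
  "test_cost (ws, v, T) = (length ws + 1) * (T + 1) + (T + 1) * 2 ^ T"

definition tphase :: "(real \<times> test) list \<Rightarrow> (nat \<Rightarrow> bool) \<Rightarrow> real" where
  "tphase ts b = (\<Sum>(\<beta>, t)\<leftarrow>ts. \<beta> * of_bool (holds t b))"

definition tcost :: "(real \<times> test) list \<Rightarrow> nat" where
  "tcost ts = (\<Sum>(\<beta>, t)\<leftarrow>ts. test_cost t)"

lemma wsum_cong: "(\<And>q. q \<in> fst ` set ws \<Longrightarrow> b q = b' q) \<Longrightarrow> wsum ws b = wsum ws b'"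
  unfolding wsum_def by (intro arg_cong[of _ _ sum_list] map_cong refl) (force split: prod.split)

lemma holds_cong: "(\<And>q. q \<in> test_qubits t \<Longrightarrow> b q = b' q) \<Longrightarrow> holds t b = holds t b'"
proof -
  assume a: "\<And>q. q \<in> test_qubits t \<Longrightarrow> b q = b' q"
  obtain ws v T where t: "t = (ws, v, T)" by (cases t) auto
  have "wsum ws b = wsum ws b'" by (rule wsum_cong) (use a t in simp)
  then show ?thesis by (simp add: t)
qed

lemma indep_holds: "test_qubits t \<inter> S = {} \<Longrightarrow> indep S (holds t)"
  unfolding indep_def by (intro allI impI holds_cong) auto

text \<open>Toggling a set bit \<open>z\<close> in the subset pairs even with odd parities, so
  exactly half of all subsets have odd parity unless every bit is zero. Thus a disjunction becomes a
  sum of parities.\<close>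

lemma sum_parity_subsets:
  assumes "finite Z"
  shows "(\<Sum>S\<in>Pow Z - {{}}. of_bool (parity_on S b)) * 2
       = (2 ^ card Z * of_bool (\<exists>z\<in>Z. b z) :: real)"
proof -
  have 0: "(\<Sum>S\<in>Pow Z - {{}}. of_bool (parity_on S b) :: real) = (\<Sum>S\<in>Pow Z. of_bool (parity_on S b))"
    by (rule sum.mono_neutral_left) (use assms in \<open>auto simp: parity_on_def\<close>)
  show ?thesis
  proof (cases "\<exists>z\<in>Z. b z")
    case False
    then have "\<not> parity_on S b" if "S \<in> Pow Z" for S
    proof -
      have "{q \<in> S. b q} = {}" using that False by auto
      then show ?thesis by (simp only: parity_on_def) simp
    qed
    then show ?thesis using False 0 by simp
  next
    case True
    then obtain z where z: "z \<in> Z" "b z" by blast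
    define Y where "Y = Z - {z}"
    have Z: "Z = insert z Y" "z \<notin> Y" "finite Y" using z assms by (auto simp: Y_def)
    have par: "parity_on (insert z S) b \<longleftrightarrow> \<not> parity_on S b" if "S \<in> Pow Y" for S
    proof -
      have "{q \<in> insert z S. b q} = insert z {q \<in> S. b q}" using z by auto
      moreover have "finite S" "z \<notin> S" using that Z finite_subset by auto
      ultimately show ?thesis by (simp add: parity_on_def)
    qed
    have "(\<Sum>S\<in>Pow Z. of_bool (parity_on S b) :: real)
        = (\<Sum>S\<in>Pow Y. of_bool (parity_on S b)) + (\<Sum>S\<in>insert z ` Pow Y. of_bool (parity_on S b))"
      unfolding Z(1) Pow_insert by (rule sum.union_disjoint) (use Z in auto)
    also have "(\<Sum>S\<in>insert z ` Pow Y. of_bool (parity_on S b) :: real)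
        = (\<Sum>S\<in>Pow Y. of_bool (parity_on (insert z S) b))"
      by (rule sum.reindex_cong[of "insert z"]) (use Z in \<open>auto simp: inj_on_def\<close>)
    also have "\<dots> = (\<Sum>S\<in>Pow Y. 1 - of_bool (parity_on S b))"
      by (rule sum.cong) (auto simp: par)
    also have "(\<Sum>S\<in>Pow Y. of_bool (parity_on S b)) + \<dots> = (2 ^ card Y :: real)"
      by (subst sum.distrib[symmetric]) (simp add: card_Pow Z)
    finally show ?thesis using 0 True Z by simp
  qed
qed

lemma cis_int_2pi: "cis (2 * pi * of_int m) = 1"
  by (rule cis_multiple_2pi) auto

lemma cis_odd_pi:
  assumes "odd (m::int)"
  shows "cis (pi * of_int m) = - 1"
proof -
  obtain k where "m = 2 * k + 1" using assms by (auto elim: oddE)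
  then have "pi * of_int m = 2 * pi * of_int k + pi" by (simp add: algebra_simps)
  then have "cis (pi * of_int m) = cis (2 * pi * of_int k) * cis pi" by (simp only: cis_mult)
  then show ?thesis by (simp only: cis_int_2pi) simp
qed

lemma lowest_bit:
  fixes D :: int
  assumes "\<not> 2 ^ T dvd D"
  shows "\<exists>k<T. \<exists>m. odd m \<and> D = 2 ^ k * m"
  using assms
proof (induction T arbitrary: D)
  case (Suc T)
  show ?case
  proof (cases "even D")
    case True
    then obtain D' where D: "D = 2 * D'" by blast
    then have "\<not> 2 ^ T dvd D'" using Suc.prems by auto
    then obtain k m where "k < T" "odd m" "D' = 2 ^ k * m" using Suc.IH by blast
    then show ?thesis using D by (intro exI[of _ "Suc k"]) auto
  next
    case False
    then show ?thesis by (intro exI[of _ 0]) auto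
  qed
qed simp

lemma pphase_append: "pphase (xs @ ys) b = pphase xs b + pphase ys b"
  by (simp add: pphase_def)

lemma pphase_concat: "pphase (concat (map f is)) b = (\<Sum>i\<leftarrow>is. pphase (f i) b)"
  by (induction "is") (auto simp: pphase_append, simp add: pphase_def)

lemma psize_append: "psize (xs @ ys) = psize xs + psize ys"
  by (simp add: psize_def)

lemma psize_concat: "psize (concat (map f is)) = (\<Sum>i\<leftarrow>is. psize (f i))"
  by (induction "is") (auto simp: psize_append, simp add: psize_def)

text \<open>The items of the phase \<open>2 \<pi> (wsum ws b - v) / 2 ^ (k + 1)\<close> controlled on the qubit \<open>z\<close>.\<close>

definition ctrl_items :: "(nat \<times> int) list \<Rightarrow> int \<Rightarrow> nat \<Rightarrow> nat \<Rightarrow> (real \<times> nat set) list" where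
  "ctrl_items ws v k z =
     concat (map (\<lambda>(q, w). let \<gamma> = pi * of_int w / 2 ^ (k + 1) in [(\<gamma>, {z}), (\<gamma>, {q}), (- \<gamma>, {z, q})]) ws)
     @ [(- (2 * pi * of_int v / 2 ^ (k + 1)), {z})]"

text \<open>For bits, \<open>2 * z * q = z + q - (z xor q)\<close>; hence three parity items per
  weight, each with half the angle.\<close>

lemma pphase_ctrl_items:
  assumes "z \<notin> fst ` set ws"
  shows "pphase (ctrl_items ws v k z) b = 2 * pi * of_int (wsum ws b - v) / 2 ^ (k + 1) * of_bool (b z)"
proof -
  have 1: "parity_on {q} b = b q" for q
    by (cases "b q") (auto simp: parity_on_def Collect_conv_if)
  have 2: "parity_on {z, q} b = (b z \<noteq> b q)" if "q \<noteq> z" for q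
  proof -
    have "{p \<in> {z, q}. b p} = (if b z then {z} else {}) \<union> (if b q then {q} else {})" by auto
    then show ?thesis using that by (auto simp: parity_on_def)
  qed
  have "pphase (concat (map (\<lambda>(q, w). let \<gamma> = pi * of_int w / 2 ^ (k + 1)
          in [(\<gamma>, {z}), (\<gamma>, {q}), (- \<gamma>, {z, q})]) ws)) b
      = (\<Sum>(q, w)\<leftarrow>ws. 2 * pi * of_int w / 2 ^ (k + 1) * of_bool (b q) * of_bool (b z))"
    unfolding pphase_concat
  proof (intro arg_cong[of _ _ sum_list] map_cong refl)
    fix qw assume "qw \<in> set ws"
    then have "fst qw \<noteq> z" using assms by auto
    then show "pphase ((\<lambda>(q, w). let \<gamma> = pi * of_int w / 2 ^ (k + 1)
          in [(\<gamma>, {z}), (\<gamma>, {q}), (- \<gamma>, {z, q})]) qw) b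
      = (case qw of (q, w) \<Rightarrow> 2 * pi * of_int w / 2 ^ (k + 1) * of_bool (b q) * of_bool (b z))"
      by (cases qw) (auto simp: pphase_def 1 2 Let_def)
  qed
  also have "\<dots> = 2 * pi * of_int (wsum ws b) / 2 ^ (k + 1) * of_bool (b z)"
    by (induction ws) (auto simp: wsum_def algebra_simps add_divide_distrib)
  finally show ?thesis
    by (simp add: ctrl_items_def pphase_append) (simp add: pphase_def 1 algebra_simps diff_divide_distrib)
qed

lemma psize_ctrl_items: "psize (ctrl_items ws v k z) \<le> 4 * length ws + 1"
proof -
  have "psize (concat (map (\<lambda>(q, w). let \<gamma> = pi * of_int w / 2 ^ (k + 1)
          in [(\<gamma>, {z}), (\<gamma>, {q}), (- \<gamma>, {z, q})]) ws)) \<le> 4 * length ws"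
    by (induction ws) (auto simp: psize_concat psize_append psize_def Let_def card_insert_if)
  then show ?thesis by (simp add: ctrl_items_def psize_append psize_def)
qed

text \<open>Work qubit \<open>k\<close> of a test starts in a uniform superposition, acquires the
  phase \<open>2 * pi * \<Delta> / 2 ^ (k + 1)\<close> and passes a Hadamard gate. If
  \<open>2 ^ T\<close> divides \<open>\<Delta>\<close>, all work qubits are surely zero. Otherwise
  let \<open>2 ^ k\<close> be the largest power of two dividing \<open>\<Delta>\<close>: the phase
  at \<open>k\<close> is \<open>- 1\<close> and that qubit is surely one. The others may be in
  superposition, but whether all are zero is certain, and only this controls the phase
  \<open>\<beta>\<close>.\<close>

lemma impl_test_phase:
  assumes ts: "\<And>\<beta> t. (\<beta>, t) \<in> set ts \<Longrightarrow> test_qubits t \<subseteq> {..<M}"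
  shows "impl n M 32 (100 * tcost ts + 1) 0 (\<lambda>x \<psi> b. cis (tphase ts b) * \<psi> b)"
proof -
  define E where "E = length ts"
  define \<beta> where "\<beta> e = fst (ts ! e)" for e
  define ws where "ws e = fst (snd (ts ! e))" for e
  define v where "v e = fst (snd (snd (ts ! e)))" for e
  define T where "T e = snd (snd (snd (ts ! e)))" for e
  define z where "z e k = M + prod_encode (e, k)" for e k
  define Z where "Z e = z e ` {..<T e}" for e
  define ZS where "ZS = (\<Union>e<E. Z e)"
  define \<Delta> where "\<Delta> e b = wsum (ws e) b - v e" for e b
  have tse: "ts ! e = (\<beta> e, ws e, v e, T e)" for e
    by (simp add: \<beta>_def ws_def v_def T_def)
  have wsM: "fst ` set (ws e) \<subseteq> {..<M}" if "e < E" for e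
    using ts[of "\<beta> e" "(ws e, v e, T e)"] that tse[of e] by (metis E_def nth_mem test_qubits.simps)
  have z_inj: "z e k = z e' k' \<longleftrightarrow> e = e' \<and> k = k'" for e k e' k' by (simp add: z_def)
  have z_ge: "z e k \<ge> M" for e k by (simp add: z_def)
  have finZ: "finite (Z e)" for e by (simp add: Z_def)
  have cardZ: "card (Z e) = T e" for e by (simp add: Z_def card_image inj_on_def z_inj)
  have finZS: "finite ZS" by (simp add: ZS_def finZ)
  have ZS_ge: "c \<ge> M" if "c \<in> ZS" for c using that z_ge by (auto simp: ZS_def Z_def)
  obtain N' where N': "\<forall>c\<in>ZS. c < N'" using finZS finite_nat_set_iff_bounded by blast
  define N where "N = Suc (max M N')"
  have NM: "M \<le> N" "N > 0" by (auto simp: N_def)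
  have ZSN: "ZS \<subseteq> {..<N}" using N' by (auto simp: N_def less_Suc_eq max_def)
  have zZS: "z e k \<in> ZS" if "e < E" "k < T e" for e k using that by (auto simp: ZS_def Z_def)
  have disZ: "Z e \<inter> Z e' = {}" if "e \<noteq> e'" for e e' using that by (auto simp: Z_def z_inj)
  have cardZS: "card ZS = (\<Sum>e<E. T e)"
    unfolding ZS_def by (subst card_UN_disjoint) (use finZ disZ cardZ in auto)
  define Zl where "Zl = sorted_list_of_set ZS"
  have Zl: "distinct Zl" "set Zl = ZS" "length Zl = card ZS" using finZS by (auto simp: Zl_def)
  define its1 where "its1 = concat (map (\<lambda>e. concat (map (\<lambda>k. ctrl_items (ws e) (v e) k (z e k)) [0..<T e])) [0..<E])"
  define neg where "neg = map (\<lambda>(\<gamma>::real, S::nat set). (- \<gamma>, S))"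
  define subs :: "nat \<Rightarrow> nat set list" where
    "subs e = (SOME xs. set xs = Pow (Z e) - {{}} \<and> distinct xs)" for e
  have subs: "set (subs e) = Pow (Z e) - {{}}" "distinct (subs e)" for e
    using someI_ex[OF finite_distinct_list[of "Pow (Z e) - {{}}"]] finZ by (auto simp: subs_def)
  \<comment> \<open>By \<open>sum_parity_subsets\<close> these items add \<open>- \<beta> e\<close>
    when some qubit of \<open>Z e\<close> is set; the global phase \<open>\<kappa>\<close> turns
    this into \<open>\<beta> e\<close> when none is.\<close>
  define its2 where "its2 = concat (map (\<lambda>e. map (\<lambda>S. (- (\<beta> e * 2 / 2 ^ T e), S)) (subs e)) [0..<E])"
  define \<kappa> where "\<kappa> = (\<Sum>e<E. \<beta> e)"
  have tc: "tcost ts = (\<Sum>e<E. (length (ws e) + 1) * (T e + 1) + (T e + 1) * 2 ^ T e)"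
    by (simp add: tcost_def sum_list_nth tse E_def case_prod_beta)
  have ok1: "S \<noteq> {} \<and> S \<subseteq> {..<N}" if "(\<gamma>, S) \<in> set its1" for \<gamma> S
  proof -
    obtain e k where e: "e < E" "k < T e" "(\<gamma>, S) \<in> set (ctrl_items (ws e) (v e) k (z e k))"
      using \<open>(\<gamma>, S) \<in> set its1\<close> by (auto simp: its1_def)
    have "q < N" if "(q, w) \<in> set (ws e)" for q w using wsM[OF e(1)] that NM(1) by force
    moreover have "z e k < N" using zZS[OF e(1,2)] ZSN by auto
    ultimately show ?thesis using e(3) by (auto simp: ctrl_items_def Let_def)
  qed
  have ok1': "S \<noteq> {} \<and> S \<subseteq> {..<N}" if "(\<gamma>, S) \<in> set (neg its1)" for \<gamma> S
    using that ok1 by (auto simp: neg_def)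
  have ok2: "S \<noteq> {} \<and> S \<subseteq> {..<N}" if "(\<gamma>, S) \<in> set its2" for \<gamma> S
    using that subs(1) ZSN by (fastforce simp: its2_def ZS_def)
  have sz1: "psize its1 \<le> (\<Sum>e<E. T e * (4 * length (ws e) + 1))"
  proof -
    have "psize its1 = (\<Sum>e<E. \<Sum>k<T e. psize (ctrl_items (ws e) (v e) k (z e k)))"
      by (simp add: its1_def psize_concat interv_sum_list_conv_sum_set_nat atLeast0LessThan)
    also have "\<dots> \<le> (\<Sum>e<E. \<Sum>k<T e. 4 * length (ws e) + 1)"
      by (intro sum_mono psize_ctrl_items)
    finally show ?thesis by simp
  qed
  have sz1': "psize (neg its1) = psize its1"
    unfolding psize_def neg_def by (induction its1) auto
  have sz2: "psize its2 \<le> (\<Sum>e<E. T e * 2 ^ T e)"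
  proof -
    have "psize its2 = (\<Sum>e<E. (\<Sum>S\<in>Pow (Z e) - {{}}. card S))"
      using subs by (simp add: its2_def psize_concat interv_sum_list_conv_sum_set_nat atLeast0LessThan)
        (simp add: psize_def comp_def sum_list_distinct_conv_sum_set subs)
    also have "\<dots> \<le> (\<Sum>e<E. (\<Sum>S\<in>Pow (Z e). T e))"
    proof (rule sum_mono)
      fix e
      have "(\<Sum>S\<in>Pow (Z e) - {{}}. card S) \<le> (\<Sum>S\<in>Pow (Z e) - {{}}. T e)"
        by (rule sum_mono) (use card_mono[OF finZ] cardZ in auto)
      also have "\<dots> \<le> (\<Sum>S\<in>Pow (Z e). T e)" by (rule sum_mono2) (use finZ in auto)
      finally show "(\<Sum>S\<in>Pow (Z e) - {{}}. card S) \<le> (\<Sum>S\<in>Pow (Z e). T e)" .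
    qed
    also have "\<dots> = (\<Sum>e<E. T e * 2 ^ T e)" by (simp add: card_Pow finZ cardZ mult.commute)
    finally show ?thesis .
  qed
  define H where "H = ones (\<lambda>_. hmat) Zl"
  define D1 where "D1 = (\<lambda>\<psi>::qstate. \<lambda>b. cis (pphase its1 b) * \<psi> b)"
  define D1' where "D1' = (\<lambda>\<psi>::qstate. \<lambda>b. cis (pphase (neg its1) b) * \<psi> b)"
  define D2 where "D2 = (\<lambda>\<psi>::qstate. \<lambda>b. cis (pphase its2 b) * \<psi> b)"
  have iH: "impl n N 1 (\<Sum>e<E. T e) 0 (\<lambda>x. H)"
    by (rule impl_weaken[OF impl_ones[of Zl N]])
      (use Zl ZSN cardZS unitary1_hmat in \<open>auto simp: H_def\<close>)
  have iD1: "impl n N 9 (11 * (\<Sum>e<E. T e * (4 * length (ws e) + 1))) 0 (\<lambda>x. D1)"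
    by (rule impl_weaken[OF impl_parity_phase[OF ok1]]) (use sz1 in \<open>auto simp: D1_def\<close>)
  have iD1': "impl n N 9 (11 * (\<Sum>e<E. T e * (4 * length (ws e) + 1))) 0 (\<lambda>x. D1')"
    by (rule impl_weaken[OF impl_parity_phase[OF ok1']]) (use sz1 sz1' in \<open>auto simp: D1'_def\<close>)
  have iD2: "impl n N 9 (11 * (\<Sum>e<E. T e * 2 ^ T e)) 0 (\<lambda>x. D2)"
    by (rule impl_weaken[OF impl_parity_phase[OF ok2]]) (use sz2 in \<open>auto simp: D2_def\<close>)
  note iG = impl_global_phase[OF NM(2), of n \<kappa>]
  \<comment> \<open>The depth is \<open>1 + 9 + 1 + 9 + 1 + 1 + 9 + 1\<close>; this 32 becomes the
    uniform depth of a program step.\<close>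
  have iall: "impl n N 32 (100 * tcost ts + 1) 0
      (\<lambda>x \<psi>. H (D1' (H (\<lambda>b. cis \<kappa> * D2 (H (D1 (H \<psi>))) b))))"
  proof (rule impl_weaken[OF impl_comp[OF impl_comp[OF impl_comp[OF impl_comp[OF impl_comp[OF
          impl_comp[OF impl_comp[OF iH iD1] iH] iD2] iG] iH] iD1'] iH]])
    have "4 * T e + 22 * (T e * (4 * length (ws e) + 1)) + 11 * (T e * 2 ^ T e)
       \<le> 100 * ((length (ws e) + 1) * (T e + 1) + (T e + 1) * 2 ^ T e)" for e
      by (simp add: algebra_simps)
    then have "(\<Sum>e<E. 4 * T e + 22 * (T e * (4 * length (ws e) + 1)) + 11 * (T e * 2 ^ T e))
       \<le> 100 * tcost ts"
      unfolding tc sum_distrib_left by (intro sum_mono)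
    then show "(\<Sum>e<E. T e) + 11 * (\<Sum>e<E. T e * (4 * length (ws e) + 1)) + (\<Sum>e<E. T e)
        + 11 * (\<Sum>e<E. T e * 2 ^ T e) + 1 + (\<Sum>e<E. T e)
        + 11 * (\<Sum>e<E. T e * (4 * length (ws e) + 1)) + (\<Sum>e<E. T e) \<le> 100 * tcost ts + 1"
      unfolding sum.distrib sum_distrib_left[symmetric] by linarith
  qed auto
  define \<Phi> where "\<Phi> b = cis (tphase ts b)" for b
  have ind\<Delta>: "indep ZS (\<Delta> e)" if "e < E" for e
    unfolding indep_def \<Delta>_def
  proof (intro allI impI arg_cong2[of _ _ _ _ minus] refl wsum_cong)
    fix b c u q assume "c \<in> ZS" "q \<in> fst ` set (ws e)"
    then show "(b(c := u)) q = b q" using ZS_ge wsM[OF that] by force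
  qed
  have tph: "tphase ts b = (\<Sum>e<E. \<beta> e * of_bool (2 ^ T e dvd \<Delta> e b))" for b
    by (simp add: tphase_def sum_list_nth tse E_def \<Delta>_def)
  have ind\<Phi>: "indep ZS \<Phi>"
    unfolding indep_def \<Phi>_def tph
  proof (intro allI impI arg_cong[of _ _ cis] sum.cong refl)
    fix b c u e assume "c \<in> ZS" "e \<in> {..<E}"
    then have "\<Delta> e (b(c := u)) = \<Delta> e b" using ind\<Delta>[of e] by (simp add: indep_def)
    then show "\<beta> e * of_bool (2 ^ T e dvd \<Delta> e (b(c := u))) = \<beta> e * of_bool (2 ^ T e dvd \<Delta> e b)" by simp
  qed
  define ang where "ang c b = (let (e, k) = prod_decode (c - M) in 2 * pi * of_int (\<Delta> e b) / 2 ^ (k + 1))" for c b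
  have ang: "ang (z e k) b = 2 * pi * of_int (\<Delta> e b) / 2 ^ (k + 1)" for e k b
    by (simp add: ang_def z_def)
  have p1: "pphase its1 b = (\<Sum>c\<in>ZS. ang c b * of_bool (b c))" for b
  proof -
    have "(\<Sum>c\<in>ZS. ang c b * of_bool (b c)) = (\<Sum>e<E. \<Sum>c\<in>Z e. ang c b * of_bool (b c))"
      unfolding ZS_def by (rule sum.UNION_disjoint) (use finZ disZ in auto)
    also have "\<dots> = (\<Sum>e<E. \<Sum>k<T e. ang (z e k) b * of_bool (b (z e k)))"
      unfolding Z_def by (subst sum.reindex) (auto simp: inj_on_def z_inj)
    also have "\<dots> = pphase its1 b"
      unfolding its1_def pphase_concat interv_sum_list_conv_sum_set_nat atLeast0LessThan
        set_upt
    proof (intro sum.cong refl)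
      fix e k assume "e \<in> {..<E}" "k \<in> {..<T e}"
      then have "z e k \<notin> fst ` set (ws e)" using wsM[of e] z_ge[of e k] by force
      then show "ang (z e k) b * of_bool (b (z e k)) = pphase (ctrl_items (ws e) (v e) k (z e k)) b"
        by (simp add: pphase_ctrl_items ang \<Delta>_def)
    qed
    finally show ?thesis by simp
  qed
  have p1': "pphase (neg its1) b = - pphase its1 b" for b
    unfolding pphase_def neg_def by (induction its1) auto
  have p2: "\<kappa> + pphase its2 b = (\<Sum>e<E. \<beta> e * of_bool (\<forall>c\<in>Z e. \<not> b c))" for b
  proof -
    have "pphase its2 b = (\<Sum>e<E. \<Sum>S\<in>Pow (Z e) - {{}}. - (\<beta> e * 2 / 2 ^ T e) * of_bool (parity_on S b))"
      unfolding its2_def pphase_concat interv_sum_list_conv_sum_set_nat atLeast0LessThan set_upt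
      by (intro sum.cong refl) (simp add: pphase_def comp_def sum_list_distinct_conv_sum_set subs)
    also have "\<dots> = (\<Sum>e<E. - \<beta> e * of_bool (\<exists>c\<in>Z e. b c))"
    proof (intro sum.cong refl)
      fix e
      have "(\<Sum>S\<in>Pow (Z e) - {{}}. - (\<beta> e * 2 / 2 ^ T e) * of_bool (parity_on S b))
          = - (\<beta> e / 2 ^ T e) * ((\<Sum>S\<in>Pow (Z e) - {{}}. of_bool (parity_on S b)) * 2)"
        by (simp only: sum_distrib_left[symmetric]) simp
      also have "\<dots> = - \<beta> e * of_bool (\<exists>c\<in>Z e. b c)"
        unfolding sum_parity_subsets[OF finZ] cardZ by simp
      finally show "(\<Sum>S\<in>Pow (Z e) - {{}}. - (\<beta> e * 2 / 2 ^ T e) * of_bool (parity_on S b))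
          = - \<beta> e * of_bool (\<exists>c\<in>Z e. b c)" .
    qed
    finally show ?thesis
      unfolding \<kappa>_def by (simp only: sum.distrib[symmetric], intro sum.cong refl) simp
  qed
  show ?thesis
  proof (rule impl_restrict[OF iall NM(1)])
    fix \<psi> assume sM: "supp M \<psi>"
    define K where "K b = \<psi> (\<lambda>q. q \<notin> ZS \<and> b q)" for b
    have indK: "indep ZS K"
      unfolding indep_def K_def by (intro allI impI arg_cong[of _ _ \<psi>]) auto
    have \<psi>K: "\<psi> = (\<lambda>b. K b * (\<Prod>c\<in>set Zl. if b c then 0 else 1))"
    proof
      fix b
      show "\<psi> b = K b * (\<Prod>c\<in>set Zl. if b c then 0 else 1)"
      proof (cases "\<exists>c\<in>ZS. b c")
        case True
        then obtain c where "c \<in> ZS" "b c" by blast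
        moreover from this have "\<psi> b = 0" using sM ZS_ge unfolding supp_def not_basis_iff by blast
        ultimately show ?thesis using Zl finZS by (auto simp: prod_zero_iff)
      next
        case False
        then have "(\<lambda>q. q \<notin> ZS \<and> b q) = b" by auto
        moreover have "(\<Prod>c\<in>set Zl. if b c then 0 else 1) = (1::complex)"
          using False Zl by (intro prod.neutral) auto
        ultimately show ?thesis by (simp add: K_def)
      qed
    qed
    have h1: "H \<psi> = (\<lambda>b. K b * (\<Prod>c\<in>set Zl. rsqrt2))"
      unfolding H_def by (subst \<psi>K, subst ones_prod[OF Zl(1), of K "\<lambda>c b u. if u then 0 else 1"])
        (use indK Zl in \<open>auto simp: hmat_eq indep_const\<close>)
    have d1: "D1 (H \<psi>) = (\<lambda>b. K b * (\<Prod>c\<in>set Zl. cis (ang c b * of_bool (b c)) * rsqrt2))"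
    proof
      fix b
      have "cis (\<Sum>c\<in>ZS. ang c b * of_bool (b c)) = (\<Prod>c\<in>ZS. cis (ang c b * of_bool (b c)))"
        using finZS by (induction ZS rule: finite_induct) (auto simp: cis_mult[symmetric])
      then show "D1 (H \<psi>) b = K b * (\<Prod>c\<in>set Zl. cis (ang c b * of_bool (b c)) * rsqrt2)"
        by (simp add: D1_def h1 p1 prod.distrib Zl)
    qed
    have inda: "indep ZS (ang c)" if "c \<in> ZS" for c
    proof -
      obtain e where e: "e < E" "c \<in> Z e" using \<open>c \<in> ZS\<close> by (auto simp: ZS_def)
      then obtain k where "c = z e k" by (auto simp: Z_def)
      then show ?thesis using ind\<Delta>[OF e(1)] by (simp add: ang indep_def)
    qed
    have h2: "H (D1 (H \<psi>)) = (\<lambda>b. K b * (\<Prod>c\<in>set Zl. (1 + (if b c then - 1 else 1) * cis (ang c b)) / 2))"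
    proof -
      have "H (D1 (H \<psi>)) = (\<lambda>b. K b * (\<Prod>c\<in>set Zl. hmat (b c) False * (cis (ang c b * of_bool False) * rsqrt2)
          + hmat (b c) True * (cis (ang c b * of_bool True) * rsqrt2)))"
        unfolding H_def d1[unfolded H_def]
        by (rule ones_prod[OF Zl(1), of K "\<lambda>c b u. cis (ang c b * of_bool u) * rsqrt2"])
          (use indK inda Zl in \<open>auto simp: indep_def\<close>)
      moreover have "rsqrt2 * rsqrt2 = 1 / 2" using rsqrt2_sq[of 1] by simp
      then have "hmat (b c) False * (cis (ang c b * of_bool False) * rsqrt2)
          + hmat (b c) True * (cis (ang c b * of_bool True) * rsqrt2)
          = (1 + (if b c then - 1 else 1) * cis (ang c b)) / 2" for b c
        by (simp add: hmat_eq mult.commute mult.left_commute[of rsqrt2 "cis _" rsqrt2])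
      ultimately show ?thesis by (simp only:)
    qed
    have d2: "(\<lambda>b. cis \<kappa> * D2 (H (D1 (H \<psi>))) b) = (\<lambda>b. \<Phi> b * H (D1 (H \<psi>)) b)"
    proof
      fix b
      show "cis \<kappa> * D2 (H (D1 (H \<psi>))) b = \<Phi> b * H (D1 (H \<psi>)) b"
      \<comment> \<open>The two phases agree only where the amplitude is nonzero. There a work qubit
        with phase 1 must be zero and one with phase \<open>- 1\<close> must be one.\<close>
      proof (cases "H (D1 (H \<psi>)) b = 0")
        case False
        then have nz: "1 + (if b c then - 1 else 1) * cis (ang c b) \<noteq> 0" if "c \<in> ZS" for c
          using that Zl finZS unfolding h2 by (auto simp: prod_zero_iff)
        have "(\<forall>c\<in>Z e. \<not> b c) \<longleftrightarrow> 2 ^ T e dvd \<Delta> e b" if e: "e < E" for e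
        proof
          assume "2 ^ T e dvd \<Delta> e b"
          then obtain m where m: "\<Delta> e b = 2 ^ T e * m" by blast
          show "\<forall>c\<in>Z e. \<not> b c"
          proof
            fix c assume "c \<in> Z e"
            then obtain k where k: "c = z e k" "k < T e" by (auto simp: Z_def)
            have "(2::real) ^ T e = 2 ^ (k + 1) * 2 ^ (T e - (k + 1))"
              using k by (simp only: power_add[symmetric]) simp
            then have "ang c b = 2 * pi * of_int (2 ^ (T e - (k + 1)) * m)"
              by (simp add: k ang m)
            then have "cis (ang c b) = 1" by (simp only: cis_int_2pi)
            then show "\<not> b c" using nz[OF zZS[OF e k(2)]] k by auto
          qed
        next
          assume zz: "\<forall>c\<in>Z e. \<not> b c"
          show "2 ^ T e dvd \<Delta> e b"
          proof (rule ccontr)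
            assume "\<not> 2 ^ T e dvd \<Delta> e b"
            then obtain k m where k: "k < T e" "odd m" "\<Delta> e b = 2 ^ k * m" using lowest_bit by blast
            have "ang (z e k) b = pi * of_int m" by (simp add: ang k)
            then have "cis (ang (z e k) b) = - 1" using cis_odd_pi[OF k(2)] by simp
            moreover have "\<not> b (z e k)" using zz k(1) by (auto simp: Z_def)
            ultimately show False using nz[OF zZS[OF e k(1)]] by simp
          qed
        qed
        then have "\<kappa> + pphase its2 b = tphase ts b"
          unfolding p2 tph by (intro sum.cong) auto
        then have "cis \<kappa> * cis (pphase its2 b) = \<Phi> b" by (simp add: cis_mult \<Phi>_def)
        then show ?thesis by (simp add: D2_def mult.assoc[symmetric])
      qed (simp add: D2_def)
    qed
    \<comment> \<open>\<open>\<Phi>\<close> does not depend on the work qubits, so it passes through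
      the uncomputation, which then cancels the computation.\<close>
    have "H (D1' (H (\<lambda>b. \<Phi> b * H (D1 (H \<psi>)) b))) = (\<lambda>b. \<Phi> b * H (D1' (H (H (D1 (H \<psi>))))) b)"
    proof -
      have "H (\<lambda>b. \<Phi> b * \<chi> b) = (\<lambda>b. \<Phi> b * H \<chi> b)" for \<chi>
        unfolding H_def by (rule ones_indep) (use ind\<Phi> Zl in simp)
      moreover have "D1' (\<lambda>b. \<Phi> b * \<chi> b) = (\<lambda>b. \<Phi> b * D1' \<chi> b)" for \<chi>
        by (auto simp: D1'_def mult.left_commute)
      ultimately show ?thesis by simp
    qed
    also have "\<dots> = (\<lambda>b. \<Phi> b * \<psi> b)"
    proof -
      have "D1' (D1 \<chi>) = \<chi>" for \<chi>
        by (auto simp: D1'_def D1_def p1' mult.assoc[symmetric] cis_mult)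
      moreover have "H (H \<chi>) = \<chi>" for \<chi> unfolding H_def by (rule ones_hmat_hmat[OF Zl(1)])
      ultimately show ?thesis by simp
    qed
    finally show "H (D1' (H (\<lambda>b. cis \<kappa> * D2 (H (D1 (H \<psi>))) b))) = (\<lambda>b. cis (tphase ts b) * \<psi> b)"
      unfolding d2 by (simp add: \<Phi>_def)
  qed (simp add: supp_mult)
qed

section \<open>Programs\<close>

text \<open>Programs never mention \<open>x\<close>: it enters their meaning only as a real angle
  \<open>\<theta>\<close>, to be taken as \<open>x / 2 ^ n\<close>. As \<open>\<theta>\<close> is
  arbitrary, a window can be analysed at any multiple \<open>2 ^ j * \<theta>\<close>. With
  \<open>neg\<close> a qubit of \<open>Rot\<close> rotates when it is zero.\<close>

datatype step =
    Ones "nat set" "nat \<Rightarrow> qmat"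
  | Phase "(real \<times> test) list"
  | Rot bool "nat set" "nat \<Rightarrow> nat"

fun sem :: "real \<Rightarrow> step \<Rightarrow> qstate \<Rightarrow> qstate" where
  "sem \<theta> (Ones S V) \<psi> = ones V (sorted_list_of_set S) \<psi>"
| "sem \<theta> (Phase ts) \<psi> = (\<lambda>b. cis (tphase ts b) * \<psi> b)"
| "sem \<theta> (Rot neg S e) \<psi> = (\<lambda>b. cis (2 * pi * \<theta> * (\<Sum>q\<in>S. 2 ^ e q * of_bool (b q \<noteq> neg))) * \<psi> b)"

abbreviation sems :: "real \<Rightarrow> step list \<Rightarrow> qstate \<Rightarrow> qstate" where
  "sems \<theta> \<equiv> fold (sem \<theta>)"

fun step_ok :: "nat set \<Rightarrow> step \<Rightarrow> bool" where
  "step_ok Q (Ones S V) \<longleftrightarrow> S \<subseteq> Q \<and> (\<forall>q\<in>S. unitary1 (V q))"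
| "step_ok Q (Phase ts) \<longleftrightarrow> (\<forall>(\<beta>, t)\<in>set ts. test_qubits t \<subseteq> Q)"
| "step_ok Q (Rot neg S e) \<longleftrightarrow> S \<subseteq> Q"

fun step_size :: "step \<Rightarrow> nat" where
  "step_size (Ones S V) = card S"
| "step_size (Phase ts) = 100 * tcost ts + 1"
| "step_size (Rot neg S e) = 4 * card S"

fun step_blacks :: "step \<Rightarrow> nat" where
  "step_blacks (Rot neg S e) = card S"
| "step_blacks _ = 0"

lemma step_ok_mono: "step_ok Q s \<Longrightarrow> Q \<subseteq> Q' \<Longrightarrow> step_ok Q' s"
  by (cases s) fastforce+

lemma ones_xmat: "distinct qs \<Longrightarrow> ones (\<lambda>_. xmat) qs \<psi> = (\<lambda>b. \<psi> (\<lambda>q. b q \<noteq> (q \<in> set qs)))"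
proof (induction qs arbitrary: \<psi>)
  case (Cons q qs)
  have "(\<lambda>p. b p \<noteq> (p \<in> set qs))(q := \<not> (b q \<noteq> (q \<in> set qs))) = (\<lambda>p. b p \<noteq> (p \<in> set (q # qs)))" for b
    using Cons.prems by (auto simp: fun_eq_iff)
  then show ?case using Cons by (simp add: apply1_xmat)
qed simp

lemma fold_black:
  "fold (apply_gate n x) (map (\<lambda>p. Black (ys p) p) ps) \<psi>
   = (\<lambda>b. cis (\<Sum>p\<leftarrow>ps. 2 * pi * real x / 2 ^ n * real (reg_value (ys p) b) * of_bool (b p)) * \<psi> b)"
proof (induction ps arbitrary: \<psi>)
  case (Cons p ps)
  have "apply_gate n x (Black (ys p) p) \<psi>
     = (\<lambda>b. cis (2 * pi * real x / 2 ^ n * real (reg_value (ys p) b) * of_bool (b p)) * \<psi> b)"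
    by (rule ext) (simp add: apply1_rz)
  then show ?case using Cons by (simp add: cis_mult[symmetric] mult_ac del: apply_gate.simps)
qed simp

text \<open>For the factor \<open>2 ^ e q\<close> the register of the black-box gate is set to a
  single one at bit \<open>e q\<close>. If \<open>e q \<ge> n\<close> there is no such bit, but then
  the rotation is by a multiple of \<open>2 * pi\<close> and is omitted, since
  \<open>\<theta> = x / 2 ^ n\<close>.\<close>

lemma impl_rot:
  assumes "S \<subseteq> {..<M}"
  shows "impl n M 3 (4 * card S) (card S) (\<lambda>x. sem (real x / 2 ^ n) (Rot neg S e))"
proof -
  have finS: "finite S" using assms finite_subset by blast
  define S' where "S' = {q \<in> S. e q < n}"
  have S': "finite S'" "S' \<subseteq> S" "card S' \<le> card S" using finS by (auto simp: S'_def intro: card_mono)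
  define r where "r q j = M + prod_encode (q, j)" for q j
  have r_inj: "r q j = r q' j' \<longleftrightarrow> q = q' \<and> j = j'" for q j q' j' by (simp add: r_def)
  have r_ge: "r q j \<ge> M" for q j by (simp add: r_def)
  have r_ne: "q \<noteq> r p j" "r p j \<noteq> q" if "q < M" for p q j using that r_ge[of p j] by auto
  define ys where "ys q = map (r q) [0..<n]" for q
  define A where "A = (\<Union>q\<in>S'. r q ` {..<n})"
  have "finite A" using S' by (auto simp: A_def)
  then obtain N' where N': "\<forall>c\<in>A. c < N'" using finite_nat_set_iff_bounded by blast
  define N where "N = max M N'"
  have NM: "M \<le> N" by (simp add: N_def)
  have rN: "r q j < N" if "q \<in> S'" "j < n" for q j using N' that by (auto simp: N_def A_def less_max_iff_disj)
  have SN: "q < N" if "q \<in> S" for q using that assms NM by auto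
  define X where "X = (\<lambda>q. r q (e q)) ` S' \<union> (if neg then S' else {})"
  define Xl where "Xl = sorted_list_of_set X"
  have finX: "finite X" using S' by (simp add: X_def)
  have Xl: "distinct Xl" "set Xl = X" "length Xl = card X" using finX by (auto simp: Xl_def)
  have cX: "card X \<le> 2 * card S"
  proof -
    have "card X \<le> card ((\<lambda>q. r q (e q)) ` S') + card (if neg then S' else {})"
      unfolding X_def by (rule card_Un_le)
    also have "\<dots> \<le> card S' + card S'" by (intro add_mono card_image_le S') auto
    finally show ?thesis using S' by simp
  qed
  have iX: "impl n N 1 (2 * card S) 0 (\<lambda>x. ones (\<lambda>_. xmat) Xl)"
  proof (rule impl_weaken[OF impl_ones[of Xl N]])
    show "set Xl \<subseteq> {..<N}" using rN SN S' by (auto simp: Xl X_def S'_def split: if_splits)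
  qed (use Xl cX unitary1_xmat in auto)
  define Sl where "Sl = sorted_list_of_set S'"
  have Sl: "distinct Sl" "set Sl = S'" "length Sl = card S'" using S' by (auto simp: Sl_def)
  define D where "D = (\<lambda>x b. cis (\<Sum>p\<leftarrow>Sl. 2 * pi * real x / 2 ^ n * real (reg_value (ys p) b) * of_bool (b p)))"
  have iB: "impl n N 1 0 (card S) (\<lambda>x \<psi> b. D x b * \<psi> b)"
  proof (rule impl_layer[where L = "map (\<lambda>p. Black (ys p) p) Sl"])
    fix g assume "g \<in> set (map (\<lambda>p. Black (ys p) p) Sl)"
    then obtain q where q: "q \<in> S'" "g = Black (ys q) q" using Sl by auto
    have "q < M" using q S' assms by auto
    then show "gate_ok n g \<and> gate_qubits g \<subseteq> {..<N}"
      using q rN[OF q(1)] NM r_ne[of q] by (auto simp: ys_def distinct_map inj_on_def r_inj)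
  next
    have "sorted_wrt (\<lambda>p q. insert p (set (ys p)) \<inter> insert q (set (ys q)) = {}) Sl"
    proof (rule sorted_wrt_distinct[OF Sl(1)])
      fix p q assume a: "p \<in> set Sl" "q \<in> set Sl" "p \<noteq> q"
      then have "p < M" "q < M" using Sl S' assms by auto
      then show "insert p (set (ys p)) \<inter> insert q (set (ys q)) = {}"
        using a(3) r_ne by (auto simp: ys_def r_inj)
    qed
    then show "sorted_wrt (\<lambda>g h. gate_qubits g \<inter> gate_qubits h = {}) (map (\<lambda>p. Black (ys p) p) Sl)"
      unfolding sorted_wrt_map gate_qubits.simps .
  next
    show "fold (apply_gate n x) (map (\<lambda>p. Black (ys p) p) Sl) \<psi> = (\<lambda>b. D x b * \<psi> b)" for x \<psi>
      by (simp add: fold_black D_def)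
  next
    have "filter (\<lambda>g. \<not> is_black g) (map (\<lambda>p. Black (ys p) p) Sl) = []" by (auto simp: filter_empty_conv)
    then show "(\<Sum>g\<leftarrow>filter (\<lambda>g. \<not> is_black g) (map (\<lambda>p. Black (ys p) p) Sl). card (gate_qubits g)) \<le> 0"
      by simp
    have "length (filter is_black (map (\<lambda>p. Black (ys p) p) Sl)) \<le> length (map (\<lambda>p. Black (ys p) p) Sl)"
      by (rule length_filter_le)
    then show "length (filter is_black (map (\<lambda>p. Black (ys p) p) Sl)) \<le> card S" using Sl S' by simp
  qed
  have iall: "impl n N 3 (4 * card S) (card S) (\<lambda>x \<psi>. ones (\<lambda>_. xmat) Xl (\<lambda>b. D x b * ones (\<lambda>_. xmat) Xl \<psi> b))"
    by (rule impl_weaken[OF impl_comp[OF impl_comp[OF iX iB] iX]]) auto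
  show ?thesis
  proof (rule impl_restrict[OF iall NM])
    fix x \<psi> assume sM: "supp M \<psi>"
    define f where "f b q = (b q \<noteq> (q \<in> X))" for b :: "nat \<Rightarrow> bool" and q
    have ff: "(\<lambda>q. f b q \<noteq> (q \<in> X)) = b" for b by (auto simp: f_def fun_eq_iff)
    show "ones (\<lambda>_. xmat) Xl (\<lambda>b. D x b * ones (\<lambda>_. xmat) Xl \<psi> b) = sem (real x / 2 ^ n) (Rot neg S e) \<psi>"
    proof
      fix b
      have "ones (\<lambda>_. xmat) Xl (\<lambda>b. D x b * ones (\<lambda>_. xmat) Xl \<psi> b) b = D x (f b) * \<psi> b"
        using ff[of b] by (simp add: ones_xmat[OF Xl(1)] Xl f_def[abs_def])
      also have "\<dots> = sem (real x / 2 ^ n) (Rot neg S e) \<psi> b"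
      proof (cases "b \<in> basis M")
        case False
        then show ?thesis using sM by (simp add: supp_def)
      next
        case True
        have bM: "\<not> b (r q j)" for q j using True r_ge[of q j] by (simp add: basis_def)
        have rv: "real (reg_value (ys q) (f b)) = 2 ^ e q" if q: "q \<in> S'" for q
        proof -
          have "f b (r q j) = (j = e q)" for j
          proof -
            have "r q j \<notin> S'" using r_ge[of q j] S' assms by auto
            then show ?thesis using bM q by (auto simp: f_def X_def r_inj)
          qed
          then have "reg_value (ys q) (f b) = (\<Sum>i<n. of_bool (i = e q) * 2 ^ i)"
            by (simp add: reg_value_def ys_def)
          also have "\<dots> = (\<Sum>i<n. if i = e q then 2 ^ i else 0)" by (rule sum.cong) auto
          also have "\<dots> = 2 ^ e q" using q by (simp add: S'_def)
          finally show ?thesis by simp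
        qed
        have fq: "f b q = (b q \<noteq> neg)" if "q \<in> S'" for q
        proof -
          have "q < M" using that S' assms by auto
          then have "q \<notin> (\<lambda>q. r q (e q)) ` S'" using r_ge by (auto simp: not_le[symmetric])
          then show ?thesis using that by (auto simp: f_def X_def)
        qed
        have "(\<Sum>p\<leftarrow>Sl. 2 * pi * real x / 2 ^ n * real (reg_value (ys p) (f b)) * of_bool (f b p))
            = (\<Sum>q\<in>S'. 2 * pi * (real x / 2 ^ n) * (2 ^ e q * of_bool (b q \<noteq> neg)))"
          unfolding sum_list_distinct_conv_sum_set[OF Sl(1)] Sl(2)
          by (rule sum.cong) (simp_all add: rv fq)
        then have D: "D x (f b) = cis (\<Sum>q\<in>S'. 2 * pi * (real x / 2 ^ n) * (2 ^ e q * of_bool (b q \<noteq> neg)))"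
          by (simp add: D_def)
        have "cis (\<Sum>q\<in>S - S'. 2 * pi * (real x / 2 ^ n) * (2 ^ e q * of_bool (b q \<noteq> neg))) = 1"
        proof -
          have "(\<Sum>q\<in>S - S'. 2 * pi * (real x / 2 ^ n) * (2 ^ e q * of_bool (b q \<noteq> neg)))
             = (\<Sum>q\<in>S - S'. 2 * pi * real_of_int (int x * 2 ^ (e q - n) * of_bool (b q \<noteq> neg)))"
          proof (rule sum.cong[OF refl])
            fix q assume "q \<in> S - S'"
            then have "n \<le> e q" by (auto simp: S'_def)
            then have "(2::real) ^ e q = 2 ^ n * 2 ^ (e q - n)"
              by (simp add: power_add[symmetric])
            then show "2 * pi * (real x / 2 ^ n) * (2 ^ e q * of_bool (b q \<noteq> neg))
               = 2 * pi * real_of_int (int x * 2 ^ (e q - n) * of_bool (b q \<noteq> neg))" by simp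
          qed
          also have "\<dots> = 2 * pi * real_of_int (\<Sum>q\<in>S - S'. int x * 2 ^ (e q - n) * of_bool (b q \<noteq> neg))"
            by (simp only: sum_distrib_left of_int_sum)
          finally show ?thesis by (simp only: cis_int_2pi)
        qed
        moreover have "(\<Sum>q\<in>S. 2 * pi * (real x / 2 ^ n) * (2 ^ e q * of_bool (b q \<noteq> neg)))
          = (\<Sum>q\<in>S - S'. 2 * pi * (real x / 2 ^ n) * (2 ^ e q * of_bool (b q \<noteq> neg)))
          + (\<Sum>q\<in>S'. 2 * pi * (real x / 2 ^ n) * (2 ^ e q * of_bool (b q \<noteq> neg)))"
          by (rule sum.subset_diff[OF S'(2) finS])
        ultimately have "cis (\<Sum>q\<in>S. 2 * pi * (real x / 2 ^ n) * (2 ^ e q * of_bool (b q \<noteq> neg))) = D x (f b)"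
          by (simp only: D cis_mult[symmetric] mult_1)
        then show ?thesis by (simp only: sem.simps sum_distrib_left)
      qed
      finally show "ones (\<lambda>_. xmat) Xl (\<lambda>b. D x b * ones (\<lambda>_. xmat) Xl \<psi> b) b
          = sem (real x / 2 ^ n) (Rot neg S e) \<psi> b" .
    qed
  qed (simp add: supp_mult)
qed

lemma impl_step:
  assumes "step_ok {..<M} s"
  shows "impl n M 32 (step_size s) (step_blacks s) (\<lambda>x. sem (real x / 2 ^ n) s)"
proof (cases s)
  case (Ones S V)
  then have "finite S" using assms finite_subset by auto
  then show ?thesis
    unfolding Ones by (intro impl_weaken[OF impl_ones[of "sorted_list_of_set S" M V]])
      (use assms Ones in auto)
next
  case (Phase ts)
  show ?thesis unfolding Phase
    by (intro impl_weaken[OF impl_test_phase[of ts M]]) (use assms Phase in auto)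
next
  case (Rot neg S e)
  show ?thesis unfolding Rot
    by (intro impl_weaken[OF impl_rot[of S M]]) (use assms Rot in auto)
qed

definition prog_ok :: "nat set \<Rightarrow> step list \<Rightarrow> bool" where
  "prog_ok Q ps \<longleftrightarrow> (\<forall>s\<in>set ps. step_ok Q s)"

definition prog_size :: "step list \<Rightarrow> nat" where
  "prog_size ps = (\<Sum>s\<leftarrow>ps. step_size s)"

definition prog_blacks :: "step list \<Rightarrow> nat" where
  "prog_blacks ps = (\<Sum>s\<leftarrow>ps. step_blacks s)"

lemma impl_prog:
  assumes "prog_ok {..<M} ps"
  shows "impl n M (32 * length ps) (prog_size ps) (prog_blacks ps) (\<lambda>x. sems (real x / 2 ^ n) ps)"
  using assms
proof (induction ps)
  case Nil
  show ?case by (simp add: prog_size_def prog_blacks_def impl_id)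
next
  case (Cons s ps)
  have "impl n M (32 + 32 * length ps) (step_size s + prog_size ps) (step_blacks s + prog_blacks ps)
      (\<lambda>x \<psi>. sems (real x / 2 ^ n) ps (sem (real x / 2 ^ n) s \<psi>))"
    by (rule impl_comp[OF impl_step]) (use Cons in \<open>auto simp: prog_ok_def\<close>)
  then show ?case by (simp add: prog_size_def prog_blacks_def)
qed

text \<open>Conjunction with the bit \<open>t\<close> inside a single congruence: the doubled
  difference leaves the lowest bit free, and \<open>1 - t\<close> makes it odd when \<open>t\<close>
  is unset.\<close>

fun ctrl_test :: "nat \<Rightarrow> test \<Rightarrow> test" where
  "ctrl_test t (ws, v, T) = ((t, - 1) # map (\<lambda>(q, w). (q, 2 * w)) ws, 2 * v - 1, T + 1)"

lemma holds_ctrl: "holds (ctrl_test t \<tau>) b \<longleftrightarrow> b t \<and> holds \<tau> b"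
proof -
  obtain ws v T where \<tau>: "\<tau> = (ws, v, T)" by (cases \<tau>) auto
  have "wsum (map (\<lambda>(q, w). (q, 2 * w)) ws) b = 2 * wsum ws b"
    by (induction ws) (auto simp: wsum_def)
  then have "wsum ((t, - 1) # map (\<lambda>(q, w). (q, 2 * w)) ws) b - (2 * v - 1)
      = 2 * (wsum ws b - v) + (1 - of_bool (b t))"
    by (simp add: wsum_def)
  moreover have "\<not> (2::int) ^ Suc T dvd 2 * k + 1" for k
  proof
    assume "(2::int) ^ Suc T dvd 2 * k + 1"
    then have "(2::int) dvd 2 * k + 1" by (metis dvd_mult_left power_Suc)
    then show False by simp
  qed
  moreover have "(2::int) ^ Suc T dvd 2 * k \<longleftrightarrow> 2 ^ T dvd k" for k by simp
  ultimately show ?thesis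
    unfolding \<tau> ctrl_test.simps holds.simps Suc_eq_plus1[symmetric]
    by (cases "b t") (simp_all only: of_bool_eq simp_thms diff_self add_0_right diff_zero)
qed

definition xor_prog :: "nat set \<Rightarrow> (nat \<Rightarrow> test list) \<Rightarrow> step list" where
  "xor_prog S tf = [Ones S (\<lambda>_. hmat),
     Phase (concat (map (\<lambda>t. map (\<lambda>\<tau>. (pi, ctrl_test t \<tau>)) (tf t)) (sorted_list_of_set S))),
     Ones S (\<lambda>_. hmat)]"

text \<open>Phases of \<open>pi\<close> add modulo \<open>2 * pi\<close>, so a list of tests
  delivers a parity. It is a disjunction when at most one test can hold, which is how most lists
  below are designed.\<close>

definition parity_tests :: "test list \<Rightarrow> (nat \<Rightarrow> bool) \<Rightarrow> bool" where
  "parity_tests ts b \<longleftrightarrow> odd (length (filter (\<lambda>\<tau>. holds \<tau> b) ts))"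

lemma parity_tests_cong:
  "(\<And>\<tau> q. \<tau> \<in> set ts \<Longrightarrow> q \<in> test_qubits \<tau> \<Longrightarrow> b q = b' q) \<Longrightarrow> parity_tests ts b = parity_tests ts b'"
  unfolding parity_tests_def
  by (intro arg_cong[of _ _ "\<lambda>l. odd (length l)"] filter_cong refl holds_cong) auto

lemma tphase_concat: "tphase (concat (map f is)) b = (\<Sum>i\<leftarrow>is. tphase (f i) b)"
  by (induction "is") (auto simp: tphase_def)

lemma cis_nat_pi: "cis (pi * real k) = cis (pi * of_bool (odd k))"
proof (cases "odd k")
  case True
  then show ?thesis using cis_odd_pi[of "int k"] by simp
next
  case False
  then obtain j where "k = 2 * j" by blast
  then show ?thesis using cis_int_2pi[of "int j"] by (simp add: mult_ac)
qed

lemma sems_xor_prog: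
  assumes "finite S" "\<And>t \<tau>. t \<in> S \<Longrightarrow> \<tau> \<in> set (tf t) \<Longrightarrow> test_qubits \<tau> \<inter> S = {}"
  shows "sems \<theta> (xor_prog S tf) \<psi> = (\<lambda>b. \<psi> (\<lambda>q. if q \<in> S then b q \<noteq> parity_tests (tf q) b else b q))"
proof -
  define l where "l = sorted_list_of_set S"
  have l: "distinct l" "set l = S" using assms(1) by (auto simp: l_def)
  have ind: "indep S (parity_tests (tf t))" if "t \<in> S" for t
    unfolding indep_def parity_tests_def
  proof (intro allI impI arg_cong[of _ _ "\<lambda>l. odd (length l)"] filter_cong refl)
    fix b q v \<tau> assume "q \<in> S" "\<tau> \<in> set (tf t)"
    then show "holds \<tau> (b(q := v)) = holds \<tau> b"
      using indep_holds[OF assms(2)[OF that]] by (auto simp: indep_def)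
  qed
  have ph: "cis (tphase (concat (map (\<lambda>t. map (\<lambda>\<tau>. (pi, ctrl_test t \<tau>)) (tf t)) l)) b)
      = cis (\<Sum>t\<in>set l. pi * of_bool (b t \<and> parity_tests (tf t) b))" for b
  proof -
    have "tphase (map (\<lambda>\<tau>. (pi, ctrl_test t \<tau>)) xs) b
        = pi * real (of_bool (b t) * length (filter (\<lambda>\<tau>. holds \<tau> b) xs))" for t xs
      by (induction xs) (auto simp: tphase_def holds_ctrl distrib_left)
    then have "tphase (concat (map (\<lambda>t. map (\<lambda>\<tau>. (pi, ctrl_test t \<tau>)) (tf t)) l)) b
        = (\<Sum>t\<in>set l. pi * real (of_bool (b t) * length (filter (\<lambda>\<tau>. holds \<tau> b) (tf t))))"
      unfolding tphase_concat by (simp only: sum_list_distinct_conv_sum_set[OF l(1)])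
    moreover have "cis (\<Sum>t\<in>A. pi * real (of_bool (b t) * length (filter (\<lambda>\<tau>. holds \<tau> b) (tf t))))
      = cis (\<Sum>t\<in>A. pi * of_bool (b t \<and> parity_tests (tf t) b))" if "finite A" for A
      using that
    proof (induction A)
      case (insert t A)
      then show ?case
        unfolding sum.insert[OF insert(1,2)] cis_mult[symmetric] cis_nat_pi
        by (simp add: parity_tests_def)
    qed simp
    ultimately show ?thesis by simp
  qed
  have "sems \<theta> (xor_prog S tf) \<psi> = ones (\<lambda>_. hmat) l
     (\<lambda>b. cis (\<Sum>t\<in>set l. pi * of_bool (b t \<and> parity_tests (tf t) b)) * ones (\<lambda>_. hmat) l \<psi> b)"
    by (simp add: xor_prog_def l_def[symmetric] ph)
  also have "\<dots> = (\<lambda>b. \<psi> (\<lambda>q. if q \<in> set l then b q \<noteq> parity_tests (tf q) b else b q))"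
    by (rule ones_hmat_phase[OF l(1)]) (use ind l in auto)
  finally show ?thesis by (simp add: l)
qed

section \<open>Inverse programs and amplitude amplification\<close>

definition supp_on :: "nat set \<Rightarrow> qstate \<Rightarrow> bool" where
  "supp_on Q \<psi> \<longleftrightarrow> (\<forall>b. b \<notin> asg Q \<longrightarrow> \<psi> b = 0)"

definition ip :: "nat set \<Rightarrow> qstate \<Rightarrow> qstate \<Rightarrow> complex" where
  "ip Q \<phi> \<psi> = (\<Sum>b\<in>asg Q. cnj (\<phi> b) * \<psi> b)"

abbreviation weight :: "nat set \<Rightarrow> ((nat \<Rightarrow> bool) \<Rightarrow> bool) \<Rightarrow> qstate \<Rightarrow> real" where
  "weight Q P \<psi> \<equiv> \<Sum>b\<in>asg Q. of_bool (P b) * (cmod (\<psi> b))\<^sup>2"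

lemma cnj_mult_self: "cnj z * z = of_real ((cmod z)\<^sup>2)"
  by (subst complex_norm_square) (rule mult.commute)

text \<open>A left inverse of a square matrix is a right inverse. The conjugates are named
  separately so that \<open>algebra\<close> treats them as independent unknowns.\<close>

lemma unitary1_adj:
  assumes "unitary1 U"
  shows "unitary1 (adj U)"
proof -
  define a b c d where "a = U False False" and "b = U False True" and "c = U True False" and "d = U True True"
  define a' b' c' d' where "a' = cnj a" and "b' = cnj b" and "c' = cnj c" and "d' = cnj d"
  have "a' * a + c' * c = 1" "b' * b + d' * d = 1" "a' * b + c' * d = 0" "b' * a + d' * c = 0"
    using assms unfolding unitary1_def a'_def b'_def c'_def d'_def a_def b_def c_def d_def
    by (simp_all add: UNIV_bool all_bool_eq add.commute)
  then have "a * a' + b * b' = 1" "c * c' + d * d' = 1" "a * c' + b * d' = 0" "c * a' + d * b' = 0"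
    by algebra+
  then show ?thesis
    unfolding unitary1_def adj_def a'_def b'_def c'_def d'_def a_def b_def c_def d_def
    by (simp add: UNIV_bool all_bool_eq add.commute)
qed

lemma adj_adj [simp]: "adj (adj U) = U"
  by (simp add: adj_def fun_eq_iff)

lemma apply1_adj:
  assumes "unitary1 U"
  shows "apply1 (adj U) q (apply1 U q \<psi>) = \<psi>"
proof
  fix b
  have u: "cnj (U False False) * U False False + cnj (U True False) * U True False = 1"
    "cnj (U False True) * U False True + cnj (U True True) * U True True = 1"
    "cnj (U False False) * U False True + cnj (U True False) * U True True = 0"
    "cnj (U False True) * U False False + cnj (U True True) * U True False = 0"
    using assms unfolding unitary1_def by (simp_all add: UNIV_bool all_bool_eq add.commute)
  define F where "F = \<psi> (b(q := False))"
  define G where "G = \<psi> (b(q := True))"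
  have "apply1 (adj U) q (apply1 U q \<psi>) b
    = cnj (U False (b q)) * (U False False * F + U False True * G)
    + cnj (U True (b q)) * (U True False * F + U True True * G)"
    by (simp add: apply1_eq adj_def F_def G_def)
  also have "\<dots> = (if b q then G else F)"
    using u by (cases "b q") (simp_all, algebra+)
  also have "\<dots> = \<psi> b" by (simp add: F_def G_def fun_upd_idem)
  finally show "apply1 (adj U) q (apply1 U q \<psi>) b = \<psi> b" .
qed

lemma ip_apply1:
  assumes "q \<in> Q" "finite Q"
  shows "ip Q \<phi> (apply1 (adj U) q \<chi>) = ip Q (apply1 U q \<phi>) \<chi>"
proof -
  define R where "R = Q - {q}"
  have R: "Q = insert q R" "q \<notin> R" "finite R" using assms by (auto simp: R_def)
  have *: "\<not> b q" if "b \<in> asg R" for b using that R by (auto simp: asg_def)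
  show ?thesis
    unfolding ip_def R(1) sum_asg_insert[OF R(2,3)]
    by (rule sum.cong[OF refl]) (simp add: apply1_eq adj_def * fun_upd_idem algebra_simps)
qed

lemma supp_on_apply1:
  assumes "supp_on Q \<psi>" "q \<in> Q"
  shows "supp_on Q (apply1 U q \<psi>)"
  unfolding supp_on_def
proof (intro allI impI)
  fix b assume "b \<notin> asg Q"
  then have "b(q := v) \<notin> asg Q" for v using assms(2) by (auto simp: asg_def)
  then show "apply1 U q \<psi> b = 0" using assms(1) by (simp add: apply1_eq supp_on_def)
qed

lemma supp_on_ones: "supp_on Q \<psi> \<Longrightarrow> set qs \<subseteq> Q \<Longrightarrow> supp_on Q (ones V qs \<psi>)"
  by (induction qs arbitrary: \<psi>) (auto simp: supp_on_apply1)

lemma ones_adj: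
  assumes "distinct qs" "\<And>q. q \<in> set qs \<Longrightarrow> unitary1 (V q)"
  shows "ones (\<lambda>q. adj (V q)) qs (ones V qs \<psi>) = \<psi>"
  using assms
proof (induction qs arbitrary: \<psi>)
  case (Cons q qs)
  have "ones (\<lambda>q. adj (V q)) (q # qs) (ones V (q # qs) \<psi>)
      = ones (\<lambda>q. adj (V q)) qs (apply1 (adj (V q)) q (apply1 (V q) q (ones V qs \<psi>)))"
    using Cons.prems by (simp add: ones_apply1)
  also have "\<dots> = \<psi>" using Cons by (simp add: apply1_adj)
  finally show ?case .
qed simp

lemma ip_ones:
  assumes "distinct qs" "set qs \<subseteq> Q" "finite Q"
  shows "ip Q \<phi> (ones (\<lambda>q. adj (V q)) qs \<chi>) = ip Q (ones V qs \<phi>) \<chi>"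
  using assms
proof (induction qs arbitrary: \<phi>)
  case (Cons q qs)
  have "ip Q \<phi> (ones (\<lambda>q. adj (V q)) (q # qs) \<chi>) = ip Q \<phi> (apply1 (adj (V q)) q (ones (\<lambda>q. adj (V q)) qs \<chi>))"
    using Cons.prems by (simp add: ones_apply1)
  also have "\<dots> = ip Q (apply1 (V q) q \<phi>) (ones (\<lambda>q. adj (V q)) qs \<chi>)"
    by (rule ip_apply1) (use Cons.prems in auto)
  also have "\<dots> = ip Q (ones V (q # qs) \<phi>) \<chi>" using Cons by simp
  finally show ?case .
qed simp

text \<open>The black-box gate rotates in one direction only; conjugation with the bit flip inverts it up to
  a global phase.\<close>

fun inv_step :: "step \<Rightarrow> step" where
  "inv_step (Ones S V) = Ones S (\<lambda>q. adj (V q))"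
| "inv_step (Phase ts) = Phase (map (\<lambda>(\<beta>, t). (- \<beta>, t)) ts)"
| "inv_step (Rot neg S e) = Rot (\<not> neg) S e"

fun gphase :: "real \<Rightarrow> step \<Rightarrow> complex" where
  "gphase \<theta> (Rot neg S e) = cis (2 * pi * \<theta> * (\<Sum>q\<in>S. 2 ^ e q))"
| "gphase \<theta> _ = 1"

definition inv_prog :: "step list \<Rightarrow> step list" where
  "inv_prog ps = rev (map inv_step ps)"

definition gphases :: "real \<Rightarrow> step list \<Rightarrow> complex" where
  "gphases \<theta> ps = (\<Prod>s\<leftarrow>ps. gphase \<theta> s)"

lemma norm_gphase: "cmod (gphase \<theta> s) = 1"
  by (cases s) auto

lemma norm_gphases: "cmod (gphases \<theta> ps) = 1"
  by (induction ps) (auto simp: gphases_def norm_mult norm_gphase)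

lemma apply1_lin:
  "apply1 U q (\<lambda>b. u * \<phi> b + w * \<chi> b) = (\<lambda>b. u * apply1 U q \<phi> b + w * apply1 U q \<chi> b)"
  by (rule ext) (simp add: apply1_eq algebra_simps)

lemma ones_lin:
  "ones V qs (\<lambda>b. u * \<phi> b + w * \<chi> b) = (\<lambda>b. u * ones V qs \<phi> b + w * ones V qs \<chi> b)"
  by (induction qs arbitrary: \<phi> \<chi>) (auto simp: apply1_lin)

lemma sem_lin:
  "sem \<theta> s (\<lambda>b. u * \<phi> b + w * \<chi> b) = (\<lambda>b. u * sem \<theta> s \<phi> b + w * sem \<theta> s \<chi> b)"
  by (cases s) (auto simp: ones_lin algebra_simps)

lemma sems_lin:
  "sems \<theta> ps (\<lambda>b. u * \<phi> b + w * \<chi> b) = (\<lambda>b. u * sems \<theta> ps \<phi> b + w * sems \<theta> ps \<chi> b)"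
  by (induction ps arbitrary: \<phi> \<chi>) (auto simp: sem_lin)

lemma sems_scale: "sems \<theta> ps (\<lambda>b. u * \<phi> b) = (\<lambda>b. u * sems \<theta> ps \<phi> b)"
  using sems_lin[of \<theta> ps u \<phi> 0 \<phi>] by simp

lemma tphase_neg: "tphase (map (\<lambda>(\<beta>, t). (- \<beta>, t)) ts) b = - tphase ts b"
  unfolding tphase_def by (induction ts) auto

lemma rot_phases:
  "cis (2 * pi * \<theta> * (\<Sum>q\<in>S. 2 ^ e q * of_bool (b q \<noteq> (\<not> neg)))) * cis (2 * pi * \<theta> * (\<Sum>q\<in>S. 2 ^ e q * of_bool (b q \<noteq> neg)))
   = cis (2 * pi * \<theta> * (\<Sum>q\<in>S. 2 ^ e q))"
proof -
  have "(\<Sum>q\<in>S. 2 ^ e q * of_bool (b q \<noteq> (\<not> neg))) + (\<Sum>q\<in>S. 2 ^ e q * of_bool (b q \<noteq> neg)) = (\<Sum>q\<in>S. (2::real) ^ e q)"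
    unfolding sum.distrib[symmetric] by (rule sum.cong) auto
  then show ?thesis by (simp only: cis_mult distrib_left[symmetric])
qed

lemma sem_inv:
  assumes "step_ok Q s" "finite Q"
  shows "sem \<theta> (inv_step s) (sem \<theta> s \<psi>) = (\<lambda>b. gphase \<theta> s * \<psi> b)"
    and "sem \<theta> s (sem \<theta> (inv_step s) \<psi>) = (\<lambda>b. gphase \<theta> s * \<psi> b)"
proof -
  have "sem \<theta> (inv_step s) (sem \<theta> s \<psi>) = (\<lambda>b. gphase \<theta> s * \<psi> b) \<and>
        sem \<theta> s (sem \<theta> (inv_step s) \<psi>) = (\<lambda>b. gphase \<theta> s * \<psi> b)"
  proof (cases s)
    case (Ones S V)
    then have "finite S" using assms finite_subset by auto
    then show ?thesis
      using assms Ones ones_adj[of "sorted_list_of_set S" V \<psi>]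
        ones_adj[of "sorted_list_of_set S" "\<lambda>q. adj (V q)" \<psi>]
      by (auto simp: unitary1_adj)
  next
    case (Phase ts)
    then show ?thesis by (simp add: tphase_neg mult.assoc[symmetric] cis_mult)
  next
    case (Rot neg S e)
    then show ?thesis
      using rot_phases[of \<theta> e _ neg S] rot_phases[of \<theta> e _ "\<not> neg" S]
      by (simp add: mult.assoc[symmetric])
  qed
  then show "sem \<theta> (inv_step s) (sem \<theta> s \<psi>) = (\<lambda>b. gphase \<theta> s * \<psi> b)"
    "sem \<theta> s (sem \<theta> (inv_step s) \<psi>) = (\<lambda>b. gphase \<theta> s * \<psi> b)" by auto
qed

text \<open>\<open>inv_step\<close> is the adjoint up to \<open>gphase\<close>: a rotation and its
  counterpart on flipped bits multiply to a constant of modulus one. The constant is carried along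
  because it still has to cancel in the amplification.\<close>

lemma ip_sem:
  assumes "step_ok Q s" "finite Q"
  shows "ip Q \<phi> (sem \<theta> (inv_step s) \<chi>) = gphase \<theta> s * ip Q (sem \<theta> s \<phi>) \<chi>"
proof (cases s)
  case (Ones S V)
  then have "finite S" using assms finite_subset by auto
  then show ?thesis
    using assms Ones by (simp add: ip_ones)
next
  case (Phase ts)
  then show ?thesis by (simp add: ip_def tphase_neg cis_cnj mult_ac)
next
  case (Rot neg S e)
  have e: "cis (2 * pi * \<theta> * (\<Sum>q\<in>S. 2 ^ e q * of_bool (b q \<noteq> (\<not> neg))))
      = gphase \<theta> s * cnj (cis (2 * pi * \<theta> * (\<Sum>q\<in>S. 2 ^ e q * of_bool (b q \<noteq> neg))))" for b
  proof -
    define u where "u = cis (2 * pi * \<theta> * (\<Sum>q\<in>S. 2 ^ e q * of_bool (b q \<noteq> neg)))"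
    have "u * cnj u = 1" by (simp add: u_def cis_cnj cis_mult)
    define v where "v = cis (2 * pi * \<theta> * (\<Sum>q\<in>S. 2 ^ e q * of_bool (b q \<noteq> (\<not> neg))))"
    have "v * u = gphase \<theta> s"
      unfolding u_def v_def Rot gphase.simps by (rule rot_phases)
    have "v = v * (u * cnj u)" by (simp only: \<open>u * cnj u = 1\<close> mult_1_right)
    also have "\<dots> = (v * u) * cnj u" by (simp only: mult.assoc)
    finally show ?thesis unfolding u_def[symmetric] v_def[symmetric] by (simp only: \<open>v * u = gphase \<theta> s\<close>)
  qed
  have "ip Q \<phi> (sem \<theta> (inv_step s) \<chi>) = (\<Sum>b\<in>asg Q. gphase \<theta> s * (cnj (sem \<theta> s \<phi> b) * \<chi> b))"
    unfolding ip_def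
  proof (rule sum.cong[OF refl])
    fix b
    show "cnj (\<phi> b) * sem \<theta> (inv_step s) \<chi> b = gphase \<theta> s * (cnj (sem \<theta> s \<phi> b) * \<chi> b)"
      unfolding Rot inv_step.simps sem.simps e complex_cnj_mult by (simp only: Rot mult_ac)
  qed
  then show ?thesis by (simp only: ip_def sum_distrib_left)
qed

lemma supp_on_sem:
  assumes "step_ok Q s" "finite Q" "supp_on Q \<psi>"
  shows "supp_on Q (sem \<theta> s \<psi>)"
proof (cases s)
  case (Ones S V)
  then have "finite S" using assms finite_subset by auto
  then show ?thesis using assms Ones by (auto intro!: supp_on_ones)
qed (use assms in \<open>auto simp: supp_on_def\<close>)

lemma supp_on_sems:
  "prog_ok Q ps \<Longrightarrow> finite Q \<Longrightarrow> supp_on Q \<psi> \<Longrightarrow> supp_on Q (sems \<theta> ps \<psi>)"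
  by (induction ps arbitrary: \<psi>) (auto simp: prog_ok_def supp_on_sem)

lemma sems_inv_prog:
  assumes "prog_ok Q ps" "finite Q"
  shows "sems \<theta> (inv_prog ps) (sems \<theta> ps \<psi>) = (\<lambda>b. gphases \<theta> ps * \<psi> b)"
    and "sems \<theta> ps (sems \<theta> (inv_prog ps) \<psi>) = (\<lambda>b. gphases \<theta> ps * \<psi> b)"
proof -
  show "sems \<theta> (inv_prog ps) (sems \<theta> ps \<psi>) = (\<lambda>b. gphases \<theta> ps * \<psi> b)"
    using assms(1)
  proof (induction ps arbitrary: \<psi>)
    case (Cons s ps)
    then have "sems \<theta> (inv_prog (s # ps)) (sems \<theta> (s # ps) \<psi>)
        = sem \<theta> (inv_step s) (\<lambda>b. gphases \<theta> ps * sem \<theta> s \<psi> b)"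
      by (simp add: inv_prog_def prog_ok_def)
    also have "\<dots> = (\<lambda>b. gphases \<theta> ps * sem \<theta> (inv_step s) (sem \<theta> s \<psi>) b)"
      using sems_scale[of \<theta> "[inv_step s]"] by simp
    also have "\<dots> = (\<lambda>b. gphases \<theta> (s # ps) * \<psi> b)"
      using Cons.prems by (simp add: sem_inv(1)[OF _ assms(2)] prog_ok_def gphases_def mult_ac)
    finally show ?case .
  qed (simp add: inv_prog_def gphases_def)
  show "sems \<theta> ps (sems \<theta> (inv_prog ps) \<psi>) = (\<lambda>b. gphases \<theta> ps * \<psi> b)"
    using assms(1)
  proof (induction ps arbitrary: \<psi>)
    case (Cons s ps)
    have "sems \<theta> (s # ps) (sems \<theta> (inv_prog (s # ps)) \<psi>)
        = sems \<theta> ps (sem \<theta> s (sem \<theta> (inv_step s) (sems \<theta> (inv_prog ps) \<psi>)))"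
      by (simp add: inv_prog_def)
    also have "\<dots> = (\<lambda>b. gphase \<theta> s * sems \<theta> ps (sems \<theta> (inv_prog ps) \<psi>) b)"
      using Cons.prems by (simp add: sem_inv(2)[OF _ assms(2)] prog_ok_def sems_scale)
    also have "\<dots> = (\<lambda>b. gphases \<theta> (s # ps) * \<psi> b)"
      using Cons by (simp add: prog_ok_def gphases_def mult.assoc)
    finally show ?case .
  qed (simp add: inv_prog_def gphases_def)
qed

lemma ip_sems:
  assumes "prog_ok Q ps" "finite Q"
  shows "ip Q \<phi> (sems \<theta> (inv_prog ps) \<chi>) = gphases \<theta> ps * ip Q (sems \<theta> ps \<phi>) \<chi>"
  using assms(1)
proof (induction ps arbitrary: \<phi>)
  case (Cons s ps)
  have "ip Q \<phi> (sems \<theta> (inv_prog (s # ps)) \<chi>) = gphase \<theta> s * ip Q (sem \<theta> s \<phi>) (sems \<theta> (inv_prog ps) \<chi>)"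
    using Cons.prems by (simp add: inv_prog_def ip_sem[OF _ assms(2)] prog_ok_def)
  also have "\<dots> = gphases \<theta> (s # ps) * ip Q (sems \<theta> (s # ps) \<phi>) \<chi>"
    using Cons by (simp add: prog_ok_def gphases_def)
  finally show ?case .
qed (simp add: inv_prog_def gphases_def)

lemma supp_on_zero_state: "supp_on Q zero_state"
  by (auto simp: supp_on_def zero_state_def asg_def)

lemma ip_zero_state:
  assumes "finite Q"
  shows "ip Q zero_state \<chi> = \<chi> (\<lambda>_. False)"
proof -
  have "ip Q zero_state \<chi> = (\<Sum>b\<in>asg Q. if b = (\<lambda>_. False) then \<chi> (\<lambda>_. False) else 0)"
    unfolding ip_def by (rule sum.cong) (auto simp: zero_state_def)
  also have "\<dots> = \<chi> (\<lambda>_. False)"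
  proof -
    have "(\<lambda>_. False) \<in> asg Q" by (simp add: asg_def)
    then show ?thesis using finite_asg[OF assms] by (simp add: sum.delta')
  qed
  finally show ?thesis .
qed

text \<open>Norm preservation is read off from the adjoint: moving the program to the other side of
  the inner product leaves the inverse program applied to its own output.\<close>

lemma norm_sems:
  assumes "prog_ok Q ps" "finite Q"
  shows "(\<Sum>b\<in>asg Q. (cmod (sems \<theta> ps zero_state b))\<^sup>2) = 1"
proof -
  define \<psi> where "\<psi> = sems \<theta> ps zero_state"
  have g: "gphases \<theta> ps \<noteq> 0" using norm_gphases[of \<theta> ps] by auto
  have "gphases \<theta> ps * ip Q \<psi> \<psi> = ip Q zero_state (sems \<theta> (inv_prog ps) \<psi>)"
    unfolding \<psi>_def by (simp add: ip_sems[OF assms])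
  also have "\<dots> = gphases \<theta> ps"
    by (simp only: \<psi>_def sems_inv_prog(1)[OF assms] ip_zero_state[OF assms(2)]) (simp add: zero_state_def)
  finally have "ip Q \<psi> \<psi> = 1" using g by simp
  moreover have "ip Q \<psi> \<psi> = of_real (\<Sum>b\<in>asg Q. (cmod (\<psi> b))\<^sup>2)"
    unfolding ip_def of_real_sum by (rule sum.cong[OF refl cnj_mult_self])
  ultimately show ?thesis by (metis \<psi>_def of_real_eq_1_iff)
qed

section \<open>Binary length and the test that all qubits of a set are zero\<close>

definition lg :: "nat \<Rightarrow> nat" where
  "lg k = (LEAST T. k < 2 ^ T)"

lemma lg_less: "k < 2 ^ lg k"
  unfolding lg_def by (rule LeastI[of _ k]) simp

lemma lg_le: "k < 2 ^ T \<Longrightarrow> lg k \<le> T"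
  unfolding lg_def by (rule Least_le)

lemma power_lg_le: "2 ^ lg k \<le> 2 * k + 1"
proof (cases "lg k")
  case (Suc T)
  then have "\<not> k < 2 ^ T" using lg_le[of k T] by auto
  then show ?thesis using Suc by simp
qed simp

text \<open>The number of set qubits is below \<open>2 ^ lg (card Q)\<close>, so it is congruent to
  zero only if it is zero. The modulus is at most \<open>2 * card Q + 1\<close>, hence the cost is
  nearly linear.\<close>

definition none_test :: "nat set \<Rightarrow> test" where
  "none_test Q = (map (\<lambda>q. (q, 1)) (sorted_list_of_set Q), 0, lg (card Q))"

lemma wsum_ones:
  assumes "finite Q"
  shows "wsum (map (\<lambda>q. (q, 1)) (sorted_list_of_set Q)) b = int (card {q \<in> Q. b q})"
proof -
  have "wsum (map (\<lambda>q. (q, 1)) (sorted_list_of_set Q)) b = (\<Sum>q\<in>Q. of_bool (b q))"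
    using assms by (simp add: wsum_def comp_def sum_list_distinct_conv_sum_set)
  also have "\<dots> = int (card {q \<in> Q. b q})"
    using assms by (simp add: Int_def)
  finally show ?thesis .
qed

lemma holds_none_test:
  assumes "finite Q"
  shows "holds (none_test Q) b \<longleftrightarrow> (\<forall>q\<in>Q. \<not> b q)"
proof -
  define k where "k = card {q \<in> Q. b q}"
  have "k \<le> card Q" unfolding k_def by (rule card_mono) (use assms in auto)
  then have "k < 2 ^ lg (card Q)" using lg_less[of "card Q"] by linarith
  then have "(2::int) ^ lg (card Q) dvd int k \<longleftrightarrow> k = 0"
  proof (cases "k = 0")
    case False
    have "int k < 2 ^ lg (card Q)" using \<open>k < 2 ^ lg (card Q)\<close> by (metis of_nat_less_iff of_nat_numeral of_nat_power)
    then show ?thesis using False zdvd_imp_le[of "2 ^ lg (card Q)" "int k"] by auto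
  qed simp
  then show ?thesis
    using assms by (auto simp: none_test_def wsum_ones k_def)
qed

lemma test_qubits_none_test: "finite Q \<Longrightarrow> test_qubits (none_test Q) = Q"
  by (auto simp: none_test_def image_image)

text \<open>A phase \<open>pi\<close> is a reflection: this is a preparation followed by one Grover
  iteration.\<close>

definition amplify :: "nat set \<Rightarrow> test \<Rightarrow> step list \<Rightarrow> step list" where
  "amplify Q flag ps = ps @ [Phase [(pi, flag)]] @ inv_prog ps @ [Phase [(pi, none_test Q)]] @ ps"

text \<open>With \<open>g\<close> the flagged part of \<open>\<psi>\<close>, the program produces \<open>(4p - 1)\<psi> - 2g\<close>, where \<open>p\<close> is the squared
  norm of \<open>g\<close>.\<close>

lemma sems_amplify:
  assumes ps: "prog_ok Q ps" and Q: "finite Q"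
    and p: "weight Q (holds flag) (sems \<theta> ps zero_state) = 1 / 4"
  shows "cmod (sems \<theta> (amplify Q flag ps) zero_state b)
    = 2 * of_bool (holds flag b) * cmod (sems \<theta> ps zero_state b)"
proof -
  define \<psi> where "\<psi> = sems \<theta> ps zero_state"
  define g where "g b = of_bool (holds flag b) * \<psi> b" for b
  define \<kappa> where "\<kappa> = gphases \<theta> ps"
  have s\<psi>: "supp_on Q \<psi>" unfolding \<psi>_def by (rule supp_on_sems[OF ps Q supp_on_zero_state])
  have sg: "supp_on Q g" using s\<psi> by (simp add: supp_on_def g_def)
  have Sf: "sem \<theta> (Phase [(pi, flag)]) \<psi> = (\<lambda>b. 1 * \<psi> b + (- 2) * g b)"
    by (rule ext) (simp add: tphase_def g_def)
  define \<xi> where "\<xi> = sems \<theta> (inv_prog ps) g"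
  have inv: "sems \<theta> (inv_prog ps) (\<lambda>b. 1 * \<psi> b + (- 2) * g b) = (\<lambda>b. \<kappa> * zero_state b + (- 2) * \<xi> b)"
    unfolding sems_lin \<xi>_def[symmetric] by (simp add: \<psi>_def sems_inv_prog(1)[OF ps Q] \<kappa>_def)
  have pi: "prog_ok Q (inv_prog ps)"
    unfolding prog_ok_def inv_prog_def
  proof
    fix s assume "s \<in> set (rev (map inv_step ps))"
    then obtain s' where s': "s' \<in> set ps" "s = inv_step s'" by auto
    then have "step_ok Q s'" using ps by (simp add: prog_ok_def)
    then show "step_ok Q s" unfolding s'(2) by (cases s') (auto simp: unitary1_adj)
  qed
  have s\<xi>: "supp_on Q \<xi>" unfolding \<xi>_def by (rule supp_on_sems[OF pi Q sg])
  have "\<xi> (\<lambda>_. False) = \<kappa> * ip Q \<psi> g"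
    using ip_sems[OF ps Q, of zero_state \<theta> g] by (simp add: ip_zero_state[OF Q] \<xi>_def \<psi>_def \<kappa>_def)
  also have "ip Q \<psi> g = of_real (weight Q (holds flag) \<psi>)"
    unfolding ip_def of_real_sum
  proof (rule sum.cong[OF refl])
    fix b
    show "cnj (\<psi> b) * g b = of_real (of_bool (holds flag b) * (cmod (\<psi> b))\<^sup>2)"
      by (cases "holds flag b") (simp_all only: g_def cnj_mult_self of_bool_eq mult_1 mult_zero_left mult_zero_right of_real_0)
  qed
  finally have \<xi>0: "\<xi> (\<lambda>_. False) = \<kappa> / 4" using p by (simp add: \<psi>_def)
  \<comment> \<open>At the zero state the amplitude is
    \<open>\<kappa> - 2 * \<kappa> / 4 = \<kappa> / 2\<close>. The reflection makes it
    \<open>- \<kappa> / 2\<close>, which equals \<open>- 2 * \<xi>\<close> there, so the whole state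
    is \<open>- 2 * \<xi>\<close>. This is where the value 1/4 is used.\<close>
  have S0: "sem \<theta> (Phase [(pi, none_test Q)]) (\<lambda>b. \<kappa> * zero_state b + (- 2) * \<xi> b)
      = (\<lambda>b. 1 * (- 2 * \<xi> b) + \<kappa> * zero_state b - \<kappa> * zero_state b)"
  proof
    fix b
    show "sem \<theta> (Phase [(pi, none_test Q)]) (\<lambda>b. \<kappa> * zero_state b + (- 2) * \<xi> b) b
      = 1 * (- 2 * \<xi> b) + \<kappa> * zero_state b - \<kappa> * zero_state b"
    proof (cases "b = (\<lambda>_. False)")
      case True
      then show ?thesis by (simp add: tphase_def holds_none_test[OF Q] zero_state_def \<xi>0)
    next
      case False
      then have z: "zero_state b = 0" by (simp add: zero_state_def)
      show ?thesis
      proof (cases "b \<in> asg Q")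
        case True
        obtain q where "b q" using False by (auto simp: fun_eq_iff)
        then have "\<not> (\<forall>q\<in>Q. \<not> b q)" using True by (auto simp: asg_def)
        then have "\<not> holds (none_test Q) b" by (simp only: holds_none_test[OF Q] not_False_eq_True)
        then show ?thesis by (simp add: tphase_def z)
      next
        case False
        then have "\<xi> b = 0" using s\<xi> by (simp add: supp_on_def)
        then show ?thesis using z by simp
      qed
    qed
  qed
  have "sems \<theta> (amplify Q flag ps) zero_state = sems \<theta> ps (\<lambda>b. - 2 * \<xi> b)"
    unfolding amplify_def fold_append comp_apply fold.simps id_apply \<psi>_def[symmetric] Sf inv S0 by simp
  also have "\<dots> = (\<lambda>b. - 2 * (\<kappa> * g b))"
    unfolding sems_scale \<xi>_def sems_inv_prog(2)[OF ps Q] \<kappa>_def ..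
  finally show ?thesis
    using norm_gphases[of \<theta> ps] by (simp add: norm_mult g_def \<psi>_def \<kappa>_def)
qed

section \<open>Running a program on disjoint blocks of qubits\<close>

text \<open>Each block sees its own qubits under the numbers below \<open>m\<close>, so one program
  serves all blocks.\<close>

definition slice :: "nat \<Rightarrow> nat \<Rightarrow> (nat \<Rightarrow> bool) \<Rightarrow> nat \<Rightarrow> bool" where
  "slice m j b = (\<lambda>q. q < m \<and> b (j * m + q))"

definition tensor :: "nat \<Rightarrow> nat \<Rightarrow> (nat \<Rightarrow> qstate) \<Rightarrow> qstate" where
  "tensor m J u b = (if b \<in> asg {..<J * m} then \<Prod>j<J. u j (slice m j b) else 0)"

fun rename_test :: "(nat \<Rightarrow> nat) \<Rightarrow> test \<Rightarrow> test" where
  "rename_test f (ws, v, T) = (map (\<lambda>(q, w). (f q, w)) ws, v, T)"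

definition blocks :: "nat \<Rightarrow> nat \<Rightarrow> nat set \<Rightarrow> nat set" where
  "blocks m J S = (\<Union>j<J. (\<lambda>q. j * m + q) ` S)"

text \<open>Block \<open>j\<close> runs the program with the rotation angle multiplied by \<open>2 ^ (j * h)\<close>.\<close>

fun par_step :: "nat \<Rightarrow> nat \<Rightarrow> nat \<Rightarrow> step \<Rightarrow> step" where
  "par_step m J h (Ones S V) = Ones (blocks m J S) (\<lambda>p. V (p mod m))"
| "par_step m J h (Phase ts) =
     Phase (concat (map (\<lambda>j. map (\<lambda>(\<beta>, t). (\<beta>, rename_test (\<lambda>q. j * m + q) t)) ts) [0..<J]))"
| "par_step m J h (Rot neg S e) = Rot neg (blocks m J S) (\<lambda>p. p div m * h + e (p mod m))"

lemma asg_lessThan: "b \<in> asg {..<N} \<longleftrightarrow> (\<forall>q\<ge>N. \<not> b q)"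
  by (auto simp: asg_def not_less) (metis not_le)

lemma block_lt: "j < J \<Longrightarrow> q < m \<Longrightarrow> j * m + q < J * (m::nat)"
proof -
  assume "j < J" "q < m"
  then have "j * m + q < Suc j * m" by simp
  also have "\<dots> \<le> J * m" using \<open>j < J\<close> by (intro mult_right_mono) auto
  finally show ?thesis .
qed

lemma block_inj:
  assumes "q < m" "q' < m"
  shows "j * m + q = j' * m + q' \<longleftrightarrow> j = j' \<and> q = (q'::nat)"
proof
  assume e: "j * m + q = j' * m + q'"
  have "(j * m + q) div m = j" "(j' * m + q') div m = j'" using assms by auto
  then have "j = j'" using e by simp
  then show "j = j' \<and> q = q'" using e by simp
qed simp

lemma slice_upd:
  assumes "q < m"
  shows "slice m i (b(j * m + q := c)) = (if i = j then (slice m j b)(q := c) else slice m i b)"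
  unfolding slice_def using assms by (auto simp: fun_eq_iff block_inj)

lemma tensor_upd:
  assumes "j < J" "q < m"
  shows "tensor m J u (b(j * m + q := c))
    = (if b \<in> asg {..<J * m} then u j ((slice m j b)(q := c)) * (\<Prod>i\<in>{..<J} - {j}. u i (slice m i b)) else 0)"
proof -
  have "b(j * m + q := c) \<in> asg {..<J * m} \<longleftrightarrow> b \<in> asg {..<J * m}"
    using block_lt[OF assms] unfolding asg_lessThan by auto
  moreover have "(\<Prod>i<J. u i (slice m i (b(j * m + q := c))))
      = u j ((slice m j b)(q := c)) * (\<Prod>i\<in>{..<J} - {j}. u i (slice m i b))"
    using assms by (subst prod.remove[of _ j]) (auto simp: slice_upd intro!: prod.cong)
  ultimately show ?thesis by (simp add: tensor_def)
qed

lemma tensor_split: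
  assumes "j < J"
  shows "tensor m J u b
    = (if b \<in> asg {..<J * m} then u j (slice m j b) * (\<Prod>i\<in>{..<J} - {j}. u i (slice m i b)) else 0)"
  unfolding tensor_def using assms by (subst prod.remove[of _ j]) auto

lemma apply1_tensor:
  assumes "j < J" "q < m"
  shows "apply1 U (j * m + q) (tensor m J u) = tensor m J (u(j := apply1 U q (u j)))"
proof
  fix b
  have "(\<Prod>i\<in>{..<J} - {j}. (u(j := apply1 U q (u j))) i (slice m i b)) = (\<Prod>i\<in>{..<J} - {j}. u i (slice m i b))"
    by (rule prod.cong) auto
  moreover have "b (j * m + q) = slice m j b q" using assms by (simp add: slice_def)
  ultimately show "apply1 U (j * m + q) (tensor m J u) b = tensor m J (u(j := apply1 U q (u j))) b"
    by (simp add: apply1_eq tensor_upd[OF assms] tensor_split[OF assms(1), of m "u(j := apply1 U q (u j))" b]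
        distrib_right mult.assoc)
qed

lemma ones_append: "ones V (xs @ ys) \<psi> = ones V ys (ones V xs \<psi>)"
  by (simp add: ones_def)

lemma ones_block:
  assumes "j < J" "set qs \<subseteq> {..<m}"
  shows "ones (\<lambda>p. V (p mod m)) (map (\<lambda>q. j * m + q) qs) (tensor m J u) = tensor m J (u(j := ones V qs (u j)))"
  using assms(2)
proof (induction qs arbitrary: u)
  case (Cons q qs)
  then have q: "q < m" "(j * m + q) mod m = q" by auto
  have "ones (\<lambda>p. V (p mod m)) (map (\<lambda>q. j * m + q) (q # qs)) (tensor m J u)
      = ones (\<lambda>p. V (p mod m)) (map (\<lambda>q. j * m + q) qs) (tensor m J (u(j := apply1 (V q) q (u j))))"
    by (simp only: list.map ones_Cons q(2) apply1_tensor[OF assms(1) q(1)])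
  also have "\<dots> = tensor m J ((u(j := apply1 (V q) q (u j)))(j := ones V qs ((u(j := apply1 (V q) q (u j))) j)))"
    by (rule Cons.IH) (use Cons.prems in simp)
  also have "\<dots> = tensor m J (u(j := ones V (q # qs) (u j)))"
    by (simp only: fun_upd_upd fun_upd_same ones_Cons)
  finally show ?case .
qed simp

lemma ones_blocks:
  assumes "K \<le> J" "set qs \<subseteq> {..<m}"
  shows "ones (\<lambda>p. V (p mod m)) (concat (map (\<lambda>j. map (\<lambda>q. j * m + q) qs) [0..<K])) (tensor m J u)
    = tensor m J (\<lambda>j. if j < K then ones V qs (u j) else u j)"
  using assms(1)
proof (induction K)
  case (Suc K)
  have "(\<lambda>j. if j < K then ones V qs (u j) else u j)(K := ones V qs (u K))
      = (\<lambda>j. if j < Suc K then ones V qs (u j) else u j)"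
    by (auto simp: fun_eq_iff less_Suc_eq)
  then show ?case
    using Suc by (simp add: ones_append ones_block[OF _ assms(2)])
qed simp

lemma distinct_concat_map:
  assumes "distinct xs" "\<And>x. x \<in> set xs \<Longrightarrow> distinct (f x)"
    "\<And>x y. x \<in> set xs \<Longrightarrow> y \<in> set xs \<Longrightarrow> x \<noteq> y \<Longrightarrow> set (f x) \<inter> set (f y) = {}"
  shows "distinct (concat (map f xs))"
  using assms
proof (induction xs)
  case (Cons x xs)
  have "set (f x) \<inter> (\<Union>y\<in>set xs. set (f y)) = {}" using Cons.prems by fastforce
  then show ?case using Cons by simp
qed simp

text \<open>Gates on different qubits commute. This reconciles the sorted order of a union of blocks
  with the order block by block.\<close>

lemma ones_perm:
  assumes "distinct ps" "distinct qs" "set ps = set qs"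
  shows "ones V ps = ones V qs"
  unfolding ones_def
proof (rule fold_multiset_equiv)
  show "mset ps = mset qs" using assms set_eq_iff_mset_eq_distinct by blast
  show "apply1 (V p) p \<circ> apply1 (V q) q = apply1 (V q) q \<circ> apply1 (V p) p" for p q
    by (cases "p = q") (auto simp: fun_eq_iff apply1_commute[of p q])
qed

lemma finite_blocks: "finite S \<Longrightarrow> finite (blocks m J S)"
  by (simp add: blocks_def)

lemma sum_blocks:
  fixes f :: "nat \<Rightarrow> 'a::comm_monoid_add"
  assumes "S \<subseteq> {..<m}"
  shows "sum f (blocks m J S) = (\<Sum>j<J. \<Sum>q\<in>S. f (j * m + q))"
proof -
  have fS: "finite S" using assms finite_subset by blast
  have "sum f (blocks m J S) = (\<Sum>j<J. sum f ((\<lambda>q. j * m + q) ` S))"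
    unfolding blocks_def
    by (rule sum.UNION_disjoint) (use assms fS in \<open>auto simp: block_inj subset_eq\<close>)
  also have "\<dots> = (\<Sum>j<J. \<Sum>q\<in>S. f (j * m + q))"
  proof (rule sum.cong[OF refl])
    fix j
    show "sum f ((\<lambda>q. j * m + q) ` S) = (\<Sum>q\<in>S. f (j * m + q))"
      by (simp add: sum.reindex inj_on_def)
  qed
  finally show ?thesis .
qed

lemma card_blocks: "S \<subseteq> {..<m} \<Longrightarrow> card (blocks m J S) = J * card S"
  using sum_blocks[of S m "\<lambda>_. 1::nat" J] by simp

lemma blocks_subset: "S \<subseteq> {..<m} \<Longrightarrow> blocks m J S \<subseteq> {..<J * m}"
  by (auto simp: blocks_def intro!: block_lt)

lemma wsum_rename: "wsum (map (\<lambda>(q, w). (f q, w)) ws) b = wsum ws (\<lambda>q. b (f q))"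
  by (induction ws) (auto simp: wsum_def)

lemma holds_rename: "holds (rename_test f t) b \<longleftrightarrow> holds t (\<lambda>q. b (f q))"
  by (cases t) (auto simp: wsum_rename)

lemma test_qubits_rename: "test_qubits (rename_test f t) = f ` test_qubits t"
  by (cases t) (auto simp: image_iff, force+)

lemma cis_sum: "finite A \<Longrightarrow> cis (\<Sum>a\<in>A. f a) = (\<Prod>a\<in>A. cis (f a))"
  by (induction A rule: finite_induct) (auto simp: cis_mult[symmetric])

lemma sem_par_step:
  assumes "step_ok {..<m} s"
  shows "sem \<theta> (par_step m J h s) (tensor m J u) = tensor m J (\<lambda>j. sem (2 ^ (j * h) * \<theta>) s (u j))"
proof (cases s)
  case (Ones S V)
  have S: "S \<subseteq> {..<m}" "finite S" using assms Ones finite_subset by auto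
  define l where "l = sorted_list_of_set S"
  have l: "distinct l" "set l = S" using S by (auto simp: l_def)
  define L where "L = concat (map (\<lambda>j. map (\<lambda>q. j * m + q) l) [0..<J])"
  have "distinct L"
    unfolding L_def by (rule distinct_concat_map) (use l S in \<open>auto simp: distinct_map inj_on_def block_inj subset_eq\<close>)
  moreover have sL: "set L = blocks m J S" by (auto simp: L_def blocks_def l)
  ultimately have "ones V' (sorted_list_of_set (blocks m J S)) = ones V' L" for V'
    by (intro ones_perm) (use S in \<open>auto simp: finite_blocks\<close>)
  then have "sem \<theta> (par_step m J h s) (tensor m J u)
      = tensor m J (\<lambda>j. if j < J then ones V l (u j) else u j)"
    unfolding Ones L_def by (simp add: ones_blocks l S)
  also have "\<dots> = tensor m J (\<lambda>j. sem (2 ^ (j * h) * \<theta>) s (u j))"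
    by (auto simp: tensor_def Ones l_def fun_eq_iff)
  finally show ?thesis .
next
  case (Phase ts)
  have tq: "test_qubits t \<subseteq> {..<m}" if "(\<beta>, t) \<in> set ts" for \<beta> t using assms Phase that by auto
  have "tphase (concat (map (\<lambda>j. map (\<lambda>(\<beta>, t). (\<beta>, rename_test (\<lambda>q. j * m + q) t)) ts) [0..<J])) b
      = (\<Sum>j<J. tphase ts (slice m j b))" for b
  proof -
    have "tphase (map (\<lambda>(\<beta>, t). (\<beta>, rename_test (\<lambda>q. j * m + q) t)) ts) b = tphase ts (slice m j b)" for j
      unfolding tphase_def map_map
    proof (intro arg_cong[of _ _ sum_list] map_cong refl)
      fix bt assume "bt \<in> set ts"
      then have "test_qubits (snd bt) \<subseteq> {..<m}" using tq by (metis prod.collapse)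
      then have "holds (snd bt) (\<lambda>q. b (j * m + q)) = holds (snd bt) (slice m j b)"
        by (intro holds_cong) (auto simp: slice_def)
      then show "((\<lambda>(\<beta>, t). \<beta> * of_bool (holds t b)) \<circ> (\<lambda>(\<beta>, t). (\<beta>, rename_test (\<lambda>q. j * m + q) t))) bt
          = (case bt of (\<beta>, t) \<Rightarrow> \<beta> * of_bool (holds t (slice m j b)))"
        by (cases bt) (simp add: holds_rename del: rename_test.simps holds.simps)
    qed
    then show ?thesis
      unfolding tphase_concat by (simp add: interv_sum_list_conv_sum_set_nat atLeast0LessThan)
  qed
  then show ?thesis
    unfolding Phase by (auto simp: tensor_def cis_sum prod.distrib)
next
  case (Rot neg S e)
  have S: "S \<subseteq> {..<m}" using assms Rot by auto
  have "2 * pi * \<theta> * (\<Sum>p\<in>blocks m J S. 2 ^ (p div m * h + e (p mod m)) * of_bool (b p \<noteq> neg))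
      = (\<Sum>j<J. 2 * pi * (2 ^ (j * h) * \<theta>) * (\<Sum>q\<in>S. 2 ^ e q * of_bool (slice m j b q \<noteq> neg)))" for b
    unfolding sum_blocks[OF S] sum_distrib_left
  proof (intro sum.cong refl)
    fix j q assume "q \<in> S"
    then have "q < m" using S by auto
    then show "2 * pi * \<theta> * (2 ^ ((j * m + q) div m * h + e ((j * m + q) mod m)) * of_bool (b (j * m + q) \<noteq> neg))
        = 2 * pi * (2 ^ (j * h) * \<theta>) * (2 ^ e q * of_bool (slice m j b q \<noteq> neg))"
      by (simp add: slice_def power_add)
  qed
  then show ?thesis
    unfolding Rot by (auto simp: tensor_def cis_sum prod.distrib)
qed

definition par_prog :: "nat \<Rightarrow> nat \<Rightarrow> nat \<Rightarrow> step list \<Rightarrow> step list" where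
  "par_prog m J h = map (par_step m J h)"

lemma sems_par_prog:
  "prog_ok {..<m} ps \<Longrightarrow>
    sems \<theta> (par_prog m J h ps) (tensor m J u) = tensor m J (\<lambda>j. sems (2 ^ (j * h) * \<theta>) ps (u j))"
  by (induction ps arbitrary: u) (auto simp: par_prog_def prog_ok_def sem_par_step)

lemma tensor_zero_state: "tensor m J (\<lambda>_. zero_state) = zero_state"
proof
  fix b
  show "tensor m J (\<lambda>_. zero_state) b = zero_state b"
  proof (cases "b \<in> asg {..<J * m}")
    case False
    then show ?thesis by (auto simp: tensor_def zero_state_def asg_def)
  next
    case True
    have "b = (\<lambda>_. False) \<longleftrightarrow> (\<forall>j<J. slice m j b = (\<lambda>_. False))"
    proof
      assume a: "\<forall>j<J. slice m j b = (\<lambda>_. False)"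
      show "b = (\<lambda>_. False)"
      proof (rule ccontr)
        assume "b \<noteq> (\<lambda>_. False)"
        then obtain p where p: "b p" by (auto simp: fun_eq_iff)
        then have "p < J * m" using True by (auto simp: asg_def)
        then have m: "m > 0" by (cases m) auto
        have "p div m < J" using \<open>p < J * m\<close> by (simp add: less_mult_imp_div_less)
        then have "\<not> slice m (p div m) b (p mod m)" using a by simp
        then show False using p m by (simp add: slice_def)
      qed
    qed (simp add: slice_def)
    then show ?thesis using True by (auto simp: tensor_def zero_state_def prod_zero_iff intro!: prod.neutral)
  qed
qed

lemma sum_asg_tensor:
  fixes f :: "nat \<Rightarrow> (nat \<Rightarrow> bool) \<Rightarrow> 'a::comm_semiring_1"
  shows "(\<Sum>b\<in>asg {..<J * m}. \<Prod>j<J. f j (slice m j b)) = (\<Prod>j<J. \<Sum>a\<in>asg {..<m}. f j a)"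
proof (induction J)
  case (Suc J)
  define S where "S = {..<J * m}"
  define T where "T = {J * m..<Suc J * m}"
  have ST: "{..<Suc J * m} = S \<union> T" "S \<inter> T = {}" by (auto simp: S_def T_def)
  have "(\<Sum>b\<in>asg {..<Suc J * m}. \<Prod>j<Suc J. f j (slice m j b))
    = (\<Sum>b\<in>asg S. \<Sum>a\<in>asg T. \<Prod>j<Suc J. f j (slice m j (\<lambda>q. if q \<in> T then a q else b q)))"
    unfolding ST(1) by (rule sum_asg_Un[OF ST(2)])
  also have "\<dots> = (\<Sum>b\<in>asg S. \<Sum>a\<in>asg T. (\<Prod>j<J. f j (slice m j b)) * f J (slice m J a))"
  proof (intro sum.cong refl)
    fix b a assume "b \<in> asg S" "a \<in> asg T"
    have "slice m j (\<lambda>q. if q \<in> T then a q else b q) = slice m j b" if "j < J" for j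
    proof
      fix q
      show "slice m j (\<lambda>q. if q \<in> T then a q else b q) q = slice m j b q"
        using block_lt[OF that, of q m] by (cases "q < m") (simp_all add: slice_def T_def)
    qed
    moreover have "slice m J (\<lambda>q. if q \<in> T then a q else b q) = slice m J a"
      by (auto simp: slice_def T_def fun_eq_iff)
    ultimately show "(\<Prod>j<Suc J. f j (slice m j (\<lambda>q. if q \<in> T then a q else b q)))
        = (\<Prod>j<J. f j (slice m j b)) * f J (slice m J a)" by simp
  qed
  also have "\<dots> = (\<Sum>b\<in>asg S. \<Prod>j<J. f j (slice m j b)) * (\<Sum>a\<in>asg T. f J (slice m J a))"
    by (simp add: sum_product)
  also have "(\<Sum>a\<in>asg T. f J (slice m J a)) = (\<Sum>a\<in>asg {..<m}. f J a)"
  proof (rule sum.reindex_bij_witness[of _ "\<lambda>a q. q \<in> T \<and> a (q - J * m)" "slice m J"])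
    fix a assume a: "a \<in> asg T"
    show "(\<lambda>q. q \<in> T \<and> slice m J a (q - J * m)) = a"
    proof
      fix q
      show "(q \<in> T \<and> slice m J a (q - J * m)) = a q"
        using a by (cases "q \<in> T") (auto simp: slice_def T_def asg_def)
    qed
  next
    fix a assume a: "a \<in> asg {..<m}"
    show "slice m J (\<lambda>q. q \<in> T \<and> a (q - J * m)) = a"
    proof
      fix q
      show "slice m J (\<lambda>q. q \<in> T \<and> a (q - J * m)) q = a q"
        using a by (cases "q < m") (auto simp: slice_def T_def asg_def)
    qed
  qed (auto simp: slice_def asg_def)
  finally show ?case using Suc by (simp add: S_def)
qed simp

lemma step_ok_par: "step_ok {..<m} s \<Longrightarrow> step_ok {..<J * m} (par_step m J h s)"
proof (cases s)
  case (Ones S V)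
  assume "step_ok {..<m} s"
  then show ?thesis using Ones blocks_subset[of S m J] by (auto simp: blocks_def subset_eq)
next
  case (Phase ts)
  assume a: "step_ok {..<m} s"
  show ?thesis unfolding Phase par_step.simps step_ok.simps
  proof (rule ballI)
    fix bt assume "bt \<in> set (concat (map (\<lambda>j. map (\<lambda>(\<beta>, t). (\<beta>, rename_test ((+) (j * m)) t)) ts) [0..<J]))"
    then obtain j \<beta> t' where j: "j < J" "bt = (\<beta>, rename_test (\<lambda>q. j * m + q) t')" "(\<beta>, t') \<in> set ts" by auto
    then have "test_qubits t' \<subseteq> {..<m}" using a Phase by auto
    then show "case bt of (\<beta>, t) \<Rightarrow> test_qubits t \<subseteq> {..<J * m}"
      using j(1) by (auto simp: j(2) test_qubits_rename intro!: block_lt)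
  qed
next
  case (Rot neg S e)
  assume "step_ok {..<m} s"
  then show ?thesis using Rot blocks_subset[of S m J] by auto
qed

lemma test_cost_rename: "test_cost (rename_test f t) = test_cost t"
  by (cases t) auto

lemma step_size_par:
  assumes "step_ok {..<m} s" "J \<ge> 1"
  shows "step_size (par_step m J h s) \<le> J * step_size s"
proof (cases s)
  case (Phase ts)
  have "tcost (map (\<lambda>(\<beta>, t). (\<beta>, rename_test f t)) ts) = tcost ts" for f
    unfolding tcost_def by (induction ts) (auto simp: test_cost_rename)
  moreover have "tcost (concat (map F is)) = (\<Sum>i\<leftarrow>is. tcost (F i))" for F :: "nat \<Rightarrow> (real \<times> test) list" and "is"
    by (induction "is") (auto simp: tcost_def)
  ultimately have "tcost (concat (map (\<lambda>j. map (\<lambda>(\<beta>, t). (\<beta>, rename_test (\<lambda>q. j * m + q) t)) ts) [0..<J])) = J * tcost ts"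
    by (simp add: sum_list_triv)
  then show ?thesis using assms(2) by (simp add: Phase)
qed (use assms card_blocks in auto)

lemma step_blacks_par: "step_ok {..<m} s \<Longrightarrow> step_blacks (par_step m J h s) = J * step_blacks s"
  by (cases s) (auto simp: card_blocks)

lemma prog_size_par:
  assumes "prog_ok {..<m} ps" "J \<ge> 1"
  shows "prog_size (par_prog m J h ps) \<le> J * prog_size ps"
  using assms(1)
proof (induction ps)
  case (Cons s ps)
  then show ?case
    using step_size_par[of m s J h] assms(2) by (simp add: prog_size_def par_prog_def prog_ok_def distrib_left add_mono)
qed (simp add: prog_size_def par_prog_def)

lemma prog_blacks_par:
  assumes "prog_ok {..<m} ps"
  shows "prog_blacks (par_prog m J h ps) = J * prog_blacks ps"
  using assms
  by (induction ps) (auto simp: prog_blacks_def par_prog_def prog_ok_def step_blacks_par distrib_left)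

lemma prog_ok_par: "prog_ok {..<m} ps \<Longrightarrow> prog_ok {..<J * m} (par_prog m J h ps)"
  by (auto simp: prog_ok_def par_prog_def step_ok_par)

section \<open>Tests for functions of weighted sums\<close>

definition value_tests :: "(nat \<times> int) list \<Rightarrow> nat \<Rightarrow> (nat \<Rightarrow> bool) \<Rightarrow> test list" where
  "value_tests ws T P = map (\<lambda>v. (ws, int v, T)) (filter P [0..<2 ^ T])"

text \<open>The tests ask for different residues, so exactly one residue matches and the parity is a
  disjunction. This is table lookup for any predicate of a sum modulo \<open>2 ^ T\<close>; its
  price is up to \<open>2 ^ T\<close> tests, affordable only for short counters.\<close>

lemma parity_value_tests:
  "parity_tests (value_tests ws T P) b \<longleftrightarrow> P (nat (wsum ws b mod 2 ^ T))"
proof -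
  define u where "u = nat (wsum ws b mod 2 ^ T)"
  have u: "wsum ws b mod 2 ^ T = int u"
    by (simp add: u_def)
  have lt: "int v < 2 ^ T \<longleftrightarrow> v < 2 ^ T" for v
    by simp
  have "wsum ws b mod 2 ^ T < 2 ^ T" by simp
  then have "int u < 2 ^ T" by (simp only: u)
  then have u2: "u < 2 ^ T" by (simp only: lt)
  have h: "holds (ws, int v, T) b \<longleftrightarrow> v = u" if "v < 2 ^ T" for v
  proof -
    have "int v mod 2 ^ T = int v"
      by (rule mod_pos_pos_trivial) (use that lt in auto)
    then have "holds (ws, int v, T) b \<longleftrightarrow> int u = int v"
      by (simp only: holds.simps mod_eq_dvd_iff[symmetric] u)
    then show ?thesis by (simp only: of_nat_eq_iff eq_commute)
  qed
  have "filter (\<lambda>\<tau>. holds \<tau> b) (value_tests ws T P) = map (\<lambda>v. (ws, int v, T)) (filter (\<lambda>v. P v \<and> v = u) [0..<2 ^ T])"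
    unfolding value_tests_def filter_map filter_filter comp_def
  proof (intro arg_cong[of _ _ "map _"] filter_cong refl)
    fix v assume "v \<in> set [0..<2 ^ T]"
    then show "(P v \<and> holds (ws, int v, T) b) = (P v \<and> v = u)" using h[of v] by simp
  qed
  also have "length \<dots> = card ({v. P v \<and> v = u} \<inter> {0..<2 ^ T})"
    by (simp only: length_map distinct_length_filter[OF distinct_upt] set_upt)
  also have "{v. P v \<and> v = u} \<inter> {0..<2 ^ T} = (if P u then {u} else {})" using u2 by auto
  finally show ?thesis by (cases "P u") (simp_all add: parity_tests_def u_def[symmetric])
qed

definition wlist :: "nat set \<Rightarrow> (nat \<Rightarrow> int) \<Rightarrow> (nat \<times> int) list" where
  "wlist S w = map (\<lambda>q. (q, w q)) (sorted_list_of_set S)"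

lemma wsum_wlist: "finite S \<Longrightarrow> wsum (wlist S w) b = (\<Sum>q\<in>S. w q * of_bool (b q))"
  by (simp add: wsum_def wlist_def comp_def sum_list_distinct_conv_sum_set)

lemma fst_set_wlist: "finite S \<Longrightarrow> fst ` set (wlist S w) = S"
  by (simp add: wlist_def image_image)

lemma length_wlist: "length (wlist S w) = card S"
  by (simp add: wlist_def)

definition pair_test :: "nat \<Rightarrow> nat \<Rightarrow> test" where
  "pair_test p q = ([(p, 1), (q, 1)], 2, 2)"

definition single_test :: "nat \<Rightarrow> test" where
  "single_test q = ([(q, 1)], 1, 1)"

lemma holds_pair_test: "holds (pair_test p q) b \<longleftrightarrow> b p \<and> b q"
  by (cases "b p"; cases "b q") (simp_all add: pair_test_def wsum_def)

lemma holds_single_test: "holds (single_test q) b \<longleftrightarrow> b q"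
  by (cases "b q") (simp_all add: single_test_def wsum_def)

lemma sum_bits:
  assumes "v < 2 ^ T"
  shows "(\<Sum>k<T. 2 ^ k * of_bool (bit v k)) = (v::nat)"
proof -
  have "(\<Sum>k<T. 2 ^ k * of_bool (bit v k)) = (\<Sum>k = 0..<T. push_bit k (of_bool (bit v k)))"
    by (rule sum.cong) (auto simp: push_bit_eq_mult)
  also have "\<dots> = take_bit T v" by (rule take_bit_sum[symmetric])
  also have "\<dots> = v" using assms by (rule take_bit_nat_eq_self)
  finally show ?thesis .
qed

section \<open>The window program\<close>

text \<open>Qubits are named by coded triples of kind, position and index. The names need not be
  contiguous: a qubit in a gap stays zero and costs nothing.\<close>

definition nm :: "nat \<Rightarrow> nat \<Rightarrow> nat \<Rightarrow> nat" where
  "nm k i j = prod_encode (k, prod_encode (i, j))"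

definition kd :: "nat \<Rightarrow> nat" where "kd q = fst (prod_decode q)"
definition pos :: "nat \<Rightarrow> nat" where "pos q = fst (prod_decode (snd (prod_decode q)))"
definition idx :: "nat \<Rightarrow> nat" where "idx q = snd (prod_decode (snd (prod_decode q)))"

lemma nm_simps [simp]: "kd (nm k i j) = k" "pos (nm k i j) = i" "idx (nm k i j) = j"
  by (simp_all add: nm_def kd_def pos_def idx_def)

lemma nm_inj [simp]: "nm k i j = nm k' i' j' \<longleftrightarrow> k = k' \<and> i = i' \<and> j = j'"
  by (simp add: nm_def)

text \<open>A Hadamard gate after a rotation by \<open>- 2 * pi * a\<close>: on a qubit with phase
  \<open>\<phi>\<close>, in turns, the outcome is a coin with bias
  \<open>cos (2 * pi * (\<phi> - a))\<close>.\<close>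

definition samp_mat :: "real \<Rightarrow> qmat" where
  "samp_mat a r c = hmat r c * (if c then cis (- (2 * pi * a)) else 1)"

text \<open>A real rotation with cosine \<open>\<rho>\<close>: applied to zero it gives zero with
  probability \<open>\<rho> ^ 2\<close>, independently of all other qubits.\<close>

definition rot_mat :: "real \<Rightarrow> qmat" where
  "rot_mat \<rho> r c = of_real (if r = c then \<rho> else if r then sqrt (1 - \<rho>\<^sup>2) else - sqrt (1 - \<rho>\<^sup>2))"

lemma unitary1_samp_mat: "unitary1 (samp_mat a)"
  by (simp add: unitary1_def samp_mat_def hmat_def UNIV_bool all_bool_eq sqrt2_sq cis_cnj cis_mult)

lemma unitary1_rot_mat:
  assumes "0 \<le> \<rho>" "\<rho> \<le> 1"
  shows "unitary1 (rot_mat \<rho>)"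
proof -
  have "\<rho>\<^sup>2 \<le> 1" using assms by (simp add: power_le_one)
  then have "\<rho> * \<rho> + sqrt (1 - \<rho>\<^sup>2) * sqrt (1 - \<rho>\<^sup>2) = 1" by (simp add: power2_eq_square)
  then have "complex_of_real \<rho> * complex_of_real \<rho>
      + complex_of_real (sqrt (1 - \<rho>\<^sup>2)) * complex_of_real (sqrt (1 - \<rho>\<^sup>2)) = 1"
    by (metis of_real_1 of_real_add of_real_mult)
  then show ?thesis by (simp add: unitary1_def rot_mat_def UNIV_bool all_bool_eq add.commute)
qed

text \<open>The quarter read off the two majority bits, coded as twice the bit of kind 1 plus the bit of kind 0.\<close>

definition quarter :: "nat \<Rightarrow> int" where
  "quarter y = (if y = 0 then 0 else if y = 1 then 1 else if y = 3 then 2 else 3)"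

text \<open>The argument packs the codes of two consecutive positions. For their quarter values
  \<open>A\<close> and \<open>A'\<close> the digit is \<open>(2 * A - A') / 4\<close> rounded to an
  integer, which is the integer carried out when the phase is doubled. It lies between
  \<open>- 1\<close> and 2, so two bits hold the digit plus 1.\<close>

definition digit :: "nat \<Rightarrow> int" where
  "digit v = (2 * quarter (v div 4) - quarter (v mod 4) + 2) div 4"

text \<open>With an offset of an eighth of a turn in either direction, the signs of the two cosines
  cut the circle into four arcs centred at the multiples of 1/4.\<close>

definition shift_angle :: "nat \<Rightarrow> real" where
  "shift_angle \<tau> = (if \<tau> = 0 then - 1 / 8 else 1 / 8)"

text \<open>Kinds of window qubits \<open>nm k i j\<close>: 0 bits of the random shift, 1 verification copies, 2 attenuator,
  3 and 4 samples, 5 bits of the compressed sums of samples, 6 and 7 majorities of the samples, 8 and 9 signed digits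
  (coded as the digit plus 1).\<close>

locale window =
  fixes g Ld Lv G :: nat and \<rho> :: real
  assumes g: "g \<ge> 1" and Lv: "Lv \<le> Ld" and Ld: "Ld \<ge> 1" and \<rho>: "0 \<le> \<rho>" "\<rho> \<le> 1"
begin

text \<open>The parameters: \<open>2 ^ g\<close> samples for each of two angles at each of
  \<open>Ld\<close> positions, \<open>Lv\<close> verification copies, \<open>G\<close> bits of
  shift, and \<open>\<rho>\<close> for the attenuator.\<close>

definition RQ :: "nat set" where "RQ = (\<lambda>a. nm 0 a 0) ` {..<G}"
definition VQ :: "nat set" where "VQ = (\<lambda>i. nm 1 i 0) ` {..<Lv}"
definition AQ :: nat where "AQ = nm 2 0 0"
definition CG :: "nat \<Rightarrow> nat \<Rightarrow> nat set" where "CG \<tau> i = (\<lambda>j. nm (3 + \<tau>) i j) ` {..<2 ^ g}"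
definition CQ :: "nat set" where "CQ = (\<Union>\<tau><2. \<Union>i<Ld. CG \<tau> i)"
definition WQ :: "nat set" where "WQ = (\<Union>\<gamma><Suc (Ld div g). nm 5 \<gamma> ` {..<2 * g + 1})"
definition MQ :: "nat set" where "MQ = (\<Union>\<tau><2. (\<lambda>i. nm (6 + \<tau>) i 0) ` {..<Ld})"
definition DQ :: "nat set" where "DQ = (\<Union>\<beta><2. (\<lambda>i. nm (8 + \<beta>) i 0) ` {..<Ld})"
definition QQ :: "nat set" where "QQ = RQ \<union> VQ \<union> {AQ} \<union> CQ \<union> WQ \<union> MQ \<union> DQ"

text \<open>The rotation of a qubit has factor \<open>2 ^ ex q\<close>: a verification copy
  represents its position, bit \<open>idx q\<close> of a compressed sum has weight
  \<open>2 ^ idx q\<close> above the first position of its group.\<close>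

definition ex :: "nat \<Rightarrow> nat" where
  "ex q = (if kd q = 1 then pos q else pos q * g + idx q)"

definition group :: "nat \<Rightarrow> nat set" where
  "group \<gamma> = {q \<in> CQ. pos q div g = \<gamma>}"

text \<open>The samples at \<open>g\<close> neighbouring positions, weighted by powers of two, have
  a sum of only \<open>2 * g + 1\<close> bits. Rotating by the bits of this sum has the same effect
  as rotating all \<open>2 * g * 2 ^ g\<close> samples, at \<open>O(g)\<close> uses of the black-box
  gate per group.\<close>

definition wtests :: "nat \<Rightarrow> test list" where
  "wtests q = value_tests (wlist (group (pos q)) (\<lambda>p. 2 ^ (pos p mod g))) (2 * g + 1) (\<lambda>v. bit v (idx q))"

definition mtests :: "nat \<Rightarrow> test list" where
  "mtests q = value_tests (wlist (CG (kd q - 6) (pos q)) (\<lambda>_. 1)) (g + 1) (\<lambda>v. 2 ^ g < 2 * v)"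

text \<open>The weights 8, 4, 2, 1 pack two codes into one number below 16. At the last position the
  missing successor counts as code 0, which is quarter 0.\<close>

definition dlist :: "nat \<Rightarrow> (nat \<times> int) list" where
  "dlist i = [(nm 7 i 0, 8), (nm 6 i 0, 4)] @ (if Suc i < Ld then [(nm 7 (Suc i) 0, 2), (nm 6 (Suc i) 0, 1)] else [])"

definition dtests :: "nat \<Rightarrow> test list" where
  "dtests q = value_tests (dlist (pos q)) 4 (\<lambda>v. bit (nat (digit v + 1)) (kd q - 8))"

text \<open>Replaces \<open>\<theta>\<close> by \<open>\<theta> + r / 2 ^ G\<close>, where
  \<open>r\<close> is held in superposition in the shift bits. The shift is known, so controlled
  phases realise it without the black-box gate.\<close>

definition shift_phases :: "(real \<times> test) list" where
  "shift_phases = concat (map (\<lambda>a. map (\<lambda>q. (2 * pi * 2 ^ ex q * 2 ^ a / 2 ^ G, pair_test (nm 0 a 0) q))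
     (sorted_list_of_set (WQ \<union> VQ))) [0..<G])"

text \<open>Rotates verification copy \<open>i\<close> back by \<open>2 ^ i\<close> times the
  estimate. The coded digit is twice a bit plus a bit minus 1, hence three phases per digit.\<close>

definition digit_phases :: "(real \<times> test) list" where
  "digit_phases = concat (map (\<lambda>i. concat (map (\<lambda>k. let \<alpha> = 2 * pi * 2 ^ i / 2 ^ Suc k in
      [(- (2 * \<alpha>), pair_test (nm 9 k 0) (nm 1 i 0)), (- \<alpha>, pair_test (nm 8 k 0) (nm 1 i 0)),
       (\<alpha>, single_test (nm 1 i 0))]) [0..<Ld])) [0..<Lv])"

text \<open>The compressed sums are uncomputed before the samples are transformed: as records of the
  samples they would destroy the interference. Majorities and digits are computed after it and may
  stay.\<close>

definition base :: "step list" where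
  "base = [Ones (RQ \<union> VQ \<union> CQ \<union> {AQ}) (\<lambda>q. if q = AQ then rot_mat \<rho> else hmat)]
     @ xor_prog WQ wtests
     @ [Phase shift_phases, Rot False (WQ \<union> VQ) ex]
     @ xor_prog WQ wtests
     @ [Ones CQ (\<lambda>q. samp_mat (shift_angle (kd q - 3)))]
     @ xor_prog MQ mtests
     @ xor_prog DQ dtests
     @ [Phase digit_phases, Ones VQ (\<lambda>_. hmat)]"

definition rval :: "(nat \<Rightarrow> bool) \<Rightarrow> nat" where
  "rval b = (\<Sum>a<G. 2 ^ a * of_bool (b (nm 0 a 0)))"

definition dval :: "(nat \<Rightarrow> bool) \<Rightarrow> nat \<Rightarrow> int" where
  "dval b k = 2 * of_bool (b (nm 9 k 0)) + of_bool (b (nm 8 k 0)) - 1"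

definition vfrac :: "(nat \<Rightarrow> bool) \<Rightarrow> real" where
  "vfrac b = (\<Sum>k<Ld. real_of_int (dval b k) / 2 ^ Suc k)"

definition samp :: "real \<Rightarrow> nat \<Rightarrow> bool \<Rightarrow> complex" where
  "samp \<theta> q u = (1 + (if u then - 1 else 1) * cis (2 * pi * (2 ^ pos q * \<theta> - shift_angle (kd q - 3)))) / 2"

definition ver :: "real \<Rightarrow> nat \<Rightarrow> bool \<Rightarrow> complex" where
  "ver \<delta> q u = (1 + (if u then - 1 else 1) * cis (2 * pi * (2 ^ pos q * \<delta>))) / 2"

definition att :: "bool \<Rightarrow> complex" where
  "att u = rot_mat \<rho> u False"

definition consistent :: "(nat \<Rightarrow> bool) \<Rightarrow> bool" where
  "consistent b \<longleftrightarrow> b \<in> asg QQ \<and> (\<forall>q\<in>WQ. \<not> b q) \<and> (\<forall>q\<in>MQ. b q = parity_tests (mtests q) b)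
     \<and> (\<forall>q\<in>DQ. b q = parity_tests (dtests q) b)"

lemma fin [simp]: "finite RQ" "finite VQ" "finite CQ" "finite WQ" "finite MQ" "finite DQ" "finite QQ"
    "finite (CG \<tau> i)" "finite (group \<gamma>)"
  by (simp_all add: RQ_def VQ_def CQ_def WQ_def MQ_def DQ_def QQ_def CG_def group_def)

lemma kd_sets: "q \<in> RQ \<Longrightarrow> kd q = 0" "q \<in> VQ \<Longrightarrow> kd q = 1" "kd AQ = 2"
  "q \<in> CQ \<Longrightarrow> kd q = 3 \<or> kd q = 4" "q \<in> WQ \<Longrightarrow> kd q = 5" "q \<in> MQ \<Longrightarrow> kd q = 6 \<or> kd q = 7"
  "q \<in> DQ \<Longrightarrow> kd q = 8 \<or> kd q = 9" "q \<in> CG \<tau> i \<Longrightarrow> kd q = 3 + \<tau>"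
  by (auto simp: RQ_def VQ_def AQ_def CQ_def CG_def WQ_def MQ_def DQ_def)

lemma disj [simp]: "RQ \<inter> VQ = {}" "RQ \<inter> CQ = {}" "VQ \<inter> CQ = {}" "WQ \<inter> VQ = {}" "WQ \<inter> CQ = {}" "WQ \<inter> RQ = {}"
  "AQ \<notin> RQ" "AQ \<notin> VQ" "AQ \<notin> CQ" "AQ \<notin> WQ" "AQ \<notin> MQ" "AQ \<notin> DQ" "MQ \<inter> DQ = {}" "MQ \<inter> CQ = {}"
  by (auto simp: RQ_def VQ_def AQ_def CQ_def CG_def WQ_def MQ_def DQ_def)

lemma ne_R: "q \<in> RQ \<Longrightarrow> q \<notin> VQ \<and> q \<notin> CQ \<and> q \<notin> WQ \<and> q \<notin> MQ \<and> q \<notin> DQ \<and> q \<noteq> AQ"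
  and ne_V: "q \<in> VQ \<Longrightarrow> q \<notin> RQ \<and> q \<notin> CQ \<and> q \<notin> WQ \<and> q \<notin> MQ \<and> q \<notin> DQ \<and> q \<noteq> AQ"
  and ne_C: "q \<in> CQ \<Longrightarrow> q \<notin> RQ \<and> q \<notin> VQ \<and> q \<notin> WQ \<and> q \<notin> MQ \<and> q \<notin> DQ \<and> q \<noteq> AQ"
  and ne_W: "q \<in> WQ \<Longrightarrow> q \<notin> RQ \<and> q \<notin> VQ \<and> q \<notin> CQ \<and> q \<notin> MQ \<and> q \<notin> DQ \<and> q \<noteq> AQ"
  and ne_M: "q \<in> MQ \<Longrightarrow> q \<notin> RQ \<and> q \<notin> VQ \<and> q \<notin> CQ \<and> q \<notin> WQ \<and> q \<notin> DQ \<and> q \<noteq> AQ"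
  and ne_D: "q \<in> DQ \<Longrightarrow> q \<notin> RQ \<and> q \<notin> VQ \<and> q \<notin> CQ \<and> q \<notin> WQ \<and> q \<notin> MQ \<and> q \<noteq> AQ"
  by (auto simp: RQ_def VQ_def AQ_def CQ_def CG_def WQ_def MQ_def DQ_def)

lemma asg_upd: "q \<in> S \<Longrightarrow> b(q := v) \<in> asg S \<longleftrightarrow> b \<in> asg S"
  by (auto simp: asg_def)

lemma vt_qubits: "\<tau> \<in> set (value_tests ws T P) \<Longrightarrow> test_qubits \<tau> = fst ` set ws"
  by (force simp: value_tests_def)

lemma wtests_qubits: "\<tau> \<in> set (wtests q) \<Longrightarrow> test_qubits \<tau> \<subseteq> CQ"
  by (auto simp: wtests_def vt_qubits fst_set_wlist group_def)

lemma CG_CQ: "q \<in> MQ \<Longrightarrow> CG (kd q - 6) (pos q) \<subseteq> CQ"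
  by (fastforce simp: MQ_def CQ_def)

lemma mtests_qubits: "q \<in> MQ \<Longrightarrow> \<tau> \<in> set (mtests q) \<Longrightarrow> test_qubits \<tau> \<subseteq> CQ"
  using CG_CQ by (auto simp: mtests_def vt_qubits fst_set_wlist)

lemma MQ_mem: "i < Ld \<Longrightarrow> nm 6 i 0 \<in> MQ" "i < Ld \<Longrightarrow> nm 7 i 0 \<in> MQ"
  by (auto simp: MQ_def intro: bexI[of _ 0] bexI[of _ 1])

lemma DQ_mem: "i < Ld \<Longrightarrow> nm 8 i 0 \<in> DQ" "i < Ld \<Longrightarrow> nm 9 i 0 \<in> DQ"
  by (auto simp: DQ_def intro: bexI[of _ 0] bexI[of _ 1])

lemma dtests_qubits: "q \<in> DQ \<Longrightarrow> \<tau> \<in> set (dtests q) \<Longrightarrow> test_qubits \<tau> \<subseteq> MQ"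
proof -
  assume "q \<in> DQ" "\<tau> \<in> set (dtests q)"
  then have "pos q < Ld" "test_qubits \<tau> = fst ` set (dlist (pos q))"
    by (auto simp: DQ_def dtests_def vt_qubits)
  then show ?thesis using MQ_mem by (auto simp: dlist_def split: if_splits)
qed

subsection \<open>Amplitudes of the window program\<close>

definition wt :: "nat \<Rightarrow> (nat \<Rightarrow> bool) \<Rightarrow> nat" where
  "wt \<gamma> b = (\<Sum>q\<in>group \<gamma>. 2 ^ (pos q mod g) * of_bool (b q))"

lemma group_subset: "group \<gamma> \<subseteq> (\<Union>r<g. \<Union>\<tau><2. CG \<tau> (\<gamma> * g + r))"
proof
  fix q assume "q \<in> group \<gamma>"
  then obtain \<tau> i j where "\<tau> < 2" "i < Ld" "q = nm (3 + \<tau>) i j" "j < 2 ^ g" "i div g = \<gamma>"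
    by (auto simp: group_def CQ_def CG_def)
  moreover from this have "q \<in> CG \<tau> (\<gamma> * g + i mod g)" by (auto simp: CG_def)
  moreover have "i mod g < g" using g by simp
  ultimately show "q \<in> (\<Union>r<g. \<Union>\<tau><2. CG \<tau> (\<gamma> * g + r))" by blast
qed

text \<open>A group has at most \<open>2 * 2 ^ g\<close> samples of each weight
  \<open>2 ^ r\<close>, and the weights with \<open>r < g\<close> add up to
  \<open>2 ^ g - 1\<close>.\<close>

lemma wt_less: "wt \<gamma> b < 2 ^ (2 * g + 1)"
proof -
  have "wt \<gamma> b \<le> (\<Sum>q\<in>group \<gamma>. 2 ^ (pos q mod g))"
    unfolding wt_def by (rule sum_mono) auto
  also have "\<dots> \<le> (\<Sum>q\<in>(\<Union>r<g. \<Union>\<tau><2. CG \<tau> (\<gamma> * g + r)). 2 ^ (pos q mod g))"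
    by (rule sum_mono2) (use group_subset in auto)
  also have "\<dots> = (\<Sum>r<g. \<Sum>q\<in>(\<Union>\<tau><2. CG \<tau> (\<gamma> * g + r)). 2 ^ (pos q mod g))"
    by (rule sum.UNION_disjoint) (auto simp: CG_def)
  also have "\<dots> = (\<Sum>r<g. \<Sum>\<tau><2. \<Sum>q\<in>CG \<tau> (\<gamma> * g + r). 2 ^ (pos q mod g))"
    by (intro sum.cong refl sum.UNION_disjoint) (auto simp: CG_def)
  also have "\<dots> = (\<Sum>r<g. \<Sum>\<tau><(2::nat). 2 ^ g * 2 ^ r)"
  proof (intro sum.cong refl)
    fix r \<tau> assume "r \<in> {..<g}"
    then have "(\<Sum>q\<in>CG \<tau> (\<gamma> * g + r). 2 ^ (pos q mod g)) = (\<Sum>q\<in>CG \<tau> (\<gamma> * g + r). 2 ^ r :: nat)"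
      by (intro sum.cong refl) (auto simp: CG_def)
    also have "\<dots> = 2 ^ g * 2 ^ r" by (simp add: CG_def card_image inj_on_def)
    finally show "(\<Sum>q\<in>CG \<tau> (\<gamma> * g + r). 2 ^ (pos q mod g)) = (2 ^ g * 2 ^ r :: nat)" .
  qed
  also have "\<dots> = 2 * 2 ^ g * (\<Sum>r<g. 2 ^ r)" by (simp add: sum_distrib_left mult_ac)
  also have "(\<Sum>r<g. 2 ^ r :: nat) = 2 ^ g - 1" using sum_power2[of g] by (simp add: atLeast0LessThan)
  also have "2 * 2 ^ g * (2 ^ g - 1) < (2 ^ (2 * g + 1) :: nat)"
  proof -
    have "2 * 2 ^ g * (2 ^ g - 1) < (2 * 2 ^ g * 2 ^ g :: nat)"
      by (intro mult_strict_left_mono) auto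
    moreover have "(2::nat) ^ (2 * g + 1) = 2 * 2 ^ g * 2 ^ g"
      by (simp add: power_even_eq power2_eq_square)
    ultimately show ?thesis by (simp only:)
  qed
  finally show ?thesis .
qed

lemma parity_wtests: "parity_tests (wtests q) b \<longleftrightarrow> bit (wt (pos q) b) (idx q)"
proof -
  have "wsum (wlist (group (pos q)) (\<lambda>p. 2 ^ (pos p mod g))) b = int (wt (pos q) b)"
    unfolding wsum_wlist[OF fin(9)] wt_def by simp
  moreover have "int (wt (pos q) b) mod 2 ^ (2 * g + 1) = int (wt (pos q) b)"
  proof (rule mod_pos_pos_trivial)
    have "int (wt (pos q) b) < int (2 ^ (2 * g + 1))" using wt_less by (simp only: of_nat_less_iff)
    then show "int (wt (pos q) b) < 2 ^ (2 * g + 1)" by (simp only: of_nat_power of_nat_numeral)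
  qed simp
  ultimately show ?thesis unfolding wtests_def parity_value_tests by (simp only: nat_int)
qed

text \<open>The bits of each group reassemble to the group sum, and
  \<open>\<gamma> * g + pos q mod g = pos q\<close> restores the exponent of every sample.\<close>

lemma sum_WQ_bits: "(\<Sum>q\<in>WQ. 2 ^ ex q * of_bool (bit (wt (pos q) b) (idx q))) = (\<Sum>q\<in>CQ. 2 ^ pos q * of_bool (b q) :: nat)"
proof -
  have "(\<Sum>q\<in>WQ. 2 ^ ex q * of_bool (bit (wt (pos q) b) (idx q)))
      = (\<Sum>\<gamma><Suc (Ld div g). \<Sum>q\<in>nm 5 \<gamma> ` {..<2 * g + 1}. 2 ^ ex q * of_bool (bit (wt (pos q) b) (idx q)))"
    unfolding WQ_def by (rule sum.UNION_disjoint) auto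
  also have "\<dots> = (\<Sum>\<gamma><Suc (Ld div g). 2 ^ (\<gamma> * g) * wt \<gamma> b)"
  proof (rule sum.cong[OF refl])
    fix \<gamma>
    have "(\<Sum>q\<in>nm 5 \<gamma> ` {..<2 * g + 1}. 2 ^ ex q * of_bool (bit (wt (pos q) b) (idx q)))
        = (\<Sum>\<kappa><2 * g + 1. 2 ^ (\<gamma> * g + \<kappa>) * of_bool (bit (wt \<gamma> b) \<kappa>) :: nat)"
      by (subst sum.reindex) (auto simp: inj_on_def ex_def)
    also have "\<dots> = 2 ^ (\<gamma> * g) * (\<Sum>\<kappa><2 * g + 1. 2 ^ \<kappa> * of_bool (bit (wt \<gamma> b) \<kappa>))"
      by (simp only: sum_distrib_left power_add mult.assoc)
    also have "(\<Sum>\<kappa><2 * g + 1. 2 ^ \<kappa> * of_bool (bit (wt \<gamma> b) \<kappa>)) = wt \<gamma> b"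
      by (rule sum_bits[OF wt_less])
    finally show "(\<Sum>q\<in>nm 5 \<gamma> ` {..<2 * g + 1}. 2 ^ ex q * of_bool (bit (wt (pos q) b) (idx q)))
        = 2 ^ (\<gamma> * g) * wt \<gamma> b" .
  qed
  also have "\<dots> = (\<Sum>\<gamma><Suc (Ld div g). \<Sum>q\<in>{q \<in> CQ. pos q div g = \<gamma>}. 2 ^ pos q * of_bool (b q))"
  proof (rule sum.cong[OF refl])
    fix \<gamma>
    show "2 ^ (\<gamma> * g) * wt \<gamma> b = (\<Sum>q\<in>{q \<in> CQ. pos q div g = \<gamma>}. 2 ^ pos q * of_bool (b q))"
      unfolding wt_def sum_distrib_left group_def
    proof (rule sum.cong[OF refl])
      fix q assume "q \<in> {q \<in> CQ. pos q div g = \<gamma>}"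
      then have "pos q = \<gamma> * g + pos q mod g" by auto
      then have "(2::nat) ^ pos q = 2 ^ (\<gamma> * g) * 2 ^ (pos q mod g)" by (metis power_add)
      then show "2 ^ (\<gamma> * g) * (2 ^ (pos q mod g) * of_bool (b q)) = (2 ^ pos q * of_bool (b q) :: nat)"
        by (simp only: mult.assoc)
    qed
  qed
  also have "\<dots> = (\<Sum>q\<in>CQ. 2 ^ pos q * of_bool (b q))"
  proof (rule sum.group)
    show "(\<lambda>q. pos q div g) ` CQ \<subseteq> {..<Suc (Ld div g)}"
      by (auto simp: CQ_def CG_def less_Suc_eq_le intro!: div_le_mono)
  qed auto
  finally show ?thesis .
qed

lemma tphase_shift_phases:
  "tphase shift_phases b = 2 * pi * (real (rval b) / 2 ^ G) * (\<Sum>q\<in>WQ \<union> VQ. 2 ^ ex q * of_bool (b q))"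
proof -
  have "tphase shift_phases b = (\<Sum>a<G. \<Sum>q\<in>WQ \<union> VQ. 2 * pi * 2 ^ ex q * 2 ^ a / 2 ^ G * of_bool (b (nm 0 a 0) \<and> b q))"
    unfolding shift_phases_def tphase_concat interv_sum_list_conv_sum_set_nat set_upt atLeast0LessThan
    by (intro sum.cong refl)
      (simp add: tphase_def comp_def holds_pair_test sum_list_distinct_conv_sum_set del: sum_list_mult_const)
  also have "\<dots> = (\<Sum>a<G. (2 ^ a * of_bool (b (nm 0 a 0))) * (2 * pi / 2 ^ G * (\<Sum>q\<in>WQ \<union> VQ. 2 ^ ex q * of_bool (b q))))"
    unfolding sum_distrib_left by (intro sum.cong refl) auto
  also have "\<dots> = real (rval b) * (2 * pi / 2 ^ G * (\<Sum>q\<in>WQ \<union> VQ. 2 ^ ex q * of_bool (b q)))"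
    unfolding sum_distrib_right[symmetric] rval_def by simp
  finally show ?thesis by simp
qed

lemma tphase_digit_phases:
  "tphase digit_phases b = (\<Sum>q\<in>VQ. - (2 * pi * (2 ^ pos q * vfrac b)) * of_bool (b q))"
proof -
  have "tphase digit_phases b = (\<Sum>i<Lv. \<Sum>k<Ld. - (2 * pi * 2 ^ i * (real_of_int (dval b k) / 2 ^ Suc k)) * of_bool (b (nm 1 i 0)))"
    unfolding digit_phases_def tphase_concat interv_sum_list_conv_sum_set_nat set_upt atLeast0LessThan
  proof (intro sum.cong refl)
    fix i k
    show "tphase (let \<alpha> = 2 * pi * 2 ^ i / 2 ^ Suc k in
        [(- (2 * \<alpha>), pair_test (nm 9 k 0) (nm 1 i 0)), (- \<alpha>, pair_test (nm 8 k 0) (nm 1 i 0)),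
       (\<alpha>, single_test (nm 1 i 0))]) b
      = - (2 * pi * 2 ^ i * (real_of_int (dval b k) / 2 ^ Suc k)) * of_bool (b (nm 1 i 0))"
      by (simp add: tphase_def Let_def holds_pair_test holds_single_test dval_def of_bool_def field_simps)
  qed
  also have "\<dots> = (\<Sum>i<Lv. - (2 * pi * (2 ^ i * vfrac b)) * of_bool (b (nm 1 i 0)))"
    unfolding vfrac_def sum_distrib_left sum_negf[symmetric] sum_distrib_right
    by (intro sum.cong refl) simp
  also have "\<dots> = (\<Sum>q\<in>VQ. - (2 * pi * (2 ^ pos q * vfrac b)) * of_bool (b q))"
    unfolding VQ_def by (subst sum.reindex) (auto simp: inj_on_def)
  finally show ?thesis .
qed

lemma sem_Ones_prod:
  assumes "finite S" "indep S K" "\<And>q v. q \<in> S \<Longrightarrow> indep S (\<lambda>b. f q b v)"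
  shows "sem \<theta> (Ones S V) (\<lambda>b. K b * (\<Prod>q\<in>S. f q b (b q)))
       = (\<lambda>b. K b * (\<Prod>q\<in>S. V q (b q) False * f q b False + V q (b q) True * f q b True))"
  using ones_prod[of "sorted_list_of_set S" K f V] assms by simp

definition init_ok :: "(nat \<Rightarrow> bool) \<Rightarrow> bool" where
  "init_ok b \<longleftrightarrow> b \<in> asg (RQ \<union> VQ \<union> CQ \<union> {AQ})"

abbreviation pref :: "(nat \<Rightarrow> bool) \<Rightarrow> complex" where
  "pref b \<equiv> rsqrt2 ^ G * att (b AQ)"

abbreviation th :: "real \<Rightarrow> (nat \<Rightarrow> bool) \<Rightarrow> real" where
  "th \<theta> b \<equiv> \<theta> + real (rval b) / 2 ^ G"

lemma sem_init:
  "sem \<theta> (Ones (RQ \<union> VQ \<union> CQ \<union> {AQ}) (\<lambda>q. if q = AQ then rot_mat \<rho> else hmat)) zero_state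
   = (\<lambda>b. of_bool (init_ok b) * (pref b * ((\<Prod>q\<in>VQ. rsqrt2) * (\<Prod>q\<in>CQ. rsqrt2))))"
proof -
  define T0 where "T0 = RQ \<union> VQ \<union> CQ \<union> {AQ}"
  have fT: "finite T0" by (simp add: T0_def)
  define V where "V q = (if q = AQ then rot_mat \<rho> else hmat)" for q
  have z: "zero_state = (\<lambda>b. of_bool (b \<in> asg T0) * (\<Prod>q\<in>T0. if b q then 0 else 1))"
  proof
    fix b
    show "zero_state b = of_bool (b \<in> asg T0) * (\<Prod>q\<in>T0. if b q then 0 else 1)"
    proof (cases "b = (\<lambda>_. False)")
      case True
      then show ?thesis by (simp add: zero_state_def asg_def)
    next
      case False
      then obtain p where "b p" by (auto simp: fun_eq_iff)
      then have "b \<notin> asg T0 \<or> (\<exists>q\<in>T0. b q)" by (auto simp: asg_def)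
      then show ?thesis using False fT by (auto simp: zero_state_def prod_zero_iff)
    qed
  qed
  have i: "indep T0 (\<lambda>b. of_bool (b \<in> asg T0) :: complex)"
    unfolding indep_def
  proof (intro allI impI arg_cong[of _ _ of_bool])
    fix b q v assume "q \<in> T0"
    then show "(b(q := v) \<in> asg T0) = (b \<in> asg T0)" by (auto simp: asg_def)
  qed
  have "sem \<theta> (Ones T0 V) zero_state
      = (\<lambda>b. of_bool (b \<in> asg T0) * (\<Prod>q\<in>T0. V q (b q) False * 1 + V q (b q) True * 0))"
    by (subst z, subst sem_Ones_prod[OF fT i, where f = "\<lambda>q b u. if u then 0 else 1"])
      (auto simp: indep_const)
  also have "\<dots> = (\<lambda>b. of_bool (init_ok b) * (pref b * ((\<Prod>q\<in>VQ. rsqrt2) * (\<Prod>q\<in>CQ. rsqrt2))))"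
  proof
    fix b
    have "(\<Prod>q\<in>T0. V q (b q) False * 1 + V q (b q) True * 0) = V AQ (b AQ) False * (\<Prod>q\<in>RQ \<union> VQ \<union> CQ. V q (b q) False)"
      unfolding T0_def by (subst prod.union_disjoint) (auto simp: mult.commute)
    also have "(\<Prod>q\<in>RQ \<union> VQ \<union> CQ. V q (b q) False) = (\<Prod>q\<in>RQ \<union> VQ \<union> CQ. rsqrt2)"
      by (rule prod.cong) (auto simp: V_def hmat_eq)
    also have "\<dots> = (\<Prod>q\<in>RQ. rsqrt2) * ((\<Prod>q\<in>VQ. rsqrt2) * (\<Prod>q\<in>CQ. rsqrt2))"
    proof -
      have "(RQ \<union> VQ) \<inter> CQ = {}" using disj by blast
      then have "(\<Prod>q\<in>RQ \<union> VQ \<union> CQ. rsqrt2) = (\<Prod>q\<in>RQ \<union> VQ. rsqrt2) * (\<Prod>q\<in>CQ. rsqrt2)"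
        by (intro prod.union_disjoint) auto
      also have "(\<Prod>q\<in>RQ \<union> VQ. rsqrt2) = (\<Prod>q\<in>RQ. rsqrt2) * (\<Prod>q\<in>VQ. rsqrt2)"
        by (intro prod.union_disjoint) auto
      finally show ?thesis by (simp only: mult.assoc)
    qed
    also have "(\<Prod>q\<in>RQ. rsqrt2) = rsqrt2 ^ G" by (simp add: RQ_def card_image inj_on_def)
    finally show "of_bool (b \<in> asg T0) * (\<Prod>q\<in>T0. V q (b q) False * 1 + V q (b q) True * 0)
      = of_bool (init_ok b) * (pref b * ((\<Prod>q\<in>VQ. rsqrt2) * (\<Prod>q\<in>CQ. rsqrt2)))"
      by (simp add: init_ok_def T0_def V_def att_def mult_ac)
  qed
  finally show ?thesis by (simp only: T0_def V_def[abs_def])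
qed

definition flips :: "nat set \<Rightarrow> (nat \<Rightarrow> test list) \<Rightarrow> (nat \<Rightarrow> bool) \<Rightarrow> nat \<Rightarrow> bool" where
  "flips S tf b = (\<lambda>q. if q \<in> S then b q \<noteq> parity_tests (tf q) b else b q)"

lemma flips_simps [simp]: "q \<notin> S \<Longrightarrow> flips S tf b q = b q" "q \<in> S \<Longrightarrow> flips S tf b q = (b q \<noteq> parity_tests (tf q) b)"
  by (simp_all add: flips_def)

lemma rval_cong: "(\<And>q. q \<in> RQ \<Longrightarrow> b q = b' q) \<Longrightarrow> rval b = rval b'"
  unfolding rval_def by (intro sum.cong refl) (auto simp: RQ_def)

lemma vfrac_cong: "(\<And>q. q \<in> DQ \<Longrightarrow> b q = b' q) \<Longrightarrow> vfrac b = vfrac b'"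
  unfolding vfrac_def dval_def using DQ_mem by (intro sum.cong refl) auto

lemma xor_W: "sems \<theta> (xor_prog WQ wtests) \<psi> = (\<lambda>b. \<psi> (flips WQ wtests b))"
  unfolding flips_def
proof (rule sems_xor_prog)
  fix t \<tau> assume "t \<in> WQ" "\<tau> \<in> set (wtests t)"
  then have "test_qubits \<tau> \<subseteq> CQ" by (intro wtests_qubits)
  then show "test_qubits \<tau> \<inter> WQ = {}" using ne_C by auto
qed simp

lemma xor_M: "sems \<theta> (xor_prog MQ mtests) \<psi> = (\<lambda>b. \<psi> (flips MQ mtests b))"
  unfolding flips_def
proof (rule sems_xor_prog)
  fix t \<tau> assume "t \<in> MQ" "\<tau> \<in> set (mtests t)"
  then have "test_qubits \<tau> \<subseteq> CQ" by (intro mtests_qubits)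
  then show "test_qubits \<tau> \<inter> MQ = {}" using ne_C by auto
qed simp

lemma xor_D: "sems \<theta> (xor_prog DQ dtests) \<psi> = (\<lambda>b. \<psi> (flips DQ dtests b))"
  unfolding flips_def
proof (rule sems_xor_prog)
  fix t \<tau> assume "t \<in> DQ" "\<tau> \<in> set (dtests t)"
  then have "test_qubits \<tau> \<subseteq> MQ" by (intro dtests_qubits)
  then show "test_qubits \<tau> \<inter> DQ = {}" using ne_M by auto
qed simp

lemma flips_W_W: "flips WQ wtests (flips WQ wtests b) = b"
proof
  fix q
  have "parity_tests (wtests q) (flips WQ wtests b) = parity_tests (wtests q) b"
  proof (rule parity_tests_cong)
    fix \<tau> p assume "\<tau> \<in> set (wtests q)" "p \<in> test_qubits \<tau>"
    then have "p \<notin> WQ" using wtests_qubits disj(5) by blast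
    then show "flips WQ wtests b p = b p" by simp
  qed
  then show "flips WQ wtests (flips WQ wtests b) q = b q"
    by (cases "q \<in> WQ") auto
qed

text \<open>Computing the compressed sums, rotating by them and uncomputing them rotates every sample.\<close>

lemma sems_phases:
  assumes "\<And>b. \<psi> b \<noteq> 0 \<Longrightarrow> init_ok b"
  shows "sems \<theta> (xor_prog WQ wtests @ [Phase shift_phases, Rot False (WQ \<union> VQ) ex] @ xor_prog WQ wtests) \<psi>
    = (\<lambda>b. ((\<Prod>q\<in>VQ. cis (2 * pi * (2 ^ pos q * th \<theta> b) * of_bool (b q)))
         * (\<Prod>q\<in>CQ. cis (2 * pi * (2 ^ pos q * th \<theta> b) * of_bool (b q)))) * \<psi> b)"
proof
  fix b
  define c where "c = flips WQ wtests b"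
  define S where "S = (\<Sum>q\<in>WQ \<union> VQ. 2 ^ ex q * of_bool (c q) :: real)"
  have rc: "rval c = rval b"
    unfolding c_def by (rule rval_cong) (use ne_R in auto)
  have "sems \<theta> (xor_prog WQ wtests @ [Phase shift_phases, Rot False (WQ \<union> VQ) ex] @ xor_prog WQ wtests) \<psi> b
      = cis (2 * pi * \<theta> * S) * (cis (tphase shift_phases c) * \<psi> b)"
    unfolding fold_append comp_apply xor_W fold.simps id_apply sem.simps c_def[symmetric] flips_W_W[of b, folded c_def]
    by (simp add: S_def)
  also have "\<dots> = cis (2 * pi * th \<theta> b * S) * \<psi> b"
    unfolding tphase_shift_phases S_def[symmetric] rc mult.assoc[symmetric] cis_mult
    by (simp add: algebra_simps)
  also have "\<dots> = ((\<Prod>q\<in>VQ. cis (2 * pi * (2 ^ pos q * th \<theta> b) * of_bool (b q)))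
         * (\<Prod>q\<in>CQ. cis (2 * pi * (2 ^ pos q * th \<theta> b) * of_bool (b q)))) * \<psi> b"
  proof (cases "\<psi> b = 0")
    case False
    then have ok: "init_ok b" by (rule assms)
    have bW: "\<not> b q" if "q \<in> WQ" for q
      using ok that kd_sets by (fastforce simp: init_ok_def asg_def)
    have "S = (\<Sum>q\<in>WQ. 2 ^ ex q * of_bool (c q)) + (\<Sum>q\<in>VQ. 2 ^ ex q * of_bool (c q))"
      unfolding S_def by (rule sum.union_disjoint) auto
    also have "(\<Sum>q\<in>WQ. 2 ^ ex q * of_bool (c q)) = real (\<Sum>q\<in>WQ. 2 ^ ex q * of_bool (bit (wt (pos q) b) (idx q)))"
      unfolding of_nat_sum by (rule sum.cong) (use bW in \<open>auto simp: c_def parity_wtests\<close>)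
    also have "\<dots> = (\<Sum>q\<in>CQ. 2 ^ pos q * of_bool (b q))"
      unfolding sum_WQ_bits by simp
    also have "(\<Sum>q\<in>VQ. 2 ^ ex q * of_bool (c q)) = (\<Sum>q\<in>VQ. 2 ^ pos q * of_bool (b q) :: real)"
    proof (rule sum.cong[OF refl])
      fix q assume q: "q \<in> VQ"
      then have "q \<notin> WQ" using disj(4) by blast
      then show "2 ^ ex q * of_bool (c q) = (2 ^ pos q * of_bool (b q) :: real)"
        using kd_sets(2)[OF q] by (simp add: c_def ex_def)
    qed
    finally have SS: "S = (\<Sum>q\<in>CQ. 2 ^ pos q * of_bool (b q)) + (\<Sum>q\<in>VQ. 2 ^ pos q * of_bool (b q))" .
    have "2 * pi * th \<theta> b * (\<Sum>q\<in>A. 2 ^ pos q * of_bool (b q)) = (\<Sum>q\<in>A. 2 * pi * (2 ^ pos q * th \<theta> b) * of_bool (b q))" for A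
      unfolding sum_distrib_left by (rule sum.cong[OF refl]) (simp only: mult_ac)
    then have "2 * pi * th \<theta> b * S = (\<Sum>q\<in>VQ. 2 * pi * (2 ^ pos q * th \<theta> b) * of_bool (b q))
        + (\<Sum>q\<in>CQ. 2 * pi * (2 ^ pos q * th \<theta> b) * of_bool (b q))"
      by (simp only: SS distrib_left add.commute)
    then have "cis (2 * pi * th \<theta> b * S) = cis (\<Sum>q\<in>VQ. 2 * pi * (2 ^ pos q * th \<theta> b) * of_bool (b q))
        * cis (\<Sum>q\<in>CQ. 2 * pi * (2 ^ pos q * th \<theta> b) * of_bool (b q))"
      by (simp only: cis_mult)
    then show ?thesis by (simp only: cis_sum[OF fin(2)] cis_sum[OF fin(3)])
  qed simp
  finally show "sems \<theta> (xor_prog WQ wtests @ [Phase shift_phases, Rot False (WQ \<union> VQ) ex] @ xor_prog WQ wtests) \<psi> b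
      = ((\<Prod>q\<in>VQ. cis (2 * pi * (2 ^ pos q * th \<theta> b) * of_bool (b q)))
         * (\<Prod>q\<in>CQ. cis (2 * pi * (2 ^ pos q * th \<theta> b) * of_bool (b q)))) * \<psi> b" .
qed

text \<open>Before the two relabellings the majority and digit qubits were zero. Pulling this
  condition back says that they hold the computed values; the majorities read only samples and the
  digits only majorities, so the order of the two steps fits.\<close>

lemma init_ok_flips: "init_ok (flips MQ mtests (flips DQ dtests b)) \<longleftrightarrow> consistent b"
proof -
  define c where "c = flips MQ mtests (flips DQ dtests b)"
  have m: "parity_tests (mtests q) (flips DQ dtests b) = parity_tests (mtests q) b" if "q \<in> MQ" for q
  proof (rule parity_tests_cong)
    fix \<tau> p assume "\<tau> \<in> set (mtests q)" "p \<in> test_qubits \<tau>"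
    then have "p \<in> CQ" using mtests_qubits[OF that] by blast
    then have "p \<notin> DQ" using kd_sets(4)[of p] kd_sets(7)[of p] by auto
    then show "flips DQ dtests b p = b p" by simp
  qed
  have cM: "c q = (b q \<noteq> parity_tests (mtests q) b)" if "q \<in> MQ" for q
  proof -
    have "q \<notin> DQ" using disj(13) that by blast
    then show ?thesis using that m by (simp add: c_def)
  qed
  have cD: "c q = (b q \<noteq> parity_tests (dtests q) b)" if "q \<in> DQ" for q
  proof -
    have "q \<notin> MQ" using disj(13) that by blast
    then show ?thesis using that by (simp add: c_def)
  qed
  have cO: "c q = b q" if "q \<notin> MQ" "q \<notin> DQ" for q using that by (simp add: c_def)
  define T0 where "T0 = RQ \<union> VQ \<union> CQ \<union> {AQ}"
  have T0: "q \<notin> MQ" "q \<notin> DQ" "q \<notin> WQ" if "q \<in> T0" for q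
    using that kd_sets(1,2,4)[of q] kd_sets(5,6,7)[of q] kd_sets(3) by (auto simp: T0_def)
  have QQ: "q \<in> QQ \<longleftrightarrow> q \<in> T0 \<or> q \<in> WQ \<or> q \<in> MQ \<or> q \<in> DQ" for q by (auto simp: QQ_def T0_def)
  have "(c q \<longrightarrow> q \<in> T0) \<longleftrightarrow> (b q \<longrightarrow> q \<in> QQ) \<and> (q \<in> WQ \<longrightarrow> \<not> b q) \<and> (q \<in> MQ \<longrightarrow> b q = parity_tests (mtests q) b)
      \<and> (q \<in> DQ \<longrightarrow> b q = parity_tests (dtests q) b)" for q
    using cM[of q] cD[of q] cO[of q] T0[of q] ne_W[of q] ne_M[of q] unfolding QQ by blast
  then have "(\<forall>q. c q \<longrightarrow> q \<in> T0) \<longleftrightarrow> consistent b" unfolding consistent_def asg_def by blast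
  moreover have "init_ok c \<longleftrightarrow> (\<forall>q. c q \<longrightarrow> q \<in> T0)" by (auto simp: init_ok_def asg_def T0_def)
  ultimately show ?thesis unfolding c_def by blast
qed

lemma rval_upd: "q \<notin> RQ \<Longrightarrow> rval (b(q := u)) = rval b"
  by (rule rval_cong) auto

text \<open>The shift, the samples and all that is computed from them stay in their registers, so
  different shifts and outcomes do not interfere. For fixed values of them the amplitude is a
  product: coins at the shifted phase, and verification qubits at the shifted phase minus the
  estimate.\<close>

lemma sems_base:
  "sems \<theta> base zero_state = (\<lambda>b. of_bool (consistent b) * (pref b
      * ((\<Prod>q\<in>CQ. samp (th \<theta> b) q (b q)) * (\<Prod>q\<in>VQ. ver (th \<theta> b - vfrac b) q (b q)))))"
proof -
  define v where "v b = (\<Prod>q\<in>VQ. rsqrt2 * cis (2 * pi * (2 ^ pos q * th \<theta> b) * of_bool (b q)))" for b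
  define \<psi>1 where "\<psi>1 = (\<lambda>b. of_bool (init_ok b) * (pref b * ((\<Prod>q\<in>VQ. rsqrt2) * (\<Prod>q\<in>CQ. rsqrt2))))"
  define \<psi>5 where "\<psi>5 = (\<lambda>b. (of_bool (init_ok b) * (pref b * v b))
      * (\<Prod>q\<in>CQ. rsqrt2 * cis (2 * pi * (2 ^ pos q * th \<theta> b) * of_bool (b q))))"
  have s5: "sems \<theta> (xor_prog WQ wtests @ [Phase shift_phases, Rot False (WQ \<union> VQ) ex] @ xor_prog WQ wtests) \<psi>1 = \<psi>5"
    by (subst sems_phases) (auto simp: \<psi>1_def \<psi>5_def v_def prod.distrib mult_ac)
  have iv: "indep CQ v"
    unfolding v_def
  proof (rule indep_prod)
    fix q assume "q \<in> VQ"
    note q = ne_V[OF this]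
    show "indep CQ (\<lambda>b. rsqrt2 * cis (2 * pi * (2 ^ pos q * th \<theta> b) * of_bool (b q)))"
      unfolding indep_def
    proof (intro allI impI)
      fix b p u assume "p \<in> CQ"
      then have "p \<noteq> q" "p \<notin> RQ" using q ne_C by auto
      then show "rsqrt2 * cis (2 * pi * (2 ^ pos q * th \<theta> (b(p := u))) * of_bool ((b(p := u)) q))
          = rsqrt2 * cis (2 * pi * (2 ^ pos q * th \<theta> b) * of_bool (b q))"
        by (simp add: rval_upd)
    qed
  qed
  have ii: "indep CQ init_ok"
    unfolding indep_def init_ok_def by (simp add: asg_upd)
  define \<psi>6 where "\<psi>6 = (\<lambda>b. of_bool (init_ok b) * (pref b * v b) * (\<Prod>q\<in>CQ. samp (th \<theta> b) q (b q)))"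
  have s6: "sem \<theta> (Ones CQ (\<lambda>q. samp_mat (shift_angle (kd q - 3)))) \<psi>5 = \<psi>6"
  proof -
    have "sem \<theta> (Ones CQ (\<lambda>q. samp_mat (shift_angle (kd q - 3)))) \<psi>5
      = (\<lambda>b. of_bool (init_ok b) * (pref b * v b) * (\<Prod>q\<in>CQ.
          samp_mat (shift_angle (kd q - 3)) (b q) False * (rsqrt2 * cis (2 * pi * (2 ^ pos q * th \<theta> b) * of_bool False))
        + samp_mat (shift_angle (kd q - 3)) (b q) True * (rsqrt2 * cis (2 * pi * (2 ^ pos q * th \<theta> b) * of_bool True))))"
      unfolding \<psi>5_def
    proof (rule sem_Ones_prod)
      show "indep CQ (\<lambda>b. of_bool (init_ok b) * (pref b * v b))"
        unfolding indep_def
      proof (intro allI impI)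
        fix b p u assume p: "p \<in> CQ"
        then have "AQ \<noteq> p" using ne_C by auto
        then show "of_bool (init_ok (b(p := u))) * (pref (b(p := u)) * v (b(p := u))) = of_bool (init_ok b) * (pref b * v b)"
          by (simp add: indepD[OF ii p] indepD[OF iv p])
      qed
      show "indep CQ (\<lambda>b. rsqrt2 * cis (2 * pi * (2 ^ pos q * th \<theta> b) * of_bool u))" for q u
        unfolding indep_def using ne_C by (simp add: rval_upd)
    qed simp
    moreover have "samp_mat a u False * (rsqrt2 * cis (2 * pi * x * of_bool False))
        + samp_mat a u True * (rsqrt2 * cis (2 * pi * x * of_bool True))
        = (1 + (if u then - 1 else 1) * cis (2 * pi * (x - a))) / 2" for a u x
    proof -
      define e where "e = cis (- (2 * pi * a))"
      define e' where "e' = cis (2 * pi * x)"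
      have r: "rsqrt2 * rsqrt2 = 1 / 2" using rsqrt2_sq[of 1] by simp
      have c: "cis (2 * pi * (x - a)) = e * e'"
        by (simp add: e_def e'_def cis_mult algebra_simps)
      have "samp_mat a u False = rsqrt2" "samp_mat a u True = (if u then - 1 else 1) * (rsqrt2 * e)"
        by (simp_all add: samp_mat_def hmat_eq e_def)
      then have "samp_mat a u False * (rsqrt2 * cis (2 * pi * x * of_bool False))
        + samp_mat a u True * (rsqrt2 * cis (2 * pi * x * of_bool True))
        = rsqrt2 * rsqrt2 + (if u then - 1 else 1) * ((rsqrt2 * e) * (rsqrt2 * e'))"
        by (simp add: e'_def mult.assoc)
      also have "(rsqrt2 * e) * (rsqrt2 * e') = (rsqrt2 * rsqrt2) * (e * e')" by (simp only: mult_ac)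
      finally show ?thesis by (simp add: r c add_divide_distrib)
    qed
    ultimately show ?thesis by (simp only: \<psi>6_def samp_def)
  qed
  define \<psi>8 where "\<psi>8 = (\<lambda>b. of_bool (consistent b) * (pref b * v b) * (\<Prod>q\<in>CQ. samp (th \<theta> b) q (b q)))"
  have s8: "sems \<theta> (xor_prog MQ mtests @ xor_prog DQ dtests) \<psi>6 = \<psi>8"
  proof
    fix b
    define c where "c = flips MQ mtests (flips DQ dtests b)"
    have cb: "c q = b q" if "q \<in> RQ \<union> VQ \<union> CQ \<union> {AQ}" for q
    proof -
      have "q \<notin> MQ" "q \<notin> DQ" using that kd_sets(1,2,4)[of q] kd_sets(6,7)[of q] kd_sets(3) by auto
      then show ?thesis by (simp add: c_def)
    qed
    have r: "rval c = rval b" by (rule rval_cong) (use cb in auto)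
    have "v c = v b" unfolding v_def r using cb by (intro prod.cong refl) auto
    moreover have "(\<Prod>q\<in>CQ. samp (th \<theta> c) q (c q)) = (\<Prod>q\<in>CQ. samp (th \<theta> b) q (b q))"
      unfolding r using cb by (intro prod.cong refl) auto
    moreover have "c AQ = b AQ" by (rule cb) simp
    moreover have "sems \<theta> (xor_prog MQ mtests @ xor_prog DQ dtests) \<psi>6 b = \<psi>6 c"
      by (simp add: xor_M xor_D c_def)
    ultimately show "sems \<theta> (xor_prog MQ mtests @ xor_prog DQ dtests) \<psi>6 b = \<psi>8 b"
      using init_ok_flips[of b] by (simp add: \<psi>6_def \<psi>8_def c_def)
  qed
  define f where "f q b u = rsqrt2 * cis (2 * pi * (2 ^ pos q * (th \<theta> b - vfrac b)) * of_bool u)" for q b u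
  define \<psi>9 where "\<psi>9 = (\<lambda>b. (of_bool (consistent b) * (pref b * (\<Prod>q\<in>CQ. samp (th \<theta> b) q (b q))))
      * (\<Prod>q\<in>VQ. f q b (b q)))"
  have s9: "sem \<theta> (Phase digit_phases) \<psi>8 = \<psi>9"
  proof
    fix b
    have "cis (tphase digit_phases b) * v b = (\<Prod>q\<in>VQ. f q b (b q))"
      unfolding tphase_digit_phases cis_sum[OF fin(2)] v_def prod.distrib[symmetric]
      by (rule prod.cong[OF refl]) (simp add: f_def mult.left_commute[of "cis _" rsqrt2] cis_mult algebra_simps of_bool_def)
    then show "sem \<theta> (Phase digit_phases) \<psi>8 b = \<psi>9 b"
      by (simp add: \<psi>8_def \<psi>9_def mult_ac)
  qed
  have ic: "indep VQ consistent"
    unfolding indep_def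
  proof (intro allI impI)
    fix b q u assume q: "q \<in> VQ"
    have nq: "q \<notin> CQ" "q \<notin> MQ" "q \<notin> DQ" "q \<notin> WQ" "q \<in> QQ"
      using q kd_sets(2)[OF q] kd_sets(4,5,6,7)[of q] by (auto simp: QQ_def)
    have m: "parity_tests (mtests p) (b(q := u)) = parity_tests (mtests p) b" if "p \<in> MQ" for p
      by (rule parity_tests_cong) (use mtests_qubits[OF that] nq in auto)
    have d: "parity_tests (dtests p) (b(q := u)) = parity_tests (dtests p) b" if "p \<in> DQ" for p
      by (rule parity_tests_cong) (use dtests_qubits[OF that] nq in auto)
    have a: "(b(q := u) \<in> asg QQ) = (b \<in> asg QQ)" using nq by (simp add: asg_upd)
    show "consistent (b(q := u)) = consistent b"
    proof -
      have "(\<forall>p\<in>WQ. \<not> (b(q := u)) p) = (\<forall>p\<in>WQ. \<not> b p)" by (rule ball_cong[OF refl]) (use nq in auto)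
      moreover have "(\<forall>p\<in>MQ. (b(q := u)) p = parity_tests (mtests p) (b(q := u))) = (\<forall>p\<in>MQ. b p = parity_tests (mtests p) b)"
        by (rule ball_cong[OF refl]) (use nq m in auto)
      moreover have "(\<forall>p\<in>DQ. (b(q := u)) p = parity_tests (dtests p) (b(q := u))) = (\<forall>p\<in>DQ. b p = parity_tests (dtests p) b)"
        by (rule ball_cong[OF refl]) (use nq d in auto)
      ultimately show ?thesis using a by (simp only: consistent_def)
    qed
  qed
  have ivf: "indep VQ vfrac"
    unfolding indep_def
  proof (intro allI impI vfrac_cong)
    fix b q u p assume "q \<in> VQ" "p \<in> DQ"
    then show "(b(q := u)) p = b p" using ne_V by auto
  qed
  have s10: "sem \<theta> (Ones VQ (\<lambda>_. hmat)) \<psi>9 = (\<lambda>b. of_bool (consistent b) * (pref b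
      * ((\<Prod>q\<in>CQ. samp (th \<theta> b) q (b q)) * (\<Prod>q\<in>VQ. ver (th \<theta> b - vfrac b) q (b q)))))"
  proof -
    have "sem \<theta> (Ones VQ (\<lambda>_. hmat)) \<psi>9
      = (\<lambda>b. (of_bool (consistent b) * (pref b * (\<Prod>q\<in>CQ. samp (th \<theta> b) q (b q))))
      * (\<Prod>q\<in>VQ. hmat (b q) False * f q b False + hmat (b q) True * f q b True))"
      unfolding \<psi>9_def
    proof (rule sem_Ones_prod)
      have "indep VQ (\<lambda>b. \<Prod>q\<in>CQ. samp (th \<theta> b) q (b q))"
      proof (rule indep_prod)
        fix q assume "q \<in> CQ"
        then show "indep VQ (\<lambda>b. samp (th \<theta> b) q (b q))"
          unfolding indep_def
        proof (intro allI impI)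
          fix b p u assume "q \<in> CQ" "p \<in> VQ"
          then have "p \<noteq> q" "p \<notin> RQ" using ne_C ne_V by auto
          then show "samp (th \<theta> (b(p := u))) q ((b(p := u)) q) = samp (th \<theta> b) q (b q)"
            by (simp add: rval_upd)
        qed
      qed
      note iS = this
      show "indep VQ (\<lambda>b. of_bool (consistent b) * (pref b * (\<Prod>q\<in>CQ. samp (th \<theta> b) q (b q))))"
        unfolding indep_def
      proof (intro allI impI)
        fix b p u assume p: "p \<in> VQ"
        then have "AQ \<noteq> p" using ne_V by auto
        then show "of_bool (consistent (b(p := u))) * (pref (b(p := u)) * (\<Prod>q\<in>CQ. samp (th \<theta> (b(p := u))) q ((b(p := u)) q)))
            = of_bool (consistent b) * (pref b * (\<Prod>q\<in>CQ. samp (th \<theta> b) q (b q)))"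
          using indepD[OF ic p, of b u] indepD[OF iS p, of b u] by simp
      qed
      show "indep VQ (\<lambda>b. f q b u)" for q u
        unfolding f_def using ivf ne_V by (simp add: indep_def rval_upd)
    qed simp
    moreover have "hmat u False * f q b False + hmat u True * f q b True = ver (th \<theta> b - vfrac b) q u" for q b u
      using rsqrt2_sq[of 1] by (simp add: hmat_eq f_def ver_def rsqrt2_sq)
    ultimately show ?thesis by (simp only: mult.assoc)
  qed
  have "base = [Ones (RQ \<union> VQ \<union> CQ \<union> {AQ}) (\<lambda>q. if q = AQ then rot_mat \<rho> else hmat)]
     @ (xor_prog WQ wtests @ [Phase shift_phases, Rot False (WQ \<union> VQ) ex] @ xor_prog WQ wtests)
     @ [Ones CQ (\<lambda>q. samp_mat (shift_angle (kd q - 3)))]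
     @ (xor_prog MQ mtests @ xor_prog DQ dtests)
     @ [Phase digit_phases] @ [Ones VQ (\<lambda>_. hmat)]"
    by (simp add: base_def)
  then have "sems \<theta> base zero_state = sem \<theta> (Ones VQ (\<lambda>_. hmat)) (sem \<theta> (Phase digit_phases)
      (sems \<theta> (xor_prog MQ mtests @ xor_prog DQ dtests)
        (sem \<theta> (Ones CQ (\<lambda>q. samp_mat (shift_angle (kd q - 3))))
          (sems \<theta> (xor_prog WQ wtests @ [Phase shift_phases, Rot False (WQ \<union> VQ) ex] @ xor_prog WQ wtests)
            (sem \<theta> (Ones (RQ \<union> VQ \<union> CQ \<union> {AQ}) (\<lambda>q. if q = AQ then rot_mat \<rho> else hmat)) zero_state)))))"
    by (simp only: fold_append comp_apply fold.simps id_apply)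
  then show ?thesis
    by (simp only: sem_init \<psi>1_def[symmetric] s5 s6 s8 s9 s10)
qed

end

subsection \<open>Probabilities of the window program\<close>

context window
begin

definition flag :: test where
  "flag = none_test (VQ \<union> {AQ})"

text \<open>The consistent assignment with shift bits \<open>a\<close>, samples \<open>c\<close>,
  and verification and attenuator qubits zero: a parametrisation of the flagged outcomes.\<close>

definition full :: "(nat \<Rightarrow> bool) \<Rightarrow> (nat \<Rightarrow> bool) \<Rightarrow> nat \<Rightarrow> bool" where
  "full a c q = (if q \<in> RQ then a q else if q \<in> CQ then c q
     else if q \<in> MQ then parity_tests (mtests q) c
     else q \<in> DQ \<and> parity_tests (dtests q) (\<lambda>p. p \<in> MQ \<and> parity_tests (mtests p) c))"

definition vf :: "(nat \<Rightarrow> bool) \<Rightarrow> real" where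
  "vf c = vfrac (full (\<lambda>_. False) c)"

definition pc :: "real \<Rightarrow> (nat \<Rightarrow> bool) \<Rightarrow> real" where
  "pc \<theta> c = (\<Prod>q\<in>CQ. (cmod (samp \<theta> q (c q)))\<^sup>2)"

definition vr :: "real \<Rightarrow> real" where
  "vr \<delta> = (\<Prod>q\<in>VQ. (cmod (ver \<delta> q False))\<^sup>2)"

lemma full_simps:
  "q \<in> RQ \<Longrightarrow> full a c q = a q" "q \<in> CQ \<Longrightarrow> full a c q = c q"
  "q \<in> MQ \<Longrightarrow> full a c q = parity_tests (mtests q) c"
  "q \<in> DQ \<Longrightarrow> full a c q = parity_tests (dtests q) (\<lambda>p. p \<in> MQ \<and> parity_tests (mtests p) c)"
  "q \<notin> RQ \<Longrightarrow> q \<notin> CQ \<Longrightarrow> q \<notin> MQ \<Longrightarrow> q \<notin> DQ \<Longrightarrow> full a c q = False"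
proof -
  show "q \<in> RQ \<Longrightarrow> full a c q = a q" by (simp add: full_def)
  show "full a c q = c q" if "q \<in> CQ" using ne_C[OF that] that by (simp add: full_def)
  show "full a c q = parity_tests (mtests q) c" if "q \<in> MQ" using ne_M[OF that] that by (simp add: full_def)
  show "full a c q = parity_tests (dtests q) (\<lambda>p. p \<in> MQ \<and> parity_tests (mtests p) c)" if "q \<in> DQ"
    using ne_D[OF that] that by (simp add: full_def)
qed (simp add: full_def)

lemma parity_mtests_cong:
  assumes "q \<in> MQ" "\<And>p. p \<in> CQ \<Longrightarrow> b p = b' p"
  shows "parity_tests (mtests q) b = parity_tests (mtests q) b'"
proof (rule parity_tests_cong)
  fix \<tau> p assume "\<tau> \<in> set (mtests q)" "p \<in> test_qubits \<tau>"
  then show "b p = b' p" using mtests_qubits[OF assms(1)] assms(2)[of p] by blast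
qed

lemma parity_dtests_cong:
  assumes "q \<in> DQ" "\<And>p. p \<in> MQ \<Longrightarrow> b p = b' p"
  shows "parity_tests (dtests q) b = parity_tests (dtests q) b'"
proof (rule parity_tests_cong)
  fix \<tau> p assume "\<tau> \<in> set (dtests q)" "p \<in> test_qubits \<tau>"
  then show "b p = b' p" using dtests_qubits[OF assms(1)] assms(2)[of p] by blast
qed

lemma consistent_full: "consistent (full a c)"
  unfolding consistent_def
proof (intro conjI ballI)
  have "q \<in> QQ" if "full a c q" for q
    using full_simps(5)[of q a c] that by (auto simp: QQ_def)
  then show "full a c \<in> asg QQ" by (auto simp: asg_def)
  fix q
  show "\<not> full a c q" if "q \<in> WQ" using full_simps(5)[of q a c] ne_W[OF that] by blast
  show "full a c q = parity_tests (mtests q) (full a c)" if "q \<in> MQ"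
    unfolding full_simps(3)[OF that] by (rule parity_mtests_cong[OF that]) (simp add: full_simps(2))
  show "full a c q = parity_tests (dtests q) (full a c)" if "q \<in> DQ"
    unfolding full_simps(4)[OF that] by (rule parity_dtests_cong[OF that]) (simp add: full_simps(3))
qed

lemma full_VA: "q \<in> VQ \<union> {AQ} \<Longrightarrow> \<not> full a c q"
proof -
  assume "q \<in> VQ \<union> {AQ}"
  then have "q \<notin> RQ \<and> q \<notin> CQ \<and> q \<notin> MQ \<and> q \<notin> DQ" using ne_V[of q] disj by fastforce
  then show "\<not> full a c q" by (simp add: full_simps(5))
qed

lemma full_restrict:
  assumes "consistent b" "\<forall>q\<in>VQ \<union> {AQ}. \<not> b q"
  shows "full (\<lambda>q. q \<in> RQ \<and> b q) (\<lambda>q. q \<in> CQ \<and> b q) = b"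
proof
  fix q
  let ?f = "full (\<lambda>q. q \<in> RQ \<and> b q) (\<lambda>q. q \<in> CQ \<and> b q)"
  have m: "parity_tests (mtests p) (\<lambda>q. q \<in> CQ \<and> b q) = b p" if "p \<in> MQ" for p
  proof -
    have "parity_tests (mtests p) (\<lambda>q. q \<in> CQ \<and> b q) = parity_tests (mtests p) b"
      by (rule parity_mtests_cong[OF that]) simp
    then show ?thesis using assms(1) that by (simp add: consistent_def)
  qed
  consider "q \<in> RQ" | "q \<in> CQ" | "q \<in> MQ" | "q \<in> DQ" | "q \<notin> RQ" "q \<notin> CQ" "q \<notin> MQ" "q \<notin> DQ" by blast
  then show "?f q = b q"
  proof cases
    case 4
    have "parity_tests (dtests q) (\<lambda>p. p \<in> MQ \<and> parity_tests (mtests p) (\<lambda>q. q \<in> CQ \<and> b q)) = parity_tests (dtests q) b"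
      by (rule parity_dtests_cong[OF 4]) (simp add: m)
    then show ?thesis using 4 assms(1) by (simp add: full_simps(4) consistent_def)
  next
    case 5
    then have "\<not> b q" using assms unfolding consistent_def asg_def QQ_def by blast
    then show ?thesis using 5 by (simp add: full_simps(5))
  qed (simp_all add: full_simps m)
qed

lemma holds_flag: "holds flag b \<longleftrightarrow> (\<forall>q\<in>VQ \<union> {AQ}. \<not> b q)"
  unfolding flag_def by (rule holds_none_test) simp

lemma rval_full: "rval (full a c) = rval a"
  by (rule rval_cong) (simp add: full_simps(1))

lemma vfrac_full: "vfrac (full a c) = vf c"
  unfolding vf_def by (rule vfrac_cong) (simp add: full_simps(4))

lemma sum_rval:
  fixes F :: "nat \<Rightarrow> 'a::comm_monoid_add"
  shows "(\<Sum>a\<in>asg RQ. F (rval a)) = (\<Sum>r<2 ^ G. F r)"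
proof -
  have "(\<Sum>a\<in>asg ((\<lambda>a. nm 0 a 0) ` {..<K}). H (\<Sum>k<K. 2 ^ k * of_bool (a (nm 0 k 0)))) = (\<Sum>r<2 ^ K. H r)"
    for K and H :: "nat \<Rightarrow> 'a"
  proof (induction K arbitrary: H)
    case (Suc K)
    let ?S = "(\<lambda>a. nm 0 a 0) ` {..<K}"
    have "(\<Sum>a\<in>asg ((\<lambda>a. nm 0 a 0) ` {..<Suc K}). H (\<Sum>k<Suc K. 2 ^ k * of_bool (a (nm 0 k 0))))
        = (\<Sum>a\<in>asg (insert (nm 0 K 0) ?S). H (\<Sum>k<Suc K. 2 ^ k * of_bool (a (nm 0 k 0))))"
      by (simp add: lessThan_Suc)
    also have "\<dots> = (\<Sum>a\<in>asg ?S. H (\<Sum>k<K. 2 ^ k * of_bool (a (nm 0 k 0)))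
        + H (2 ^ K + (\<Sum>k<K. 2 ^ k * of_bool (a (nm 0 k 0)))))"
    proof (subst sum_asg_insert)
      show "(\<Sum>b\<in>asg ?S. H (\<Sum>k<Suc K. 2 ^ k * of_bool (b (nm 0 k 0))) +
          H (\<Sum>k<Suc K. 2 ^ k * of_bool ((b(nm 0 K 0 := True)) (nm 0 k 0))))
        = (\<Sum>a\<in>asg ?S. H (\<Sum>k<K. 2 ^ k * of_bool (a (nm 0 k 0)))
        + H (2 ^ K + (\<Sum>k<K. 2 ^ k * of_bool (a (nm 0 k 0)))))"
      proof (rule sum.cong[OF refl])
        fix a assume "a \<in> asg ?S"
        then have 1: "\<not> a (nm 0 K 0)" by (auto simp: asg_def)
        have 2: "(\<Sum>k<K. 2 ^ k * of_bool ((a(nm 0 K 0 := True)) (nm 0 k 0)) :: nat) = (\<Sum>k<K. 2 ^ k * of_bool (a (nm 0 k 0)))"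
          by (rule sum.cong) auto
        show "H (\<Sum>k<Suc K. 2 ^ k * of_bool (a (nm 0 k 0))) + H (\<Sum>k<Suc K. 2 ^ k * of_bool ((a(nm 0 K 0 := True)) (nm 0 k 0)))
          = H (\<Sum>k<K. 2 ^ k * of_bool (a (nm 0 k 0))) + H (2 ^ K + (\<Sum>k<K. 2 ^ k * of_bool (a (nm 0 k 0))))"
          unfolding sum.lessThan_Suc 2 using 1 by (simp add: add.commute)
      qed
    qed auto
    also have "\<dots> = (\<Sum>r<2 ^ K. H r) + (\<Sum>r<2 ^ K. H (2 ^ K + r))"
      unfolding sum.distrib Suc.IH[of H] Suc.IH[of "\<lambda>r. H (2 ^ K + r)"] ..
    also have "\<dots> = (\<Sum>r<2 ^ Suc K. H r)"
    proof -
      have "{..<2 ^ Suc K} = {..<2 ^ K} \<union> (\<lambda>r. 2 ^ K + r) ` {..<2 ^ K :: nat}"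
      proof (intro equalityI subsetI)
        fix r :: nat assume "r \<in> {..<2 ^ Suc K}"
        then have "r < 2 ^ K \<or> (r - 2 ^ K < 2 ^ K \<and> r = 2 ^ K + (r - 2 ^ K))" by auto
        then show "r \<in> {..<2 ^ K} \<union> (\<lambda>r. 2 ^ K + r) ` {..<2 ^ K}" by blast
      qed auto
      moreover have "sum H ((\<lambda>r. 2 ^ K + r) ` {..<2 ^ K}) = (\<Sum>r<2 ^ K. H (2 ^ K + r))"
        by (subst sum.reindex) (auto simp: inj_on_def)
      moreover have "sum H ({..<2 ^ K} \<union> (\<lambda>r. 2 ^ K + r) ` {..<2 ^ K})
          = (\<Sum>r<2 ^ K. H r) + sum H ((\<lambda>r. 2 ^ K + r) ` {..<2 ^ K})"
        by (rule sum.union_disjoint) auto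
      ultimately show ?thesis by metis
    qed
    finally show ?case .
  qed simp
  from this[where H = F] show ?thesis unfolding RQ_def rval_def .
qed

text \<open>Flagged outcomes correspond one to one to pairs of a shift and a sample assignment. The
  squared amplitude of \<open>rsqrt2 ^ G\<close> is the uniform distribution of the shift, so the
  probability is an average over the grid \<open>r / 2 ^ G\<close>.\<close>

lemma sum_flagged:
  assumes "\<And>a c. E (full a c) = E' (rval a) c"
  shows "weight QQ (\<lambda>b. holds flag b \<and> E b) (sems \<theta> base zero_state)
    = \<rho>\<^sup>2 / 2 ^ G * (\<Sum>r<2 ^ G. \<Sum>c\<in>asg CQ. of_bool (E' r c) *
        (pc (\<theta> + real r / 2 ^ G) c * vr (\<theta> + real r / 2 ^ G - vf c)))"
proof -
  let ?p = "\<lambda>r c. pc (\<theta> + real r / 2 ^ G) c * vr (\<theta> + real r / 2 ^ G - vf c)"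
  define B where "B = {b. consistent b \<and> holds flag b}"
  have BQ: "B \<subseteq> asg QQ" by (auto simp: B_def consistent_def)
  have "weight QQ (\<lambda>b. holds flag b \<and> E b) (sems \<theta> base zero_state)
      = (\<Sum>b\<in>B. of_bool (E b) * (cmod (sems \<theta> base zero_state b))\<^sup>2)"
  proof (rule sum.mono_neutral_cong_right)
    show "\<forall>b\<in>asg QQ - B. of_bool (holds flag b \<and> E b) * (cmod (sems \<theta> base zero_state b))\<^sup>2 = 0"
      by (auto simp: B_def sems_base)
  qed (use BQ in \<open>auto simp: B_def\<close>)
  also have "\<dots> = (\<Sum>(a, c)\<in>asg RQ \<times> asg CQ. of_bool (E (full a c)) * (cmod (sems \<theta> base zero_state (full a c)))\<^sup>2)"
  proof (rule sum.reindex_bij_witness[of _ "\<lambda>(a, c). full a c" "\<lambda>b. (\<lambda>q. q \<in> RQ \<and> b q, \<lambda>q. q \<in> CQ \<and> b q)"])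
    fix b assume "b \<in> B"
    then have "consistent b" "\<forall>q\<in>VQ \<union> {AQ}. \<not> b q" unfolding B_def by (auto simp: holds_flag)
    then show "(case (\<lambda>q. q \<in> RQ \<and> b q, \<lambda>q. q \<in> CQ \<and> b q) of (a, c) \<Rightarrow> full a c) = b"
      using full_restrict by simp
    then show "(case (\<lambda>q. q \<in> RQ \<and> b q, \<lambda>q. q \<in> CQ \<and> b q) of (a, c) \<Rightarrow>
        of_bool (E (full a c)) * (cmod (sems \<theta> base zero_state (full a c)))\<^sup>2)
        = of_bool (E b) * (cmod (sems \<theta> base zero_state b))\<^sup>2" by simp
  next
    fix ac assume ac: "ac \<in> asg RQ \<times> asg CQ"
    obtain a c where [simp]: "ac = (a, c)" by (cases ac)
    have "(\<lambda>q. q \<in> RQ \<and> full a c q) = a" "(\<lambda>q. q \<in> CQ \<and> full a c q) = c"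
      using ac full_simps(1,2) by (auto simp: asg_def fun_eq_iff)
    then show "(\<lambda>q. q \<in> RQ \<and> (case ac of (a, c) \<Rightarrow> full a c) q, \<lambda>q. q \<in> CQ \<and> (case ac of (a, c) \<Rightarrow> full a c) q) = ac"
      by simp
    show "(case ac of (a, c) \<Rightarrow> full a c) \<in> B"
      using consistent_full[of a c] full_VA[of _ a c] by (simp add: B_def holds_flag)
  qed (auto simp: asg_def)
  also have "\<dots> = (\<Sum>(a, c)\<in>asg RQ \<times> asg CQ. \<rho>\<^sup>2 / 2 ^ G * (of_bool (E' (rval a) c) *
        ?p (rval a) c))"
  proof (rule sum.cong[OF refl], clarify)
    fix a c
    define t where "t = \<theta> + real (rval a) / 2 ^ G"
    have fA: "\<not> full a c AQ" using full_VA[of AQ a c] by simp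
    have "(cmod rsqrt2)\<^sup>2 = 1 / 2"
      by (simp add: rsqrt2_def norm_divide power_divide)
    then have "((cmod rsqrt2)\<^sup>2) ^ G = 1 / 2 ^ G" by (simp only: power_one_over)
    moreover have "(cmod (rsqrt2 ^ G * att (full a c AQ)))\<^sup>2 = ((cmod rsqrt2)\<^sup>2) ^ G * \<rho>\<^sup>2"
    proof -
      have "cmod (att (full a c AQ)) = \<rho>" using fA \<rho> by (simp add: att_def rot_mat_def)
      then show ?thesis by (simp only: norm_mult norm_power power_mult_distrib power_mult[symmetric] mult.commute)
    qed
    ultimately have "(cmod (rsqrt2 ^ G * att (full a c AQ)))\<^sup>2 = \<rho>\<^sup>2 / 2 ^ G" by simp
    moreover have "(cmod (\<Prod>q\<in>CQ. samp t q (full a c q)))\<^sup>2 = pc t c"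
      unfolding pc_def prod_norm[symmetric] prod_power_distrib
      by (rule prod.cong) (auto simp: full_simps(2))
    moreover have "(cmod (\<Prod>q\<in>VQ. ver (t - vf c) q (full a c q)))\<^sup>2 = vr (t - vf c)"
      unfolding vr_def prod_norm[symmetric] prod_power_distrib
      by (rule prod.cong) (use full_VA[of _ a c] in auto)
    moreover have "cmod (sems \<theta> base zero_state (full a c)) = cmod (rsqrt2 ^ G * att (full a c AQ))
        * (cmod (\<Prod>q\<in>CQ. samp t q (full a c q)) * cmod (\<Prod>q\<in>VQ. ver (t - vf c) q (full a c q)))"
      unfolding sems_base by (simp add: consistent_full rval_full vfrac_full t_def norm_mult)
    ultimately show "of_bool (E (full a c)) * (cmod (sems \<theta> base zero_state (full a c)))\<^sup>2 =
       \<rho>\<^sup>2 / 2 ^ G * (of_bool (E' (rval a) c) *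
        ?p (rval a) c)"
      unfolding t_def[symmetric] assms by (simp add: power_mult_distrib)
  qed
  also have "\<dots> = \<rho>\<^sup>2 / 2 ^ G * (\<Sum>a\<in>asg RQ. \<Sum>c\<in>asg CQ. of_bool (E' (rval a) c) *
        ?p (rval a) c)"
    unfolding sum.cartesian_product sum_distrib_left by (rule sum.cong[OF refl]) (simp only: case_prod_beta)
  also have "(\<Sum>a\<in>asg RQ. \<Sum>c\<in>asg CQ. of_bool (E' (rval a) c) *
        ?p (rval a) c)
      = (\<Sum>r<2 ^ G. \<Sum>c\<in>asg CQ. of_bool (E' r c) *
        ?p r c)"
    by (rule sum_rval[of "\<lambda>r. \<Sum>c\<in>asg CQ. of_bool (E' r c) * ?p r c"])
  finally show ?thesis .
qed

end

section \<open>Trigonometric polynomials and quarter estimates\<close>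

text \<open>Trigonometric polynomials with integer frequencies of modulus at most \<open>D\<close>.
  The inductive form reduces the averaging argument to a single frequency.\<close>

inductive trig :: "int \<Rightarrow> (real \<Rightarrow> complex) \<Rightarrow> bool" for D where
  trig_cis: "\<bar>k\<bar> \<le> D \<Longrightarrow> trig D (\<lambda>\<theta>. c * cis (2 * pi * (of_int k * \<theta>)))"
| trig_add: "trig D f \<Longrightarrow> trig D h \<Longrightarrow> trig D (\<lambda>\<theta>. f \<theta> + h \<theta>)"

lemma trig_const: "D \<ge> 0 \<Longrightarrow> trig D (\<lambda>_. c)"
  using trig_cis[of 0 D c] by simp

lemma trig_mult:
  assumes "trig D f" "trig E h"
  shows "trig (D + E) (\<lambda>\<theta>. f \<theta> * h \<theta>)"
  using assms(1)
proof induction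
  case (trig_cis k c)
  from assms(2) show ?case
  proof induction
    case (trig_cis l d)
    have "trig (D + E) (\<lambda>\<theta>. (c * d) * cis (2 * pi * (of_int (k + l) * \<theta>)))"
      using trig_cis \<open>\<bar>k\<bar> \<le> D\<close> by (intro trig.trig_cis) linarith
    also have "(\<lambda>\<theta>. (c * d) * cis (2 * pi * (of_int (k + l) * \<theta>)))
        = (\<lambda>\<theta>. c * cis (2 * pi * (of_int k * \<theta>)) * (d * cis (2 * pi * (of_int l * \<theta>))))"
      by (simp add: fun_eq_iff distrib_left distrib_right cis_mult[symmetric])
    finally show ?case .
  next
    case (trig_add f h)
    then have "trig (D + E) (\<lambda>\<theta>. c * cis (2 * pi * (of_int k * \<theta>)) * f \<theta> + c * cis (2 * pi * (of_int k * \<theta>)) * h \<theta>)"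
      by (intro trig.trig_add)
    then show ?case by (simp only: distrib_left)
  qed
next
  case (trig_add f' h')
  then have "trig (D + E) (\<lambda>\<theta>. f' \<theta> * h \<theta> + h' \<theta> * h \<theta>)" by (intro trig.trig_add)
  then show ?case by (simp only: distrib_right)
qed

lemma trig_sum:
  assumes "D \<ge> 0" "\<And>a. a \<in> A \<Longrightarrow> trig D (f a)"
  shows "trig D (\<lambda>\<theta>. \<Sum>a\<in>A. f a \<theta>)"
proof (cases "finite A")
  case True
  then show ?thesis using assms(2)
  proof induction
    case empty
    then show ?case using trig_const[OF assms(1), of 0] by simp
  next
    case (insert a A)
    then show ?case by (simp add: trig_add)
  qed
qed (use trig_const[OF assms(1), of 0] in simp)

lemma trig_prod:
  assumes "finite A" "\<And>a. a \<in> A \<Longrightarrow> trig (D a) (f a)"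
  shows "trig (\<Sum>a\<in>A. D a) (\<lambda>\<theta>. \<Prod>a\<in>A. f a \<theta>)"
  using assms
proof induction
  case empty
  then show ?case using trig_const[of 0 1] by simp
next
  case (insert a A)
  then show ?case by (simp add: trig_mult)
qed

lemma trig_cos: "trig (2 ^ p) (\<lambda>\<theta>. of_real ((1 + \<sigma> * cos (2 * pi * (2 ^ p * \<theta> - a))) / 2))"
proof -
  let ?w = "\<lambda>\<theta>. (of_real \<sigma> / 4 * cis (- (2 * pi * a))) * cis (2 * pi * (of_int (2 ^ p) * \<theta>))
      + (of_real \<sigma> / 4 * cis (2 * pi * a)) * cis (2 * pi * (of_int (- (2 ^ p)) * \<theta>))"
  have "trig (2 ^ p) (\<lambda>\<theta>. 1 / 2 + ?w \<theta>)"
    by (intro trig_add trig_const trig_cis) simp_all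
  also have "(\<lambda>\<theta>. 1 / 2 + ?w \<theta>)
    = (\<lambda>\<theta>. of_real ((1 + \<sigma> * cos (2 * pi * (2 ^ p * \<theta> - a))) / 2))"
  proof
    fix \<theta>
    define t where "t = 2 * pi * (2 ^ p * \<theta> - a)"
    have "cis (- (2 * pi * a)) * cis (2 * pi * (of_int (2 ^ p) * \<theta>)) = cis t"
      "cis (2 * pi * a) * cis (2 * pi * (of_int (- (2 ^ p)) * \<theta>)) = cis (- t)"
      by (simp_all add: cis_mult t_def algebra_simps)
    moreover have "cis t + cis (- t) = 2 * of_real (cos t)"
      by (simp add: complex_eq_iff)
    ultimately have "?w \<theta> = of_real \<sigma> / 4 * (2 * of_real (cos t))"
      by (simp only: mult.assoc distrib_left[symmetric])
    moreover have "complex_of_real ((1 + \<sigma> * c) / 2) = 1 / 2 + of_real \<sigma> / 4 * (2 * of_real c)" for c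
      by (simp add: field_simps)
    ultimately show "1 / 2 + ?w \<theta>
      = of_real ((1 + \<sigma> * cos (2 * pi * (2 ^ p * \<theta> - a))) / 2)"
      by (simp only: t_def)
  qed
  finally show ?thesis .
qed

lemma cis_2pi_eq_1: "cis (2 * pi * x) = 1 \<longleftrightarrow> x \<in> \<int>"
proof
  assume "cis (2 * pi * x) = 1"
  then have "cos (2 * pi * x) = 1" by (simp add: complex_eq_iff)
  then obtain k :: int where "2 * pi * x = of_int k * 2 * pi" by (auto simp: cos_one_2pi_int)
  then have "x = of_int k" by simp
  then show "x \<in> \<int>" by simp
qed (auto elim: Ints_cases simp: cis_int_2pi)

text \<open>Only the frequencies divisible by the number of points survive the average over an equidistant grid.\<close>

lemma trig_average:
  assumes "trig D f" "N > 0" "real N * \<theta> \<in> \<int> \<or> D < int N"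
  shows "(\<Sum>r<N. f (\<theta> + real r / real N)) = (\<Sum>r<N. f (real r / real N))"
  using assms(1)
proof induction
  case (trig_cis k c)
  define z where "z = cis (2 * pi * (of_int k / real N))"
  have pw: "cis (2 * pi * (of_int k * (real r / real N))) = z ^ r" for r
    by (simp add: z_def Complex.DeMoivre mult_ac)
  have "cis (2 * pi * (of_int k * (\<theta> + real r / real N))) = cis (2 * pi * (of_int k * \<theta>)) * z ^ r" for r
    by (simp only: distrib_left cis_mult[symmetric] pw)
  then have "(\<Sum>r<N. c * cis (2 * pi * (of_int k * (\<theta> + real r / real N))))
      = (\<Sum>r<N. cis (2 * pi * (of_int k * \<theta>)) * (c * z ^ r))"
    by (simp only: mult.left_commute)
  also have "\<dots> = cis (2 * pi * (of_int k * \<theta>)) * (\<Sum>r<N. c * z ^ r)" by (rule sum_distrib_left[symmetric])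
  also have "\<dots> = (\<Sum>r<N. c * z ^ r)"
  proof (cases "z = 1")
    case True
    then obtain m :: int where m: "real_of_int k / real N = of_int m"
      unfolding z_def cis_2pi_eq_1 by (elim Ints_cases)
    then have k: "real_of_int k = of_int m * real N" using assms(2) by (simp add: field_simps)
    have "of_int k * \<theta> \<in> \<int>" using assms(3)
    proof
      assume "real N * \<theta> \<in> \<int>"
      then have "of_int m * (real N * \<theta>) \<in> \<int>" by (rule Ints_mult[OF Ints_of_int])
      then show ?thesis by (simp only: k mult.assoc)
    next
      assume "D < int N"
      from k have "real_of_int k = real_of_int (m * int N)" by simp
      then have "k = m * int N" by (simp only: of_int_eq_iff)
      then have "m = 0"
      proof (cases "m = 0")
        case False
        then have "1 * int N \<le> \<bar>m\<bar> * int N" by (intro mult_right_mono) auto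
        then show ?thesis using \<open>k = m * int N\<close> trig_cis \<open>D < int N\<close> by (simp add: abs_mult)
      qed
      then show ?thesis using k by simp
    qed
    then have "cis (2 * pi * (of_int k * \<theta>)) = 1" by (simp only: cis_2pi_eq_1)
    then show ?thesis by simp
  next
    case False
    have "z ^ N = cis (2 * pi * of_int k)" using pw[of N] assms(2) by simp
    then have "z ^ N = 1" by (simp add: cis_2pi_eq_1)
    then have "(\<Sum>r<N. z ^ r) = 0" using False by (simp add: geometric_sum)
    then show ?thesis by (simp add: sum_distrib_left[symmetric])
  qed
  finally show ?case by (simp only: pw)
next
  case (trig_add f h)
  then show ?case by (simp only: sum.distrib)
qed


text \<open>The constant 7/24 comes from \<open>cos (2 * pi * (7 / 24)) = - sin (pi / 12)\<close>,
  which is slightly below \<open>- 1/4\<close>; the half-angle formula reduces this to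
  \<open>sqrt 3 < 7 / 4\<close>.\<close>

lemma cos_near:
  assumes "cos (2 * pi * y) \<ge> - 1 / 4"
  obtains k :: int where "\<bar>y - of_int k\<bar> < 7 / 24"
proof -
  define z where "z = y - of_int (round y)"
  have z: "\<bar>z\<bar> \<le> 1 / 2" using of_int_round_abs_le[of y] by (simp add: z_def abs_minus_commute)
  have "cos (2 * pi * y) = cos (2 * pi * z)"
  proof -
    have "2 * pi * y = 2 * pi * z + 2 * pi * of_int (round y)"
      by (simp add: z_def right_diff_distrib)
    then show ?thesis by (simp only: cos_add cos_int_2pin sin_int_2pin mult_1_right mult_zero_right diff_zero)
  qed
  also have "\<dots> = cos (2 * pi * \<bar>z\<bar>)" using cos_abs_real[of "2 * pi * z"] by (simp add: abs_mult)
  finally have c: "cos (2 * pi * \<bar>z\<bar>) \<ge> - 1 / 4" using assms by simp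
  have "\<bar>z\<bar> < 7 / 24"
  proof (rule ccontr)
    assume "\<not> \<bar>z\<bar> < 7 / 24"
    then have 1: "cos (2 * pi * \<bar>z\<bar>) \<le> cos (2 * pi * (7 / 24))"
      using z by (intro cos_monotone_0_pi_le mult_left_mono) (auto simp: field_simps)
    have "cos (2 * pi * (7 / 24)) = cos (pi / 12 + pi / 2)" by (rule arg_cong[where f = cos]) simp
    also have "\<dots> = - sin (pi / 12)" by (simp only: cos_add cos_pi_half sin_pi_half mult_zero_right mult_1_right diff_0)
    finally have 2: "cos (2 * pi * (7 / 24)) = - sin (pi / 12)" .
    have "sqrt 3 < 7 / 4" by (rule real_less_lsqrt) (simp_all add: power2_eq_square)
    moreover have "cos (pi / 6) = 1 - 2 * (sin (pi / 12))\<^sup>2"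
      using cos_double_sin[of "pi / 12"] by simp
    ultimately have "(1 / 4)\<^sup>2 < (sin (pi / 12))\<^sup>2"
      by (simp add: cos_30 power2_eq_square)
    moreover have "sin (pi / 12) \<ge> 0" by (rule sin_ge_zero) auto
    ultimately have "1 / 4 < sin (pi / 12)" by (rule power_less_imp_less_base)
    then show False using 1 2 c by simp
  qed
  then show ?thesis using that[of "round y"] by (simp add: z_def)
qed

text \<open>Each bit confines \<open>\<phi>\<close> modulo 1 to an arc of radius 7/24, centred an
  eighth before or after a multiple of 1/2. The two centres are 1/4 apart, so the arcs meet in an
  arc around the quarter value of radius \<open>7/24 - 1/8 = 1/6\<close>.\<close>

lemma quarter_near:
  fixes m0 m1 :: bool
  assumes "(if m0 then cos (2 * pi * (\<phi> + 1 / 8)) \<le> 1 / 4 else cos (2 * pi * (\<phi> + 1 / 8)) \<ge> - 1 / 4)"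
    "(if m1 then cos (2 * pi * (\<phi> - 1 / 8)) \<le> 1 / 4 else cos (2 * pi * (\<phi> - 1 / 8)) \<ge> - 1 / 4)"
  obtains k :: int where "\<bar>\<phi> - of_int k - of_int (quarter (of_bool m0 + 2 * of_bool m1)) / 4\<bar> < 1 / 6"
proof -
  have *: "\<exists>k::int. \<bar>y - of_bool m / 2 - of_int k\<bar> < 7 / 24"
    if "if m then cos (2 * pi * y) \<le> 1 / 4 else cos (2 * pi * y) \<ge> - 1 / 4" for m y
  proof (cases m)
    case True
    have "cos (2 * pi * (y - 1 / 2)) = cos (2 * pi * y - pi)" by (simp add: algebra_simps)
    also have "\<dots> = - cos (2 * pi * y)" by simp
    finally have "cos (2 * pi * (y - 1 / 2)) \<ge> - 1 / 4" using that True by simp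
    then obtain k :: int where "\<bar>y - 1 / 2 - of_int k\<bar> < 7 / 24" by (rule cos_near)
    then show ?thesis using True by auto
  next
    case False
    then have "cos (2 * pi * y) \<ge> - 1 / 4" using that by simp
    then obtain k :: int where "\<bar>y - of_int k\<bar> < 7 / 24" by (rule cos_near)
    then show ?thesis using False by auto
  qed
  obtain k :: int where k: "\<bar>\<phi> + 1 / 8 - of_bool m0 / 2 - of_int k\<bar> < 7 / 24" using *[OF assms(1)] by blast
  obtain l :: int where l: "\<bar>\<phi> - 1 / 8 - of_bool m1 / 2 - of_int l\<bar> < 7 / 24" using *[OF assms(2)] by blast
  define d where "d = k - l"
  have d: "of_int k = of_int l + real_of_int d" by (simp add: d_def)
  show ?thesis
  proof (cases m0; cases m1)
    assume m: "m0" "m1"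
    from k l m have "-1 < real_of_int d" "real_of_int d < 1" unfolding d abs_less_iff by simp_all
    then have "d = 0" by linarith
    then show ?thesis using that[of l] k l m unfolding d abs_less_iff by (simp add: quarter_def)
  next
    assume m: "m0" "\<not> m1"
    from k l m have "-1 < real_of_int d" "real_of_int d < 1" unfolding d abs_less_iff by simp_all
    then have "d = 0" by linarith
    then show ?thesis using that[of l] k l m unfolding d abs_less_iff by (simp add: quarter_def)
  next
    assume m: "\<not> m0" "m1"
    from k l m have "0 < real_of_int d" "real_of_int d < 2" unfolding d abs_less_iff by simp_all
    then have "d = 1" by linarith
    then show ?thesis using that[of l] k l m unfolding d abs_less_iff by (simp add: quarter_def)
  next
    assume m: "\<not> m0" "\<not> m1"
    from k l m have "-1 < real_of_int d" "real_of_int d < 1" unfolding d abs_less_iff by simp_all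
    then have "d = 0" by linarith
    then show ?thesis using that[of l] k l m unfolding d abs_less_iff by (simp add: quarter_def)
  qed
qed

text \<open>The strict bound $1/6$ makes $|a' - 2a| < 2$ for consecutive quarter values $a, a'$, and that is
  exactly what rounding in the digit recovers.\<close>

lemma digit_eq:
  fixes A A' n n' :: int and \<phi> :: real
  assumes "\<bar>\<phi> - of_int n - of_int A / 4\<bar> < 1 / 6" "\<bar>2 * \<phi> - of_int n' - of_int A' / 4\<bar> < 1 / 6"
  shows "(2 * A - A' + 2) div 4 = n' - 2 * n"
proof -
  define \<kappa> where "\<kappa> = A' + 4 * n' - 2 * (A + 4 * n)"
  have "real_of_int \<kappa> = of_int A' + 4 * of_int n' - 2 * of_int A - 8 * of_int n" by (simp add: \<kappa>_def)
  then have "- 2 < real_of_int \<kappa>" "real_of_int \<kappa> < 2" using assms unfolding abs_less_iff by - linarith+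
  then have "- 2 < \<kappa>" "\<kappa> < 2" by linarith+
  moreover have "2 * A - A' + 2 = (2 - \<kappa>) + 4 * (n' - 2 * n)" by (simp add: \<kappa>_def)
  ultimately show ?thesis by simp
qed

text \<open>Doubling turns the error 1/6 into 1/3, and rounding half a quarter value adds at most
  1/2. That the total 5/6 is below 1 makes the estimate exact on a grid.\<close>

lemma digit_last:
  fixes n :: int and v :: nat and \<phi> :: real
  assumes "\<bar>\<phi> - of_int n - of_int (quarter (v div 4)) / 4\<bar> < 1 / 6" "v mod 4 = 0"
  shows "\<bar>2 * \<phi> - of_int (2 * n + digit v)\<bar> < 5 / 6"
proof -
  define A where "A = quarter (v div 4)"
  have A: "A = 0 \<or> A = 1 \<or> A = 2 \<or> A = 3" by (simp add: A_def quarter_def)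
  have "digit v = (2 * A + 2) div 4" using assms(2) by (simp add: digit_def A_def quarter_def[of 0])
  moreover have "- 1 / 6 < \<phi> - of_int n - of_int A / 4" "\<phi> - of_int n - of_int A / 4 < 1 / 6"
    using assms(1) unfolding A_def by - linarith+
  ultimately have "- 5 / 6 < 2 * \<phi> - of_int (2 * n + digit v)" "2 * \<phi> - of_int (2 * n + digit v) < 5 / 6"
    using A by auto
  then show ?thesis by linarith
qed


section \<open>The verification kernel and the weight of a wrong majority\<close>

lemma cmod_half_cis: "(cmod ((1 + (if u then - 1 else 1) * cis t) / 2))\<^sup>2 = (1 + (if u then - 1 else 1) * cos t) / 2"
proof -
  have "(cmod (1 + of_real s * cis t))\<^sup>2 = 2 + 2 * s * cos t" if "s * s = 1" for s :: real
  proof -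
    have "(cmod (1 + of_real s * cis t))\<^sup>2 = 1 + 2 * s * cos t + s * s * ((sin t)\<^sup>2 + (cos t)\<^sup>2)"
    proof -
      have "(cmod (1 + of_real s * cis t))\<^sup>2 = (1 + s * cos t)\<^sup>2 + (s * sin t)\<^sup>2" by (simp add: cmod_power2)
      then show ?thesis by algebra
    qed
    then show ?thesis using that by simp
  qed
  from this[of 1] this[of "- 1"] show ?thesis
    by (cases u) (simp_all add: norm_divide power_divide)
qed

text \<open>Repeated use of \<open>sin (2 * t) = 2 * sin t * cos t\<close>. The product is the
  normalised Fejer kernel of order \<open>2 ^ L\<close>; stated without a quotient, it also holds
  where the sine vanishes.\<close>

lemma prod_cos_double:
  "(\<Prod>i<L. (cos (pi * (2 ^ i * \<delta>)))\<^sup>2) * (2 ^ L * sin (pi * \<delta>))\<^sup>2 = (sin (pi * (2 ^ L * \<delta>)))\<^sup>2"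
proof (induction L)
  case (Suc L)
  have "(\<Prod>i<Suc L. (cos (pi * (2 ^ i * \<delta>)))\<^sup>2) * (2 ^ Suc L * sin (pi * \<delta>))\<^sup>2
      = ((\<Prod>i<L. (cos (pi * (2 ^ i * \<delta>)))\<^sup>2) * (2 ^ L * sin (pi * \<delta>))\<^sup>2) * (2 * cos (pi * (2 ^ L * \<delta>)))\<^sup>2"
    by (simp add: power_mult_distrib)
  also have "\<dots> = (2 * sin (pi * (2 ^ L * \<delta>)) * cos (pi * (2 ^ L * \<delta>)))\<^sup>2"
    unfolding Suc.IH by (simp add: power_mult_distrib)
  also have "\<dots> = (sin (2 * (pi * (2 ^ L * \<delta>))))\<^sup>2" by (simp only: sin_double)
  finally show ?case by (simp add: mult_ac)
qed simp

lemma sin_int_shift: "(sin (pi * (x + of_int k)))\<^sup>2 = (sin (pi * x))\<^sup>2"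
proof -
  have "sin (pi * (x + of_int k)) = sin (pi * x) * cos (pi * of_int k)"
    by (simp only: distrib_left sin_add sin_npi_int mult_zero_right add_0_right)
  moreover have "(cos (pi * of_int k))\<^sup>2 = 1"
    using sin_cos_squared_add[of "pi * of_int k"] by simp
  ultimately show ?thesis by (simp add: power_mult_distrib)
qed

text \<open>After reduction to distance at most 1/2 from an integer, the cubic Taylor bound on
  \<open>[0, 2]\<close> gives \<open>sin y \<ge> y / 3\<close>, and \<open>y\<close> is at least
  twice the distance.\<close>

lemma sin_far:
  assumes "0 < \<eta>" "\<And>k::int. \<eta> \<le> \<bar>\<delta> - of_int k\<bar>"
  shows "\<eta> / 2 \<le> \<bar>sin (pi * \<delta>)\<bar>"
proof -
  define z where "z = \<delta> - of_int (round \<delta>)"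
  have z: "\<bar>z\<bar> \<le> 1 / 2" using of_int_round_abs_le[of \<delta>] by (simp add: z_def abs_minus_commute)
  have e: "\<eta> \<le> \<bar>z\<bar>" using assms(2)[of "round \<delta>"] by (simp add: z_def)
  have "(sin (pi * \<delta>))\<^sup>2 = (sin (pi * z))\<^sup>2"
    using sin_int_shift[of z "round \<delta>"] by (simp add: z_def)
  then have 1: "\<bar>sin (pi * \<delta>)\<bar> = \<bar>sin (pi * z)\<bar>" by (simp add: power2_eq_iff abs_eq_iff)
  have 2: "\<bar>sin (pi * z)\<bar> = sin (pi * \<bar>z\<bar>)"
  proof (cases "z \<ge> 0")
    case True
    then have "sin (pi * z) \<ge> 0" using z by (intro sin_ge_zero) (auto simp: mult_le_cancel_left1)
    then show ?thesis using True by simp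
  next
    case False
    then have "sin (pi * (- z)) \<ge> 0" using z mult_left_mono[of "- z" 1 pi] mult_left_mono[of 0 "- z" pi]
      by (intro sin_ge_zero) auto
    then show ?thesis using False by simp
  qed
  define y where "y = pi * \<bar>z\<bar>"
  have "y \<le> 4 * (1 / 2)" unfolding y_def using z pi_less_4 by (intro mult_mono) auto
  then have y: "0 \<le> y" "y \<le> 2" by (auto simp: y_def)
  have "\<bar>sin y - (\<Sum>m<3. sin_coeff m * y ^ m)\<bar> \<le> inverse (fact 3) * \<bar>y\<bar> ^ 3" by (rule Maclaurin_sin_bound)
  then have "\<bar>sin y - y\<bar> \<le> y ^ 3 / 6"
    using y by (simp add: sin_coeff_def eval_nat_numeral)
  then have "sin y \<ge> y - y ^ 3 / 6" by linarith
  moreover have "y ^ 3 \<le> 4 * y"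
  proof -
    have "y * y \<le> 2 * 2" using y by (intro mult_mono) auto
    then have "(y * y) * y \<le> 4 * y" using y by (intro mult_right_mono) auto
    then show ?thesis by (simp add: power3_eq_cube)
  qed
  moreover have "2 * \<bar>z\<bar> \<le> y" unfolding y_def using pi_ge_two by (intro mult_right_mono) auto
  ultimately have "sin y \<ge> 2 / 3 * \<bar>z\<bar>" by linarith
  then show ?thesis using 1 2 e by (simp add: y_def)
qed

text \<open>The product is \<open>5/4\<close> to the excess of set over unset bits. It bounds the
  indicator of a wrong majority by a product over the samples, as in the proof of a Chernoff
  bound.\<close>

lemma majority_weight:
  assumes "finite S" "card S \<le> 2 * card {q \<in> S. c q}"
  shows "1 \<le> (\<Prod>q\<in>S. if c q then 5 / 4 else 4 / 5 :: real)"
proof -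
  define a b where "a = card {q \<in> S. c q}" and "b = card {q \<in> S. \<not> c q}"
  have "card S = a + b"
    unfolding a_def b_def using assms(1) by (subst card_Un_disjoint[symmetric]) (auto intro: arg_cong[of _ _ card])
  then have "b \<le> a" using assms(2) by (simp add: a_def)
  have "(\<Prod>q\<in>S. if c q then 5 / 4 else 4 / 5 :: real) = (5 / 4) ^ a * (4 / 5) ^ b"
    using assms(1) by (simp add: prod.If_cases a_def b_def Int_def conj_commute)
  also have "\<dots> = (5 / 4) ^ (a - b) * ((5 / 4) ^ b * (4 / 5) ^ b)"
    using \<open>b \<le> a\<close> by (simp add: power_add[symmetric] mult.assoc[symmetric])
  also have "\<dots> = (5 / 4) ^ (a - b)" by (simp add: power_mult_distrib[symmetric])
  finally show ?thesis by simp
qed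

subsection \<open>Completeness and soundness of a window\<close>

definition far :: "nat \<Rightarrow> real \<Rightarrow> bool" where
  "far m \<delta> \<longleftrightarrow> (\<forall>k::int. 1 / 2 ^ m < \<bar>\<delta> - of_int k\<bar>)"

context window
begin

definition pr :: "real \<Rightarrow> nat \<Rightarrow> bool \<Rightarrow> real" where
  "pr \<theta> q u = (1 + (if u then - 1 else 1) * cos (2 * pi * (2 ^ pos q * \<theta> - shift_angle (kd q - 3)))) / 2"

definition maj :: "(nat \<Rightarrow> bool) \<Rightarrow> nat \<Rightarrow> nat \<Rightarrow> bool" where
  "maj c \<tau> i = parity_tests (mtests (nm (6 + \<tau>) i 0)) c"

definition quart :: "(nat \<Rightarrow> bool) \<Rightarrow> nat \<Rightarrow> nat" where
  "quart c i = (if i < Ld then of_bool (maj c 0 i) + 2 * of_bool (maj c 1 i) else 0)"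

text \<open>A nearly fair coin may show either majority: both bits are accepted when the bias is at
  most 1/4 in modulus. Only a clearly biased coin can fail, and its failure probability is
  exponentially small in the number of samples.\<close>

definition good :: "real \<Rightarrow> (nat \<Rightarrow> bool) \<Rightarrow> nat \<Rightarrow> nat \<Rightarrow> bool" where
  "good \<theta> c \<tau> i = (let x = cos (2 * pi * (2 ^ i * \<theta> - shift_angle \<tau>)) in if maj c \<tau> i then x \<le> 1 / 4 else x \<ge> - 1 / 4)"

lemma pc_pr: "pc \<theta> c = (\<Prod>q\<in>CQ. pr \<theta> q (c q))"
  unfolding pc_def pr_def samp_def cmod_half_cis ..

lemma pr_nonneg: "pr \<theta> q u \<ge> 0"
proof -
  have "- 1 \<le> cos x" "cos x \<le> 1" for x :: real by simp_all
  from this[of "2 * pi * (2 ^ pos q * \<theta> - shift_angle (kd q - 3))"] show ?thesis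
    unfolding pr_def by (cases u) (simp_all del: cos_ge_minus_one cos_le_one)
qed

lemma pr_sum: "pr \<theta> q False + pr \<theta> q True = 1"
  by (simp add: pr_def add_divide_distrib[symmetric])

lemma pc_nonneg: "pc \<theta> c \<ge> 0"
  unfolding pc_pr by (intro prod_nonneg) (simp add: pr_nonneg)

lemma sum_pc: "(\<Sum>c\<in>asg CQ. pc \<theta> c) = 1"
  unfolding pc_pr by (subst sum_asg_prod) (simp_all add: pr_sum)

lemma vr_cos: "vr \<delta> = (\<Prod>i<Lv. (cos (pi * (2 ^ i * \<delta>)))\<^sup>2)"
proof -
  have "vr \<delta> = (\<Prod>q\<in>VQ. (cos (pi * (2 ^ pos q * \<delta>)))\<^sup>2)"
    unfolding vr_def
  proof (rule prod.cong[OF refl])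
    fix q
    have "(cmod (ver \<delta> q False))\<^sup>2 = (1 + cos (2 * (pi * (2 ^ pos q * \<delta>)))) / 2"
      unfolding ver_def cmod_half_cis by (simp add: mult.assoc)
    also have "\<dots> = (cos (pi * (2 ^ pos q * \<delta>)))\<^sup>2"
      unfolding cos_double_cos by simp
    finally show "(cmod (ver \<delta> q False))\<^sup>2 = (cos (pi * (2 ^ pos q * \<delta>)))\<^sup>2" .
  qed
  also have "\<dots> = (\<Prod>i<Lv. (cos (pi * (2 ^ i * \<delta>)))\<^sup>2)"
    unfolding VQ_def by (subst prod.reindex) (auto simp: inj_on_def)
  finally show ?thesis .
qed

lemma vr_bounds: "0 \<le> vr \<delta>" "vr \<delta> \<le> 1"
  unfolding vr_cos by (auto intro!: prod_nonneg prod_le_1 simp: abs_square_le_1)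

lemma vr_sin: "vr \<delta> * (2 ^ Lv * sin (pi * \<delta>))\<^sup>2 = (sin (pi * (2 ^ Lv * \<delta>)))\<^sup>2"
  unfolding vr_cos by (rule prod_cos_double)

text \<open>By \<open>vr_sin\<close> the kernel is at most
  \<open>1 / (2 ^ Lv * sin (pi * \<delta>)) ^ 2\<close>, and the sine is at least
  \<open>1 / 2 ^ (m + 1)\<close> in modulus.\<close>

lemma vr_far:
  assumes "\<And>k::int. 1 / 2 ^ m \<le> \<bar>\<delta> - of_int k\<bar>"
  shows "vr \<delta> \<le> 4 ^ (m + 1) / 4 ^ Lv"
proof -
  have "1 / 2 ^ m / 2 \<le> \<bar>sin (pi * \<delta>)\<bar>" using assms by (intro sin_far) auto
  then have "(1 / 2 ^ (m + 1))\<^sup>2 \<le> (sin (pi * \<delta>))\<^sup>2"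
    by (intro iffD1[OF abs_le_square_iff]) simp
  then have s: "1 / 4 ^ (m + 1) \<le> (sin (pi * \<delta>))\<^sup>2"
    by (simp add: power_one_over power_even_eq[symmetric] power_mult[symmetric] mult.commute[of _ 2] power_mult)
  have "vr \<delta> * (4 ^ Lv * (1 / 4 ^ (m + 1))) \<le> vr \<delta> * (4 ^ Lv * (sin (pi * \<delta>))\<^sup>2)"
    using s vr_bounds by (intro mult_left_mono) auto
  also have "\<dots> = vr \<delta> * (2 ^ Lv * sin (pi * \<delta>))\<^sup>2"
    by (simp add: power_mult_distrib power_mult[symmetric] mult.commute[of _ 2] power_mult)
  also have "\<dots> \<le> 1" unfolding vr_sin by (simp add: abs_square_le_1)
  finally show ?thesis by (simp add: field_simps)
qed

text \<open>The Fejer kernel vanishes at all nonintegral points of its own grid. This is why the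
  case of few bits has no wrong branch.\<close>

lemma vr_zero:
  assumes "2 ^ Lv * \<delta> \<in> \<int>" "\<delta> \<notin> \<int>"
  shows "vr \<delta> = 0"
proof -
  have "sin (pi * (2 ^ Lv * \<delta>)) = 0" using assms(1) by (auto elim!: Ints_cases)
  moreover have "sin (pi * \<delta>) \<noteq> 0"
  proof
    assume "sin (pi * \<delta>) = 0"
    then obtain k :: int where "pi * \<delta> = of_int k * pi" by (auto simp: sin_zero_iff_int2)
    then have "\<delta> = of_int k" by simp
    then show False using assms(2) by simp
  qed
  ultimately show ?thesis using vr_sin[of \<delta>] by simp
qed

text \<open>Writing each squared cosine as \<open>1 - x i\<close>, the product is at least one minus
  the sum of the \<open>x i\<close>. These are at most \<open>16 * 4 ^ i / 4 ^ Ld\<close>, so three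
  more estimated than verified positions bring the sum down to 1/12.\<close>

lemma vr_near:
  assumes "Lv + 3 \<le> Ld" "\<bar>e\<bar> < 5 / 6"
  shows "vr (of_int k + e / 2 ^ Ld) \<ge> 1 / 2"
proof -
  define x where "x i = (sin (pi * (2 ^ i * (of_int k + e / 2 ^ Ld))))\<^sup>2" for i
  have x1: "x i \<le> 1" "0 \<le> x i" for i by (simp_all add: x_def abs_square_le_1)
  have xb: "x i \<le> 16 * 4 ^ i / 4 ^ Ld" for i
  proof -
    have "x i = (sin (pi * (2 ^ i * (e / 2 ^ Ld))))\<^sup>2"
      using sin_int_shift[of "2 ^ i * (e / 2 ^ Ld)" "2 ^ i * k"] by (simp add: x_def distrib_left add.commute)
    also have "\<dots> \<le> (pi * (2 ^ i * (e / 2 ^ Ld)))\<^sup>2"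
      using abs_sin_x_le_abs_x by (intro iffD1[OF abs_le_square_iff])
    also have "\<dots> = (pi * e)\<^sup>2 * (4 ^ i / 4 ^ Ld)"
      by (simp add: power_mult_distrib power_divide power_mult[symmetric] mult.commute[of _ 2] power_mult)
    also have "\<dots> \<le> 4\<^sup>2 * (4 ^ i / 4 ^ Ld)"
    proof (intro mult_right_mono)
      have "\<bar>pi * e\<bar> \<le> 4 * 1" unfolding abs_mult using assms(2) pi_less_4 by (intro mult_mono) auto
      then show "(pi * e)\<^sup>2 \<le> 4\<^sup>2" by (intro iffD1[OF abs_le_square_iff]) simp
    qed simp
    finally show ?thesis by simp
  qed
  have "1 - (\<Sum>i<n. x i) \<le> (\<Prod>i<n. 1 - x i)" for n
  proof (induction n)
    case (Suc n)
    have "1 - (\<Sum>i<Suc n. x i) \<le> (1 - (\<Sum>i<n. x i)) * (1 - x n)"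
      using x1 by (simp add: algebra_simps sum_nonneg)
    also have "\<dots> \<le> (\<Prod>i<n. 1 - x i) * (1 - x n)" using Suc x1 by (intro mult_right_mono) auto
    finally show ?case by simp
  qed simp
  moreover have "(\<Prod>i<Lv. 1 - x i) = vr (of_int k + e / 2 ^ Ld)"
    unfolding vr_cos x_def by (simp add: cos_squared_eq)
  moreover have "(\<Sum>i<Lv. x i) \<le> 1 / 2"
  proof -
    have "(\<Sum>i<Lv. x i) \<le> (\<Sum>i<Lv. 16 / 4 ^ Ld * 4 ^ i)" by (rule sum_mono) (use xb in simp)
    also have "\<dots> = 16 / 4 ^ Ld * ((4 ^ Lv - 1) / 3)"
      unfolding sum_distrib_left[symmetric] by (simp add: geometric_sum)
    also have "\<dots> \<le> 16 / 4 ^ Ld * (4 ^ Lv / 3)" by (intro mult_left_mono) auto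
    also have "\<dots> \<le> 16 / 4 ^ (Lv + 3) * (4 ^ Lv / 3)"
      using assms(1) by (intro mult_right_mono divide_left_mono power_increasing) auto
    also have "\<dots> \<le> 1 / 2" by (simp add: power_add)
    finally show ?thesis .
  qed
  ultimately show ?thesis by (metis diff_left_mono field_sum_of_halves add_diff_cancel_right' order_trans)
qed

lemma vr_int: "vr (of_int k) = 1"
proof -
  have "(cos (pi * (2 ^ i * real_of_int k)))\<^sup>2 = 1" for i
    using sin_int_shift[of 0 "2 ^ i * k"] sin_cos_squared_add[of "pi * (2 ^ i * real_of_int k)"] by simp
  then show ?thesis by (simp add: vr_cos)
qed

lemma maj_iff:
  assumes "\<tau> < 2"
  shows "maj c \<tau> i \<longleftrightarrow> 2 ^ g < 2 * card {q \<in> CG \<tau> i. c q}"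
proof -
  let ?n = "card {q \<in> CG \<tau> i. c q}"
  have "?n \<le> card (CG \<tau> i)" by (intro card_mono) auto
  also have "\<dots> = 2 ^ g" unfolding CG_def by (subst card_image) (auto simp: inj_on_def)
  finally have n: "?n \<le> 2 ^ g" .
  have "wsum (wlist (CG \<tau> i) (\<lambda>_. 1)) c = int ?n"
    unfolding wsum_wlist[OF fin(8)] by (simp add: of_bool_def sum.If_cases Int_def)
  moreover have "int ?n mod 2 ^ (g + 1) = int ?n"
  proof (rule mod_pos_pos_trivial)
    have "?n < 2 ^ (g + 1)" using n by (rule le_less_trans) simp
    then have "int ?n < int (2 ^ (g + 1))" by (simp only: of_nat_less_iff)
    then show "int ?n < 2 ^ (g + 1)" by simp
  qed simp
  ultimately show ?thesis
    using assms unfolding maj_def mtests_def parity_value_tests by simp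
qed

text \<open>Exponential Markov inequality. With bias above 1/4 the likely value has probability
  above 5/8. Weighting it by 4/5 and the other value by 5/4 gives an expected weight of at most
  \<open>4/5 * 5/8 + 5/4 * 3/8 = 31/32\<close> per sample.\<close>

lemma prob_not_good:
  assumes "\<tau> < 2" "i < Ld"
  shows "(\<Sum>c\<in>asg CQ. of_bool (\<not> good \<theta> c \<tau> i) * pc \<theta> c) \<le> (31 / 32) ^ 2 ^ g"
proof -
  define x where "x = cos (2 * pi * (2 ^ i * \<theta> - shift_angle \<tau>))"
  have sub: "CG \<tau> i \<subseteq> CQ" using assms by (auto simp: CQ_def)
  have cardCG: "card (CG \<tau> i) = 2 ^ g" unfolding CG_def by (subst card_image) (auto simp: inj_on_def)
  have prx: "pr \<theta> q u = (1 + (if u then - 1 else 1) * x) / 2" if "q \<in> CG \<tau> i" for q u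
    using that by (auto simp: pr_def x_def CG_def)
  have main: "(\<Sum>c\<in>asg CQ. of_bool (\<not> good \<theta> c \<tau> i) * pc \<theta> c) \<le> (31 / 32) ^ 2 ^ g"
    if v: "v \<longleftrightarrow> x < 0" "\<bar>x\<bar> > 1 / 4" for v
  proof -
    \<comment> \<open>\<open>v\<close> is the likely value of a sample, so a wrong majority collects
      weight at least 1.\<close>
    define w where "w u = (if u = v then 4 / 5 else 5 / 4 :: real)" for u
    have bad: "of_bool (\<not> good \<theta> c \<tau> i) \<le> (\<Prod>q\<in>CG \<tau> i. w (c q))" for c
    proof (cases "good \<theta> c \<tau> i")
      case True
      have "0 \<le> (\<Prod>q\<in>CG \<tau> i. w (c q))" by (intro prod_nonneg) (simp add: w_def)
      then show ?thesis using True by simp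
    next
      case False
      then have m: "maj c \<tau> i = (\<not> v)" using v unfolding good_def x_def[symmetric] Let_def
        by (cases v) (auto split: if_splits)
      have split: "card (CG \<tau> i) = card {q \<in> CG \<tau> i. c q} + card {q \<in> CG \<tau> i. \<not> c q}"
        by (subst card_Un_disjoint[symmetric]) (auto intro: arg_cong[of _ _ card])
      have "card (CG \<tau> i) \<le> 2 * card {q \<in> CG \<tau> i. c q \<noteq> v}"
        using m split cardCG unfolding maj_iff[OF assms(1)] by (cases v) auto
      from majority_weight[OF fin(8) this]
      have "1 \<le> (\<Prod>q\<in>CG \<tau> i. if c q \<noteq> v then 5 / 4 else 4 / 5 :: real)" .
      also have "\<dots> = (\<Prod>q\<in>CG \<tau> i. w (c q))" by (rule prod.cong) (auto simp: w_def)
      finally show ?thesis by simp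
    qed
    have "(\<Sum>c\<in>asg CQ. of_bool (\<not> good \<theta> c \<tau> i) * pc \<theta> c)
        \<le> (\<Sum>c\<in>asg CQ. \<Prod>q\<in>CQ. (if q \<in> CG \<tau> i then w (c q) else 1) * pr \<theta> q (c q))"
    proof (rule sum_mono)
      fix c
      have "(\<Prod>q\<in>CQ. (if q \<in> CG \<tau> i then w (c q) else 1)) = (\<Prod>q\<in>CG \<tau> i. w (c q))"
        using sub by (subst prod.inter_restrict[symmetric]) (auto simp: Int_absorb1)
      then show "of_bool (\<not> good \<theta> c \<tau> i) * pc \<theta> c \<le> (\<Prod>q\<in>CQ. (if q \<in> CG \<tau> i then w (c q) else 1) * pr \<theta> q (c q))"
        unfolding prod.distrib pc_pr[symmetric] using bad[of c] pc_nonneg[of \<theta> c] by (simp only: mult_right_mono)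
    qed
    also have "\<dots> = (\<Prod>q\<in>CQ. (if q \<in> CG \<tau> i then w False else 1) * pr \<theta> q False + (if q \<in> CG \<tau> i then w True else 1) * pr \<theta> q True)"
      by (rule sum_asg_prod) simp
    also have "\<dots> = (\<Prod>q\<in>CQ. if q \<in> CG \<tau> i then w False * pr \<theta> q False + w True * pr \<theta> q True else 1)"
      by (intro prod.cong refl) (simp add: pr_sum)
    also have "\<dots> = (\<Prod>q\<in>CG \<tau> i. w False * pr \<theta> q False + w True * pr \<theta> q True)"
      using sub by (subst prod.inter_restrict[symmetric]) (auto simp: Int_absorb1)
    also have "\<dots> \<le> (\<Prod>q\<in>CG \<tau> i. 31 / 32)"
    proof (rule prod_mono, intro conjI)
      fix q assume "q \<in> CG \<tau> i"
      then show "w False * pr \<theta> q False + w True * pr \<theta> q True \<le> 31 / 32"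
        using v by (cases v) (simp_all add: prx w_def field_simps)
      show "0 \<le> w False * pr \<theta> q False + w True * pr \<theta> q True"
        using pr_nonneg by (intro add_nonneg_nonneg mult_nonneg_nonneg) (simp_all add: w_def)
    qed
    finally show ?thesis by (simp add: cardCG)
  qed
  show ?thesis
  proof (cases "\<bar>x\<bar> > 1 / 4")
    case True
    then show ?thesis using main[of "x < 0"] by simp
  next
    case False
    then have "good \<theta> c \<tau> i" for c unfolding good_def x_def[symmetric] Let_def by auto
    then show ?thesis by simp
  qed
qed

lemma prob_some_not_good:
  "(\<Sum>c\<in>asg CQ. of_bool (\<not> (\<forall>\<tau><2. \<forall>i<Ld. good \<theta> c \<tau> i)) * pc \<theta> c) \<le> 2 * real Ld * (31 / 32) ^ 2 ^ g"
proof -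
  have "(\<Sum>c\<in>asg CQ. of_bool (\<not> (\<forall>\<tau><2. \<forall>i<Ld. good \<theta> c \<tau> i)) * pc \<theta> c)
      \<le> (\<Sum>c\<in>asg CQ. \<Sum>\<tau><2. \<Sum>i<Ld. of_bool (\<not> good \<theta> c \<tau> i) * pc \<theta> c)"
  proof (rule sum_mono)
    fix c
    show "of_bool (\<not> (\<forall>\<tau><2. \<forall>i<Ld. good \<theta> c \<tau> i)) * pc \<theta> c \<le> (\<Sum>\<tau><2. \<Sum>i<Ld. of_bool (\<not> good \<theta> c \<tau> i) * pc \<theta> c)"
    proof (cases "\<forall>\<tau><2. \<forall>i<Ld. good \<theta> c \<tau> i")
      case True
      have "0 \<le> (\<Sum>\<tau><2. \<Sum>i<Ld. of_bool (\<not> good \<theta> c \<tau> i) * pc \<theta> c)"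
        by (intro sum_nonneg mult_nonneg_nonneg) (simp_all add: pc_nonneg)
      then show ?thesis using True by simp
    next
      case False
      then obtain \<tau> i where ti: "\<tau> < 2" "i < Ld" "\<not> good \<theta> c \<tau> i" by blast
      have "pc \<theta> c = of_bool (\<not> good \<theta> c \<tau> i) * pc \<theta> c" using ti by simp
      also have "\<dots> \<le> (\<Sum>i<Ld. of_bool (\<not> good \<theta> c \<tau> i) * pc \<theta> c)"
        using ti by (intro member_le_sum) (simp_all add: pc_nonneg)
      also have "\<dots> \<le> (\<Sum>\<tau><2. \<Sum>i<Ld. of_bool (\<not> good \<theta> c \<tau> i) * pc \<theta> c)"
        using ti by (intro member_le_sum[where f = "\<lambda>\<tau>. \<Sum>i<Ld. of_bool (\<not> good \<theta> c \<tau> i) * pc \<theta> c"])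
          (auto intro!: sum_nonneg mult_nonneg_nonneg simp: pc_nonneg)
      finally show ?thesis using False by simp
    qed
  qed
  also have "\<dots> = (\<Sum>\<tau><2. \<Sum>i<Ld. \<Sum>c\<in>asg CQ. of_bool (\<not> good \<theta> c \<tau> i) * pc \<theta> c)"
    by (simp only: sum.swap[of _ _ "asg CQ"])
  also have "\<dots> \<le> (\<Sum>\<tau><2::nat. \<Sum>i<Ld. (31 / 32) ^ 2 ^ g)"
    by (intro sum_mono prob_not_good) auto
  finally show ?thesis by simp
qed

lemma digit_bits: "2 * of_bool (bit (nat (digit v + 1)) 1) + of_bool (bit (nat (digit v + 1)) 0) - 1 = digit v"
proof -
  have q: "0 \<le> quarter y" "quarter y \<le> 3" for y by (simp_all add: quarter_def)
  have "- 1 \<le> digit v" "digit v \<le> 2"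
    unfolding digit_def using q[of "v div 4"] q[of "v mod 4"] by linarith+
  then have "digit v = - 1 \<or> digit v = 0 \<or> digit v = 1 \<or> digit v = 2" by linarith
  then show ?thesis by (elim disjE) (simp_all add: bit_iff_odd nat_add_distrib numeral_3_eq_3[symmetric])
qed

lemma quart_less: "quart c i < 4"
  by (simp add: quart_def)

lemma vf_digit: "vf c = (\<Sum>k<Ld. real_of_int (digit (4 * quart c k + quart c (Suc k))) / 2 ^ Suc k)"
  unfolding vf_def vfrac_def
proof (rule sum.cong[OF refl])
  fix k assume "k \<in> {..<Ld}"
  then have k: "k < Ld" by simp
  let ?m = "\<lambda>p. p \<in> MQ \<and> parity_tests (mtests p) c"
  have m: "?m (nm 6 i 0) = maj c 0 i" "?m (nm 7 i 0) = maj c 1 i" if "i < Ld" for i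
    using MQ_mem[OF that] by (simp_all add: maj_def)
  define y where "y = 4 * quart c k + quart c (Suc k)"
  have y: "y < 16" using quart_less[of c k] quart_less[of c "Suc k"] by (simp add: y_def)
  have "wsum (dlist k) ?m = int y"
    using k m[OF k] m[of "Suc k"] by (simp add: dlist_def wsum_def y_def quart_def)
  then have w: "nat (wsum (dlist k) ?m mod 2 ^ 4) = y" using y by simp
  have "full (\<lambda>_. False) c (nm 8 k 0) = bit (nat (digit y + 1)) 0"
    "full (\<lambda>_. False) c (nm 9 k 0) = bit (nat (digit y + 1)) 1"
    unfolding full_simps(4)[OF DQ_mem(1)[OF k]] full_simps(4)[OF DQ_mem(2)[OF k]] dtests_def parity_value_tests nm_simps w
    by simp_all
  then have "dval (full (\<lambda>_. False) c) k = digit y"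
    unfolding dval_def using digit_bits[of y] by simp
  then show "real_of_int (dval (full (\<lambda>_. False) c) k) / 2 ^ Suc k
      = real_of_int (digit (4 * quart c k + quart c (Suc k))) / 2 ^ Suc k" by (simp add: y_def)
qed

lemma good_quart:
  assumes "i < Ld" "\<forall>\<tau><2. \<forall>i<Ld. good \<theta> c \<tau> i"
  obtains n :: int where "\<bar>2 ^ i * \<theta> - of_int n - of_int (quarter (quart c i)) / 4\<bar> < 1 / 6"
proof -
  have sa: "2 ^ i * \<theta> - shift_angle 0 = 2 ^ i * \<theta> + 1 / 8" "2 ^ i * \<theta> - shift_angle 1 = 2 ^ i * \<theta> - 1 / 8"
    by (simp_all add: shift_angle_def)
  have "good \<theta> c 0 i" "good \<theta> c 1 i" using assms by auto
  then have "if maj c 0 i then cos (2 * pi * (2 ^ i * \<theta> + 1 / 8)) \<le> 1 / 4 else cos (2 * pi * (2 ^ i * \<theta> + 1 / 8)) \<ge> - 1 / 4"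
    "if maj c 1 i then cos (2 * pi * (2 ^ i * \<theta> - 1 / 8)) \<le> 1 / 4 else cos (2 * pi * (2 ^ i * \<theta> - 1 / 8)) \<ge> - 1 / 4"
    unfolding good_def Let_def by (simp_all only: sa)
  from quarter_near[OF this] obtain n :: int
    where "\<bar>2 ^ i * \<theta> - of_int n - of_int (quarter (of_bool (maj c 0 i) + 2 * of_bool (maj c 1 i))) / 4\<bar> < 1 / 6" .
  then show ?thesis using that assms(1) by (simp add: quart_def)
qed

text \<open>If \<open>n k\<close> is the integer that goes with the quarter value at position
  \<open>k\<close>, the digit is \<open>n (Suc k) - 2 * n k\<close>, so the weighted sum of digits
  telescopes. Only the last digit, which has no successor, contributes an error. Individual
  roundings may be ambiguous; their errors do not accumulate.\<close>

lemma good_vf: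
  assumes gd: "\<forall>\<tau><2. \<forall>i<Ld. good \<theta> c \<tau> i"
  obtains k :: int and e where "\<bar>e\<bar> < 5 / 6" "\<theta> - vf c = of_int k + e / 2 ^ Ld"
proof -
  have "\<forall>i. \<exists>n::int. i < Ld \<longrightarrow> \<bar>2 ^ i * \<theta> - of_int n - of_int (quarter (quart c i)) / 4\<bar> < 1 / 6"
    using good_quart[OF _ gd] by metis
  then obtain n :: "nat \<Rightarrow> int" where
    n: "\<And>i. i < Ld \<Longrightarrow> \<bar>2 ^ i * \<theta> - of_int (n i) - of_int (quarter (quart c i)) / 4\<bar> < 1 / 6" by metis
  obtain D where D: "Ld = Suc D" using Ld by (cases Ld) auto
  define dg where "dg k = digit (4 * quart c k + quart c (Suc k))" for k
  have dg: "dg k = n (Suc k) - 2 * n k" if "k < D" for k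
  proof -
    have "dg k = (2 * quarter (quart c k) - quarter (quart c (Suc k)) + 2) div 4"
      using quart_less[of c "Suc k"] by (simp add: dg_def digit_def)
    also have "\<dots> = n (Suc k) - 2 * n k"
      using n[of k] n[of "Suc k"] that D by (intro digit_eq) (simp_all add: mult.assoc)
    finally show ?thesis .
  qed
  have "quart c Ld = 0" by (simp add: quart_def)
  then have dl: "\<bar>2 * (2 ^ D * \<theta>) - of_int (2 * n D + dg D)\<bar> < 5 / 6"
    unfolding dg_def using n[of D] D quart_less[of c D] by (intro digit_last) simp_all
  have tel: "(\<Sum>k<m. real_of_int (dg k) / 2 ^ Suc k) = real_of_int (n m) / 2 ^ m - real_of_int (n 0)" if "m \<le> D" for m
    using that
  proof (induction m)
    case (Suc m)
    then have "(\<Sum>k<Suc m. real_of_int (dg k) / 2 ^ Suc k)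
        = real_of_int (n m) / 2 ^ m - real_of_int (n 0) + real_of_int (n (Suc m) - 2 * n m) / 2 ^ Suc m"
      by (simp add: dg)
    also have "\<dots> = real_of_int (n (Suc m)) / 2 ^ Suc m - real_of_int (n 0)" by (simp add: field_simps)
    finally show ?case .
  qed simp
  have "vf c = (\<Sum>k<Ld. real_of_int (dg k) / 2 ^ Suc k)" unfolding vf_digit dg_def ..
  also have "\<dots> = (\<Sum>k<Suc D. real_of_int (dg k) / 2 ^ Suc k)" by (rule sum.cong) (simp_all add: D)
  also have "\<dots> = real_of_int (n D) / 2 ^ D - real_of_int (n 0) + real_of_int (dg D) / 2 ^ Suc D"
    using tel[of D] by simp
  finally have "\<theta> - vf c = of_int (n 0) + (2 * (2 ^ D * \<theta>) - of_int (2 * n D + dg D)) / 2 ^ Ld"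
    by (simp add: D field_simps)
  then show ?thesis using that dl by blast
qed

lemma vf_grid: "\<exists>k::int. vf c * 2 ^ Ld = of_int k"
proof -
  have "vf c * 2 ^ Ld = (\<Sum>k<Ld. real_of_int (digit (4 * quart c k + quart c (Suc k)) * 2 ^ (Ld - Suc k)))"
    unfolding vf_digit sum_distrib_right
  proof (rule sum.cong[OF refl])
    fix k assume "k \<in> {..<Ld}"
    then have "(2::real) ^ Ld = 2 ^ (Ld - Suc k) * 2 ^ Suc k" unfolding power_add[symmetric] by simp
    then show "real_of_int (digit (4 * quart c k + quart c (Suc k))) / 2 ^ Suc k * 2 ^ Ld
        = real_of_int (digit (4 * quart c k + quart c (Suc k)) * 2 ^ (Ld - Suc k))"
      by (simp add: field_simps)
  qed
  also have "\<dots> = of_int (\<Sum>k<Ld. digit (4 * quart c k + quart c (Suc k)) * 2 ^ (Ld - Suc k))" by simp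
  finally show ?thesis by blast
qed

section \<open>The average over the shift\<close>

definition avg :: "real \<Rightarrow> real" where
  "avg \<theta> = (\<Sum>r<2 ^ G. \<Sum>c\<in>asg CQ. pc (\<theta> + real r / 2 ^ G) c * vr (\<theta> + real r / 2 ^ G - vf c)) / 2 ^ G"

lemma trig_pc: "trig (\<Sum>q\<in>CQ. 2 ^ pos q) (\<lambda>\<theta>. of_real (pc \<theta> c))"
  unfolding pc_pr of_real_prod pr_def by (intro trig_prod trig_cos) simp

lemma trig_vr: "trig (\<Sum>q\<in>VQ. 2 ^ pos q) (\<lambda>\<theta>. of_real (vr (\<theta> - v)))"
proof -
  have "vr (\<theta> - v) = (\<Prod>q\<in>VQ. (1 + 1 * cos (2 * pi * (2 ^ pos q * \<theta> - 2 ^ pos q * v))) / 2)" for \<theta>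
    unfolding vr_def ver_def cmod_half_cis by (simp add: right_diff_distrib)
  then show ?thesis by (simp only: of_real_prod) (intro trig_prod trig_cos fin)
qed

text \<open>Each sample and each verification copy contributes its own power of two; this total
  dictates how many bits of shift are needed.\<close>

lemma degree_bound: "(\<Sum>q\<in>CQ. 2 ^ pos q) + (\<Sum>q\<in>VQ. 2 ^ pos q) < (2 * 2 ^ g + 1) * (2 ^ Ld :: int)"
proof -
  have geo: "(\<Sum>i<n. 2 ^ i) = (2 ^ n - 1 :: int)" for n by (induction n) auto
  have cg: "(\<Sum>q\<in>CG \<tau> i. 2 ^ pos q) = (2 ^ g * 2 ^ i :: int)" for \<tau> i
    unfolding CG_def by (subst sum.reindex) (auto simp: inj_on_def)
  have "(\<Sum>q\<in>CQ. 2 ^ pos q) = (\<Sum>\<tau><2. \<Sum>q\<in>(\<Union>i<Ld. CG \<tau> i). 2 ^ pos q :: int)"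
    unfolding CQ_def by (rule sum.UNION_disjoint) (auto simp: CG_def)
  also have "\<dots> = (\<Sum>\<tau><2. \<Sum>i<Ld. \<Sum>q\<in>CG \<tau> i. 2 ^ pos q)"
    by (intro sum.cong refl sum.UNION_disjoint) (auto simp: CG_def)
  also have "\<dots> = 2 * 2 ^ g * (2 ^ Ld - 1)"
    unfolding cg sum_distrib_left[symmetric] geo by simp
  finally have 1: "(\<Sum>q\<in>CQ. 2 ^ pos q) = 2 * 2 ^ g * (2 ^ Ld - 1 :: int)" .
  have "(\<Sum>q\<in>VQ. 2 ^ pos q) = (\<Sum>i<Lv. 2 ^ i :: int)"
    unfolding VQ_def by (subst sum.reindex) (auto simp: inj_on_def)
  also have "\<dots> \<le> 2 ^ Ld - 1" unfolding geo by (intro diff_right_mono power_increasing Lv) simp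
  finally have 2: "(\<Sum>q\<in>VQ. 2 ^ pos q) \<le> (2 ^ Ld - 1 :: int)" .
  have "2 * 2 ^ g * (2 ^ Ld - 1) \<le> 2 * 2 ^ g * (2 ^ Ld :: int)" by simp
  then show ?thesis using 1 2 by (simp only: distrib_right)
qed

text \<open>For fixed outcomes the probability is a trigonometric polynomial in the phase. If
  \<open>\<theta>\<close> lies on the grid, adding it only permutes the grid modulo 1; if the grid
  is finer than the degree, only the constant term survives.\<close>

lemma avg_const:
  assumes "2 ^ G * \<theta> \<in> \<int> \<or> (2 * 2 ^ g + 1) * 2 ^ Ld \<le> (2 :: int) ^ G"
  shows "avg \<theta> = avg 0"
proof -
  define D where "D = (\<Sum>q\<in>CQ. 2 ^ pos q) + (\<Sum>q\<in>VQ. 2 ^ pos q :: int)"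
  define F where "F \<theta> = (\<Sum>c\<in>asg CQ. pc \<theta> c * vr (\<theta> - vf c))" for \<theta>
  have D0: "D \<ge> 0" unfolding D_def by (intro add_nonneg_nonneg sum_nonneg) auto
  have "trig D (\<lambda>\<theta>. of_real (F \<theta>))"
    unfolding F_def of_real_sum of_real_mult D_def
    by (intro trig_sum trig_mult trig_pc trig_vr D0[unfolded D_def])
  moreover have "real (2 ^ G) * \<theta> \<in> \<int> \<or> D < int (2 ^ G)"
    using assms degree_bound unfolding D_def by auto
  ultimately have "(\<Sum>r<2 ^ G. complex_of_real (F (\<theta> + real r / real (2 ^ G)))) = (\<Sum>r<2 ^ G. of_real (F (real r / real (2 ^ G))))"
    by (intro trig_average) auto
  then have "complex_of_real (\<Sum>r<2 ^ G. F (\<theta> + real r / real (2 ^ G))) = of_real (\<Sum>r<2 ^ G. F (real r / real (2 ^ G)))"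
    by (simp only: of_real_sum)
  then have "(\<Sum>r<2 ^ G. F (\<theta> + real r / real (2 ^ G))) = (\<Sum>r<2 ^ G. F (real r / real (2 ^ G)))"
    by (simp only: of_real_eq_iff)
  then show ?thesis unfolding avg_def F_def by simp
qed

text \<open>All majorities are good with probability at least 1/2, and then the verification passes
  with probability at least 1/2.\<close>

lemma avg_ge:
  assumes "4 * real Ld * (31 / 32) ^ 2 ^ g \<le> 1" "Lv + 3 \<le> Ld \<or> Ld = G \<and> 2 ^ G * \<theta> \<in> \<int>"
  shows "1 / 4 \<le> avg \<theta>"
proof -
  have "1 / 4 \<le> (\<Sum>c\<in>asg CQ. pc (\<theta> + real r / 2 ^ G) c * vr (\<theta> + real r / 2 ^ G - vf c))" for r
  proof -
    define t where "t = \<theta> + real r / 2 ^ G"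
    define ok where "ok c \<longleftrightarrow> (\<forall>\<tau><2. \<forall>i<Ld. good t c \<tau> i)" for c
    have v: "1 / 2 \<le> vr (t - vf c)" if okc: "ok c" for c
    proof -
      obtain k :: int and e where e: "\<bar>e\<bar> < 5 / 6" "t - vf c = of_int k + e / 2 ^ Ld"
        by (rule good_vf[OF okc[unfolded ok_def]])
      show ?thesis using assms(2)
      proof
        assume "Lv + 3 \<le> Ld"
        then show ?thesis unfolding e(2) using e(1) by (rule vr_near)
      next
        assume *: "Ld = G \<and> 2 ^ G * \<theta> \<in> \<int>"
        obtain m :: int where m: "vf c * 2 ^ Ld = of_int m" using vf_grid by blast
        have "e = 2 ^ Ld * (t - vf c) - of_int (k * 2 ^ Ld)" unfolding e(2) by (simp add: field_simps)
        also have "\<dots> = 2 ^ G * \<theta> + of_nat r - of_int m - of_int (k * 2 ^ Ld)"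
          using m * by (simp add: t_def field_simps)
        \<comment> \<open>On the grid the error \<open>e\<close> is an integer of modulus below 5/6,
          hence zero.\<close>
        finally have "e \<in> \<int>" using * by simp
        then have "e = 0" using e(1) Ints_nonzero_abs_less1[of e] by simp
        then show ?thesis using e(2) by (simp add: vr_int)
      qed
    qed
    have "1 = (\<Sum>c\<in>asg CQ. of_bool (ok c) * pc t c) + (\<Sum>c\<in>asg CQ. of_bool (\<not> ok c) * pc t c)"
      unfolding sum.distrib[symmetric] sum_pc[of t, symmetric] by (intro sum.cong refl) simp
    moreover have "(\<Sum>c\<in>asg CQ. of_bool (\<not> ok c) * pc t c) \<le> 1 / 2"
      using prob_some_not_good[of t] assms(1) unfolding ok_def by linarith
    ultimately have "1 / 4 \<le> 1 / 2 * (\<Sum>c\<in>asg CQ. of_bool (ok c) * pc t c)" by simp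
    also have "\<dots> = (\<Sum>c\<in>asg CQ. 1 / 2 * (of_bool (ok c) * pc t c))" by (rule sum_distrib_left)
    also have "\<dots> \<le> (\<Sum>c\<in>asg CQ. pc t c * vr (t - vf c))"
    proof (rule sum_mono)
      fix c
      show "1 / 2 * (of_bool (ok c) * pc t c) \<le> pc t c * vr (t - vf c)"
        using v[of c] pc_nonneg[of t c] vr_bounds(1)[of "t - vf c"] mult_left_mono[of "1 / 2" "vr (t - vf c)" "pc t c"]
        by (cases "ok c") simp_all
    qed
    finally show ?thesis unfolding t_def .
  qed
  then have "(\<Sum>r<(2 ^ G :: nat). 1 / 4 :: real) \<le> (\<Sum>r<2 ^ G. \<Sum>c\<in>asg CQ. pc (\<theta> + real r / 2 ^ G) c * vr (\<theta> + real r / 2 ^ G - vf c))"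
    by (intro sum_mono)
  then show ?thesis unfolding avg_def by (simp add: field_simps)
qed

lemma flag_prob: "weight QQ (holds flag) (sems \<theta> base zero_state) = \<rho>\<^sup>2 * avg \<theta>"
  using sum_flagged[of "\<lambda>_. True" "\<lambda>_ _. True" \<theta>] by (simp add: avg_def)

abbreviation missed :: "nat \<Rightarrow> real \<Rightarrow> (nat \<Rightarrow> bool) \<Rightarrow> bool" where
  "missed m \<theta> b \<equiv> far m (th \<theta> b - vfrac b)"

text \<open>The bound on the kernel holds for every shift and every outcome of the samples, so it
  survives averaging however likely a wrong estimate is.\<close>

lemma far_prob:
  assumes "\<And>r c. far m (\<theta> + real r / 2 ^ G - vf c) \<Longrightarrow> vr (\<theta> + real r / 2 ^ G - vf c) \<le> \<zeta>" "0 \<le> \<zeta>"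
  shows "weight QQ (\<lambda>b. holds flag b \<and> missed m \<theta> b) (sems \<theta> base zero_state) \<le> \<zeta>"
proof -
  have "weight QQ (\<lambda>b. holds flag b \<and> missed m \<theta> b) (sems \<theta> base zero_state)
    = \<rho>\<^sup>2 / 2 ^ G * (\<Sum>r<2 ^ G. \<Sum>c\<in>asg CQ. of_bool (far m (\<theta> + real r / 2 ^ G - vf c)) *
        (pc (\<theta> + real r / 2 ^ G) c * vr (\<theta> + real r / 2 ^ G - vf c)))"
    by (rule sum_flagged) (simp add: rval_full vfrac_full)
  also have "\<dots> \<le> \<rho>\<^sup>2 / 2 ^ G * (\<Sum>r<2 ^ G. \<Sum>c\<in>asg CQ. pc (\<theta> + real r / 2 ^ G) c * \<zeta>)"
  proof (intro mult_left_mono sum_mono)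
    fix r c
    show "of_bool (far m (\<theta> + real r / 2 ^ G - vf c)) * (pc (\<theta> + real r / 2 ^ G) c * vr (\<theta> + real r / 2 ^ G - vf c))
        \<le> pc (\<theta> + real r / 2 ^ G) c * \<zeta>"
      using assms(1)[of r c] assms(2) pc_nonneg[of "\<theta> + real r / 2 ^ G" c]
      by (cases "far m (\<theta> + real r / 2 ^ G - vf c)") (simp_all add: mult_left_mono)
  qed simp
  also have "\<dots> = \<rho>\<^sup>2 * \<zeta>" unfolding sum_distrib_right[symmetric] sum_pc by simp
  also have "\<dots> \<le> 1 * \<zeta>" using \<rho> assms(2) by (intro mult_right_mono) (auto simp: power_le_one)
  finally show ?thesis by simp
qed

lemma vr_far_exact:
  assumes "Lv = Ld" "Ld = G" "2 ^ G * \<theta> \<in> \<int>" "far m (\<theta> + real r / 2 ^ G - vf c)"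
  shows "vr (\<theta> + real r / 2 ^ G - vf c) = 0"
proof (rule vr_zero)
  obtain k :: int where k: "vf c * 2 ^ Ld = of_int k" using vf_grid by blast
  have "2 ^ Lv * (\<theta> + real r / 2 ^ G - vf c) = 2 ^ G * \<theta> + of_nat r - of_int k"
    using k assms by (simp add: field_simps)
  then show "2 ^ Lv * (\<theta> + real r / 2 ^ G - vf c) \<in> \<int>" using assms(3) by simp
  show "\<theta> + real r / 2 ^ G - vf c \<notin> \<int>"
  proof
    assume "\<theta> + real r / 2 ^ G - vf c \<in> \<int>"
    then obtain k :: int where "\<theta> + real r / 2 ^ G - vf c = of_int k" by (elim Ints_cases)
    then show False using assms(4) unfolding far_def by (auto dest: spec[of _ k])
  qed
qed

lemma vr_far_wide:
  assumes "far m \<delta>"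
  shows "vr \<delta> \<le> 4 ^ (m + 1) / 4 ^ Lv"
  using assms unfolding far_def by (intro vr_far) (simp add: less_imp_le)

end

section \<open>Size of the window program\<close>

lemma prog_append:
  "prog_ok Q (ps @ qs) \<longleftrightarrow> prog_ok Q ps \<and> prog_ok Q qs"
  "prog_size (ps @ qs) = prog_size ps + prog_size qs"
  "prog_blacks (ps @ qs) = prog_blacks ps + prog_blacks qs"
  by (auto simp: prog_ok_def prog_size_def prog_blacks_def)

lemma prog_Cons:
  "prog_ok Q (s # ps) \<longleftrightarrow> step_ok Q s \<and> prog_ok Q ps"
  "prog_size (s # ps) = step_size s + prog_size ps"
  "prog_blacks (s # ps) = step_blacks s + prog_blacks ps"
  by (auto simp: prog_ok_def prog_size_def prog_blacks_def)

lemma prog_Nil: "prog_ok Q []" "prog_size [] = 0" "prog_blacks [] = 0"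
  by (auto simp: prog_ok_def prog_size_def prog_blacks_def)

lemma prog_ok_mono: "prog_ok Q ps \<Longrightarrow> Q \<subseteq> Q' \<Longrightarrow> prog_ok Q' ps"
  unfolding prog_ok_def using step_ok_mono by blast

lemma prog_inv:
  shows "prog_ok Q ps \<Longrightarrow> prog_ok Q (inv_prog ps)"
    and "prog_size (inv_prog ps) = prog_size ps"
    and "prog_blacks (inv_prog ps) = prog_blacks ps"
proof -
  have "step_ok Q s \<Longrightarrow> step_ok Q (inv_step s)" for s by (cases s) (auto simp: unitary1_adj)
  moreover have tc: "tcost (map (\<lambda>(\<beta>, t). (- \<beta>, t)) ts) = tcost ts" for ts
    unfolding tcost_def map_map by (rule arg_cong[where f = sum_list], rule map_cong) auto
  moreover have "step_size (inv_step s) = step_size s" "step_blacks (inv_step s) = step_blacks s" for s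
    by (cases s; simp add: tc)+
  ultimately show "prog_ok Q ps \<Longrightarrow> prog_ok Q (inv_prog ps)" "prog_size (inv_prog ps) = prog_size ps"
    "prog_blacks (inv_prog ps) = prog_blacks ps"
    by (auto simp: prog_ok_def prog_size_def prog_blacks_def inv_prog_def comp_def rev_map[symmetric])
qed

lemma prog_ok_amplify:
  assumes "prog_ok Q ps" "finite Q" "test_qubits f \<subseteq> Q"
  shows "prog_ok Q (amplify Q f ps)"
  using assms by (simp add: amplify_def prog_append prog_Cons prog_Nil prog_inv test_qubits_none_test)

lemma prog_size_amplify:
  "prog_size (amplify Q f ps) = 3 * prog_size ps + 100 * (test_cost f + test_cost (none_test Q)) + 2"
  by (simp add: amplify_def prog_append prog_Cons prog_Nil prog_inv tcost_def)

lemma prog_blacks_amplify: "prog_blacks (amplify Q f ps) = 3 * prog_blacks ps"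
  by (simp add: amplify_def prog_append prog_Cons prog_Nil prog_inv)

lemma prog_blacks_xor: "prog_blacks (xor_prog S tf) = 0"
  by (simp add: xor_prog_def prog_Cons prog_Nil)

lemma test_qubits_ctrl: "test_qubits (ctrl_test t \<tau>) = insert t (test_qubits \<tau>)"
  by (cases \<tau>) (auto simp: image_image case_prod_beta)

lemma test_cost_ctrl: "test_cost (ctrl_test t (ws, v, T)) = (length ws + 2) * (T + 2) + (T + 2) * 2 ^ (T + 1)"
  by simp

lemma prog_ok_xor:
  assumes "S \<subseteq> Q" "finite S" "\<And>t \<tau>. t \<in> S \<Longrightarrow> \<tau> \<in> set (tf t) \<Longrightarrow> test_qubits \<tau> \<subseteq> Q"
  shows "prog_ok Q (xor_prog S tf)"
  using assms by (auto simp: xor_prog_def prog_Cons prog_Nil unitary1_hmat test_qubits_ctrl simp del: ctrl_test.simps)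

lemma tcost_concat: "tcost (concat (map f xs)) = (\<Sum>x\<leftarrow>xs. tcost (f x))"
  by (induction xs) (auto simp: tcost_def)

lemma prog_size_xor:
  assumes "finite S" "\<And>t. t \<in> S \<Longrightarrow> length (tf t) \<le> n" "\<And>t ws v T. t \<in> S \<Longrightarrow> (ws, v, T) \<in> set (tf t) \<Longrightarrow>
    (length ws + 2) * (T + 2) + (T + 2) * 2 ^ (T + 1) \<le> k"
  shows "prog_size (xor_prog S tf) \<le> card S * (100 * (n * k) + 2) + 1"
proof -
  have 1: "tcost (map (\<lambda>\<tau>. (pi, ctrl_test t \<tau>)) (tf t)) \<le> n * k" if "t \<in> S" for t
  proof -
    have "tcost (map (\<lambda>\<tau>. (pi, ctrl_test t \<tau>)) (tf t)) = (\<Sum>\<tau>\<leftarrow>tf t. test_cost (ctrl_test t \<tau>))"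
      by (simp add: tcost_def comp_def)
    also have "\<dots> \<le> (\<Sum>\<tau>\<leftarrow>tf t. k)"
    proof (rule sum_list_mono)
      fix \<tau> assume \<tau>: "\<tau> \<in> set (tf t)"
      obtain ws v T where "\<tau> = (ws, v, T)" by (cases \<tau>)
      then show "test_cost (ctrl_test t \<tau>) \<le> k" using assms(3)[OF that, of ws v T] \<tau> by (simp only: test_cost_ctrl)
    qed
    also have "\<dots> = length (tf t) * k" by (simp add: sum_list_triv)
    also have "\<dots> \<le> n * k" using assms(2)[OF that] by simp
    finally show ?thesis .
  qed
  have "tcost (concat (map (\<lambda>t. map (\<lambda>\<tau>. (pi, ctrl_test t \<tau>)) (tf t)) (sorted_list_of_set S)))
      = (\<Sum>t\<leftarrow>sorted_list_of_set S. tcost (map (\<lambda>\<tau>. (pi, ctrl_test t \<tau>)) (tf t)))"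
    by (rule tcost_concat)
  also have "\<dots> = (\<Sum>t\<in>S. tcost (map (\<lambda>\<tau>. (pi, ctrl_test t \<tau>)) (tf t)))"
    using assms(1) by (simp add: sum_list_distinct_conv_sum_set)
  also have "\<dots> \<le> (\<Sum>t\<in>S. n * k)" by (rule sum_mono) (rule 1)
  finally have "tcost (concat (map (\<lambda>t. map (\<lambda>\<tau>. (pi, ctrl_test t \<tau>)) (tf t)) (sorted_list_of_set S))) \<le> card S * (n * k)"
    by simp
  then show ?thesis by (simp add: xor_prog_def prog_Cons prog_Nil algebra_simps)
qed

lemma prog_size_xor_values:
  assumes "finite S" "\<And>t. t \<in> S \<Longrightarrow> length (ws t) \<le> w"
  shows "prog_size (xor_prog S (\<lambda>t. value_tests (ws t) T (P t)))
    \<le> card S * (100 * (2 ^ T * ((w + 2) * (T + 2) + (T + 2) * 2 ^ (T + 1))) + 2) + 1"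
proof (rule prog_size_xor)
  fix t assume t: "t \<in> S"
  have "length (filter (P t) [0..<2 ^ T]) \<le> length [0..<(2::nat) ^ T]" by (rule length_filter_le)
  then show "length (value_tests (ws t) T (P t)) \<le> 2 ^ T" by (simp add: value_tests_def)
  fix ws' v T' assume "(ws', v, T') \<in> set (value_tests (ws t) T (P t))"
  then have "ws' = ws t" "T' = T" by (auto simp: value_tests_def)
  then show "(length ws' + 2) * (T' + 2) + (T' + 2) * 2 ^ (T' + 1) \<le> (w + 2) * (T + 2) + (T + 2) * 2 ^ (T + 1)"
    using assms(2)[OF t] by (simp only: add_le_mono1 mult_le_mono1)
qed (rule assms(1))

lemma lg_square: "lg k * lg k \<le> 8 * k + 4"
proof -
  have "T * T \<le> 4 * 2 ^ T" for T :: nat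
  proof (induction T rule: less_induct)
    case (less T)
    show ?case
    proof (cases "T < 3")
      case True
      then have "T = 0 \<or> T = 1 \<or> T = 2" by auto
      then show ?thesis by auto
    next
      case False
      then obtain U where U: "T = Suc U" "U \<ge> 2" by (cases T) auto
      have "2 * U + 1 \<le> U * U \<or> U = 2"
      proof (cases "U = 2")
        case False
        then have "3 * U \<le> U * U" using U by (intro mult_right_mono) auto
        then show ?thesis using U by linarith
      qed simp
      moreover have "U * U \<le> 4 * 2 ^ U" using less U by auto
      ultimately show ?thesis using U by auto
    qed
  qed
  from this[of "lg k"] power_lg_le[of k] show ?thesis by linarith
qed

lemma none_test_cost:
  assumes "k = card Q" "finite Q"
  shows "test_cost (none_test Q) \<le> (lg k + 1) * (3 * k + 2)"
proof -
  have "test_cost (none_test Q) = (lg k + 1) * (k + 1 + 2 ^ lg k)"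
    using assms by (simp add: none_test_def algebra_simps)
  also have "\<dots> \<le> (lg k + 1) * (k + 1 + (2 * k + 1))" using power_lg_le by (intro mult_left_mono add_left_mono) auto
  finally show ?thesis by (simp add: algebra_simps)
qed

context window
begin

abbreviation amp :: "step list" where
  "amp \<equiv> amplify QQ flag base"

lemma prog_ok_base: "prog_ok QQ base"
proof -
  have nm: "nm 0 a 0 \<in> RQ" if "a < G" for a using that by (auto simp: RQ_def)
  have nv: "nm 1 i 0 \<in> VQ" if "i < Lv" for i using that by (auto simp: VQ_def)
  have sub: "RQ \<subseteq> QQ" "VQ \<subseteq> QQ" "AQ \<in> QQ" "CQ \<subseteq> QQ" "WQ \<subseteq> QQ" "MQ \<subseteq> QQ" "DQ \<subseteq> QQ"
    by (auto simp: QQ_def)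
  have sp: "step_ok QQ (Phase shift_phases)"
    using sub nm by (auto simp: shift_phases_def pair_test_def)
  have dp: "step_ok QQ (Phase digit_phases)"
    using sub nv DQ_mem by (auto simp: digit_phases_def pair_test_def single_test_def Let_def)
  have xw: "prog_ok QQ (xor_prog WQ wtests)"
  proof (rule prog_ok_xor)
    show "test_qubits \<tau> \<subseteq> QQ" if "t \<in> WQ" "\<tau> \<in> set (wtests t)" for t \<tau> using wtests_qubits[OF that(2)] sub by blast
  qed (use sub in auto)
  have xm: "prog_ok QQ (xor_prog MQ mtests)"
  proof (rule prog_ok_xor)
    show "test_qubits \<tau> \<subseteq> QQ" if "t \<in> MQ" "\<tau> \<in> set (mtests t)" for t \<tau> using mtests_qubits[OF that] sub by blast
  qed (use sub in auto)
  have xd: "prog_ok QQ (xor_prog DQ dtests)"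
  proof (rule prog_ok_xor)
    show "test_qubits \<tau> \<subseteq> QQ" if "t \<in> DQ" "\<tau> \<in> set (dtests t)" for t \<tau> using dtests_qubits[OF that] sub by blast
  qed (use sub in auto)
  show ?thesis unfolding base_def prog_append prog_Cons
    using sp dp xw xm xd sub \<rho> by (auto simp: prog_Nil unitary1_hmat unitary1_samp_mat unitary1_rot_mat simp del: step_ok.simps(2))
qed

lemma card_CG: "card (CG \<tau> i) = 2 ^ g"
  unfolding CG_def by (subst card_image) (auto simp: inj_on_def)

lemma card_CQ: "card CQ \<le> 2 * (Ld * 2 ^ g)"
proof -
  have "card CQ \<le> (\<Sum>\<tau><2. card (\<Union>i<Ld. CG \<tau> i))" unfolding CQ_def by (rule card_UN_le) simp
  also have "\<dots> \<le> (\<Sum>\<tau><2::nat. \<Sum>i<Ld. card (CG \<tau> i))" by (intro sum_mono card_UN_le) simp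
  finally show ?thesis by (simp add: card_CG)
qed

lemma card_WQ: "card WQ \<le> Suc (Ld div g) * (2 * g + 1)"
proof -
  have "card WQ \<le> (\<Sum>\<gamma><Suc (Ld div g). card (nm 5 \<gamma> ` {..<2 * g + 1}))" unfolding WQ_def by (rule card_UN_le) simp
  also have "\<dots> \<le> (\<Sum>\<gamma><Suc (Ld div g). 2 * g + 1)"
    by (intro sum_mono) (use card_image_le[of "{..<2 * g + 1}"] in simp)
  finally show ?thesis by simp
qed

lemma card_group: "card (group \<gamma>) \<le> 2 * (g * 2 ^ g)"
proof -
  have "card (group \<gamma>) \<le> card (\<Union>r<g. \<Union>\<tau><2. CG \<tau> (\<gamma> * g + r))" by (rule card_mono[OF _ group_subset]) auto
  also have "\<dots> \<le> (\<Sum>r<g. card (\<Union>\<tau><2. CG \<tau> (\<gamma> * g + r)))" by (rule card_UN_le) simp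
  also have "\<dots> \<le> (\<Sum>r<g. \<Sum>\<tau><2::nat. card (CG \<tau> (\<gamma> * g + r)))" by (intro sum_mono card_UN_le) simp
  finally show ?thesis by (simp add: card_CG)
qed

lemma card_RQ: "card RQ = G" and card_VQ: "card VQ = Lv"
  unfolding RQ_def VQ_def by (subst card_image; auto simp: inj_on_def)+

lemma card_MQ: "card MQ \<le> 2 * Ld"
proof -
  have "card MQ \<le> (\<Sum>\<tau><2. card ((\<lambda>i. nm (6 + \<tau>) i 0) ` {..<Ld}))" unfolding MQ_def by (rule card_UN_le) simp
  also have "\<dots> \<le> (\<Sum>\<tau><2::nat. Ld)" by (intro sum_mono) (use card_image_le[of "{..<Ld}"] in simp)
  finally show ?thesis by simp
qed

lemma card_DQ: "card DQ \<le> 2 * Ld"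
proof -
  have "card DQ \<le> (\<Sum>\<tau><2. card ((\<lambda>i. nm (8 + \<tau>) i 0) ` {..<Ld}))" unfolding DQ_def by (rule card_UN_le) simp
  also have "\<dots> \<le> (\<Sum>\<tau><2::nat. Ld)" by (intro sum_mono) (use card_image_le[of "{..<Ld}"] in simp)
  finally show ?thesis by simp
qed

lemma tcost_shift_phases: "tcost shift_phases = 21 * (G * card (WQ \<union> VQ))"
  unfolding shift_phases_def tcost_concat interv_sum_list_conv_sum_set_nat set_upt atLeast0LessThan
  by (simp add: tcost_def comp_def pair_test_def sum_list_triv)

lemma tcost_digit_phases: "tcost digit_phases = 50 * (Lv * Ld)"
  unfolding digit_phases_def tcost_concat interv_sum_list_conv_sum_set_nat set_upt atLeast0LessThan
  by (simp add: tcost_def Let_def pair_test_def single_test_def)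

lemma size_W: "prog_size (xor_prog WQ wtests) \<le> card WQ * (100 * (2 ^ (2 * g + 1) * ((2 * (g * 2 ^ g) + 2) * (2 * g + 1 + 2) + (2 * g + 1 + 2) * 2 ^ (2 * g + 1 + 1))) + 2) + 1"
  unfolding wtests_def[abs_def] by (rule prog_size_xor_values) (simp_all add: length_wlist card_group)

lemma size_M: "prog_size (xor_prog MQ mtests) \<le> card MQ * (100 * (2 ^ (g + 1) * ((2 ^ g + 2) * (g + 1 + 2) + (g + 1 + 2) * 2 ^ (g + 1 + 1))) + 2) + 1"
  unfolding mtests_def[abs_def] by (rule prog_size_xor_values) (simp_all add: length_wlist card_CG)

lemma size_D: "prog_size (xor_prog DQ dtests) \<le> card DQ * (100 * (2 ^ 4 * ((4 + 2) * (4 + 2) + (4 + 2) * 2 ^ (4 + 1))) + 2) + 1"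
  unfolding dtests_def[abs_def] by (rule prog_size_xor_values) (simp_all add: dlist_def)

lemma blacks_base: "prog_blacks base = card (WQ \<union> VQ)"
  by (simp add: base_def prog_append prog_Cons prog_Nil prog_blacks_xor)

lemma aff:
  fixes x y :: nat
  assumes "x \<le> c * y" "b \<le> d * y"
  shows "100 * x + b \<le> (100 * c + d) * y"
  using assms by (simp add: algebra_simps)

text \<open>\<open>L\<close> measures the window and \<open>s\<close> the number of samples. A
  window may cost \<open>O(L ^ 2)\<close> gates, so a cost \<open>L * s ^ k\<close> is within budget
  as long as \<open>s ^ k \<le> L\<close>.\<close>

context
  fixes L s :: nat
  assumes L: "Ld \<le> L" "G \<le> 2 * L" "s ^ 8 \<le> L" and s: "s = 2 ^ g"
begin

lemma bnd: "g + 1 \<le> s" "2 \<le> s" "1 \<le> L" "s \<le> L" "s * s \<le> L" "L * s ^ 5 \<le> L * L" "L * s ^ 3 \<le> L * L" "L * s \<le> L * L" "L \<le> L * L"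
proof -
  show gs: "g + 1 \<le> s" unfolding s using less_exp[of g] by linarith
  then show s2: "2 \<le> s" using g by simp
  have p: "s ^ k \<le> L" if "k \<le> 8" for k
    using power_increasing[OF that, of s] s2 L(3) by linarith
  show "1 \<le> L" using p[of 0] by simp
  show "s \<le> L" using p[of 1] by simp
  show "s * s \<le> L" using p[of 2] by (simp add: power2_eq_square)
  show "L * s ^ 5 \<le> L * L" using p[of 5] by simp
  show "L * s ^ 3 \<le> L * L" using p[of 3] by simp
  show "L * s \<le> L * L" using p[of 1] by simp
  show "L \<le> L * L" using p[of 0] by simp
qed

text \<open>There are about \<open>Ld / g\<close> groups of \<open>2 * g + 1\<close> bits: the
  factor \<open>g\<close> cancels. This makes the number of uses of the black-box gate linear in
  \<open>L\<close>.\<close>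

lemma card_WQ_le: "card WQ \<le> 4 * L"
proof -
  have "Ld div g * (2 * g + 1) \<le> Ld div g * (3 * g)" using g by (intro mult_left_mono) auto
  also have "\<dots> \<le> 3 * Ld" using div_times_less_eq_dividend[of Ld g] by (simp add: mult_ac)
  finally have "card WQ \<le> 3 * Ld + (2 * g + 1)" using card_WQ by simp
  moreover have "2 * g + 1 \<le> s * s"
  proof -
    have "2 * s \<le> s * s" using bnd by (intro mult_right_mono) auto
    then show ?thesis using bnd by linarith
  qed
  ultimately show ?thesis using L bnd by linarith
qed

lemma card_CQ_le: "card CQ \<le> 2 * (L * s)"
proof -
  have "Ld * s \<le> L * s" using L by simp
  then show ?thesis using card_CQ unfolding s by linarith
qed

lemma card_QQ_le: "card QQ \<le> 8 * (L * s)"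
proof -
  have "card QQ \<le> card RQ + card VQ + 1 + card CQ + card WQ + card MQ + card DQ"
    unfolding QQ_def by (intro order_trans[OF card_Un_le] add_mono order_refl) simp_all
  moreover have "L * 2 \<le> L * s" using bnd by (intro mult_left_mono) auto
  ultimately show ?thesis
    using card_RQ card_VQ card_CQ_le card_WQ_le card_MQ card_DQ L Lv bnd by linarith
qed

text \<open>Lookup over \<open>O(s ^ 2)\<close> values, each test costing \<open>O(s ^ 3)\<close>,
  gives \<open>s ^ 5\<close> per bit of a compressed sum, the largest power of \<open>s\<close> in
  the program.\<close>

lemma size_W_le: "prog_size (xor_prog WQ wtests) \<le> 16805 * (L * L)"
proof -
  let ?k = "(2 * (g * s) + 2) * (2 * g + 1 + 2) + (2 * g + 1 + 2) * (4 * (s * s))"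
  have a: "2 * g + 1 + 2 \<le> 3 * s" using bnd by linarith
  have b: "2 * (g * s) + 2 \<le> 3 * (s * s)"
  proof -
    have "g * s \<le> s * s" "2 * 2 \<le> s * s" using bnd by (intro mult_mono; simp)+
    moreover have "(g + 1) * s \<le> s * s" using bnd by (intro mult_mono) auto
    ultimately show ?thesis using bnd by (simp only: add_mult_distrib)
  qed
  have c: "2 ^ (2 * g + 1) = 2 * (s * s)" "2 ^ (2 * g + 1 + 1) = 4 * (s * s)"
    unfolding s by (simp_all add: power_add mult_2)
  have "(2 * (g * s) + 2) * (2 * g + 1 + 2) \<le> (3 * (s * s)) * (3 * s)" by (rule mult_mono[OF b a]) auto
  moreover have "(2 * g + 1 + 2) * (4 * (s * s)) \<le> (3 * s) * (4 * (s * s))" by (rule mult_right_mono[OF a]) simp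
  ultimately have d: "?k \<le> 21 * s ^ 3"
    by (simp add: power3_eq_cube)
  have "2 * (s * s) * ?k \<le> 2 * (s * s) * (21 * s ^ 3)"
    by (rule mult_left_mono[OF d]) simp
  also have "\<dots> = 42 * s ^ 5" by (simp only: power_numeral_odd power_numeral_even power_one_right Let_def numeral_3_eq_3 power3_eq_cube) (simp add: power_def)
  finally have f: "2 * (s * s) * ?k \<le> 42 * s ^ 5" .
  have "2 ^ 5 \<le> s ^ 5" using bnd by (intro power_mono) auto
  then have "2 \<le> s ^ 5" by simp
  then have e: "100 * (2 * (s * s) * ?k) + 2 \<le> 4201 * s ^ 5"
    using aff[OF f, of 2 1] by simp
  have "prog_size (xor_prog WQ wtests) \<le> (4 * L) * (4201 * s ^ 5) + 1"
    using size_W[unfolded c, folded s] mult_mono[OF card_WQ_le e] by linarith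
  then show ?thesis using bnd by linarith
qed

lemma size_M_le: "prog_size (xor_prog MQ mtests) \<le> 4805 * (L * L)"
proof -
  have a: "g + 1 + 2 \<le> 2 * s" using bnd by linarith
  have b: "s + 2 \<le> 2 * s" using bnd by linarith
  have c: "2 ^ (g + 1) = 2 * s" "2 ^ (g + 1 + 1) = 4 * s"
    unfolding s by (simp_all add: power_add)
  have "(s + 2) * (g + 1 + 2) \<le> (2 * s) * (2 * s)" by (rule mult_mono[OF b a]) auto
  moreover have "(g + 1 + 2) * (4 * s) \<le> (2 * s) * (4 * s)" by (rule mult_right_mono[OF a]) simp
  moreover have "(2 * s) * (2 * s) + (2 * s) * (4 * s) = 12 * (s * s)" by simp
  ultimately have d: "(s + 2) * (g + 1 + 2) + (g + 1 + 2) * (4 * s) \<le> 12 * (s * s)" using add_mono by metis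
  have "2 * s * ((s + 2) * (g + 1 + 2) + (g + 1 + 2) * (4 * s)) \<le> 2 * s * (12 * (s * s))"
    by (rule mult_left_mono[OF d]) simp
  also have "\<dots> = 24 * s ^ 3" by (simp add: power3_eq_cube)
  finally have f: "2 * s * ((s + 2) * (g + 1 + 2) + (g + 1 + 2) * (4 * s)) \<le> 24 * s ^ 3" .
  have "2 ^ 3 \<le> s ^ 3" using bnd by (intro power_mono) auto
  then have "2 \<le> s ^ 3" by simp
  then have e: "100 * (2 * s * ((s + 2) * (g + 1 + 2) + (g + 1 + 2) * (4 * s))) + 2 \<le> 2402 * s ^ 3"
    using aff[OF f, of 2 1] by simp
  have "card MQ \<le> 2 * L" using card_MQ L by linarith
  then have "prog_size (xor_prog MQ mtests) \<le> (2 * L) * (2402 * s ^ 3) + 1"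
    using size_M[unfolded c, folded s] mult_mono[OF _ e, of "card MQ" "2 * L"] by linarith
  then show ?thesis using bnd by linarith
qed

lemma size_base_le: "prog_size base \<le> 1000000 * (L * L)"
proof -
  have "prog_size (xor_prog DQ dtests) \<le> (2 * L) * 364802 + 1"
    using size_D mult_right_mono[of "card DQ" "2 * L" 364802] card_DQ L by simp
  then have sd: "prog_size (xor_prog DQ dtests) \<le> 729605 * (L * L)" using bnd by linarith
  have wv: "card (WQ \<union> VQ) \<le> 5 * L" using card_Un_le[of WQ VQ] card_WQ_le card_VQ Lv L by linarith
  have "G * card (WQ \<union> VQ) \<le> (2 * L) * (5 * L)" using wv L by (intro mult_mono) auto
  then have sp: "tcost shift_phases \<le> 210 * (L * L)" unfolding tcost_shift_phases by simp
  have "Lv * Ld \<le> L * L" using L Lv by (intro mult_mono) auto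
  then have dp: "tcost digit_phases \<le> 50 * (L * L)" unfolding tcost_digit_phases by simp
  have "card (RQ \<union> VQ \<union> CQ \<union> {AQ}) \<le> card QQ" by (rule card_mono) (auto simp: QQ_def)
  then have i: "card (RQ \<union> VQ \<union> CQ \<union> {AQ}) \<le> 8 * (L * L)" using card_QQ_le bnd by linarith
  have "prog_size base = card (RQ \<union> VQ \<union> CQ \<union> {AQ}) + 2 * prog_size (xor_prog WQ wtests)
      + 100 * tcost shift_phases + 4 * card (WQ \<union> VQ) + card CQ + prog_size (xor_prog MQ mtests)
      + prog_size (xor_prog DQ dtests) + 100 * tcost digit_phases + card VQ + 2"
    by (simp add: base_def prog_append prog_Cons prog_Nil)
  then show ?thesis using i size_W_le sp wv card_CQ_le size_M_le sd dp card_VQ Lv L bnd by linarith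
qed

lemma none_test_cost_le:
  assumes "Q \<subseteq> QQ"
  shows "test_cost (none_test Q) \<le> 234 * (L * L)"
proof -
  have fQ: "finite Q" by (rule finite_subset[OF assms fin(7)])
  have k: "card Q \<le> 8 * (L * s)" using card_mono[OF _ assms] card_QQ_le by simp
  have "L < 2 ^ lg L" by (rule lg_less)
  then have "8 * (L * s) < 8 * (2 ^ lg L * s)" using bnd by simp
  also have "\<dots> = 2 ^ (lg L + g + 3)" unfolding s by (simp add: power_add)
  finally have lk: "lg (card Q) \<le> lg L + g + 3" using k by (intro lg_le) linarith
  \<comment> \<open>Compared through squares: both \<open>lg L ^ 2\<close> and \<open>s ^ 2\<close>
    are linear in \<open>L\<close>, so the product \<open>lg L * s\<close> is too.\<close>
  have "lg L * s \<le> 4 * L"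
  proof -
    have "(lg L * s) * (lg L * s) = (lg L * lg L) * (s * s)" by (simp add: mult_ac)
    also have "\<dots> \<le> (12 * L) * L"
    proof (rule mult_mono)
      show "lg L * lg L \<le> 12 * L" using lg_square[of L] bnd by linarith
    qed (use bnd in auto)
    also have "\<dots> \<le> (4 * L) * (4 * L)" by simp
    finally show ?thesis by (metis mult_le_mono not_le mult_strict_mono' le0)
  qed
  moreover have "(g + 4) * s \<le> 5 * L"
  proof -
    have "(g + 1) * s \<le> s * s" using bnd by (intro mult_mono) auto
    then show ?thesis using bnd by (simp add: add_mult_distrib)
  qed
  ultimately have ls: "(lg L + g + 4) * s \<le> 9 * L" by (simp add: add_mult_distrib)
  have "test_cost (none_test Q) \<le> (lg (card Q) + 1) * (3 * card Q + 2)" by (rule none_test_cost[OF refl fQ])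
  also have "\<dots> \<le> (lg L + g + 4) * (26 * (L * s))"
  proof (rule mult_mono)
    have "1 * 1 \<le> L * s" using bnd by (intro mult_mono) auto
    then show "3 * card Q + 2 \<le> 26 * (L * s)" using k by linarith
  qed (use lk in auto)
  also have "\<dots> = 26 * L * ((lg L + g + 4) * s)" by (simp add: mult_ac)
  also have "\<dots> \<le> 26 * L * (9 * L)" using ls by (rule mult_left_mono) simp
  finally show ?thesis by simp
qed

lemma size_amplify: "prog_size amp \<le> 4000000 * (L * L)"
proof -
  have "test_cost flag \<le> 234 * (L * L)" unfolding flag_def by (rule none_test_cost_le) (auto simp: QQ_def)
  then show ?thesis
    using size_base_le none_test_cost_le[OF order_refl] bnd(3,9)
    unfolding prog_size_amplify distrib_left by linarith
qed

lemma blacks_amplify: "prog_blacks amp \<le> 15 * L"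
  unfolding prog_blacks_amplify blacks_base using card_Un_le[of WQ VQ] card_WQ_le card_VQ Lv L by linarith

end

end


text \<open>The attenuator \<open>\<rho>\<close> makes the flag probability exactly \<open>1/4\<close>, so that one amplification step is exact. This is possible since
  that probability is independent of \<open>\<theta>\<close>.\<close>

lemma window_exists:
  fixes \<Theta> :: "real set"
  assumes "g \<ge> 1" "Lv \<le> Ld" "Ld \<ge> 1" "4 * real Ld * (31 / 32) ^ 2 ^ g \<le> 1"
    and cases: "Lv = Ld \<and> Ld = G \<and> (\<forall>\<theta>\<in>\<Theta>. 2 ^ G * \<theta> \<in> \<int>) \<and> \<zeta> = 0
      \<or> Lv + 3 \<le> Ld \<and> (2 * 2 ^ g + 1) * 2 ^ Ld \<le> (2 :: int) ^ G \<and> \<zeta> = 4 ^ (m + 1) / 4 ^ Lv"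
  shows "\<exists>\<rho>. window g Ld Lv \<rho> \<and> (\<forall>\<theta>\<in>\<Theta>. \<forall>u. u = sems \<theta> (window.amp g Ld Lv G \<rho>) zero_state \<longrightarrow>
    (\<Sum>b\<in>asg (window.QQ g Ld Lv G). (cmod (u b))\<^sup>2) = 1 \<and>
    weight (window.QQ g Ld Lv G) (window.missed Ld G m \<theta>) u \<le> 4 * \<zeta>)"
proof -
  \<comment> \<open>\<open>avg\<close> is the same constant for every \<open>\<rho>\<close>, so an
    arbitrary attenuator serves to speak of it before the right one is chosen.\<close>
  interpret w0: window g Ld Lv G 0 by unfold_locales (use assms in auto)
  have ac: "w0.avg \<theta> = w0.avg 0" if "\<theta> \<in> \<Theta>" for \<theta> using cases that by (intro w0.avg_const) blast
  have ag: "1 / 4 \<le> w0.avg 0" by (rule w0.avg_ge[OF assms(4)]) (use cases in auto)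
  \<comment> \<open>The flag probability is \<open>\<rho> ^ 2 * avg\<close>;
    \<open>avg \<ge> 1/4\<close> is exactly what makes this \<open>\<rho>\<close> at most 1.\<close>
  define \<rho> where "\<rho> = sqrt (1 / (4 * w0.avg 0))"
  have r2: "\<rho>\<^sup>2 * w0.avg 0 = 1 / 4" using ag by (simp add: \<rho>_def)
  have "0 \<le> \<rho>" "\<rho> \<le> 1" using ag by (simp_all add: \<rho>_def)
  then interpret w: window g Ld Lv G \<rho> by unfold_locales (use assms in auto)
  show ?thesis
  proof (intro exI[of _ \<rho>] conjI ballI allI impI)
    show "window g Ld Lv \<rho>" by (rule w.window_axioms)
    fix \<theta> u assume \<theta>: "\<theta> \<in> \<Theta>" and u: "u = sems \<theta> (w.amp) zero_state"
    have "test_qubits w.flag \<subseteq> w.QQ" unfolding w.flag_def by (subst test_qubits_none_test) (auto simp: w.QQ_def)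
    then have ok: "prog_ok w.QQ (w.amp)" by (intro prog_ok_amplify w.prog_ok_base w.fin)
    show "(\<Sum>b\<in>asg w.QQ. (cmod (u b))\<^sup>2) = 1" unfolding u by (rule norm_sems[OF ok w.fin(7)])
    have "weight w.QQ (holds w.flag) (sems \<theta> w.base zero_state) = 1 / 4"
      unfolding w.flag_prob ac[OF \<theta>] by (rule r2)
    from sems_amplify[OF w.prog_ok_base w.fin(7) this]
    have ub: "(cmod (u b))\<^sup>2 = 4 * (of_bool (holds w.flag b) * (cmod (sems \<theta> w.base zero_state b))\<^sup>2)" for b
      unfolding u by (simp add: power_mult_distrib)
    have "weight w.QQ (w.missed m \<theta>) u
      = (\<Sum>b\<in>asg w.QQ. 4 * (of_bool (holds w.flag b \<and> w.missed m \<theta> b) * (cmod (sems \<theta> w.base zero_state b))\<^sup>2))"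
      by (intro sum.cong refl) (auto simp: ub)
    also have "\<dots> = 4 * weight w.QQ (\<lambda>b. holds w.flag b \<and> w.missed m \<theta> b) (sems \<theta> w.base zero_state)"
      by (rule sum_distrib_left[symmetric])
    also have "\<dots> \<le> 4 * \<zeta>"
    proof (intro mult_left_mono w.far_prob)
      show "0 \<le> \<zeta>" using cases by auto
      fix r c assume f: "far m (\<theta> + real r / 2 ^ G - w.vf c)"
      show "w.vr (\<theta> + real r / 2 ^ G - w.vf c) \<le> \<zeta>"
        using cases
      proof
        assume *: "Lv = Ld \<and> Ld = G \<and> (\<forall>\<theta>\<in>\<Theta>. 2 ^ G * \<theta> \<in> \<int>) \<and> \<zeta> = 0"
        then show ?thesis using w.vr_far_exact[OF _ _ _ f] \<theta> by auto
      next
        assume "Lv + 3 \<le> Ld \<and> (2 * 2 ^ g + 1) * 2 ^ Ld \<le> (2 :: int) ^ G \<and> \<zeta> = 4 ^ (m + 1) / 4 ^ Lv"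
        then show ?thesis using w.vr_far_wide[OF f] by simp
      qed
    qed simp
    finally show "weight w.QQ (w.missed m \<theta>) u \<le> 4 * \<zeta>" .
  qed
qed

section \<open>Classical post-processing\<close>

definition stages_prog :: "(nat set \<times> (nat \<Rightarrow> test list)) list \<Rightarrow> step list" where
  "stages_prog st = concat (map (\<lambda>(S, tf). xor_prog S tf) st)"

definition targets :: "(nat set \<times> (nat \<Rightarrow> test list)) list \<Rightarrow> nat set" where
  "targets st = (\<Union>(S, tf)\<in>set st. S)"

fun stages_ok :: "nat set \<Rightarrow> (nat set \<times> (nat \<Rightarrow> test list)) list \<Rightarrow> bool" where
  "stages_ok Q [] \<longleftrightarrow> True"
| "stages_ok Q ((S, tf) # st) \<longleftrightarrow> finite S \<and> S \<inter> Q = {} \<and> (\<forall>t\<in>S. \<forall>\<tau>\<in>set (tf t). test_qubits \<tau> \<subseteq> Q) \<and> stages_ok (Q \<union> S) st"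

text \<open>On fresh zero targets the program is an injective relabelling of basis states:
  \<open>E\<close> writes the results, \<open>h\<close> removes them. Squared amplitudes are merely
  transported, so post-processing can be argued as a classical computation.\<close>

lemma sum_xor_prog:
  assumes S: "finite S" "S \<inter> Q = {}" "\<And>t \<tau>. t \<in> S \<Longrightarrow> \<tau> \<in> set (tf t) \<Longrightarrow> test_qubits \<tau> \<subseteq> Q"
    and Q: "finite Q" "supp_on Q \<psi>"
  defines "E \<equiv> \<lambda>a q. if q \<in> S then parity_tests (tf q) a else a q"
  shows "supp_on (Q \<union> S) (sems \<theta> (xor_prog S tf) \<psi>)"
    and "weight (Q \<union> S) P (sems \<theta> (xor_prog S tf) \<psi>) = weight Q (\<lambda>a. P (E a)) \<psi>"
proof -
  have par: "parity_tests (tf t) b = parity_tests (tf t) b'" if "t \<in> S" "\<And>q. q \<in> Q \<Longrightarrow> b q = b' q" for t b b'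
  proof (rule parity_tests_cong)
    fix \<tau> q assume "\<tau> \<in> set (tf t)" "q \<in> test_qubits \<tau>"
    then show "b q = b' q" using S(3)[OF that(1)] that(2)[of q] by blast
  qed
  define h where "h b = (\<lambda>q. if q \<in> S then b q \<noteq> parity_tests (tf q) b else b q)" for b :: "nat \<Rightarrow> bool"
  have \<psi>1: "sems \<theta> (xor_prog S tf) \<psi> b = \<psi> (h b)" for b
  proof -
    have "sems \<theta> (xor_prog S tf) \<psi> = (\<lambda>b. \<psi> (\<lambda>q. if q \<in> S then b q \<noteq> parity_tests (tf q) b else b q))"
      by (rule sems_xor_prog[OF S(1)]) (use S in blast)
    then show ?thesis by (simp add: h_def)
  qed
  have hE: "h (E a) = a" if "a \<in> asg Q" for a
  proof
    fix q
    have "parity_tests (tf q) (E a) = parity_tests (tf q) a" if "q \<in> S"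
      by (rule par[OF that]) (use S(2) in \<open>auto simp: E_def\<close>)
    moreover have "\<not> a q" if "q \<in> S" using that \<open>a \<in> asg Q\<close> S(2) by (auto simp: asg_def)
    ultimately show "h (E a) q = a q" by (auto simp: h_def E_def)
  qed
  have Eh: "E (h b) = b" if "h b \<in> asg Q" for b
  proof
    fix q
    show "E (h b) q = b q"
    proof (cases "q \<in> S")
      case True
      then have "\<not> h b q" using that S(2) by (auto simp: asg_def)
      then have "b q = parity_tests (tf q) b" using True by (simp add: h_def)
      moreover have "parity_tests (tf q) (h b) = parity_tests (tf q) b"
        by (rule par[OF True]) (use S(2) in \<open>auto simp: h_def\<close>)
      ultimately show ?thesis using True by (simp add: E_def)
    qed (simp add: E_def h_def)
  qed
  have Easg: "E a \<in> asg (Q \<union> S)" if "a \<in> asg Q" for a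
    using that by (auto simp: asg_def E_def)
  show supp: "supp_on (Q \<union> S) (sems \<theta> (xor_prog S tf) \<psi>)"
    unfolding supp_on_def
  proof (intro allI impI)
    fix b assume b: "b \<notin> asg (Q \<union> S)"
    have "h b \<notin> asg Q"
    proof
      assume "h b \<in> asg Q"
      then have "b \<in> asg (Q \<union> S)" using Eh[of b] Easg[of "h b"] by simp
      then show False using b by simp
    qed
    then show "sems \<theta> (xor_prog S tf) \<psi> b = 0" using Q(2) by (simp add: \<psi>1 supp_on_def)
  qed
  have "(\<Sum>b\<in>asg (Q \<union> S). of_bool (P b) * (cmod (\<psi> (h b)))\<^sup>2) = (\<Sum>b\<in>{b. h b \<in> asg Q}. of_bool (P b) * (cmod (\<psi> (h b)))\<^sup>2)"
  proof (rule sum.mono_neutral_right)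
    show "finite (asg (Q \<union> S))" using Q S by (simp add: finite_asg)
    show "{b. h b \<in> asg Q} \<subseteq> asg (Q \<union> S)" using Eh Easg by force
    show "\<forall>b\<in>asg (Q \<union> S) - {b. h b \<in> asg Q}. of_bool (P b) * (cmod (\<psi> (h b)))\<^sup>2 = 0"
      using Q(2) by (simp add: supp_on_def)
  qed
  also have "\<dots> = weight Q (\<lambda>a. P (E a)) \<psi>"
    by (rule sum.reindex_bij_witness[of _ E h]) (use hE Eh in auto)
  finally show "weight (Q \<union> S) P (sems \<theta> (xor_prog S tf) \<psi>) = weight Q (\<lambda>a. P (E a)) \<psi>"
    by (simp only: \<psi>1)
qed

text \<open>\<open>F\<close> extends an input assignment by all computed registers, and the output
  distribution is the image of the input distribution under \<open>F\<close>. Its equations refer to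
  the final assignment, as later stages do not alter what earlier ones read.\<close>

lemma sum_stages_prog:
  assumes "stages_ok Q st" "finite Q" "supp_on Q \<psi>"
  shows "\<exists>F. (\<forall>a\<in>asg Q. F a \<in> asg (Q \<union> targets st) \<and> (\<forall>q\<in>Q. F a q = a q)
      \<and> (\<forall>(S, tf)\<in>set st. \<forall>q\<in>S. F a q = parity_tests (tf q) (F a)))
    \<and> (\<forall>P. weight (Q \<union> targets st) P (sems \<theta> (stages_prog st) \<psi>)
         = weight Q (\<lambda>a. P (F a)) \<psi>)"
  using assms
proof (induction st arbitrary: Q \<psi>)
  case Nil
  show ?case by (rule exI[of _ "\<lambda>a. a"]) (simp add: stages_prog_def targets_def)
next
  case (Cons s st)
  obtain S tf where s: "s = (S, tf)" by (cases s)
  have S: "finite S" "S \<inter> Q = {}" "\<And>t \<tau>. t \<in> S \<Longrightarrow> \<tau> \<in> set (tf t) \<Longrightarrow> test_qubits \<tau> \<subseteq> Q" "stages_ok (Q \<union> S) st"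
    using Cons.prems(1) by (auto simp: s)
  define \<psi>1 where "\<psi>1 = sems \<theta> (xor_prog S tf) \<psi>"
  define E where "E = (\<lambda>a q. if q \<in> S then parity_tests (tf q) a else a q)"
  have x1: "supp_on (Q \<union> S) \<psi>1" unfolding \<psi>1_def by (rule sum_xor_prog(1)[OF S(1-3) Cons.prems(2,3)])
  have x2: "weight (Q \<union> S) P \<psi>1 = weight Q (\<lambda>a. P (E a)) \<psi>" for P
    unfolding \<psi>1_def E_def by (rule sum_xor_prog(2)[OF S(1-3) Cons.prems(2,3)])
  have u: "Q \<union> targets (s # st) = Q \<union> S \<union> targets st" by (auto simp: targets_def s)
  have p: "sems \<theta> (stages_prog (s # st)) \<psi> = sems \<theta> (stages_prog st) \<psi>1"
    by (simp add: stages_prog_def s \<psi>1_def)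
  obtain F where F: "\<And>b. b \<in> asg (Q \<union> S) \<Longrightarrow> F b \<in> asg (Q \<union> S \<union> targets st)"
      "\<And>b q. b \<in> asg (Q \<union> S) \<Longrightarrow> q \<in> Q \<union> S \<Longrightarrow> F b q = b q"
      "\<And>b S' tf' q. b \<in> asg (Q \<union> S) \<Longrightarrow> (S', tf') \<in> set st \<Longrightarrow> q \<in> S' \<Longrightarrow> F b q = parity_tests (tf' q) (F b)"
      "\<And>P. weight (Q \<union> S \<union> targets st) P (sems \<theta> (stages_prog st) \<psi>1)
         = weight (Q \<union> S) (\<lambda>b. P (F b)) \<psi>1"
    using Cons.IH[OF S(4) _ x1] S(1) Cons.prems(2) by fastforce
  have Easg: "E a \<in> asg (Q \<union> S)" if "a \<in> asg Q" for a
    using that by (auto simp: asg_def E_def)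
  have FE: "F (E a) q = a q" if "a \<in> asg Q" "q \<in> Q" for a q
    using F(2)[OF Easg[OF that(1)], of q] that S(2) by (auto simp: E_def)
  have FS: "F (E a) q = parity_tests (tf q) (F (E a))" if "a \<in> asg Q" "q \<in> S" for a q
  proof -
    have "F (E a) q = parity_tests (tf q) a" using F(2)[OF Easg[OF that(1)], of q] that by (simp add: E_def)
    also have "\<dots> = parity_tests (tf q) (F (E a))"
    proof (rule parity_tests_cong)
      fix \<tau> p assume "\<tau> \<in> set (tf q)" "p \<in> test_qubits \<tau>"
      then have "p \<in> Q" using S(3)[OF that(2)] by blast
      then show "a p = F (E a) p" using FE[OF that(1)] by simp
    qed
    finally show ?thesis .
  qed
  show ?case unfolding u p
  proof (intro exI[of _ "\<lambda>a. F (E a)"] conjI ballI allI)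
    fix a assume a: "a \<in> asg Q"
    show "F (E a) \<in> asg (Q \<union> S \<union> targets st)" by (rule F(1)[OF Easg[OF a]])
    show "F (E a) q = a q" if "q \<in> Q" for q by (rule FE[OF a that])
    show "case Stf of (S, tf) \<Rightarrow> \<forall>q\<in>S. F (E a) q = parity_tests (tf q) (F (E a))" if "Stf \<in> set (s # st)" for Stf
      using that FS[OF a] F(3)[OF Easg[OF a]] by (auto simp: s)
  next
    fix P
    show "weight (Q \<union> S \<union> targets st) P (sems \<theta> (stages_prog st) \<psi>1)
         = weight Q (\<lambda>a. P (F (E a))) \<psi>"
      unfolding F(4) by (rule x2)
  qed
qed


section \<open>The nearest stop and dyadic trees\<close>

lemma parity_tests_simps:
  "parity_tests [] b \<longleftrightarrow> False"
  "parity_tests (\<tau> # ts) b \<longleftrightarrow> holds \<tau> b \<noteq> parity_tests ts b"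
  "parity_tests (ts @ us) b \<longleftrightarrow> parity_tests ts b \<noteq> parity_tests us b"
  by (auto simp: parity_tests_def)

lemma parity_tests_unique:
  assumes "distinct xs" "\<And>x y. x \<in> set xs \<Longrightarrow> y \<in> set xs \<Longrightarrow> holds (f x) b \<Longrightarrow> holds (f y) b \<Longrightarrow> x = y"
  shows "parity_tests (map f xs) b \<longleftrightarrow> (\<exists>x\<in>set xs. holds (f x) b)"
  using assms
proof (induction xs)
  case (Cons x xs)
  have "parity_tests (map f xs) b \<longleftrightarrow> (\<exists>x\<in>set xs. holds (f x) b)"
    using Cons.prems by (intro Cons.IH) auto
  moreover have "\<not> (\<exists>y\<in>set xs. holds (f y) b)" if "holds (f x) b"
    using Cons.prems that by (metis distinct.simps(2) list.set_intros)
  ultimately show ?case by (auto simp: parity_tests_simps)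
qed (simp add: parity_tests_simps)

lemma parity_tests_filter:
  "parity_tests (map f xs) b \<longleftrightarrow> odd (length (filter (\<lambda>x. holds (f x) b) xs))"
  by (simp add: parity_tests_def filter_map comp_def)

text \<open>Used with \<open>m\<close> contained in \<open>st\<close>: the last stop in
  \<open>[a, b)\<close> exists and is marked. Stops will be the odd quarter values, and the mark is
  the value 3.\<close>

definition last_stop :: "(nat \<Rightarrow> bool) \<Rightarrow> (nat \<Rightarrow> bool) \<Rightarrow> nat \<Rightarrow> nat \<Rightarrow> bool" where
  "last_stop st m a b \<longleftrightarrow> (\<exists>p. a \<le> p \<and> p < b \<and> m p \<and> (\<forall>t. p < t \<and> t < b \<longrightarrow> \<not> st t))"

text \<open>The second alternative requires the right part to be free of stops, which excludes the
  first; the disjunction is therefore an exclusive or, the connective that phases compute.\<close>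

lemma last_stop_split:
  assumes "\<And>p. m p \<Longrightarrow> st p" "a \<le> c" "c \<le> b"
  shows "last_stop st m a b \<longleftrightarrow> last_stop st m c b \<noteq> ((\<forall>t. c \<le> t \<and> t < b \<longrightarrow> \<not> st t) \<and> last_stop st m a c)"
proof (cases "\<forall>t. c \<le> t \<and> t < b \<longrightarrow> \<not> st t")
  case True
  then have "\<not> last_stop st m c b" using assms(1) by (auto simp: last_stop_def)
  moreover have "last_stop st m a b \<longleftrightarrow> last_stop st m a c"
  proof
    assume "last_stop st m a b"
    then obtain p where p: "a \<le> p" "p < b" "m p" "\<forall>t. p < t \<and> t < b \<longrightarrow> \<not> st t" by (auto simp: last_stop_def)
    have "p < c" using True p(2) assms(1)[OF p(3)] by (meson not_le)
    then show "last_stop st m a c" unfolding last_stop_def using p assms(3) by (meson order_less_le_trans)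
  next
    assume "last_stop st m a c"
    then obtain p where p: "a \<le> p" "p < c" "m p" "\<forall>t. p < t \<and> t < c \<longrightarrow> \<not> st t" by (auto simp: last_stop_def)
    have "\<not> st t" if "p < t" "t < b" for t using p(4) True that by (cases "t < c") auto
    then show "last_stop st m a b" unfolding last_stop_def using p assms(3) by (meson order_less_le_trans)
  qed
  ultimately show ?thesis using True by simp
next
  case False
  then obtain t where t: "c \<le> t" "t < b" "st t" by blast
  have "last_stop st m a b \<longleftrightarrow> last_stop st m c b"
  proof
    assume "last_stop st m a b"
    then obtain p where p: "a \<le> p" "p < b" "m p" "\<forall>t. p < t \<and> t < b \<longrightarrow> \<not> st t" by (auto simp: last_stop_def)
    have "c \<le> p" using p(4) t by (meson le_trans not_le)
    then show "last_stop st m c b" unfolding last_stop_def using p by blast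
  next
    assume "last_stop st m c b"
    then show "last_stop st m a b" unfolding last_stop_def using assms(2) by (meson le_trans)
  qed
  then show ?thesis using False by blast
qed

text \<open>The node with index \<open>i\<close> at height \<open>h\<close> stands for the dyadic
  interval from \<open>i * 2 ^ h\<close> to \<open>Suc i * 2 ^ h\<close>.\<close>

definition node :: "(nat \<Rightarrow> bool) \<Rightarrow> nat \<Rightarrow> nat \<Rightarrow> bool" where
  "node st h i \<longleftrightarrow> (\<exists>p. p div 2 ^ h = i \<and> st p)"

lemma div_eq_interval: "p div 2 ^ h = i \<longleftrightarrow> i * 2 ^ h \<le> p \<and> p < Suc i * (2::nat) ^ h"
proof -
  have "i * 2 ^ h \<le> p \<and> p < Suc i * 2 ^ h \<Longrightarrow> p div 2 ^ h = i" by (rule div_nat_eqI) (auto simp: mult.commute)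
  moreover have "p div 2 ^ h = i \<Longrightarrow> i * 2 ^ h \<le> p \<and> p < Suc i * 2 ^ h"
    using dividend_less_div_times[of "2 ^ h" p] by (auto simp: mult.commute)
  ultimately show ?thesis by blast
qed

lemma div_Suc_power: "(p::nat) div 2 ^ Suc h = p div 2 ^ h div 2"
  by (simp only: power_Suc2 div_mult2_eq)

lemma all_interval_split:
  fixes c :: nat
  assumes "a \<le> c" "c \<le> b"
  shows "(\<forall>t. a \<le> t \<and> t < b \<longrightarrow> P t) \<longleftrightarrow> (\<forall>t. a \<le> t \<and> t < c \<longrightarrow> P t) \<and> (\<forall>t. c \<le> t \<and> t < b \<longrightarrow> P t)"
proof (intro iffI conjI allI impI)
  fix t assume "(\<forall>t. a \<le> t \<and> t < c \<longrightarrow> P t) \<and> (\<forall>t. c \<le> t \<and> t < b \<longrightarrow> P t)" "a \<le> t \<and> t < b"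
  then show "P t" by (cases "t < c") auto
qed (use assms in auto)

lemma node_interval: "(\<forall>t. i * 2 ^ h \<le> t \<and> t < Suc i * 2 ^ h \<longrightarrow> \<not> st t) \<longleftrightarrow> \<not> node st h i"
  unfolding node_def div_eq_interval by blast

abbreviation right_free :: "(nat \<Rightarrow> bool) \<Rightarrow> nat \<Rightarrow> nat \<Rightarrow> bool" where
  "right_free st h p \<equiv> \<forall>t<h. even (p div 2 ^ t) \<longrightarrow> \<not> node st t (Suc (p div 2 ^ t))"

abbreviation left_free :: "(nat \<Rightarrow> bool) \<Rightarrow> nat \<Rightarrow> nat \<Rightarrow> bool" where
  "left_free st h p \<equiv> \<forall>t<h. odd (p div 2 ^ t) \<longrightarrow> \<not> node st t (p div 2 ^ t - 1)"

text \<open>Along the path upwards from leaf \<open>p\<close>, the right siblings at heights below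
  \<open>h\<close> tile the part of the block behind \<open>p\<close>. So \<open>h\<close> nodes
  replace up to \<open>2 ^ h\<close> leaves.\<close>

lemma none_after:
  "(\<forall>t. Suc p \<le> t \<and> t < Suc (p div 2 ^ h) * 2 ^ h \<longrightarrow> \<not> st t)
    \<longleftrightarrow> right_free st h p"
proof (induction h)
  case (Suc h)
  define u where "u = p div 2 ^ h"
  have lt: "Suc p \<le> Suc u * 2 ^ h" using div_eq_interval[of p h u] by (simp add: u_def)
  have d: "p div 2 ^ Suc h = u div 2" by (simp only: div_Suc_power u_def)
  have "(\<forall>t. Suc p \<le> t \<and> t < Suc (u div 2) * 2 ^ Suc h \<longrightarrow> \<not> st t)
      \<longleftrightarrow> (\<forall>t. Suc p \<le> t \<and> t < Suc u * 2 ^ h \<longrightarrow> \<not> st t) \<and> (even u \<longrightarrow> \<not> node st h (Suc u))"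
  proof (cases "even u")
    case True
    then have e: "Suc (u div 2) * 2 ^ Suc h = Suc (Suc u) * 2 ^ h" by (auto elim!: evenE)
    have le: "Suc u * 2 ^ h \<le> Suc (Suc u) * 2 ^ h" by simp
    show ?thesis unfolding e all_interval_split[OF lt le] node_interval using True by simp
  next
    case False
    then have e: "Suc (u div 2) * 2 ^ Suc h = Suc u * 2 ^ h" by (auto elim!: oddE)
    show ?thesis unfolding e using False by simp
  qed
  then show ?case unfolding d All_less_Suc Suc.IH[symmetric] u_def[symmetric] by blast
qed auto

lemma none_before:
  "(\<forall>t. p div 2 ^ h * 2 ^ h \<le> t \<and> t < p \<longrightarrow> \<not> st t)
    \<longleftrightarrow> left_free st h p"
proof (induction h)
  case (Suc h)
  define u where "u = p div 2 ^ h"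
  have lt: "u * 2 ^ h \<le> p" using div_eq_interval[of p h u] by (simp add: u_def)
  have d: "p div 2 ^ Suc h = u div 2" by (simp only: div_Suc_power u_def)
  have "(\<forall>t. u div 2 * 2 ^ Suc h \<le> t \<and> t < p \<longrightarrow> \<not> st t)
      \<longleftrightarrow> (\<forall>t. u * 2 ^ h \<le> t \<and> t < p \<longrightarrow> \<not> st t) \<and> (odd u \<longrightarrow> \<not> node st h (u - 1))"
  proof (cases "even u")
    case True
    then have e: "u div 2 * 2 ^ Suc h = u * 2 ^ h" by (auto elim!: evenE)
    show ?thesis unfolding e using True by simp
  next
    case False
    then have e: "u div 2 * 2 ^ Suc h = (u - 1) * 2 ^ h" and s: "Suc (u - 1) = u" by (auto elim!: oddE)
    have le: "(u - 1) * 2 ^ h \<le> u * 2 ^ h" by simp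
    have n: "(\<forall>t. (u - 1) * 2 ^ h \<le> t \<and> t < u * 2 ^ h \<longrightarrow> \<not> st t) \<longleftrightarrow> \<not> node st h (u - 1)"
      using node_interval[of "u - 1" h st] unfolding s .
    show ?thesis unfolding e all_interval_split[OF le lt] n using False by blast
  qed
  then show ?case unfolding d All_less_Suc Suc.IH[symmetric] u_def[symmetric] by blast
qed auto

definition node_last :: "(nat \<Rightarrow> bool) \<Rightarrow> (nat \<Rightarrow> bool) \<Rightarrow> nat \<Rightarrow> nat \<Rightarrow> bool" where
  "node_last st m h i \<longleftrightarrow> last_stop st m (i * 2 ^ h) (Suc i * 2 ^ h)"

text \<open>The left siblings on the path tile the part of the block before \<open>p\<close>, and
  the last stop lies in the lowest nonempty one. At most one height qualifies, so an odd count means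
  that one exists.\<close>

lemma last_stop_prefix:
  assumes "\<And>p. m p \<Longrightarrow> st p"
  shows "last_stop st m (p div 2 ^ h * 2 ^ h) p
    \<longleftrightarrow> odd (length (filter (\<lambda>t. odd (p div 2 ^ t) \<and> node_last st m t (p div 2 ^ t - 1)
        \<and> left_free st t p) [0..<h]))"
proof (induction h)
  case 0
  show ?case by (simp add: last_stop_def)
next
  case (Suc h)
  define u where "u = p div 2 ^ h"
  define P where "P t \<longleftrightarrow> odd (p div 2 ^ t) \<and> node_last st m t (p div 2 ^ t - 1)
        \<and> left_free st t p" for t
  have lt: "u * 2 ^ h \<le> p" using div_eq_interval[of p h u] by (simp add: u_def)
  have d: "p div 2 ^ Suc h = u div 2" by (simp only: div_Suc_power u_def)
  have "last_stop st m (u div 2 * 2 ^ Suc h) p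
      \<longleftrightarrow> last_stop st m (u * 2 ^ h) p \<noteq> (odd u \<and> node_last st m h (u - 1)
        \<and> left_free st h p)"
  proof (cases "even u")
    case True
    then have e: "u div 2 * 2 ^ Suc h = u * 2 ^ h" by (auto elim!: evenE)
    show ?thesis unfolding e using True by simp
  next
    case False
    then have e: "u div 2 * 2 ^ Suc h = (u - 1) * 2 ^ h" and s: "Suc (u - 1) = u" by (auto elim!: oddE)
    have le: "(u - 1) * 2 ^ h \<le> u * 2 ^ h" by simp
    have 1: "last_stop st m ((u - 1) * 2 ^ h) p \<longleftrightarrow> last_stop st m (u * 2 ^ h) p
        \<noteq> ((\<forall>t. u * 2 ^ h \<le> t \<and> t < p \<longrightarrow> \<not> st t) \<and> last_stop st m ((u - 1) * 2 ^ h) (u * 2 ^ h))"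
      by (rule last_stop_split[OF _ le lt]) (rule assms)
    have 2: "node_last st m h (u - 1) \<longleftrightarrow> last_stop st m ((u - 1) * 2 ^ h) (u * 2 ^ h)"
      unfolding node_last_def s ..
    define B where "B \<longleftrightarrow> left_free st h p"
    have 3: "(\<forall>t. u * 2 ^ h \<le> t \<and> t < p \<longrightarrow> \<not> st t) \<longleftrightarrow> B"
      unfolding u_def B_def by (rule none_before)
    show ?thesis unfolding e 1 2 3 B_def[symmetric] using False by (simp only: simp_thms conj_commute)
  qed
  then have 1: "last_stop st m (p div 2 ^ Suc h * 2 ^ Suc h) p \<longleftrightarrow> last_stop st m (p div 2 ^ h * 2 ^ h) p \<noteq> P h"
    unfolding d u_def P_def .
  have 2: "last_stop st m (p div 2 ^ h * 2 ^ h) p \<longleftrightarrow> odd (length (filter P [0..<h]))"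
    using Suc.IH unfolding P_def[abs_def] .
  have "length (filter P [0..<Suc h]) = length (filter P [0..<h]) + of_bool (P h)" by simp
  then have "last_stop st m (p div 2 ^ Suc h * 2 ^ Suc h) p \<longleftrightarrow> odd (length (filter P [0..<Suc h]))"
    unfolding 1 2 by (cases "P h") simp_all
  then show ?case unfolding P_def[abs_def] .
qed

text \<open>The second claim is uniqueness of the witness; it allows the existential statement to be
  computed as a parity over the leaves.\<close>

lemma node_last_sum:
  assumes "\<And>p. m p \<Longrightarrow> st p"
  shows "node_last st m h i \<longleftrightarrow> (\<exists>p. p div 2 ^ h = i \<and> m p \<and> right_free st h p)"
    and "p div 2 ^ h = i \<Longrightarrow> q div 2 ^ h = i \<Longrightarrow> m p \<Longrightarrow> m q \<Longrightarrow> right_free st h p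
      \<Longrightarrow> right_free st h q \<Longrightarrow> p = q"
proof -
  show "node_last st m h i \<longleftrightarrow> (\<exists>p. p div 2 ^ h = i \<and> m p \<and> right_free st h p)"
    unfolding none_after[symmetric] node_last_def last_stop_def Suc_le_eq
  proof (intro iffI; elim exE conjE)
    fix p assume p: "i * 2 ^ h \<le> p" "p < Suc i * 2 ^ h" "m p" "\<forall>t. p < t \<and> t < Suc i * 2 ^ h \<longrightarrow> \<not> st t"
    then have "p div 2 ^ h = i" by (simp only: div_eq_interval)
    then show "\<exists>p. p div 2 ^ h = i \<and> m p \<and> (\<forall>t. p < t \<and> t < Suc (p div 2 ^ h) * 2 ^ h \<longrightarrow> \<not> st t)"
      using p by blast
  next
    fix p assume p: "p div 2 ^ h = i" "m p" "\<forall>t. p < t \<and> t < Suc (p div 2 ^ h) * 2 ^ h \<longrightarrow> \<not> st t"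
    then have "i * 2 ^ h \<le> p \<and> p < Suc i * 2 ^ h" by (simp only: div_eq_interval[symmetric])
    then show "\<exists>p. i * 2 ^ h \<le> p \<and> p < Suc i * 2 ^ h \<and> m p \<and> (\<forall>t. p < t \<and> t < Suc i * 2 ^ h \<longrightarrow> \<not> st t)"
      using p by blast
  qed
  assume a: "p div 2 ^ h = i" "q div 2 ^ h = i" "m p" "m q"
    "right_free st h p"
    "right_free st h q"
  have "\<not> p < q" if "p div 2 ^ h = i" "q div 2 ^ h = i" "m q" "right_free st h p" for p q
  proof
    assume "p < q"
    moreover have "q < Suc (p div 2 ^ h) * 2 ^ h" using that(1,2) div_eq_interval[of q h i] by simp
    moreover have "\<forall>t. p < t \<and> t < Suc (p div 2 ^ h) * 2 ^ h \<longrightarrow> \<not> st t"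
      using that(4) unfolding none_after[symmetric] Suc_le_eq .
    ultimately show False using assms[OF that(3)] by blast
  qed
  from this[OF a(1,2,4,5)] this[OF a(2,1,3,6)] show "p = q" by simp
qed

text \<open>The search is self-similar: at block boundaries each block acts as a single position, a
  stop if it contains one and marked if its last stop is. This yields the second level of the
  tree.\<close>

lemma last_stop_blocks:
  assumes "\<And>p. m p \<Longrightarrow> st p"
  shows "last_stop st m 0 (i * 2 ^ h) \<longleftrightarrow> last_stop (node st h) (node_last st m h) 0 i"
proof (induction i)
  case (Suc i)
  have 1: "i * 2 ^ h \<le> Suc i * 2 ^ h" by simp
  have nl: "node st h p" if np: "node_last st m h p" for p
  proof -
    obtain q where "p * 2 ^ h \<le> q \<and> q < Suc p * 2 ^ h" "m q"
      using np unfolding node_last_def last_stop_def by blast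
    then have "q div 2 ^ h = p" "st q" using assms by (simp_all only: div_eq_interval)
    then show ?thesis unfolding node_def by blast
  qed
  define N M where "N = node st h" and "M = node_last st m h"
  have 2: "last_stop N M i (Suc i) \<longleftrightarrow> M i"
  proof
    assume "last_stop N M i (Suc i)"
    then obtain p where "i \<le> p" "p < Suc i" "M p" unfolding last_stop_def by blast
    moreover from this have "p = i" by simp
    ultimately show "M i" by simp
  next
    assume "M i"
    then show "last_stop N M i (Suc i)" unfolding last_stop_def by (intro exI[of _ i]) auto
  qed
  have 3: "(\<forall>t. i \<le> t \<and> t < Suc i \<longrightarrow> \<not> N t) \<longleftrightarrow> \<not> N i"
  proof
    assume a: "\<not> N i"
    show "\<forall>t. i \<le> t \<and> t < Suc i \<longrightarrow> \<not> N t"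
    proof (intro allI impI)
      fix t assume "i \<le> t \<and> t < Suc i"
      then have "t = i" by simp
      then show "\<not> N t" using a by simp
    qed
  qed simp
  have "last_stop st m 0 (Suc i * 2 ^ h) \<longleftrightarrow> last_stop st m (i * 2 ^ h) (Suc i * 2 ^ h)
      \<noteq> ((\<forall>t. i * 2 ^ h \<le> t \<and> t < Suc i * 2 ^ h \<longrightarrow> \<not> st t) \<and> last_stop st m 0 (i * 2 ^ h))"
    by (rule last_stop_split[OF _ le0 1]) (rule assms)
  then have a: "last_stop st m 0 (Suc i * 2 ^ h) \<longleftrightarrow> M i \<noteq> (\<not> N i \<and> last_stop st m 0 (i * 2 ^ h))"
    unfolding node_interval node_last_def[symmetric] N_def M_def .
  have "last_stop N M 0 (Suc i) \<longleftrightarrow> last_stop N M i (Suc i) \<noteq> ((\<forall>t. i \<le> t \<and> t < Suc i \<longrightarrow> \<not> N t) \<and> last_stop N M 0 i)"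
    by (rule last_stop_split) (use nl in \<open>simp_all add: N_def M_def\<close>)
  then have "last_stop N M 0 (Suc i) \<longleftrightarrow> M i \<noteq> (\<not> N i \<and> last_stop N M 0 i)"
    unfolding 2 3 .
  then show ?case using a Suc.IH by (simp only: N_def M_def)
qed (simp add: last_stop_def)

section \<open>Tests that compute the tree\<close>

definition leaves :: "nat \<Rightarrow> nat \<Rightarrow> nat \<Rightarrow> nat set" where
  "leaves N h i = {p. p < N \<and> p div 2 ^ h = i}"

abbreviation right_sibs :: "(nat \<Rightarrow> nat \<Rightarrow> nat) \<Rightarrow> nat \<Rightarrow> nat \<Rightarrow> nat set" where
  "right_sibs NO h p \<equiv> (\<lambda>t. NO t (Suc (p div 2 ^ t))) ` {t. t < h \<and> even (p div 2 ^ t)}"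

abbreviation left_sibs :: "(nat \<Rightarrow> nat \<Rightarrow> nat) \<Rightarrow> nat \<Rightarrow> nat \<Rightarrow> nat set" where
  "left_sibs NO h p \<equiv> (\<lambda>t. NO t (p div 2 ^ t - 1)) ` {t. t < h \<and> odd (p div 2 ^ t)}"

text \<open>The test \<open>([], 0, 0)\<close> always holds and negates the zero test.\<close>

definition or_tests :: "(nat \<Rightarrow> nat) \<Rightarrow> nat \<Rightarrow> nat \<Rightarrow> nat \<Rightarrow> test list" where
  "or_tests so N h i = [none_test (so ` leaves N h i), ([], 0, 0)]"

definition last_tests :: "(nat \<Rightarrow> nat) \<Rightarrow> (nat \<Rightarrow> nat \<Rightarrow> nat) \<Rightarrow> nat \<Rightarrow> nat \<Rightarrow> nat \<Rightarrow> test list" where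
  "last_tests sm NO N h i = map (\<lambda>p. ctrl_test (sm p)
     (none_test (right_sibs NO h p))) (sorted_list_of_set (leaves N h i))"

text \<open>\<open>X\<close> holds further qubits that must be zero; it will contain the stop bit of
  the position itself.\<close>

definition prefix_tests :: "(nat \<Rightarrow> nat \<Rightarrow> nat) \<Rightarrow> (nat \<Rightarrow> nat \<Rightarrow> nat) \<Rightarrow> nat set \<Rightarrow> nat \<Rightarrow> nat \<Rightarrow> test list" where
  "prefix_tests NO MO X H p = map (\<lambda>t. ctrl_test (MO t (p div 2 ^ t - 1))
     (none_test (X \<union> left_sibs NO t p))) (filter (\<lambda>t. odd (p div 2 ^ t)) [0..<H])"

lemma holds_ctrl_none: "finite S \<Longrightarrow> holds (ctrl_test t (none_test S)) b \<longleftrightarrow> b t \<and> (\<forall>q\<in>S. \<not> b q)"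
  by (simp only: holds_ctrl holds_none_test)

lemma finite_leaves [simp]: "finite (leaves N h i)"
  by (simp add: leaves_def)

lemma parity_or_tests: "parity_tests (or_tests so N h i) b \<longleftrightarrow> node (\<lambda>p. p < N \<and> b (so p)) h i"
  by (auto simp: or_tests_def parity_tests_simps holds_none_test node_def leaves_def)

lemma parity_last_tests:
  fixes so sm :: "nat \<Rightarrow> nat" and N :: nat
  defines "st \<equiv> \<lambda>b p. p < N \<and> b (so p)" and "m \<equiv> \<lambda>b p. p < N \<and> b (sm p)"
  assumes no: "\<And>t i. t < h \<Longrightarrow> i < N + 2 \<Longrightarrow> b (NO t i) = node (st b) t i" and m: "\<And>p. m b p \<Longrightarrow> st b p"
  shows "parity_tests (last_tests sm NO N h i) b \<longleftrightarrow> node_last (st b) (m b) h i"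
proof -
  have hl: "holds (ctrl_test (sm p) (none_test (right_sibs NO h p))) b
      \<longleftrightarrow> m b p \<and> right_free (st b) h p" if "p < N" for p
  proof -
    have "b (NO t (Suc (p div 2 ^ t))) = node (st b) t (Suc (p div 2 ^ t))" if "t < h" for t
    proof (rule no[OF that])
      show "Suc (p div 2 ^ t) < N + 2" using \<open>p < N\<close> div_le_dividend[of p "2 ^ t"] by linarith
    qed
    then show ?thesis using that by (subst holds_ctrl_none) (auto simp: m_def)
  qed
  have "parity_tests (last_tests sm NO N h i) b
      \<longleftrightarrow> (\<exists>p\<in>set (sorted_list_of_set (leaves N h i)). holds (ctrl_test (sm p) (none_test (right_sibs NO h p))) b)"
    unfolding last_tests_def
  proof (rule parity_tests_unique)
    fix p q assume "p \<in> set (sorted_list_of_set (leaves N h i))" "q \<in> set (sorted_list_of_set (leaves N h i))"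
    then have pq: "p < N" "q < N" "p div 2 ^ h = i" "q div 2 ^ h = i" by (auto simp: leaves_def)
    assume "holds (ctrl_test (sm p) (none_test (right_sibs NO h p))) b"
      "holds (ctrl_test (sm q) (none_test (right_sibs NO h q))) b"
    then show "p = q" unfolding hl[OF pq(1)] hl[OF pq(2)]
      using node_last_sum(2)[where m = "m b" and st = "st b", OF _ pq(3,4)] m by blast
  qed simp
  also have "\<dots> \<longleftrightarrow> (\<exists>p. p div 2 ^ h = i \<and> m b p \<and> right_free (st b) h p)"
    using hl by (auto simp: leaves_def m_def)
  also have "\<dots> \<longleftrightarrow> node_last (st b) (m b) h i"
    by (rule node_last_sum(1)[symmetric]) (rule m)
  finally show ?thesis .
qed

lemma parity_prefix_tests:
  assumes no: "\<And>t. t < H \<Longrightarrow> b (NO t (p div 2 ^ t - 1)) = node st t (p div 2 ^ t - 1)"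
    and mo: "\<And>t. t < H \<Longrightarrow> b (MO t (p div 2 ^ t - 1)) = node_last st m t (p div 2 ^ t - 1)"
    and m: "\<And>p. m p \<Longrightarrow> st p" and X: "finite X"
  shows "parity_tests (prefix_tests NO MO X H p) b \<longleftrightarrow> (\<forall>q\<in>X. \<not> b q) \<and> last_stop st m (p div 2 ^ H * 2 ^ H) p"
proof -
  define P where "P t \<longleftrightarrow> odd (p div 2 ^ t) \<and> node_last st m t (p div 2 ^ t - 1)
        \<and> left_free st t p" for t
  have hl: "holds (ctrl_test (MO t (p div 2 ^ t - 1))
     (none_test (X \<union> left_sibs NO t p))) b \<and> odd (p div 2 ^ t)
     \<longleftrightarrow> (\<forall>q\<in>X. \<not> b q) \<and> P t" if "t < H" for t
  proof -
    have "(\<forall>q\<in>left_sibs NO t p. \<not> b q)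
        \<longleftrightarrow> left_free st t p"
      using no that by auto
    then show ?thesis
      using X mo[OF that] by (subst holds_ctrl_none) (simp_all only: P_def ball_Un, auto)
  qed
  have "parity_tests (prefix_tests NO MO X H p) b \<longleftrightarrow> odd (length (filter (\<lambda>t. (\<forall>q\<in>X. \<not> b q) \<and> P t) [0..<H]))"
    unfolding prefix_tests_def parity_tests_filter filter_filter
    using hl by (intro arg_cong[where f = "\<lambda>l. odd (length l)"] filter_cong) auto
  also have "\<dots> \<longleftrightarrow> (\<forall>q\<in>X. \<not> b q) \<and> odd (length (filter P [0..<H]))"
    by (cases "\<forall>q\<in>X. \<not> b q") (simp_all only: simp_thms filter_True filter_False, auto)
  also have "odd (length (filter P [0..<H])) \<longleftrightarrow> last_stop st m (p div 2 ^ H * 2 ^ H) p"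
    unfolding P_def[abs_def] by (rule last_stop_prefix[symmetric]) (rule m)
  finally show ?thesis .
qed

text \<open>Kinds of registers: for every position, 0 odd quarter value, 1 quarter value 3, 2 quarter value 2; 3 and 4 tree nodes
  over the positions; 5 and 6 tree nodes over blocks of \<open>2 ^ \<tau>\<close> positions; 7 last stop before a block; 8 output.
  A single tree over all positions would cost a factor \<open>log\<^sup>3 n\<close>; with blocks of size about \<open>log\<^sup>2 n\<close> only the
  few blocks pay it.\<close>

definition reg :: "nat \<Rightarrow> nat \<Rightarrow> nat \<Rightarrow> nat \<Rightarrow> nat" where
  "reg B k h i = B + nm k h i"

lemma reg_inj [simp]: "reg B k h i = reg B k' h' i' \<longleftrightarrow> k = k' \<and> h = h' \<and> i = i'"
  by (simp add: reg_def)

lemma reg_decode [simp]: "pos (reg B k h i - B) = h" "idx (reg B k h i - B) = i" "kd (reg B k h i - B) = k"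
  by (simp_all add: reg_def)

definition grid :: "nat \<Rightarrow> nat \<Rightarrow> nat \<Rightarrow> nat \<Rightarrow> nat set" where
  "grid B k H N = (\<lambda>(h, i). reg B k h i) ` ({..H} \<times> {..<N})"

lemma finite_grid [simp]: "finite (grid B k H N)"
  by (simp add: grid_def)

lemma reg_grid [simp]: "reg B k h i \<in> grid B k' H N \<longleftrightarrow> k = k' \<and> h \<le> H \<and> i < N"
  by (auto simp: grid_def)

lemma gridE:
  assumes "q \<in> grid B k H N"
  obtains h i where "q = reg B k h i" "h \<le> H" "i < N"
  using assms by (auto simp: grid_def)

definition blk :: "nat \<Rightarrow> nat \<Rightarrow> nat" where
  "blk n \<tau> = Suc (n div 2 ^ \<tau>)"

text \<open>The exclusive or of mutually exclusive ways to reach a marked last stop: at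
  \<open>k\<close> itself, inside the block of \<open>k\<close>, or before that block. The bit for
  quarter value 2 is added on top.\<close>

definition out_tests :: "nat \<Rightarrow> nat \<Rightarrow> nat \<Rightarrow> test list" where
  "out_tests B \<tau> k = [single_test (reg B 2 0 k), single_test (reg B 1 0 k)]
     @ prefix_tests (reg B 3) (reg B 4) {reg B 0 0 k} \<tau> k
     @ [ctrl_test (reg B 7 0 (k div 2 ^ \<tau>))
         (none_test (insert (reg B 0 0 k) (left_sibs (reg B 3) \<tau> k)))]"

text \<open>The levels have more nodes than positions because the right sibling of the last node is
  read too.\<close>

definition post :: "nat \<Rightarrow> nat \<Rightarrow> nat \<Rightarrow> nat \<Rightarrow> (nat set \<times> (nat \<Rightarrow> test list)) list" where
  "post B n \<tau> H =
    [(grid B 3 \<tau> (n + 2), \<lambda>q. or_tests (reg B 0 0) n (pos (q - B)) (idx (q - B))),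
     (grid B 4 \<tau> (n + 2), \<lambda>q. last_tests (reg B 1 0) (reg B 3) n (pos (q - B)) (idx (q - B))),
     (grid B 5 H (blk n \<tau> + 2), \<lambda>q. or_tests (reg B 3 \<tau>) (blk n \<tau>) (pos (q - B)) (idx (q - B))),
     (grid B 6 H (blk n \<tau> + 2), \<lambda>q. last_tests (reg B 4 \<tau>) (reg B 5) (blk n \<tau>) (pos (q - B)) (idx (q - B))),
     (grid B 7 0 (blk n \<tau>), \<lambda>q. prefix_tests (reg B 5) (reg B 6) {} H (idx (q - B))),
     (grid B 8 0 n, \<lambda>q. out_tests B \<tau> (idx (q - B)))]"

lemma blk_bound: "p < n \<Longrightarrow> p div 2 ^ \<tau> < blk n \<tau>" "blk n \<tau> \<le> n + 1"
  unfolding blk_def using div_le_mono[of p n "2 ^ \<tau>"] div_le_dividend[of n "2 ^ \<tau>"] by linarith+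

lemma post_correct:
  assumes eq: "\<forall>(S, tf)\<in>set (post B n \<tau> H). \<forall>q\<in>S. b q = parity_tests (tf q) b"
    and H: "blk n \<tau> \<le> 2 ^ H"
    and mo: "\<And>p. p < n \<Longrightarrow> b (reg B 1 0 p) \<Longrightarrow> b (reg B 0 0 p)"
    and k: "k < n"
  shows "b (reg B 8 0 k) \<longleftrightarrow> b (reg B 2 0 k)
    \<noteq> last_stop (\<lambda>p. p < n \<and> b (reg B 0 0 p)) (\<lambda>p. p < n \<and> b (reg B 1 0 p)) 0 (Suc k)"
proof -
  define st where "st = (\<lambda>p. p < n \<and> b (reg B 0 0 p))"
  define m where "m = (\<lambda>p. p < n \<and> b (reg B 1 0 p))"
  have ms: "m p \<Longrightarrow> st p" for p using mo by (simp add: m_def st_def)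
  have le2: "a div 2 ^ t - 1 < c + 2" if "a < c" for a t c :: nat
    using that div_le_dividend[of a "2 ^ t"] by linarith
  have e3: "b (reg B 3 h i) = node st h i" if "h \<le> \<tau>" "i < n + 2" for h i
  proof -
    have "b (reg B 3 h i) = parity_tests (or_tests (reg B 0 0) n h i) b"
      using eq that by (auto simp: post_def)
    then show ?thesis by (simp only: parity_or_tests st_def)
  qed
  have e4: "b (reg B 4 h i) = node_last st m h i" if "h \<le> \<tau>" "i < n + 2" for h i
  proof -
    have "b (reg B 4 h i) = parity_tests (last_tests (reg B 1 0) (reg B 3) n h i) b"
      using eq that by (auto simp: post_def)
    also have "\<dots> = node_last st m h i"
      unfolding st_def m_def
      by (rule parity_last_tests) (use e3 mo that in \<open>auto simp: st_def\<close>)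
    finally show ?thesis .
  qed
  define st2 where "st2 = node st \<tau>"
  define m2 where "m2 = node_last st m \<tau>"
  have ms2: "m2 i \<Longrightarrow> st2 i" for i
  proof -
    assume "m2 i"
    then obtain p where "i * 2 ^ \<tau> \<le> p \<and> p < Suc i * 2 ^ \<tau>" "m p"
      unfolding m2_def node_last_def last_stop_def by blast
    then have "p div 2 ^ \<tau> = i" "st p" using ms by (simp_all only: div_eq_interval)
    then show "st2 i" unfolding st2_def node_def by blast
  qed
  have st2b: "i < blk n \<tau>" if "st2 i" for i
    using that blk_bound(1) unfolding st2_def node_def st_def by blast
  have l2: "(\<lambda>i. i < blk n \<tau> \<and> b (reg B 3 \<tau> i)) = st2" "(\<lambda>i. i < blk n \<tau> \<and> b (reg B 4 \<tau> i)) = m2"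
  proof -
    have "b (reg B 3 \<tau> i) = st2 i" "b (reg B 4 \<tau> i) = m2 i" if "i < blk n \<tau>" for i
      using e3[of \<tau> i] e4[of \<tau> i] that blk_bound(2)[of n \<tau>] by (auto simp: st2_def m2_def)
    then show "(\<lambda>i. i < blk n \<tau> \<and> b (reg B 3 \<tau> i)) = st2" "(\<lambda>i. i < blk n \<tau> \<and> b (reg B 4 \<tau> i)) = m2"
      using st2b ms2 by (auto simp: fun_eq_iff)
  qed
  have e5: "b (reg B 5 h i) = node st2 h i" if "h \<le> H" "i < blk n \<tau> + 2" for h i
  proof -
    have "b (reg B 5 h i) = parity_tests (or_tests (reg B 3 \<tau>) (blk n \<tau>) h i) b"
      using eq that by (auto simp: post_def)
    then show ?thesis by (simp only: parity_or_tests l2)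
  qed
  have e6: "b (reg B 6 h i) = node_last st2 m2 h i" if "h \<le> H" "i < blk n \<tau> + 2" for h i
  proof -
    have "b (reg B 6 h i) = parity_tests (last_tests (reg B 4 \<tau>) (reg B 5) (blk n \<tau>) h i) b"
      using eq that by (auto simp: post_def)
    also have "\<dots> = node_last (\<lambda>i. i < blk n \<tau> \<and> b (reg B 3 \<tau> i)) (\<lambda>i. i < blk n \<tau> \<and> b (reg B 4 \<tau> i)) h i"
    proof (rule parity_last_tests)
      fix p assume "p < blk n \<tau> \<and> b (reg B 4 \<tau> p)"
      then have "m2 p" using fun_cong[OF l2(2), of p] by simp
      then show "p < blk n \<tau> \<and> b (reg B 3 \<tau> p)" using ms2 fun_cong[OF l2(1), of p] by simp
    qed (use e5 that in \<open>simp add: l2\<close>)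
    finally show ?thesis by (simp only: l2)
  qed
  have e7: "b (reg B 7 0 i) = last_stop st m 0 (i * 2 ^ \<tau>)" if i: "i < blk n \<tau>" for i
  proof -
    have "b (reg B 7 0 i) = parity_tests (prefix_tests (reg B 5) (reg B 6) {} H i) b"
      using eq i by (auto simp: post_def)
    also have "\<dots> \<longleftrightarrow> (\<forall>q\<in>{}. \<not> b q) \<and> last_stop st2 m2 (i div 2 ^ H * 2 ^ H) i"
      by (rule parity_prefix_tests) (use le2[OF i] e5 e6 ms2 in auto)
    \<comment> \<open>The second tree has a single root over all blocks, so its prefixes start at
      0.\<close>
    also have "i div 2 ^ H = 0" using i H by simp
    finally have "b (reg B 7 0 i) = last_stop st2 m2 0 i" by simp
    also have "\<dots> = last_stop st m 0 (i * 2 ^ \<tau>)"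
      unfolding st2_def m2_def by (rule last_stop_blocks[symmetric]) (rule ms)
    finally show ?thesis .
  qed
  define c where "c = k div 2 ^ \<tau> * 2 ^ \<tau>"
  have ck: "c \<le> k" using div_eq_interval[of k \<tau> "k div 2 ^ \<tau>"] by (simp add: c_def)
  have pre: "parity_tests (prefix_tests (reg B 3) (reg B 4) {reg B 0 0 k} \<tau> k) b \<longleftrightarrow> \<not> st k \<and> last_stop st m c k"
  proof -
    have "parity_tests (prefix_tests (reg B 3) (reg B 4) {reg B 0 0 k} \<tau> k) b
        \<longleftrightarrow> (\<forall>q\<in>{reg B 0 0 k}. \<not> b q) \<and> last_stop st m (k div 2 ^ \<tau> * 2 ^ \<tau>) k"
      by (rule parity_prefix_tests) (use le2[OF k] e3 e4 ms in auto)
    then show ?thesis using k by (simp add: st_def c_def)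
  qed
  have nb: "holds (ctrl_test (reg B 7 0 (k div 2 ^ \<tau>))
         (none_test (insert (reg B 0 0 k) (left_sibs (reg B 3) \<tau> k)))) b
      \<longleftrightarrow> last_stop st m 0 c \<and> \<not> st k \<and> (\<forall>t. c \<le> t \<and> t < k \<longrightarrow> \<not> st t)"
  proof -
    have "(\<forall>q\<in>left_sibs (reg B 3) \<tau> k. \<not> b q)
        \<longleftrightarrow> (\<forall>t. c \<le> t \<and> t < k \<longrightarrow> \<not> st t)"
      unfolding c_def none_before using e3 le2[OF k] by auto
    moreover have "b (reg B 7 0 (k div 2 ^ \<tau>)) = last_stop st m 0 c"
      unfolding c_def by (rule e7[OF blk_bound(1)[OF k]])
    ultimately show ?thesis using k by (subst holds_ctrl_none) (auto simp: st_def)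
  qed
  have "b (reg B 8 0 k) = parity_tests (out_tests B \<tau> k) b"
    using eq k by (auto simp: post_def)
  also have "\<dots> \<longleftrightarrow> b (reg B 2 0 k) \<noteq> (m k \<noteq> ((\<not> st k \<and> last_stop st m c k)
      \<noteq> (last_stop st m 0 c \<and> \<not> st k \<and> (\<forall>t. c \<le> t \<and> t < k \<longrightarrow> \<not> st t))))"
  proof -
    have "b (reg B 1 0 k) = m k" using k by (simp add: m_def)
    then show ?thesis unfolding out_tests_def parity_tests_simps pre nb holds_single_test by blast
  qed
  also have "\<dots> \<longleftrightarrow> b (reg B 2 0 k) \<noteq> last_stop st m 0 (Suc k)"
  proof -
    have 1: "last_stop st m 0 (Suc k) \<longleftrightarrow> last_stop st m k (Suc k) \<noteq> ((\<forall>t. k \<le> t \<and> t < Suc k \<longrightarrow> \<not> st t) \<and> last_stop st m 0 k)"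
      by (rule last_stop_split) (auto simp: ms)
    have 2: "last_stop st m k (Suc k) \<longleftrightarrow> m k"
      unfolding last_stop_def using le_less_Suc_eq by auto
    have 3: "(\<forall>t. k \<le> t \<and> t < Suc k \<longrightarrow> \<not> st t) \<longleftrightarrow> \<not> st k"
      using le_less_Suc_eq by auto
    have 4: "last_stop st m 0 k \<longleftrightarrow> last_stop st m c k \<noteq> ((\<forall>t. c \<le> t \<and> t < k \<longrightarrow> \<not> st t) \<and> last_stop st m 0 c)"
      by (rule last_stop_split) (auto simp: ms ck)
    show ?thesis unfolding 1 2 3 4 by blast
  qed
  finally show ?thesis unfolding st_def m_def .
qed

lemma test_qubits_ctrl_none: "finite S \<Longrightarrow> test_qubits (ctrl_test t (none_test S)) = insert t S"
  by (simp only: test_qubits_ctrl test_qubits_none_test)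

lemma grid_kind: "q \<in> grid B k H N \<Longrightarrow> B \<le> q \<and> kd (q - B) = k"
  by (auto simp: grid_def reg_def)

lemma qubits_or_tests: "\<tau> \<in> set (or_tests so N h i) \<Longrightarrow> test_qubits \<tau> \<subseteq> so ` {..<N}"
  unfolding or_tests_def using test_qubits_none_test[of "so ` leaves N h i"] by (auto simp: leaves_def)

lemma qubits_last_tests:
  assumes "\<tau> \<in> set (last_tests sm NO N h i)"
  shows "test_qubits \<tau> \<subseteq> sm ` {..<N} \<union> (\<lambda>(h, i). NO h i) ` ({..<h} \<times> {..<N + 2})"
proof -
  obtain p where p: "p \<in> leaves N h i" "\<tau> = ctrl_test (sm p) (none_test (right_sibs NO h p))"
    using assms by (auto simp: last_tests_def)
  have "Suc (p div 2 ^ t) < N + 2" for t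
    using p(1) div_le_dividend[of p "2 ^ t"] by (simp add: leaves_def del: div_le_dividend)
  then show ?thesis using p(1) unfolding p(2) by (subst test_qubits_ctrl_none) (auto simp: leaves_def)
qed

lemma qubits_prefix_tests:
  assumes "\<tau> \<in> set (prefix_tests NO MO X H p)" "finite X" "p < N"
  shows "test_qubits \<tau> \<subseteq> X \<union> (\<lambda>(h, i). NO h i) ` ({..<H} \<times> {..<N}) \<union> (\<lambda>(h, i). MO h i) ` ({..<H} \<times> {..<N})"
proof -
  obtain t where t: "t < H" "\<tau> = ctrl_test (MO t (p div 2 ^ t - 1))
     (none_test (X \<union> left_sibs NO t p))"
    using assms(1) by (auto simp: prefix_tests_def)
  have "p div 2 ^ s - 1 < N" for s
    using assms(3) div_le_dividend[of p "2 ^ s"] by linarith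
  then show ?thesis using t(1) assms(2) unfolding t(2) by (subst test_qubits_ctrl_none) auto
qed

lemma stages_ok_post:
  assumes "Q \<subseteq> {..<B}"
  shows "stages_ok (Q \<union> grid B 0 0 n \<union> grid B 1 0 n \<union> grid B 2 0 n) (post B n \<tau> H)"
proof -
  define Q0 where "Q0 = Q \<union> grid B 0 0 n \<union> grid B 1 0 n \<union> grid B 2 0 n"
  have kinds: "q \<notin> grid B k H' N'" if "q \<in> Q0" "k > 2" for q k H' N'
  proof
    assume "q \<in> grid B k H' N'"
    then have "B \<le> q" "kd (q - B) = k" using grid_kind by blast+
    then show False using that assms by (auto simp: Q0_def subset_iff dest: grid_kind)
  qed
  have dis: "grid B k H' N' \<inter> Q0 = {}" if "k > 2" for k H' N'
    using kinds that by blast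
  have disk: "grid B k H' N' \<inter> grid B k' H'' N'' = {}" if "k \<noteq> k'" for k k' H' N' H'' N''
    using grid_kind that by blast
  have b2: "blk n \<tau> \<le> n + 1" by (rule blk_bound(2))
  let ?Q4 = "Q0 \<union> grid B 3 \<tau> (n + 2) \<union> grid B 4 \<tau> (n + 2)"
  let ?Q6 = "?Q4 \<union> grid B 5 H (blk n \<tau> + 2) \<union> grid B 6 H (blk n \<tau> + 2)"
  show ?thesis unfolding post_def stages_ok.simps Q0_def[symmetric]
  proof (intro conjI ballI TrueI finite_grid)
    fix q t assume "q \<in> grid B 3 \<tau> (n + 2)" "t \<in> set (or_tests (reg B 0 0) n (pos (q - B)) (idx (q - B)))"
    then show "test_qubits t \<subseteq> Q0"
      using qubits_or_tests by (fastforce simp: Q0_def)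
  next
    fix q t assume q: "q \<in> grid B 4 \<tau> (n + 2)" and t: "t \<in> set (last_tests (reg B 1 0) (reg B 3) n (pos (q - B)) (idx (q - B)))"
    show "test_qubits t \<subseteq> Q0 \<union> grid B 3 \<tau> (n + 2)"
      using qubits_last_tests[OF t] q by (auto elim!: gridE simp: Q0_def subset_iff)
  next
    fix q t assume "q \<in> grid B 5 H (blk n \<tau> + 2)" "t \<in> set (or_tests (reg B 3 \<tau>) (blk n \<tau>) (pos (q - B)) (idx (q - B)))"
    then show "test_qubits t \<subseteq> ?Q4"
      using qubits_or_tests b2 by fastforce
  next
    fix q t assume q: "q \<in> grid B 6 H (blk n \<tau> + 2)" and t: "t \<in> set (last_tests (reg B 4 \<tau>) (reg B 5) (blk n \<tau>) (pos (q - B)) (idx (q - B)))"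
    show "test_qubits t \<subseteq> ?Q4 \<union> grid B 5 H (blk n \<tau> + 2)"
      using qubits_last_tests[OF t] q b2 by (auto elim!: gridE simp: subset_iff)
  next
    fix q t assume q: "q \<in> grid B 7 0 (blk n \<tau>)" and t: "t \<in> set (prefix_tests (reg B 5) (reg B 6) {} H (idx (q - B)))"
    then have i: "idx (q - B) < blk n \<tau>" by (auto elim!: gridE)
    show "test_qubits t \<subseteq> ?Q6"
      using qubits_prefix_tests[OF t _ i] by (auto simp: subset_iff)
  next
    fix q t assume q: "q \<in> grid B 8 0 n" and t: "t \<in> set (out_tests B \<tau> (idx (q - B)))"
    then have k: "idx (q - B) < n" by (auto elim!: gridE)
    define k where "k = idx (q - B)"
    have kb: "k div 2 ^ \<tau> < blk n \<tau>" "k < n" using k blk_bound(1) by (auto simp: k_def)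
    have km: "k div 2 ^ s - 1 < n + 2" for s using kb(2) div_le_dividend[of k "2 ^ s"] by linarith
    show "test_qubits t \<subseteq> ?Q6 \<union> grid B 7 0 (blk n \<tau>)"
    proof -
      consider "t = single_test (reg B 2 0 k)" | "t = single_test (reg B 1 0 k)"
        | "t \<in> set (prefix_tests (reg B 3) (reg B 4) {reg B 0 0 k} \<tau> k)"
        | "t = ctrl_test (reg B 7 0 (k div 2 ^ \<tau>))
         (none_test (insert (reg B 0 0 k) (left_sibs (reg B 3) \<tau> k)))"
        using t unfolding out_tests_def k_def by auto
      then show ?thesis
      proof cases
        case 3
        show ?thesis using qubits_prefix_tests[OF 3 _ kb(2)] kb(2) by (auto simp: subset_iff Q0_def)
      next
        case 4
        have "test_qubits t = insert (reg B 7 0 (k div 2 ^ \<tau>)) (insert (reg B 0 0 k) (left_sibs (reg B 3) \<tau> k))"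
          unfolding 4 by (rule test_qubits_ctrl_none) simp
        then show ?thesis using kb km by (auto simp: Q0_def)
      qed (use kb in \<open>auto simp: single_test_def Q0_def\<close>)
    qed
  qed (simp_all add: Int_Un_distrib dis disk)
qed

section \<open>Cost of the post-processing\<close>

definition tests_cost :: "test list \<Rightarrow> nat" where
  "tests_cost ts = (\<Sum>\<tau>\<leftarrow>ts. test_cost \<tau>)"

lemma tests_cost_append: "tests_cost (ts @ us) = tests_cost ts + tests_cost us"
  by (simp add: tests_cost_def)

lemma test_cost_ctrl_le: "test_cost (ctrl_test t \<tau>) \<le> 4 * test_cost \<tau>"
proof -
  obtain ws v T where \<tau>: "\<tau> = (ws, v, T)" by (cases \<tau>)
  have "(length ws + 2) * (T + 2) \<le> (2 * (length ws + 1)) * (2 * (T + 1))" by (rule mult_mono) auto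
  moreover have "(T + 2) * 2 ^ (T + 1) \<le> (2 * (T + 1)) * 2 ^ (T + 1)" by (rule mult_right_mono) auto
  ultimately show ?thesis unfolding \<tau> test_cost_ctrl by simp
qed

lemma prog_size_xor_le:
  assumes "finite S"
  shows "prog_size (xor_prog S tf) \<le> 2 * card S + 400 * (\<Sum>t\<in>S. tests_cost (tf t)) + 1"
proof -
  have 1: "tcost (map (\<lambda>\<tau>. (pi, ctrl_test t \<tau>)) ts) \<le> 4 * tests_cost ts" for t ts
  proof (induction ts)
    case (Cons \<tau> ts)
    then show ?case using test_cost_ctrl_le[of t \<tau>] by (simp add: tcost_def tests_cost_def del: ctrl_test.simps)
  qed (simp add: tcost_def)
  have "tcost (concat (map (\<lambda>t. map (\<lambda>\<tau>. (pi, ctrl_test t \<tau>)) (tf t)) (sorted_list_of_set S)))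
      = (\<Sum>t\<in>S. tcost (map (\<lambda>\<tau>. (pi, ctrl_test t \<tau>)) (tf t)))"
    using assms by (simp add: tcost_concat sum_list_distinct_conv_sum_set)
  also have "\<dots> \<le> (\<Sum>t\<in>S. 4 * tests_cost (tf t))" by (rule sum_mono) (rule 1)
  also have "\<dots> = 4 * (\<Sum>t\<in>S. tests_cost (tf t))" by (rule sum_distrib_left[symmetric])
  finally show ?thesis by (simp add: xor_prog_def prog_Cons prog_Nil)
qed

lemma none_test_cost_card:
  assumes "finite S" "card S \<le> k"
  shows "test_cost (none_test S) \<le> (k + 1) * (3 * k + 2)"
proof -
  have "card S < 2 ^ k" using assms(2) less_exp[of k] by linarith
  then have "lg (card S) \<le> k" by (rule lg_le)
  then have "(lg (card S) + 1) * (3 * card S + 2) \<le> (k + 1) * (3 * k + 2)" using assms(2) by (intro mult_mono) auto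
  then show ?thesis using none_test_cost[OF refl assms(1)] by linarith
qed

lemma ctrl_none_cost:
  assumes "finite S" "card S \<le> k"
  shows "test_cost (ctrl_test t (none_test S)) \<le> 12 * ((k + 1) * (k + 1))"
proof -
  have "(k + 1) * (3 * k + 2) \<le> (k + 1) * (3 * (k + 1))" by (rule mult_left_mono) auto
  then show ?thesis using none_test_cost_card[OF assms] test_cost_ctrl_le[of t "none_test S"] by simp
qed

lemma sum_grid:
  "(\<Sum>q\<in>grid B k H N. f (pos (q - B)) (idx (q - B))) = (\<Sum>h\<le>H. \<Sum>i<N. f h i)"
proof -
  have "(\<Sum>q\<in>grid B k H N. f (pos (q - B)) (idx (q - B))) = (\<Sum>(h, i)\<in>{..H} \<times> {..<N}. f h i)"
    unfolding grid_def by (subst sum.reindex) (auto simp: inj_on_def intro!: sum.cong)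
  then show ?thesis by (simp add: sum.cartesian_product)
qed

lemma card_grid: "card (grid B k H N) = (H + 1) * N"
  unfolding grid_def by (subst card_image) (auto simp: inj_on_def card_cartesian_product)

lemma sum_card_leaves: "(\<Sum>i<M. card (leaves N h i)) \<le> N"
proof -
  have "(\<Sum>i<M. card (leaves N h i)) = card (\<Union>i<M. leaves N h i)"
    by (rule card_UN_disjoint[symmetric]) (auto simp: leaves_def)
  also have "\<dots> \<le> card {..<N}" by (rule card_mono) (auto simp: leaves_def)
  finally show ?thesis by simp
qed

text \<open>A node of height \<open>h\<close> has at most \<open>2 ^ h\<close> leaves, so its
  counter has at most \<open>h + 1\<close> bits; over one level the leaves are disjoint, which makes
  the level linear in \<open>N\<close> up to the factor \<open>h + 2\<close>.\<close>

lemma or_tests_cost: "tests_cost (or_tests so N h i) \<le> (h + 2) * (3 * card (leaves N h i) + 4)"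
proof -
  define S where "S = so ` leaves N h i"
  have c: "card S \<le> card (leaves N h i)" unfolding S_def by (rule card_image_le) simp
  have "leaves N h i \<subseteq> {i * 2 ^ h..<Suc i * 2 ^ h}"
    unfolding leaves_def div_eq_interval by auto
  then have "card (leaves N h i) \<le> card {i * 2 ^ h..<Suc i * 2 ^ h}" by (intro card_mono) auto
  then have "card S < 2 ^ (h + 1)" using c by (simp add: le_less_trans)
  then have "lg (card S) \<le> h + 1" by (rule lg_le)
  then have "(lg (card S) + 1) * (3 * card S + 2) \<le> (h + 2) * (3 * card (leaves N h i) + 2)"
    using c by (intro mult_mono) auto
  moreover have "test_cost (none_test S) \<le> (lg (card S) + 1) * (3 * card S + 2)"
    by (rule none_test_cost) (simp_all add: S_def)
  moreover have "tests_cost (or_tests so N h i) = test_cost (none_test S) + 2"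
    by (simp add: or_tests_def tests_cost_def S_def)
  ultimately show ?thesis by (simp add: algebra_simps)
qed

lemma last_tests_cost: "tests_cost (last_tests sm NO N h i) \<le> card (leaves N h i) * (12 * ((h + 1) * (h + 1)))"
proof -
  have "tests_cost (last_tests sm NO N h i) = (\<Sum>p\<in>leaves N h i. test_cost (ctrl_test (sm p)
     (none_test (right_sibs NO h p))))"
    by (simp add: tests_cost_def last_tests_def comp_def sum_list_distinct_conv_sum_set)
  also have "\<dots> \<le> (\<Sum>p\<in>leaves N h i. 12 * ((h + 1) * (h + 1)))"
  proof (rule sum_mono, rule ctrl_none_cost)
    fix p
    have "card (right_sibs NO h p) \<le> card {t. t < h \<and> even (p div 2 ^ t)}"
      by (rule card_image_le) simp
    also have "\<dots> \<le> card {..<h}" by (rule card_mono) auto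
    finally show "card (right_sibs NO h p) \<le> h" by simp
  qed simp
  finally show ?thesis by simp
qed

lemma prefix_tests_cost:
  assumes "finite X" "card X \<le> 1"
  shows "tests_cost (prefix_tests NO MO X H p) \<le> H * (12 * ((H + 2) * (H + 2)))"
proof -
  have "tests_cost (prefix_tests NO MO X H p) \<le> (\<Sum>t\<leftarrow>filter (\<lambda>t. odd (p div 2 ^ t)) [0..<H]. 12 * ((H + 2) * (H + 2)))"
    unfolding tests_cost_def prefix_tests_def map_map
  proof (rule sum_list_mono)
    fix t assume "t \<in> set (filter (\<lambda>t. odd (p div 2 ^ t)) [0..<H])"
    then have t: "t < H" by simp
    let ?S = "X \<union> left_sibs NO t p"
    have "card (left_sibs NO t p) \<le> card {s. s < t \<and> odd (p div 2 ^ s)}"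
      by (rule card_image_le) simp
    also have "\<dots> \<le> card {..<t}" by (rule card_mono) auto
    finally have "card ?S \<le> H + 1" using card_Un_le[of X "left_sibs NO t p"] assms t by simp
    from ctrl_none_cost[OF _ this] show "(test_cost \<circ> (\<lambda>t. ctrl_test (MO t (p div 2 ^ t - 1))
     (none_test (X \<union> left_sibs NO t p)))) t \<le> 12 * ((H + 2) * (H + 2))"
      using assms(1) by simp
  qed
  also have "\<dots> = length (filter (\<lambda>t. odd (p div 2 ^ t)) [0..<H]) * (12 * ((H + 2) * (H + 2)))"
    by (simp add: sum_list_triv)
  also have "\<dots> \<le> H * (12 * ((H + 2) * (H + 2)))"
    using length_filter_le[of "\<lambda>t. odd (p div 2 ^ t)" "[0..<H]"] by (intro mult_right_mono) auto
  finally show ?thesis .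
qed

lemma size_grid:
  fixes c Y :: nat
  assumes "(\<Sum>h\<le>H. \<Sum>i<N. tests_cost (f h i)) \<le> c * Y" "(H + 1) * N \<le> 3 * Y" "1 \<le> Y"
  shows "prog_size (xor_prog (grid B k H N) (\<lambda>q. f (pos (q - B)) (idx (q - B)))) \<le> (400 * c + 7) * Y"
proof -
  define S where "S = (\<Sum>h\<le>H. \<Sum>i<N. tests_cost (f h i))"
  have "prog_size (xor_prog (grid B k H N) (\<lambda>q. f (pos (q - B)) (idx (q - B)))) \<le> 2 * ((H + 1) * N) + 400 * S + 1"
    using prog_size_xor_le[OF finite_grid[of B k H N], of "\<lambda>q. f (pos (q - B)) (idx (q - B))"]
    unfolding sum_grid[where f = "\<lambda>h i. tests_cost (f h i)"] card_grid S_def .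
  also have "\<dots> \<le> 2 * (3 * Y) + 400 * (c * Y) + 1 * Y"
    using assms unfolding S_def by (intro add_mono mult_left_mono) auto
  finally show ?thesis by (simp add: add_mult_distrib)
qed

lemma node_count:
  fixes H N :: nat
  assumes "N \<ge> 1"
  shows "(H + 1) * (N + 2) \<le> 3 * (N * (H + 2) ^ 3)" "1 \<le> N * (H + 2) ^ 3"
proof -
  have "(H + 1) * 1 * 1 \<le> (H + 2) * (H + 2) * (H + 2)" by (intro mult_mono) auto
  then have "(H + 1) * (N + 2) \<le> (H + 2) * (H + 2) * (H + 2) * (3 * N)" using assms by (intro mult_mono) auto
  then show "(H + 1) * (N + 2) \<le> 3 * (N * (H + 2) ^ 3)" unfolding power3_eq_cube by (simp only: mult_ac)
  have "1 * 1 \<le> N * (H + 2) ^ 3" using assms by (intro mult_mono) auto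
  then show "1 \<le> N * (H + 2) ^ 3" by simp
qed

lemma size_or_stage:
  assumes "N \<ge> 1"
  shows "prog_size (xor_prog (grid B k H (N + 2)) (\<lambda>q. or_tests so N (pos (q - B)) (idx (q - B)))) \<le> 7000 * (N * (H + 2) ^ 3)"
proof -
  have "(\<Sum>h\<le>H. \<Sum>i<N + 2. tests_cost (or_tests so N h i)) \<le> (\<Sum>h\<le>H. (H + 2) * (15 * N))"
  proof (rule sum_mono)
    fix h assume h: "h \<in> {..H}"
    have "(\<Sum>i<N + 2. tests_cost (or_tests so N h i)) \<le> (\<Sum>i<N + 2. (H + 2) * (3 * card (leaves N h i) + 4))"
      by (intro sum_mono order_trans[OF or_tests_cost] mult_right_mono) (use h in auto)
    also have "\<dots> = (H + 2) * (3 * (\<Sum>i<N + 2. card (leaves N h i)) + 4 * (N + 2))"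
      by (simp only: sum_distrib_left[symmetric] sum.distrib sum_constant card_lessThan) simp
    also have "\<dots> \<le> (H + 2) * (15 * N)"
    proof (rule mult_left_mono)
      have "3 * c + 4 * (N + 2) \<le> 15 * N" if "c \<le> N" for c using that assms by simp
      then show "3 * (\<Sum>i<N + 2. card (leaves N h i)) + 4 * (N + 2) \<le> 15 * N"
        using sum_card_leaves by blast
    qed simp
    finally show "(\<Sum>i<N + 2. tests_cost (or_tests so N h i)) \<le> (H + 2) * (15 * N)" .
  qed
  also have "\<dots> = 15 * (N * ((H + 1) * (H + 2) * 1))" by (simp add: algebra_simps)
  also have "\<dots> \<le> 15 * (N * ((H + 2) * (H + 2) * (H + 2)))" by (intro mult_left_mono mult_mono) auto
  finally have "(\<Sum>h\<le>H. \<Sum>i<N + 2. tests_cost (or_tests so N h i)) \<le> 15 * (N * (H + 2) ^ 3)"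
    by (simp only: power3_eq_cube)
  from size_grid[where f = "or_tests so N", OF this node_count[OF assms], of B k] show ?thesis
    by (rule order_trans) (rule mult_right_mono, simp_all)
qed

lemma size_last_stage:
  assumes "N \<ge> 1"
  shows "prog_size (xor_prog (grid B k H (N + 2)) (\<lambda>q. last_tests sm NO N (pos (q - B)) (idx (q - B)))) \<le> 7000 * (N * (H + 2) ^ 3)"
proof -
  have "(\<Sum>h\<le>H. \<Sum>i<N + 2. tests_cost (last_tests sm NO N h i)) \<le> (\<Sum>h\<le>H. N * (12 * ((H + 1) * (H + 1))))"
  proof (rule sum_mono)
    fix h assume h: "h \<in> {..H}"
    have "(\<Sum>i<N + 2. tests_cost (last_tests sm NO N h i)) \<le> (\<Sum>i<N + 2. card (leaves N h i) * (12 * ((H + 1) * (H + 1))))"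
      by (intro sum_mono order_trans[OF last_tests_cost] mult_left_mono mult_mono) (use h in auto)
    also have "\<dots> = (\<Sum>i<N + 2. card (leaves N h i)) * (12 * ((H + 1) * (H + 1)))"
      by (rule sum_distrib_right[symmetric])
    also have "\<dots> \<le> N * (12 * ((H + 1) * (H + 1)))" by (rule mult_right_mono[OF sum_card_leaves]) simp
    finally show "(\<Sum>i<N + 2. tests_cost (last_tests sm NO N h i)) \<le> N * (12 * ((H + 1) * (H + 1)))" .
  qed
  also have "\<dots> = 12 * (N * ((H + 1) * (H + 1) * (H + 1)))" by (simp add: algebra_simps)
  also have "\<dots> \<le> 12 * (N * ((H + 2) * (H + 2) * (H + 2)))" by (intro mult_left_mono mult_mono) auto
  finally have "(\<Sum>h\<le>H. \<Sum>i<N + 2. tests_cost (last_tests sm NO N h i)) \<le> 12 * (N * (H + 2) ^ 3)"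
    by (simp only: power3_eq_cube)
  from size_grid[where f = "last_tests sm NO N", OF this node_count[OF assms], of B k] show ?thesis
    by (rule order_trans) (rule mult_right_mono, simp_all)
qed

lemma size_leaf_stage:
  assumes "N \<ge> 1" "\<And>i. tests_cost (f i) \<le> 40 * (H + 2) ^ 3"
  shows "prog_size (xor_prog (grid B k 0 N) (\<lambda>q. f (idx (q - B)))) \<le> 17000 * (N * (H + 2) ^ 3)"
proof -
  have "(\<Sum>h\<le>0::nat. \<Sum>i<N. tests_cost (f i)) \<le> (\<Sum>h\<le>0::nat. \<Sum>i<N. 40 * (H + 2) ^ 3)" by (intro sum_mono assms)
  also have "\<dots> = 40 * (N * (H + 2) ^ 3)" by simp
  finally have "(\<Sum>h\<le>0::nat. \<Sum>i<N. tests_cost (f i)) \<le> 40 * (N * (H + 2) ^ 3)" .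
  moreover have "(0 + 1) * N \<le> 3 * (N * (H + 2) ^ 3)" by simp
  ultimately have "prog_size (xor_prog (grid B k 0 N) (\<lambda>q. f (idx (q - B)))) \<le> (400 * 40 + 7) * (N * (H + 2) ^ 3)"
    by (rule size_grid[where f = "\<lambda>_. f", OF _ _ node_count(2)[OF assms(1)]])
  then show ?thesis by (rule order_trans) (rule mult_right_mono, simp_all)
qed

lemma out_tests_cost: "tests_cost (out_tests B \<tau> k) \<le> 40 * (\<tau> + 2) ^ 3"
proof -
  define S where "S = insert (reg B 0 0 k) (left_sibs (reg B 3) \<tau> k)"
  have "card (left_sibs (reg B 3) \<tau> k) \<le> card {t. t < \<tau> \<and> odd (k div 2 ^ t)}"
    by (rule card_image_le) simp
  also have "\<dots> \<le> card {..<\<tau>}" by (rule card_mono) auto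
  finally have "card S \<le> \<tau> + 1" unfolding S_def by (simp add: card_insert_if)
  then have "test_cost (ctrl_test (reg B 7 0 (k div 2 ^ \<tau>)) (none_test S)) \<le> 12 * ((\<tau> + 2) * (\<tau> + 2))"
    using ctrl_none_cost[of S "\<tau> + 1"] by (simp add: S_def)
  moreover have "tests_cost (prefix_tests (reg B 3) (reg B 4) {reg B 0 0 k} \<tau> k) \<le> \<tau> * (12 * ((\<tau> + 2) * (\<tau> + 2)))"
    by (rule prefix_tests_cost) auto
  moreover have "tests_cost (out_tests B \<tau> k) = 16 + (tests_cost (prefix_tests (reg B 3) (reg B 4) {reg B 0 0 k} \<tau> k)
      + test_cost (ctrl_test (reg B 7 0 (k div 2 ^ \<tau>)) (none_test S)))"
    unfolding out_tests_def tests_cost_append S_def[symmetric] by (simp add: tests_cost_def single_test_def del: ctrl_test.simps)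
  moreover have "16 + (\<tau> * (12 * ((\<tau> + 2) * (\<tau> + 2))) + 12 * ((\<tau> + 2) * (\<tau> + 2))) \<le> 40 * (\<tau> + 2) ^ 3"
  proof -
    have "2 * 2 * 2 \<le> (\<tau> + 2) ^ 3" unfolding power3_eq_cube by (intro mult_mono) auto
    moreover have "\<tau> * (12 * ((\<tau> + 2) * (\<tau> + 2))) + 24 * ((\<tau> + 2) * (\<tau> + 2)) = 12 * (\<tau> + 2) ^ 3"
      unfolding power3_eq_cube by (simp add: algebra_simps)
    ultimately show ?thesis by linarith
  qed
  ultimately show ?thesis by linarith
qed

lemma size_post:
  assumes "n \<ge> 1"
  shows "prog_size (stages_prog (post B n \<tau> H)) \<le> 31000 * (n * (\<tau> + 2) ^ 3 + blk n \<tau> * (H + 2) ^ 3)"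
proof -
  have b: "blk n \<tau> \<ge> 1" by (simp add: blk_def)
  have p: "tests_cost (prefix_tests (reg B 5) (reg B 6) {} H i) \<le> 40 * (H + 2) ^ 3" for i
  proof -
    have "H * (12 * ((H + 2) * (H + 2))) \<le> (H + 2) * (40 * ((H + 2) * (H + 2)))" by (intro mult_mono) auto
    also have "\<dots> = 40 * (H + 2) ^ 3" unfolding power3_eq_cube by (simp only: mult_ac)
    finally have "H * (12 * ((H + 2) * (H + 2))) \<le> 40 * (H + 2) ^ 3" .
    from order_trans[OF prefix_tests_cost this] show ?thesis by simp
  qed
  have "prog_size (stages_prog (post B n \<tau> H))
    \<le> 7000 * (n * (\<tau> + 2) ^ 3) + (7000 * (n * (\<tau> + 2) ^ 3) + (7000 * (blk n \<tau> * (H + 2) ^ 3)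
     + (7000 * (blk n \<tau> * (H + 2) ^ 3) + (17000 * (blk n \<tau> * (H + 2) ^ 3) + 17000 * (n * (\<tau> + 2) ^ 3)))))"
    unfolding post_def stages_prog_def list.map prod.case concat.simps prog_append append_Nil2
    by (intro add_mono size_or_stage size_last_stage size_leaf_stage out_tests_cost p assms b)
  then show ?thesis by simp
qed

lemma blacks_stages: "prog_blacks (stages_prog st) = 0"
  by (induction st) (auto simp: stages_prog_def prog_Nil prog_append prog_blacks_xor)

lemma length_stages: "length (stages_prog st) = 3 * length st"
  by (induction st) (auto simp: stages_prog_def xor_prog_def)

lemma prog_ok_stages:
  assumes "stages_ok Q st"
  shows "prog_ok (Q \<union> targets st) (stages_prog st)"
  using assms
proof (induction st arbitrary: Q)
  case Nil
  show ?case by (simp add: stages_prog_def prog_Nil)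
next
  case (Cons s st)
  obtain S tf where s: "s = (S, tf)" by (cases s)
  have S: "finite S" "\<And>t \<tau>. t \<in> S \<Longrightarrow> \<tau> \<in> set (tf t) \<Longrightarrow> test_qubits \<tau> \<subseteq> Q" "stages_ok (Q \<union> S) st"
    using Cons.prems by (auto simp: s)
  have "prog_ok (Q \<union> S \<union> targets st) (xor_prog S tf)"
    by (rule prog_ok_xor) (use S in blast)+
  then have "prog_ok (Q \<union> S \<union> targets st) (xor_prog S tf @ stages_prog st)"
    using Cons.IH[OF S(3)] by (simp add: prog_append)
  then show ?case by (simp add: stages_prog_def targets_def s Un_assoc)
qed

section \<open>From estimates to quarter values and bits\<close>

lemma digit_expansion:
  fixes d :: "nat \<Rightarrow> int"
  assumes d: "\<And>k. lo \<le> d k" "\<And>k. d k \<le> hi" and lh: "lo \<le> 0" "0 \<le> hi" and L: "i + 7 \<le> L"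
  obtains z :: int and e :: real where "2 ^ i * (\<Sum>k<L. of_int (d k) / 2 ^ Suc k) = of_int z + of_int (\<Sum>t<7. 2 ^ (6 - t) * d (i + t)) / 128 + e"
    "of_int lo / 128 \<le> e" "e \<le> of_int hi / 128"
proof -
  define w where "w k = 2 ^ i * (of_int (d k) / 2 ^ Suc k :: real)" for k
  \<comment> \<open>Digits before \<open>i\<close> contribute an integer, the next seven a multiple
    of 1/128, and the tail at most its largest digit times 1/128.\<close>
  obtain M where M: "L = i + 7 + M" using L le_Suc_ex by blast
  have spl: "(\<Sum>k<a + b. f k) = (\<Sum>k<a. f k) + (\<Sum>t<b. f (a + t))" for a b and f :: "nat \<Rightarrow> real"
    by (induction b) auto
  have "2 ^ i * (\<Sum>k<L. of_int (d k) / 2 ^ Suc k) = (\<Sum>k<i + 7 + M. w k)"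
    unfolding sum_distrib_left w_def M ..
  also have "\<dots> = (\<Sum>k<i. w k) + (\<Sum>t<7. w (i + t)) + (\<Sum>t<M. w (i + 7 + t))"
    unfolding spl ..
  also have "(\<Sum>k<i. w k) = of_int (\<Sum>k<i. 2 ^ (i - Suc k) * d k)"
  proof -
    have "w k = of_int (2 ^ (i - Suc k) * d k)" if "k < i" for k
    proof -
      have "(2::real) ^ i = 2 ^ (i - Suc k) * 2 ^ Suc k" using that unfolding power_add[symmetric] by simp
      then show ?thesis by (simp add: w_def)
    qed
    then show ?thesis by simp
  qed
  also have "(\<Sum>t<7. w (i + t)) = of_int (\<Sum>t<7. 2 ^ (6 - t) * d (i + t)) / 128"
    by (simp add: w_def eval_nat_numeral power_add field_simps)
  finally have eq: "2 ^ i * (\<Sum>k<L. of_int (d k) / 2 ^ Suc k) = of_int (\<Sum>k<i. 2 ^ (i - Suc k) * d k)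
      + of_int (\<Sum>t<7. 2 ^ (6 - t) * d (i + t)) / 128 + (\<Sum>t<M. w (i + 7 + t))" .
  have wt: "w (i + 7 + t) = of_int (d (i + 7 + t)) * (1 / 256 * (1 / 2) ^ t)" for t
    by (simp add: w_def power_add power_divide)
  have geo: "(\<Sum>t<M. 1 / 256 * (1 / 2) ^ t) \<le> (1 / 128 :: real)"
    unfolding sum_distrib_left[symmetric] by (simp add: geometric_sum)
  have geo0: "0 \<le> (\<Sum>t<M. 1 / 256 * (1 / 2) ^ t :: real)" by (intro sum_nonneg) simp
  show ?thesis
  proof (rule that[OF eq])
    have "of_int lo / 128 \<le> of_int lo * (\<Sum>t<M. 1 / 256 * (1 / 2) ^ t :: real)"
      using mult_left_mono_neg[OF geo, of "of_int lo"] lh by simp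
    also have "\<dots> = (\<Sum>t<M. of_int lo * (1 / 256 * (1 / 2) ^ t))" by (rule sum_distrib_left)
    also have "\<dots> \<le> (\<Sum>t<M. w (i + 7 + t))" unfolding wt by (intro sum_mono mult_right_mono) (use d in auto)
    finally show "of_int lo / 128 \<le> (\<Sum>t<M. w (i + 7 + t))" .
    have "(\<Sum>t<M. w (i + 7 + t)) \<le> (\<Sum>t<M. of_int hi * (1 / 256 * (1 / 2) ^ t))"
      unfolding wt by (intro sum_mono mult_right_mono) (use d in auto)
    also have "\<dots> = of_int hi * (\<Sum>t<M. 1 / 256 * (1 / 2) ^ t)" by (rule sum_distrib_left[symmetric])
    also have "\<dots> \<le> of_int hi / 128" using mult_left_mono[OF geo, of "of_int hi"] lh by simp
    finally show "(\<Sum>t<M. w (i + 7 + t)) \<le> of_int hi / 128" .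
  qed
qed

text \<open>The sum \<open>u\<close> of \<open>quarter_list\<close> exceeds the first seven digits of the estimate, in units of \<open>1 / 128\<close>, by \<open>127\<close> (because
  the digits are coded with an offset), hence the \<open>u + 1\<close>.\<close>

definition quarter_near_test :: "nat \<Rightarrow> nat" where
  "quarter_near_test u = (((u + 1) mod 128 + 16) div 32) mod 4"

text \<open>Adding 16 and dividing by 32 rounds a multiple of 1/128 to the nearest quarter, with
  error at most 1/8. Together with \<open>5 / 256\<close> this is still below 1/6, which is why
  seven digits suffice.\<close>

lemma quarter_of_sum:
  fixes \<rho> :: int and \<phi> e :: real
  assumes "\<phi> = of_int z + of_int \<rho> / 128 + e" "\<bar>e\<bar> \<le> 5 / 256"
  shows "\<exists>k::int. \<bar>\<phi> - of_int k - real (quarter_near_test (nat ((\<rho> + 127) mod 128))) / 4\<bar> < 1 / 6"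
proof -
  define u where "u = nat ((\<rho> + 127) mod 128)"
  have "(\<rho> + 127) mod 128 \<ge> 0" by simp
  then have u: "int u = (\<rho> + 127) mod 128" by (simp add: u_def)
  have "int ((u + 1) mod 128) = \<rho> mod 128"
    unfolding zmod_int of_nat_add u by (simp add: mod_add_left_eq)
  then have "int (quarter_near_test u) = ((\<rho> mod 128 + 16) div 32) mod 4"
    unfolding quarter_near_test_def by (simp add: zdiv_int zmod_int)
  then obtain A D R :: int where A: "int (quarter_near_test u) = A" "\<rho> mod 128 + 16 = 32 * D + R" "0 \<le> R" "R < 32" "D = A + 4 * (D div 4)"
    by (metis (no_types, lifting) mult_div_mod_eq pos_mod_bound pos_mod_sign zero_less_numeral add.commute)
  obtain c p where "D = A + 4 * c" "\<rho> = \<rho> mod 128 + 128 * p"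
    using A(5) mult_div_mod_eq[of 128 \<rho>] by (metis add.commute)
  then have "\<rho> = 32 * A + 128 * (c + p) + R - 16" using A(2) by (simp add: algebra_simps)
  then have "of_int \<rho> / 128 = real_of_int A / 4 + of_int (c + p) + (of_int R - 16) / 128"
    by (simp add: field_simps)
  moreover have "- 1 / 8 \<le> (real_of_int R - 16) / 128" "(real_of_int R - 16) / 128 \<le> 1 / 8" using A(3,4) by simp_all
  moreover have "real (quarter_near_test u) = of_int A" using A(1) by (metis of_int_of_nat_eq)
  ultimately have "\<bar>\<phi> - of_int (z + (c + p)) - real (quarter_near_test u) / 4\<bar> < 1 / 6"
    using assms unfolding of_int_add by linarith
  then show ?thesis unfolding u_def by blast
qed

lemma quarter_range:
  fixes f :: real and z :: int and A :: nat
  assumes "0 \<le> f" "f < 1" "\<bar>f - of_int z - real A / 4\<bar> < 1 / 6" "A < 4"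
  shows "A = 0 \<Longrightarrow> f < 1 / 6 \<or> f > 5 / 6" "A = 1 \<Longrightarrow> f < 5 / 12" "A = 2 \<Longrightarrow> 1 / 3 < f \<and> f < 2 / 3" "A = 3 \<Longrightarrow> f > 7 / 12"
proof -
  \<comment> \<open>The only wrap-around is a fraction just below 1 with quarter value 0.\<close>
  have "z = 0 \<or> z = 1 \<and> A = 0"
  proof -
    have "real A \<ge> 0" "real A \<le> 3" using assms(4) by simp_all
    then have "- 1 < real_of_int z" "real_of_int z < 2" using assms(1-3) by - linarith+
    then have "z = 0 \<or> z = 1" by linarith
    moreover have "A = 0" if "z = 1"
    proof (rule ccontr)
      assume "A \<noteq> 0"
      then have "1 \<le> real A" by simp
      then show False using assms(2,3) that by simp
    qed
    ultimately show ?thesis by blast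
  qed
  then have z0: "real_of_int z = 0 \<or> real_of_int z = 1 \<and> A = 0" by auto
  have b: "- 1 / 6 < f - of_int z - real A / 4" "f - of_int z - real A / 4 < 1 / 6" using assms(3) by - linarith+
  have zz: "real_of_int z = 0" if "A \<noteq> 0" using z0 that by blast
  show "A = 0 \<Longrightarrow> f < 1 / 6 \<or> f > 5 / 6" using z0 b by auto
  show "f < 5 / 12" if "A = 1" using zz b that by simp
  show "1 / 3 < f \<and> f < 2 / 3" if "A = 2" using zz b that by simp
  show "f > 7 / 12" if "A = 3" using zz b that by simp
qed

text \<open>An even quarter value leaves only the choice between equality with the next lower bit and its negation, and the
  quarter value below it is then not 2; so the bit is read off at the nearest odd position below.\<close>

lemma bit_from_quarters:
  fixes A :: "nat \<Rightarrow> nat"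
  assumes near: "\<And>k. k < n \<Longrightarrow> A k < 4 \<and> (\<exists>z::int. \<bar>real x / 2 ^ Suc k - of_int z - real (A k) / 4\<bar> < 1 / 6)"
    and k: "k < n"
  shows "bit x k \<longleftrightarrow> (A k = 2) \<noteq> last_stop (\<lambda>p. p < n \<and> odd (A p)) (\<lambda>p. p < n \<and> A p = 3) 0 (Suc k)"
proof -
  \<comment> \<open>\<open>f k\<close> is the fractional part of \<open>x / 2 ^ k\<close>, that is,
    the bits below \<open>k\<close> read as a binary fraction; prepending a bit halves it.\<close>
  define f where "f k = real (x mod 2 ^ k) / 2 ^ k" for k
  have f01: "0 \<le> f k" "f k < 1" for k
  proof -
    have "real (x mod 2 ^ k) < real (2 ^ k)" by (subst of_nat_less_iff) simp
    then show "0 \<le> f k" "f k < 1" by (simp_all add: f_def)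
  qed
  have fS: "f (Suc k) = (of_bool (bit x k) + f k) / 2" for k
  proof -
    have "x mod 2 ^ Suc k = of_bool (bit x k) * 2 ^ k + x mod 2 ^ k"
      using mod_mult2_eq[of x "2 ^ k" 2] by (simp add: bit_iff_odd mult.commute mod_2_eq_odd)
    then have "real (x mod 2 ^ Suc k) = of_bool (bit x k) * 2 ^ k + real (x mod 2 ^ k)"
      by (metis of_nat_add of_nat_mult of_nat_numeral of_nat_of_bool of_nat_power)
    then show ?thesis by (simp add: f_def field_simps)
  qed
  have fz: "\<exists>z::int. \<bar>f (Suc k) - of_int z - real (A k) / 4\<bar> < 1 / 6" if k: "k < n" for k
  proof -
    obtain z :: int where z: "\<bar>real x / 2 ^ Suc k - of_int z - real (A k) / 4\<bar> < 1 / 6" using near[OF k] by blast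
    have "real x = real (x mod 2 ^ Suc k) + real (2 ^ Suc k) * real (x div 2 ^ Suc k)"
      by (metis mod_mult_div_eq of_nat_add of_nat_mult)
    then have "real x / 2 ^ Suc k = f (Suc k) + real (x div 2 ^ Suc k)" by (simp add: f_def field_simps)
    then have "\<bar>f (Suc k) - of_int (z - int (x div 2 ^ Suc k)) - real (A k) / 4\<bar> < 1 / 6"
      using z unfolding of_int_diff of_int_of_nat_eq by linarith
    then show ?thesis by blast
  qed
  define st m where "st = (\<lambda>p. p < n \<and> odd (A p))" and "m = (\<lambda>p. p < n \<and> A p = 3)"
  have ms: "m p \<Longrightarrow> st p" for p by (auto simp: m_def st_def)
  have step: "last_stop st m 0 (Suc k) \<longleftrightarrow> (if odd (A k) then A k = 3 else last_stop st m 0 k)" if "k < n" for k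
  proof -
    have "last_stop st m 0 (Suc k) \<longleftrightarrow> last_stop st m k (Suc k) \<noteq> ((\<forall>t. k \<le> t \<and> t < Suc k \<longrightarrow> \<not> st t) \<and> last_stop st m 0 k)"
      by (rule last_stop_split) (auto simp: ms)
    moreover have "last_stop st m k (Suc k) \<longleftrightarrow> m k"
      unfolding last_stop_def using le_less_Suc_eq by auto
    moreover have "(\<forall>t. k \<le> t \<and> t < Suc k \<longrightarrow> \<not> st t) \<longleftrightarrow> \<not> st k"
      using le_less_Suc_eq by auto
    ultimately show ?thesis using that by (auto simp: m_def st_def)
  qed
  have "bit x k \<longleftrightarrow> (A k = 2) \<noteq> last_stop st m 0 (Suc k)" using k
  proof (induction k)
    case 0
    obtain z :: int where z: "\<bar>f (Suc 0) - of_int z - real (A 0) / 4\<bar> < 1 / 6" using fz[OF 0] by blast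
    have A4: "A 0 < 4" using near 0 by blast
    have "f 0 = 0" by (simp add: f_def)
    then have f1: "f (Suc 0) = of_bool (bit x 0) / 2" using fS[of 0] by simp
    have "last_stop st m 0 0 = False" by (simp add: last_stop_def)
    moreover have "A 0 = 0 \<or> A 0 = 1 \<or> A 0 = 2 \<or> A 0 = 3" using A4 by linarith
    ultimately show ?case
      using quarter_range[OF f01 z A4] f1 step[OF 0] by (cases "bit x 0") auto
  next
    case (Suc k)
    obtain z :: int where z: "\<bar>f (Suc (Suc k)) - of_int z - real (A (Suc k)) / 4\<bar> < 1 / 6" using fz[OF Suc.prems] by blast
    obtain z' :: int where z': "\<bar>f (Suc k) - of_int z' - real (A k) / 4\<bar> < 1 / 6" using fz[of k] Suc.prems by auto
    have A4: "A (Suc k) < 4" "A k < 4" using near[of k] near[of "Suc k"] Suc.prems by auto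
    have A: "A (Suc k) = 0 \<or> A (Suc k) = 1 \<or> A (Suc k) = 2 \<or> A (Suc k) = 3" using A4 by linarith
    have IH: "bit x k \<longleftrightarrow> (A k = 2) \<noteq> last_stop st m 0 (Suc k)" using Suc by simp
    note r = quarter_range[OF f01 z A4(1)] and r' = quarter_range[OF f01 z' A4(2)]
    have f2: "f (Suc (Suc k)) = (of_bool (bit x (Suc k)) + f (Suc k)) / 2" by (rule fS)
    have f1: "f (Suc k) = (of_bool (bit x k) + f k) / 2" by (rule fS)
    show ?case
    proof (cases "odd (A (Suc k))")
      case True
      then show ?thesis using A r f2 f01[of "Suc k"] step[OF Suc.prems] by (cases "bit x (Suc k)") auto
    next
      case False
      then have A02: "A (Suc k) = 0 \<or> A (Suc k) = 2" using A by auto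
      \<comment> \<open>An even value puts the fraction within 1/6 of a multiple of 1/2, so its
        double modulo 1, which is \<open>f (Suc k)\<close>, is within 1/3 of an integer. The next
        lower bit then determines this bit.\<close>
      have fk: "f (Suc k) < 1 / 3 \<and> (bit x (Suc k) \<longleftrightarrow> A (Suc k) = 2) \<or> f (Suc k) > 2 / 3 \<and> (bit x (Suc k) \<longleftrightarrow> A (Suc k) \<noteq> 2)"
        using A02 r f2 f01[of "Suc k"] by (cases "bit x (Suc k)") auto
      have "A k \<noteq> 2" using fk r'(3) by auto
      then have "bit x k \<longleftrightarrow> last_stop st m 0 (Suc k)" using IH by simp
      moreover have "bit x (Suc k) \<longleftrightarrow> (A (Suc k) = 2) \<noteq> bit x k"
        using fk f1 f01[of k] by (cases "bit x k") auto
      ultimately show ?thesis using step[OF Suc.prems] False by simp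
    qed
  qed
  then show ?thesis by (simp only: st_def m_def)
qed

text \<open>The phase is the estimate minus the shift, so the shift bits enter negatively. They are
  stored with the least significant bit first, the digits with the most significant first; hence the
  index \<open>G - Suc (i + t)\<close>.\<close>

definition quarter_list :: "nat \<Rightarrow> nat \<Rightarrow> nat \<Rightarrow> (nat \<times> int) list" where
  "quarter_list G off i = concat (map (\<lambda>t. [(off + nm 9 (i + t) 0, 2 * 2 ^ (6 - t)), (off + nm 8 (i + t) 0, 2 ^ (6 - t)),
     (off + nm 0 (G - Suc (i + t)) 0, - (2 ^ (6 - t)))]) [0..<7])"

lemma wsum_quarter_list:
  "wsum (quarter_list G off i) b = (\<Sum>t<7. 2 ^ (6 - t) * (2 * of_bool (b (off + nm 9 (i + t) 0))
     + of_bool (b (off + nm 8 (i + t) 0)) - of_bool (b (off + nm 0 (G - Suc (i + t)) 0))))"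
proof -
  have c: "wsum (concat (map F ts)) b = (\<Sum>t\<leftarrow>ts. wsum (F t) b)" for F :: "nat \<Rightarrow> (nat \<times> int) list" and ts
    by (induction ts) (auto simp: wsum_def)
  show ?thesis unfolding quarter_list_def c interv_sum_list_conv_sum_set_nat set_upt atLeast0LessThan
    by (intro sum.cong refl) (simp add: wsum_def algebra_simps)
qed

lemma length_quarter_list: "length (quarter_list G off i) = 21"
  by (simp add: quarter_list_def length_concat comp_def interv_sum_list_conv_sum_set_nat)

context window
begin

lemma rval_rev: "real (rval a) / 2 ^ G = (\<Sum>k<G. real_of_int (of_bool (a (nm 0 (G - Suc k) 0))) / 2 ^ Suc k)"
proof -
  have "real (rval a) / 2 ^ G = (\<Sum>k<G. 2 ^ k * of_bool (a (nm 0 k 0)) / 2 ^ G)"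
    unfolding rval_def by (simp only: of_nat_sum of_nat_mult of_nat_power of_nat_numeral of_nat_of_bool sum_divide_distrib)
  also have "\<dots> = (\<Sum>k<G. 2 ^ (G - Suc k) * of_bool (a (nm 0 (G - Suc k) 0)) / 2 ^ G)"
    by (rule sum.nat_diff_reindex[symmetric])
  also have "\<dots> = (\<Sum>k<G. real_of_int (of_bool (a (nm 0 (G - Suc k) 0))) / 2 ^ Suc k)"
  proof (rule sum.cong[OF refl])
    fix k assume "k \<in> {..<G}"
    then have "(2::real) ^ G = 2 ^ (G - Suc k) * 2 ^ Suc k" unfolding power_add[symmetric] by simp
    then show "2 ^ (G - Suc k) * of_bool (a (nm 0 (G - Suc k) 0)) / 2 ^ G
        = real_of_int (of_bool (a (nm 0 (G - Suc k) 0))) / 2 ^ Suc k" by simp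
  qed
  finally show ?thesis .
qed

text \<open>The error budget in units of \<open>1 / 256\<close>: the tail of the signed digits lies
  between \<open>- 2\<close> and 4, the tail of the shift between 0 and 2, and the deviation of the
  estimate, magnified by \<open>2 ^ i\<close>, is at most 1. The total is at most 5 in
  modulus.\<close>

lemma quarter_test:
  assumes i: "i + 7 \<le> Ld" "i + 7 \<le> G" "i + 8 \<le> m" and nf: "\<not> missed m \<theta> a"
    and ab: "\<And>q. q \<in> QQ \<Longrightarrow> b (off + q) = a q"
  shows "\<exists>z::int. \<bar>2 ^ i * \<theta> - of_int z - real (quarter_near_test (nat (wsum (quarter_list G off i) b mod 2 ^ 7))) / 4\<bar> < 1 / 6"
proof -
  define dg where "dg k = dval a k" for k
  define rg :: "nat \<Rightarrow> int" where "rg k = of_bool (a (nm 0 (G - Suc k) 0))" for k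
  have d: "- 1 \<le> dg k" "dg k \<le> 2" for k by (simp_all add: dg_def dval_def)
  have r: "0 \<le> rg k" "rg k \<le> 1" for k by (simp_all add: rg_def)
  obtain z1 :: int and e1 where v: "2 ^ i * vfrac a = of_int z1 + of_int (\<Sum>t<7. 2 ^ (6 - t) * dg (i + t)) / 128 + e1"
      "- 1 / 128 \<le> e1" "e1 \<le> 2 / 128"
    using digit_expansion[where d = dg and lo = "- 1" and hi = 2, OF d _ _ i(1)] unfolding vfrac_def dg_def[symmetric] by auto
  obtain z2 :: int and e2 where w: "2 ^ i * (real (rval a) / 2 ^ G) = of_int z2 + of_int (\<Sum>t<7. 2 ^ (6 - t) * rg (i + t)) / 128 + e2"
      "0 \<le> e2" "e2 \<le> 1 / 128"
    using digit_expansion[where d = rg and lo = 0 and hi = 1, OF r _ _ i(2)] unfolding rval_rev rg_def[symmetric] by auto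
  obtain k :: int where k: "\<bar>\<theta> + real (rval a) / 2 ^ G - vfrac a - of_int k\<bar> \<le> 1 / 2 ^ m"
    using nf unfolding far_def by (auto simp: not_less)
  define \<delta> where "\<delta> = 2 ^ i * (\<theta> + real (rval a) / 2 ^ G - vfrac a - of_int k)"
  have dl: "\<bar>\<delta>\<bar> \<le> 1 / 256"
  proof -
    have "\<bar>\<delta>\<bar> \<le> 2 ^ i * (1 / 2 ^ m)" unfolding \<delta>_def abs_mult using k by (intro mult_mono) auto
    also have "\<dots> \<le> 2 ^ i * (1 / 2 ^ (i + 8))" using i(3) by (intro mult_left_mono divide_left_mono power_increasing) auto
    finally show ?thesis by (simp add: power_add)
  qed
  define \<rho>' where "\<rho>' = (\<Sum>t<7. 2 ^ (6 - t) * dg (i + t)) - (\<Sum>t<7. 2 ^ (6 - t) * rg (i + t))"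
  have "2 ^ i * \<theta> = 2 ^ i * vfrac a - 2 ^ i * (real (rval a) / 2 ^ G) + of_int (2 ^ i * k) + \<delta>"
    by (simp add: \<delta>_def algebra_simps)
  then have "2 ^ i * \<theta> = of_int (z1 - z2 + 2 ^ i * k) + of_int \<rho>' / 128 + (e1 - e2 + \<delta>)"
    unfolding v(1) w(1) by (simp add: \<rho>'_def diff_divide_distrib)
  moreover have "\<bar>e1 - e2 + \<delta>\<bar> \<le> 5 / 256" using v(2,3) w(2,3) dl by linarith
  ultimately have "\<exists>z::int. \<bar>2 ^ i * \<theta> - of_int z - real (quarter_near_test (nat ((\<rho>' + 127) mod 128))) / 4\<bar> < 1 / 6"
    by (rule quarter_of_sum)
  moreover have "wsum (quarter_list G off i) b = \<rho>' + 127"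
  proof -
    have b: "b (off + nm 9 (i + t) 0) = a (nm 9 (i + t) 0)" "b (off + nm 8 (i + t) 0) = a (nm 8 (i + t) 0)"
      "b (off + nm 0 (G - Suc (i + t)) 0) = a (nm 0 (G - Suc (i + t)) 0)" if "t < 7" for t
      using that i DQ_mem[of "i + t"] by (auto intro!: ab simp: QQ_def RQ_def)
    have "wsum (quarter_list G off i) b = (\<Sum>t<7. 2 ^ (6 - t) * (dg (i + t) + 1 - rg (i + t)))"
      unfolding wsum_quarter_list by (intro sum.cong refl) (simp add: b dg_def rg_def dval_def)
    also have "\<dots> = \<rho>' + (\<Sum>t<7. 2 ^ (6 - t))"
      unfolding \<rho>'_def by (simp add: algebra_simps sum.distrib sum_subtractf)
    also have "(\<Sum>t<7. 2 ^ (6 - t)) = (127 :: int)" by (simp add: eval_nat_numeral)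
    finally show ?thesis .
  qed
  ultimately show ?thesis by simp
qed

end

text \<open>Bit \<open>k\<close> needs \<open>x / 2 ^ Suc k\<close>, which is
  \<open>2 ^ K * x / 2 ^ n\<close> for \<open>K = n - Suc k\<close>. Window \<open>K div h\<close>
  runs at \<open>2 ^ (K div h * h)\<close> times the phase and is read at offset
  \<open>K mod h\<close>; it has more positions than the \<open>h\<close> offsets, so seven digits
  are always available.\<close>

abbreviation quarter_tests :: "nat \<Rightarrow> nat \<Rightarrow> nat \<Rightarrow> nat \<Rightarrow> (nat \<Rightarrow> bool) \<Rightarrow> nat \<Rightarrow> test list" where
  "quarter_tests M G h n P k \<equiv> let K = n - Suc k in
     value_tests (quarter_list G (K div h * M) (K mod h)) 7 (\<lambda>u. P (quarter_near_test u))"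

definition first :: "nat \<Rightarrow> nat \<Rightarrow> nat \<Rightarrow> nat \<Rightarrow> nat \<Rightarrow> (nat set \<times> (nat \<Rightarrow> test list)) list" where
  "first B M G h n = map (\<lambda>(\<kappa>, P). (grid B \<kappa> 0 n, \<lambda>q. quarter_tests M G h n P (idx (q - B))))
    [(0, odd), (1, \<lambda>A. A = 3), (2, \<lambda>A. A = 2)]"

lemma size_first:
  assumes "n \<ge> 1"
  shows "prog_size (stages_prog (first B M G h n)) \<le> 200000000 * n"
proof -
  have "tests_cost (value_tests (quarter_list G off i) 7 P) \<le> 128 * 1200" for off i P
  proof -
    have "tests_cost (value_tests (quarter_list G off i) 7 P) = (\<Sum>v\<leftarrow>filter P [0..<2 ^ 7]. 22 * 8 + 8 * 2 ^ 7)"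
      by (simp add: tests_cost_def value_tests_def comp_def length_quarter_list)
    also have "\<dots> = length (filter P [0..<2 ^ 7]) * 1200" by (simp add: sum_list_triv)
    also have "\<dots> \<le> length [0..<(2::nat) ^ 7] * 1200" by (intro mult_right_mono length_filter_le) simp
    finally show ?thesis by simp
  qed
  note tc = this
  have st: "prog_size (xor_prog (grid B \<kappa> 0 n) (\<lambda>q. quarter_tests M G h n P (idx (q - B)))) \<le> 2 * n + 400 * (n * (128 * 1200)) + 1" for \<kappa> P
  proof -
    have "(\<Sum>q\<in>grid B \<kappa> 0 n. tests_cost (quarter_tests M G h n P (idx (q - B)))) \<le> of_nat (card (grid B \<kappa> 0 n)) * (128 * 1200)"
      unfolding Let_def by (rule sum_bounded_above) (rule tc)
    then show ?thesis
      using prog_size_xor_le[OF finite_grid[of B \<kappa> 0 n], of "\<lambda>q. quarter_tests M G h n P (idx (q - B))"] by (simp add: card_grid)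
  qed
  have "prog_size (stages_prog (first B M G h n)) \<le> (2 * n + 400 * (n * (128 * 1200)) + 1) + ((2 * n + 400 * (n * (128 * 1200)) + 1) + (2 * n + 400 * (n * (128 * 1200)) + 1))"
    unfolding first_def stages_prog_def list.map prod.case concat.simps prog_append append_Nil2
    by (intro add_mono st)
  then show ?thesis using assms by simp
qed

section \<open>The complete circuit\<close>

lemma stages_ok_append: "stages_ok Q (st @ st') \<longleftrightarrow> stages_ok Q st \<and> stages_ok (Q \<union> targets st) st'"
  by (induction st arbitrary: Q) (auto simp: targets_def Un_assoc)

lemma targets_first: "targets (first B M G h n) = grid B 0 0 n \<union> grid B 1 0 n \<union> grid B 2 0 n"
  by (auto simp: targets_def first_def)

lemma stages_ok_first:
  assumes q: "\<And>i. i < h + 6 \<Longrightarrow> nm 9 i 0 < M \<and> nm 8 i 0 < M \<and> nm 0 (G - Suc i) 0 < M" and n: "n \<le> J * h" "h \<ge> 1"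
  shows "stages_ok {..<J * M} (first (J * M) M G h n)"
proof -
  have t1: "test_qubits \<tau> \<subseteq> {..<J * M}"
    if "k < n" "\<tau> \<in> set (value_tests (quarter_list G ((n - Suc k) div h * M) ((n - Suc k) mod h)) 7 P)" for k \<tau> P
  proof -
    define K where "K = n - Suc k"
    have "K < J * h" using that(1) n by (simp add: K_def)
    then have j: "K div h < J" by (simp add: less_mult_imp_div_less)
    have i: "K mod h < h" using n by simp
    have "test_qubits \<tau> \<subseteq> fst ` set (quarter_list G (K div h * M) (K mod h))"
      using that(2) by (auto simp: value_tests_def K_def)
    also have "\<dots> \<subseteq> {..<J * M}"
    proof
      fix p assume "p \<in> fst ` set (quarter_list G (K div h * M) (K mod h))"
      then obtain t where "t < 7" "p \<in> {K div h * M + nm 9 (K mod h + t) 0, K div h * M + nm 8 (K mod h + t) 0,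
          K div h * M + nm 0 (G - Suc (K mod h + t)) 0}"
        unfolding quarter_list_def by auto
      moreover from this have "K mod h + t < h + 6" using i by linarith
      ultimately show "p \<in> {..<J * M}" using q[of "K mod h + t"] by (auto intro: block_lt[OF j])
    qed
    finally show ?thesis .
  qed
  have tq: "test_qubits \<tau> \<subseteq> {..<J * M}"
    if qg: "q \<in> grid (J * M) \<kappa> 0 n" and "\<tau> \<in> set (let K = n - Suc (idx (q - J * M)) in value_tests (quarter_list G (K div h * M) (K mod h)) 7 P)" for q \<tau> \<kappa> P
  proof -
    obtain l i where "q = reg (J * M) \<kappa> l i" "l \<le> 0" "i < n" by (rule gridE[OF qg])
    then show ?thesis using that(2) t1 unfolding Let_def reg_decode by simp
  qed
  have g: "grid (J * M) \<kappa> 0 n \<inter> {..<J * M} = {}" for \<kappa> by (auto dest: grid_kind)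
  have gg: "grid (J * M) \<kappa> 0 n \<inter> grid (J * M) \<kappa>' 0 n = {}" if "\<kappa> \<noteq> \<kappa>'" for \<kappa> \<kappa>'
    using that by (auto dest: grid_kind)
  show ?thesis unfolding first_def list.map prod.case stages_ok.simps
    using tq by (intro conjI ballI TrueI finite_grid subset_trans[OF tq]) (auto simp: Int_Un_distrib g gg)
qed

text \<open>The windows are not entangled, so success probabilities multiply; Bernoulli's inequality
  gives the form of a union bound.\<close>

lemma prob_tensor:
  assumes norm: "\<And>j. j < J \<Longrightarrow> (\<Sum>a\<in>asg {..<M}. (cmod (u j a))\<^sup>2) = 1"
    and bad: "\<And>j. j < J \<Longrightarrow> weight {..<M} (bad j) (u j) \<le> \<delta>" and \<delta>: "\<delta> \<le> 1"
  shows "1 - real J * \<delta> \<le> weight {..<J * M} (\<lambda>b. \<forall>j<J. \<not> bad j (slice M j b)) (tensor M J u)"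
proof -
  have ob: "of_bool (\<forall>j<K. P j) = (\<Prod>j<K. of_bool (P j) :: real)" for K and P :: "nat \<Rightarrow> bool"
    by (induction K) (auto simp: less_Suc_eq)
  have "weight {..<J * M} (\<lambda>b. \<forall>j<J. \<not> bad j (slice M j b)) (tensor M J u)
      = (\<Sum>b\<in>asg {..<J * M}. \<Prod>j<J. of_bool (\<not> bad j (slice M j b)) * (cmod (u j (slice M j b)))\<^sup>2)"
    by (rule sum.cong[OF refl]) (simp add: tensor_def prod_norm[symmetric] prod_power_distrib prod.distrib ob)
  also have "\<dots> = (\<Prod>j<J. \<Sum>a\<in>asg {..<M}. of_bool (\<not> bad j a) * (cmod (u j a))\<^sup>2)"
    by (rule sum_asg_tensor)
  also have "(\<Prod>j<J. 1 - \<delta>) \<le> \<dots>"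
  proof (rule prod_mono)
    fix j assume "j \<in> {..<J}"
    then have j: "j < J" by simp
    have "1 = weight {..<M} (\<lambda>a. \<not> bad j a) (u j) + weight {..<M} (bad j) (u j)"
      unfolding norm[OF j, symmetric] sum.distrib[symmetric] by (rule sum.cong) auto
    then show "0 \<le> 1 - \<delta> \<and> 1 - \<delta> \<le> weight {..<M} (\<lambda>a. \<not> bad j a) (u j)"
      using bad[OF j] \<delta> by simp
  qed
  finally have "(1 - \<delta>) ^ J \<le> weight {..<J * M} (\<lambda>b. \<forall>j<J. \<not> bad j (slice M j b)) (tensor M J u)"
    by simp
  moreover have "1 + real J * (- \<delta>) \<le> (1 + (- \<delta>)) ^ J" by (rule Bernoulli_inequality) (use \<delta> in simp)
  ultimately show ?thesis by simp
qed

context window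
begin

text \<open>\<open>a\<close> is the joint outcome of the windows and \<open>b\<close> its extension
  by the computed registers. An accuracy of \<open>1 / 2 ^ (h + 7)\<close> leaves
  \<open>1 / 256\<close> after multiplication by \<open>2 ^ i\<close> with
  \<open>i < h\<close>.\<close>

lemma decode_correct:
  assumes n: "n \<ge> 1" "h \<ge> 1" "n \<le> J * h" and hL: "h + 6 \<le> Ld" "h + 6 \<le> G" and M: "QQ \<subseteq> {..<M}" and H: "blk n \<tau> \<le> 2 ^ H"
    and ab: "\<And>q. q < J * M \<Longrightarrow> b q = a q"
    and near: "\<And>j. j < J \<Longrightarrow> \<not> missed (h + 7) (2 ^ (j * h) * (real x / 2 ^ n)) (slice M j a)"
    and eq: "\<forall>(S, tf)\<in>set (first (J * M) M G h n @ post (J * M) n \<tau> H). \<forall>q\<in>S. b q = parity_tests (tf q) b"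
    and k: "k < n"
  shows "b (reg (J * M) 8 0 k) = bit x k"
proof -
  define B where "B = J * M"
  define A where "A k = (let K = n - Suc k in
      quarter_near_test (nat (wsum (quarter_list G (K div h * M) (K mod h)) b mod 2 ^ 7)))" for k
  have bA: "b (reg B 0 0 k) = odd (A k)" "b (reg B 1 0 k) = (A k = 3)" "b (reg B 2 0 k) = (A k = 2)" if "k < n" for k
    using eq that unfolding first_def B_def[symmetric] A_def Let_def
    by (auto simp: parity_value_tests)
  have A: "A k < 4 \<and> (\<exists>z::int. \<bar>real x / 2 ^ Suc k - of_int z - real (A k) / 4\<bar> < 1 / 6)" if k: "k < n" for k
  proof -
    define K where "K = n - Suc k"
    have Kn: "K + Suc k = n" using k by (simp add: K_def)
    have j: "K div h < J" using Kn n by (intro less_mult_imp_div_less) linarith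
    have i: "K mod h < h" using n by simp
    have "2 ^ (K mod h) * (2 ^ (K div h * h) * (real x / 2 ^ n)) = 2 ^ K * (real x / 2 ^ n)"
      by (simp add: power_add[symmetric] mult.assoc[symmetric] del: times_divide_eq_right)
    also have "\<dots> = real x / 2 ^ Suc k" unfolding Kn[symmetric] power_add by simp
    finally have t: "2 ^ (K mod h) * (2 ^ (K div h * h) * (real x / 2 ^ n)) = real x / 2 ^ Suc k" .
    have "\<exists>z::int. \<bar>2 ^ (K mod h) * (2 ^ (K div h * h) * (real x / 2 ^ n)) - of_int z
        - real (quarter_near_test (nat (wsum (quarter_list G (K div h * M) (K mod h)) b mod 2 ^ 7))) / 4\<bar> < 1 / 6"
    proof (rule quarter_test[where m = "h + 7" and a = "slice M (K div h) a"])
      show "\<not> missed (h + 7) (2 ^ (K div h * h) * (real x / 2 ^ n)) (slice M (K div h) a)"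
        by (rule near[OF j])
      fix q assume "q \<in> QQ"
      then have q: "q < M" using M by auto
      then show "b (K div h * M + q) = slice M (K div h) a q"
        using ab[OF block_lt[OF j q]] by (simp add: slice_def)
    qed (use i hL in auto)
    moreover have "A k < 4" by (simp add: A_def Let_def quarter_near_test_def)
    moreover have AK: "A k = quarter_near_test (nat (wsum (quarter_list G (K div h * M) (K mod h)) b mod 2 ^ 7))"
      by (simp only: A_def Let_def K_def)
    ultimately show ?thesis unfolding t AK[symmetric] by blast
  qed
  have "b (reg B 8 0 k) \<longleftrightarrow> b (reg B 2 0 k)
    \<noteq> last_stop (\<lambda>p. p < n \<and> b (reg B 0 0 p)) (\<lambda>p. p < n \<and> b (reg B 1 0 p)) 0 (Suc k)"
  proof (rule post_correct[OF _ H _ k])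
    show "\<forall>(S, tf)\<in>set (post B n \<tau> H). \<forall>q\<in>S. b q = parity_tests (tf q) b" using eq unfolding B_def by auto
    show "b (reg B 0 0 p)" if "p < n" "b (reg B 1 0 p)" for p using that bA[of p] by simp
  qed
  also have "(\<lambda>p. p < n \<and> b (reg B 0 0 p)) = (\<lambda>p. p < n \<and> odd (A p))" using bA(1) by auto
  also have "(\<lambda>p. p < n \<and> b (reg B 1 0 p)) = (\<lambda>p. p < n \<and> A p = 3)" using bA(2) by auto
  also have "b (reg B 2 0 k) = (A k = 2)" by (rule bA(3)[OF k])
  also have "((A k = 2) \<noteq> last_stop (\<lambda>p. p < n \<and> odd (A p)) (\<lambda>p. p < n \<and> A p = 3) 0 (Suc k)) = bit x k"
    by (rule bit_from_quarters[symmetric, OF A k])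
  finally show ?thesis unfolding B_def .
qed

end

lemma length_base: "length (window.base g Ld Lv G \<rho>) = 18" if "window g Ld Lv \<rho>"
  by (simp add: window.base_def[OF that] xor_prog_def)

lemma length_amplify: "length (amplify Q f ps) = 3 * length ps + 2"
  by (simp add: amplify_def inv_prog_def)

text \<open>Decoding only transports probabilities, so success is at least as likely as the event
  that no window misses. The requirement on single windows is kept as the hypothesis
  \<open>run\<close>, which separates the circuit from the choice of parameters.\<close>

lemma assemble:
  assumes win: "window g Ld Lv \<rho>"
    and n: "n \<ge> 1" "h \<ge> 1" "n \<le> J * h" and hL: "h + 6 \<le> Ld" "h + 6 \<le> G" and H: "blk n \<tau> \<le> 2 ^ H"
    and \<delta>: "\<delta> \<le> 1" "real J * \<delta> \<le> \<epsilon>"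
    and run: "\<And>x j u. x < 2 ^ n \<Longrightarrow> j < J \<Longrightarrow>
      u = sems (2 ^ (j * h) * (real x / 2 ^ n)) (window.amp g Ld Lv G \<rho>) zero_state \<Longrightarrow>
      (\<Sum>b\<in>asg (window.QQ g Ld Lv G). (cmod (u b))\<^sup>2) = 1 \<and>
      weight (window.QQ g Ld Lv G) (window.missed Ld G (h + 7) (2 ^ (j * h) * (real x / 2 ^ n))) u \<le> \<delta>"
    and sz: "prog_size (window.amp g Ld Lv G \<rho>) \<le> sz"
    and bl: "prog_blacks (window.amp g Ld Lv G \<rho>) \<le> bl"
  shows "\<exists>N outs C. determines n \<epsilon> N outs C \<and> depth C \<le> 2656
    \<and> circuit_size C \<le> J * sz + (200000000 * n + 31000 * (n * (\<tau> + 2) ^ 3 + blk n \<tau> * (H + 2) ^ 3))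
    \<and> black_uses C \<le> J * bl"
proof -
  interpret w: window g Ld Lv G \<rho> by (rule win)
  define amp where "amp = amplify w.QQ w.flag w.base"
  obtain M where M: "w.QQ \<subseteq> {..<M}"
    using finite_nat_set_iff_bounded[of w.QQ] w.fin(7) by auto
  have "test_qubits w.flag \<subseteq> w.QQ" unfolding w.flag_def by (subst test_qubits_none_test) (auto simp: w.QQ_def)
  then have okQ: "prog_ok w.QQ amp" unfolding amp_def by (intro prog_ok_amplify w.prog_ok_base w.fin)
  have ok: "prog_ok {..<M} amp" by (rule prog_ok_mono[OF okQ M])
  define st where "st = first (J * M) M G h n @ post (J * M) n \<tau> H"
  have J: "J \<ge> 1" using n by (cases J) auto
  have so: "stages_ok {..<J * M} st"
  proof -
    have nmM: "nm 9 i 0 < M \<and> nm 8 i 0 < M \<and> nm 0 (G - Suc i) 0 < M" if "i < h + 6" for i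
    proof -
      have "nm 9 i 0 \<in> w.QQ" "nm 8 i 0 \<in> w.QQ" using w.DQ_mem[of i] that hL by (simp_all add: w.QQ_def)
      moreover have "nm 0 (G - Suc i) 0 \<in> w.QQ" using that hL by (auto simp: w.QQ_def w.RQ_def)
      ultimately show ?thesis using M by auto
    qed
    show ?thesis unfolding st_def stages_ok_append targets_first
      using stages_ok_first[OF nmM n(3,2)] stages_ok_post[OF order_refl, of "J * M" n \<tau> H] by (simp add: Un_assoc)
  qed
  define prog where "prog = par_prog M J h amp @ stages_prog st"
  define QT where "QT = {..<J * M} \<union> targets st"
  have okp: "prog_ok QT prog"
    unfolding prog_def prog_append QT_def
    using prog_ok_mono[OF prog_ok_par[OF ok, of J h]] prog_ok_stages[OF so] by simp
  have fint: "finite (targets st)"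
    by (auto simp: st_def targets_def first_def post_def)
  then have finQ: "finite QT" by (simp add: QT_def)
  then obtain N0 where N0: "QT \<subseteq> {..<N0}" using finite_nat_set_iff_bounded[of QT] by auto
  have "impl n N0 (32 * length prog) (prog_size prog) (prog_blacks prog) (\<lambda>x. sems (real x / 2 ^ n) prog)"
    by (rule impl_prog) (rule prog_ok_mono[OF okp N0])
  then obtain N C where C: "N0 \<le> N" "circuit_ok n N C" "depth C \<le> 32 * length prog" "circuit_size C \<le> prog_size prog"
      "black_uses C \<le> prog_blacks prog" and Cr: "\<And>x \<psi>. supp N0 \<psi> \<Longrightarrow> fold (apply_gate n x) (concat C) \<psi> = sems (real x / 2 ^ n) prog \<psi>"
    unfolding impl_def by blast
  \<comment> \<open>Three runs of 18 steps and two reflections give 56, nine stages of three steps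
    give 27; the depth bound is \<open>32 * 83 = 2656\<close>.\<close>
  have lp: "length prog = 83"
    unfolding prog_def length_append length_stages par_prog_def length_map amp_def length_amplify length_base[OF win]
    by (simp add: st_def first_def post_def)
  have "prog_size prog \<le> J * sz + (200000000 * n + 31000 * (n * (\<tau> + 2) ^ 3 + blk n \<tau> * (H + 2) ^ 3))"
  proof -
    have "prog_size (par_prog M J h amp) \<le> J * prog_size amp" by (rule prog_size_par[OF ok J])
    also have "\<dots> \<le> J * sz" using sz by (simp add: amp_def)
    finally have "prog_size (par_prog M J h amp) \<le> J * sz" .
    moreover have "prog_size (stages_prog st) = prog_size (stages_prog (first (J * M) M G h n)) + prog_size (stages_prog (post (J * M) n \<tau> H))"
      by (simp add: st_def stages_prog_def prog_append)
    ultimately show ?thesis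
      unfolding prog_def prog_append using size_first[OF n(1), of "J * M" M G h] size_post[OF n(1), of "J * M" \<tau> H] by linarith
  qed
  moreover have "prog_blacks prog \<le> J * bl"
    unfolding prog_def prog_append blacks_stages prog_blacks_par[OF ok] using bl by (simp add: amp_def)
  moreover
  define outs where "outs = map (reg (J * M) 8 0) [0..<n]"
  have o8: "reg (J * M) 8 0 k \<in> QT" if "k < n" for k
    using that by (auto simp: QT_def st_def targets_def post_def)
  have "determines n \<epsilon> N outs C" unfolding determines_def
  proof (intro conjI allI impI)
    show "circuit_ok n N C" by (rule C(2))
    show "length outs = n" "distinct outs" by (simp_all add: outs_def distinct_map inj_on_def)
    have "set outs \<subseteq> QT" using o8 by (auto simp: outs_def)
    then show "set outs \<subseteq> {..<N}" using N0 C(1) by auto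
    fix x :: nat assume x: "x < 2 ^ n"
    define \<theta> where "\<theta> = real x / 2 ^ n"
    define u where "u j = sems (2 ^ (j * h) * \<theta>) amp zero_state" for j
    define T where "T = tensor M J u"
    have Tr: "sems \<theta> (par_prog M J h amp) zero_state = T"
      using sems_par_prog[OF ok, of \<theta> J h "\<lambda>_. zero_state"] unfolding tensor_zero_state T_def u_def[abs_def] .
    have "supp N0 zero_state" by (simp add: supp_def zero_state_def basis_def)
    then have runC: "run n x C = sems \<theta> (stages_prog st) T"
      unfolding run_def using Cr[of zero_state x] by (simp add: prog_def \<theta>_def[symmetric] Tr)
    have suppT: "supp_on {..<J * M} T" by (simp add: supp_on_def T_def tensor_def)
    from sum_stages_prog[OF so finite_lessThan suppT, of \<theta>, folded QT_def]
    obtain F where F0: "\<forall>a\<in>asg {..<J * M}. F a \<in> asg QT \<and> (\<forall>q\<in>{..<J * M}. F a q = a q)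
          \<and> (\<forall>(S, tf)\<in>set st. \<forall>q\<in>S. F a q = parity_tests (tf q) (F a))"
        and F3: "\<forall>P. weight QT P (sems \<theta> (stages_prog st) T)
         = weight {..<J * M} (\<lambda>a. P (F a)) T"
      by (elim exE conjE)
    have F1: "F a q = a q" if "a \<in> asg {..<J * M}" "q < J * M" for a q using F0 that by simp
    have F2: "\<forall>(S, tf)\<in>set st. \<forall>q\<in>S. F a q = parity_tests (tf q) (F a)" if "a \<in> asg {..<J * M}" for a
      using bspec[OF F0 that] by (elim conjE)
    define bad where "bad j a = w.missed (h + 7) (2 ^ (j * h) * \<theta>) a" for j a
    define P where "P b \<longleftrightarrow> map b outs = binary_expansion n x" for b
    have good: "P (F a)" if a: "a \<in> asg {..<J * M}" and g: "\<forall>j<J. \<not> bad j (slice M j a)" for a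
    proof -
      have "F a (reg (J * M) 8 0 k) = bit x k" if k: "k < n" for k
        by (rule w.decode_correct[OF n(1,2,3) hL M H F1[OF a] _ F2[OF a, unfolded st_def] k])
          (use g in \<open>auto simp: bad_def \<theta>_def\<close>)
      then show ?thesis by (simp add: P_def outs_def binary_expansion_def)
    qed
    have QM: "(\<Sum>a\<in>asg {..<M}. f a * (cmod (u j a))\<^sup>2) = (\<Sum>a\<in>asg w.QQ. f a * (cmod (u j a))\<^sup>2)" for f :: "(nat \<Rightarrow> bool) \<Rightarrow> real" and j
    proof (rule sum.mono_neutral_right)
      show "asg w.QQ \<subseteq> asg {..<M}" using M by (auto simp: asg_def)
      have "supp_on w.QQ (u j)" unfolding u_def by (rule supp_on_sems[OF okQ w.fin(7) supp_on_zero_state])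
      then show "\<forall>a\<in>asg {..<M} - asg w.QQ. f a * (cmod (u j a))\<^sup>2 = 0" by (simp add: supp_on_def)
    qed simp
    have "1 - \<epsilon> \<le> 1 - real J * \<delta>" using \<delta> by simp
    also have "\<dots> \<le> weight {..<J * M} (\<lambda>b. \<forall>j<J. \<not> bad j (slice M j b)) T"
      unfolding T_def
    proof (rule prob_tensor[OF _ _ \<delta>(1)])
      fix j assume j: "j < J"
      have "u j = sems (2 ^ (j * h) * (real x / 2 ^ n)) w.amp zero_state"
        by (simp add: u_def \<theta>_def amp_def)
      from run[OF x j this] have r: "(\<Sum>b\<in>asg w.QQ. (cmod (u j b))\<^sup>2) = 1" "weight w.QQ (bad j) (u j) \<le> \<delta>"
        by (simp_all add: bad_def \<theta>_def)
      show "(\<Sum>a\<in>asg {..<M}. (cmod (u j a))\<^sup>2) = 1" using QM[of "\<lambda>_. 1" j] r(1) by simp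
      show "weight {..<M} (bad j) (u j) \<le> \<delta>" unfolding QM by (rule r(2))
    qed
    also have "\<dots> \<le> weight {..<J * M} (\<lambda>a. P (F a)) T"
      using good by (intro sum_mono mult_right_mono) (auto simp: of_bool_def)
    also have "\<dots> = weight QT P (run n x C)" unfolding runC by (rule F3[rule_format, symmetric])
    also have "\<dots> = (\<Sum>b\<in>{b \<in> asg QT. P b}. (cmod (run n x C b))\<^sup>2)"
      using finQ by (intro sum.mono_neutral_cong_right) auto
    also have "\<dots> \<le> prob_outcome N outs (binary_expansion n x) (run n x C)"
      unfolding prob_outcome_def P_def
    proof (rule sum_mono2)
      show "finite {b \<in> basis N. map b outs = binary_expansion n x}" by (simp add: basis_eq_asg)
      show "{b \<in> asg QT. map b outs = binary_expansion n x} \<subseteq> {b \<in> basis N. map b outs = binary_expansion n x}"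
        using N0 C(1) by (auto simp: basis_eq_asg asg_def)
    qed simp
    finally show "1 - \<epsilon> \<le> prob_outcome N outs (binary_expansion n x) (run n x C)" .
  qed
  ultimately show ?thesis using C(3,4,5) unfolding lp by (intro exI[of _ N] exI[of _ outs] exI[of _ C]) auto
qed

section \<open>Choice of the parameters\<close>

lemma cube_le_power: "(T + 1) ^ 3 \<le> 8 * (2::nat) ^ T"
proof (induction T rule: less_induct)
  case (less T)
  show ?case
  proof (cases "T \<le> 3")
    case True
    then have "T = 0 \<or> T = 1 \<or> T = 2 \<or> T = 3" by linarith
    then show ?thesis by (elim disjE) (simp_all add: power3_eq_cube)
  next
    case False
    then obtain U where U: "T = Suc U" "U \<ge> 3" by (cases T) auto
    define y where "y = U + 1"
    have y: "y \<ge> 4" using U by (simp add: y_def)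
    have a: "4 * y \<le> y * y" using y by (rule mult_right_mono) simp
    have "4 * (y * y) \<le> y * (y * y)" using y by (rule mult_right_mono) simp
    moreover have "3 * y + 1 \<le> y * y" using a y by linarith
    moreover have "(y + 1) ^ 3 = y * (y * y) + 3 * (y * y) + 3 * y + 1" "2 * y ^ 3 = 2 * (y * (y * y))"
      by (simp_all add: power3_eq_cube algebra_simps)
    ultimately have "(y + 1) ^ 3 \<le> 2 * y ^ 3" by linarith
    also have "\<dots> \<le> 2 * (8 * 2 ^ U)" using less[of U] U by (simp add: y_def)
    finally show ?thesis using U by (simp add: y_def)
  qed
qed

text \<open>Since \<open>(31 / 32) ^ 32 \<le> 1 / 2\<close>, the power is at most
  \<open>1 / 2 ^ 2 ^ (g - 5)\<close>, while the factor in front is \<open>2 ^ (10 + 8 * g)\<close>.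
  The exponents compare in the right way from \<open>g = 12\<close> on, as
  \<open>106 \<le> 128\<close>.\<close>

lemma majority_error:
  assumes "g \<ge> 12"
  shows "4 * 256 ^ (g + 1) * (31 / 32) ^ 2 ^ g \<le> (1 :: real)"
proof -
  have e: "10 + 8 * g \<le> 2 ^ (g - 5)"
    using assms
  proof (induction g rule: dec_induct)
    case (step g)
    have "Suc g - 5 = Suc (g - 5)" using step by simp
    moreover have "8 \<le> (2::nat) ^ (g - 5)" using step by linarith
    ultimately show ?case using step by simp
  qed simp
  have p: "(2::nat) ^ g = 32 * 2 ^ (g - 5)"
  proof -
    have "g = 5 + (g - 5)" using assms by simp
    then have "(2::nat) ^ g = 2 ^ 5 * 2 ^ (g - 5)" by (metis power_add)
    then show ?thesis by simp
  qed
  have "(31 / 32 :: real) ^ 2 ^ g = ((31 / 32) ^ 32) ^ 2 ^ (g - 5)" unfolding p power_mult ..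
  also have "\<dots> \<le> (1 / 2) ^ 2 ^ (g - 5)" by (rule power_mono) (simp_all add: power_divide)
  also have "\<dots> \<le> (1 / 2) ^ (10 + 8 * g)" by (rule power_decreasing[OF e]) simp_all
  also have "\<dots> = 1 / (4 * 256 ^ (g + 1))" by (simp add: power_add power_mult power_one_over)
  finally show ?thesis by (simp add: field_simps)
qed

text \<open>Two regimes meet here. For \<open>n \<le> L\<close> all phases lie on the grid of step
  \<open>1 / 2 ^ L\<close> and nothing fails. Otherwise \<open>L\<close> exceeds
  \<open>2 * h\<close> by a margin, so that the kernel bound \<open>4 ^ (h + 8) / 4 ^ Lv\<close>
  still decays like \<open>1 / 4 ^ h\<close>.\<close>

lemma determines_exists:
  assumes g: "g \<ge> 12" "256 ^ g \<le> L" "L < 256 ^ (g + 1)" and n: "n \<ge> 1" "h \<ge> 1" "n \<le> J * h" and hL: "2 * h + 100 \<le> L"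
    and H: "blk n \<tau> \<le> 2 ^ H" and \<epsilon>: "0 < \<epsilon>" "\<epsilon> < 1"
    and cases: "n \<le> L \<or> real J * 4 \<le> \<epsilon> * (16 * 4 ^ h)"
  shows "\<exists>N outs C. determines n \<epsilon> N outs C \<and> depth C \<le> 2656
    \<and> circuit_size C \<le> J * (4000000 * (L * L)) + (200000000 * n + 31000 * (n * (\<tau> + 2) ^ 3 + blk n \<tau> * (H + 2) ^ 3))
    \<and> black_uses C \<le> J * (15 * L)"
proof -
  have J: "J \<ge> 1" using n by (cases J) auto
  have s8: "(2 ^ g) ^ 8 \<le> L" using g(2) by (simp add: power_mult[symmetric] mult.commute[of g 8]) (simp add: power_mult)
  have gL: "g + 2 \<le> L"
  proof -
    have "g + 1 < 2 ^ (g + 1)" by (rule less_exp)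
    also have "(2::nat) ^ (g + 1) \<le> 2 ^ (8 * g)" using g(1) by (intro power_increasing) auto
    also have "\<dots> \<le> L" using g(2) by (simp add: power_mult)
    finally show ?thesis by simp
  qed
  have "real L \<le> 256 ^ (g + 1)" using g(3) by (metis less_imp_le of_nat_le_iff of_nat_numeral of_nat_power)
  then have "4 * real L * (31 / 32) ^ 2 ^ g \<le> 4 * 256 ^ (g + 1) * (31 / 32) ^ 2 ^ g" by (intro mult_right_mono) auto
  then have err: "4 * real L * (31 / 32) ^ 2 ^ g \<le> 1" using majority_error[OF g(1)] by linarith
  obtain Lv G \<delta> \<Theta> where p: "Lv \<le> L" "G \<le> 2 * L" "L \<le> G" "\<delta> \<le> 1" "real J * \<delta> \<le> \<epsilon>"
    "\<And>x j. x < 2 ^ n \<Longrightarrow> j < J \<Longrightarrow> 2 ^ (j * h) * (real x / 2 ^ n) \<in> \<Theta>"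
    "Lv = L \<and> L = G \<and> (\<forall>\<theta>\<in>\<Theta>. 2 ^ G * \<theta> \<in> \<int>) \<and> \<delta> / 4 = 0
      \<or> Lv + 3 \<le> L \<and> (2 * 2 ^ g + 1) * 2 ^ L \<le> (2 :: int) ^ G \<and> \<delta> / 4 = 4 ^ (h + 7 + 1) / 4 ^ Lv"
    using cases
  proof
    assume nL: "n \<le> L"
    have "2 ^ L * (2 ^ (j * h) * (real x / 2 ^ n)) \<in> \<int>" for j x
    proof -
      have "(2::real) ^ L = 2 ^ (L - n) * 2 ^ n" using nL unfolding power_add[symmetric] by simp
      then have "2 ^ L * (2 ^ (j * h) * (real x / 2 ^ n)) = real (2 ^ (L - n) * (2 ^ (j * h) * x))" by simp
      then show ?thesis by (simp only: Ints_of_nat)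
    qed
    \<comment> \<open>Estimate, verification and shift all use the grid of step
      \<open>1 / 2 ^ L\<close>, and the error is 0.\<close>
    then show ?thesis using \<epsilon>
      by (intro that[of L L 0 "{\<theta>. 2 ^ L * \<theta> \<in> \<int>}"]) auto
  next
    assume a: "real J * 4 \<le> \<epsilon> * (16 * 4 ^ h)"
    \<comment> \<open>The factor 4 in front is the gain of the amplification, which also multiplies
      the wrong branches.\<close>
    define \<delta> :: real where "\<delta> = 4 * (4 ^ (h + 8) / 4 ^ (L - 3))"
    have "\<delta> \<le> 4 * (4 ^ (h + 8) / 4 ^ (2 * h + 10))"
      unfolding \<delta>_def using hL by (intro mult_left_mono divide_left_mono power_increasing) auto
    also have "\<dots> = 4 / (16 * 4 ^ h)"
    proof -
      have "2 * h + 10 = (h + 8) + (2 + h)" by simp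
      then have "(4::real) ^ (2 * h + 10) = 4 ^ (h + 8) * (4 ^ 2 * 4 ^ h)" by (simp only: power_add)
      then show ?thesis by simp
    qed
    finally have "real J * \<delta> \<le> real J * (4 / (16 * 4 ^ h))" by (rule mult_left_mono) simp
    also have "\<dots> \<le> \<epsilon>" using a by (simp add: field_simps)
    finally have Jd: "real J * \<delta> \<le> \<epsilon>" .
    have "1 * \<delta> \<le> real J * \<delta>" using J by (intro mult_right_mono) (auto simp: \<delta>_def)
    then have "\<delta> \<le> 1" using Jd \<epsilon> by simp
    moreover have "(2 * 2 ^ g + 1) * 2 ^ L \<le> (2 :: int) ^ (L + g + 2)"
    proof -
      have "(1::int) \<le> 2 ^ g" by simp
      then have "2 * 2 ^ g + 1 \<le> 4 * (2 :: int) ^ g" by linarith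
      then have "(2 * 2 ^ g + 1) * 2 ^ L \<le> 4 * 2 ^ g * (2 :: int) ^ L" by (rule mult_right_mono) simp
      then show ?thesis by (simp add: power_add mult_ac)
    qed
    \<comment> \<open>\<open>Lv = L - 3\<close> is what \<open>vr_near\<close> demands, and
      \<open>G = L + g + 2\<close> makes the grid finer than the degree.\<close>
    ultimately show ?thesis using Jd gL hL
      by (intro that[of "L - 3" "L + g + 2" \<delta> UNIV]) (auto simp: \<delta>_def)
  qed
  obtain \<rho> where win: "window g L Lv \<rho>" and run: "\<forall>\<theta>\<in>\<Theta>. \<forall>u. u = sems \<theta> (window.amp g L Lv G \<rho>) zero_state \<longrightarrow>
    (\<Sum>b\<in>asg (window.QQ g L Lv G). (cmod (u b))\<^sup>2) = 1 \<and>
    weight (window.QQ g L Lv G) (window.missed L G (h + 7) \<theta>) u \<le> 4 * (\<delta> / 4)"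
  proof -
    have "g \<ge> 1" "L \<ge> 1" using g(1) hL by auto
    from window_exists[OF this(1) p(1) this(2) err p(7)] show ?thesis
      by (elim exE conjE) (rule that)
  qed
  show ?thesis
  proof (rule assemble[OF win n(1,2,3) _ _ H p(4,5)])
    fix x j u
    assume "x < 2 ^ n" "j < J"
      "u = sems (2 ^ (j * h) * (real x / 2 ^ n)) (window.amp g L Lv G \<rho>) zero_state"
    then show "(\<Sum>b\<in>asg (window.QQ g L Lv G). (cmod (u b))\<^sup>2) = 1 \<and>
      weight (window.QQ g L Lv G) (window.missed L G (h + 7) (2 ^ (j * h) * (real x / 2 ^ n))) u \<le> \<delta>"
      using run[rule_format, OF p(6)[of x j], of u] by simp
  next
    show "prog_size (window.amp g L Lv G \<rho>) \<le> 4000000 * (L * L)"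
      by (rule window.size_amplify[OF win order_refl p(2) s8 refl])
    show "prog_blacks (window.amp g L Lv G \<rho>) \<le> 15 * L"
      by (rule window.blacks_amplify[OF win order_refl p(2) s8 refl])
  qed (use hL p(3) in auto)
qed

text \<open>Blocks have \<open>2 ^ (2 * lg l)\<close> positions, at least \<open>l ^ 2\<close> of
  them. The lower level costs the cube of \<open>O(log l)\<close> per position, which is
  \<open>O(l)\<close>; the upper level costs \<open>O(l ^ 3)\<close> for each of
  \<open>O(n / l ^ 2)\<close> blocks.\<close>

lemma two_level_cost:
  assumes "n \<ge> 1" "l \<ge> 1" "n \<le> 2 ^ l"
  shows "n * (2 * lg l + 2) ^ 3 + blk n (2 * lg l) * (lg (blk n (2 * lg l)) + 2) ^ 3 \<le> 320 * (n * l)"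
proof -
  define T where "T = lg l"
  define N where "N = blk n (2 * T)"
  have lT: "l < 2 ^ T" unfolding T_def by (rule lg_less)
  have T3: "(2 * T + 2) ^ 3 \<le> 192 * l"
  proof -
    have "(2 * T + 2) ^ 3 = 8 * (T + 1) ^ 3" by (simp add: power3_eq_cube algebra_simps)
    moreover have "(T + 1) ^ 3 \<le> 8 * 2 ^ T" by (rule cube_le_power)
    moreover have "2 ^ T \<le> 2 * l + 1" unfolding T_def by (rule power_lg_le)
    ultimately show ?thesis using assms(2) by linarith
  qed
  have N3: "N * (lg N + 2) ^ 3 \<le> 128 * (n * l)"
  proof (cases "n < 2 ^ (2 * T)")
    \<comment> \<open>With fewer positions than one block there is a single block, and the upper
      tree has constant cost.\<close>
    case True
    then have "N = 1" by (simp add: N_def blk_def)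
    moreover have "lg 1 \<le> 1" by (rule lg_le) simp
    then have "(lg 1 + 2) ^ 3 \<le> 3 ^ 3" by (intro power_mono) auto
    moreover have "1 * 1 \<le> n * l" using assms by (intro mult_mono) auto
    ultimately show ?thesis by (simp del: One_nat_def)
  next
    case False
    define Q where "Q = (2::nat) ^ (2 * T)"
    have nQ: "Q \<le> n" using False by (simp add: Q_def)
    have QT: "Q = 2 ^ T * 2 ^ T" by (simp add: Q_def mult_2 power_add)
    have lQ: "l * l \<le> Q" unfolding QT using lT by (intro mult_mono) auto
    have NQ: "N * Q \<le> 2 * n"
    proof -
      have "n div Q * Q \<le> n" by simp
      moreover have "N * Q = Q + n div Q * Q" by (simp add: N_def blk_def Q_def)
      ultimately show ?thesis using nQ by linarith
    qed
    have "2 * N \<le> 2 * n"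
    proof -
      have "2 \<le> Q"
      proof -
        have "2 ^ 1 \<le> (2::nat) ^ T" using lT assms(2) by (intro power_increasing) (cases T, auto)
        then have "2 * 1 \<le> (2::nat) ^ T * 2 ^ T" by (intro mult_mono) auto
        then show ?thesis by (simp add: QT)
      qed
      then have "N * 2 \<le> N * Q" by (rule mult_left_mono) simp
      then show ?thesis using NQ by linarith
    qed
    then have "N \<le> 2 ^ l" using assms(3) by linarith
    also have "\<dots> < (2::nat) ^ (l + 1)" by simp
    finally have "N < 2 ^ (l + 1)" .
    then have "lg N \<le> l + 1" by (rule lg_le)
    then have "(lg N + 2) ^ 3 \<le> (4 * l) ^ 3" using assms(2) by (intro power_mono) auto
    then have "N * (lg N + 2) ^ 3 \<le> N * (4 * l) ^ 3" by (rule mult_left_mono) simp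
    also have "\<dots> = 64 * (N * (l * l) * l)" by (simp add: power3_eq_cube mult_ac)
    also have "\<dots> \<le> 64 * (N * Q * l)" using lQ by (intro mult_left_mono mult_right_mono) auto
    also have "\<dots> \<le> 64 * (2 * n * l)" using NQ by (intro mult_left_mono mult_right_mono) auto
    finally show ?thesis by simp
  qed
  have "n * (2 * T + 2) ^ 3 \<le> n * (192 * l)" using T3 by (rule mult_left_mono) simp
  then have "n * (2 * T + 2) ^ 3 + N * (lg N + 2) ^ 3 \<le> n * (192 * l) + 128 * (n * l)" using N3 by (rule add_mono)
  also have "\<dots> = 320 * (n * l)" by simp
  finally show ?thesis unfolding T_def N_def .
qed

text \<open>The maximum with 1 gives the order bound a meaning when \<open>n = 1\<close> and
  \<open>\<epsilon>\<close> is close to 1, where the logarithm tends to 0. Depth and constant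
  precede \<open>n\<close> and \<open>\<epsilon>\<close>; independence of \<open>x\<close> is part
  of \<open>determines\<close>.\<close>

theorem theorem17:
  shows "\<exists>(d::nat) (K::real). \<forall>(n::nat) (\<epsilon>::real). n \<ge> 1 \<and> 0 < \<epsilon> \<and> \<epsilon> < 1 \<longrightarrow>
    (\<exists>N outs C. determines n \<epsilon> N outs C \<and> depth C \<le> d
       \<and> real (circuit_size C) \<le> K * (real n * max 1 (log 2 (real n / \<epsilon>)))
       \<and> real (black_uses C) \<le> K * (real n * max 1 (log 2 (real n / \<epsilon>))))"
proof -
  \<comment> \<open>\<open>256 ^ 12\<close> forces \<open>g \<ge> 12\<close>, the threshold of
    \<open>majority_error\<close>, for every \<open>L \<ge> c\<close>.\<close>
  define c :: nat where "c = 2 ^ 96"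
  have c: "c = 256 ^ 12" "c \<ge> 102" by (simp_all add: c_def)
  define K0 where "K0 = 8000000 * (c * c) + 200000000 + 31000 * 320"
  have main: "\<exists>N outs C. determines n \<epsilon> N outs C \<and> depth C \<le> 2656
       \<and> real (circuit_size C) \<le> real (2 * K0) * (real n * R) \<and> real (black_uses C) \<le> real (2 * K0) * (real n * R)"
    if n: "n \<ge> 1" and \<epsilon>: "0 < \<epsilon>" "\<epsilon> < 1" and R: "R = max 1 (log 2 (real n / \<epsilon>))" for n \<epsilon> R
  proof -
    define l where "l = nat \<lceil>R\<rceil>"
    have R1: "R \<ge> 1" by (simp add: R)
    then have Rl: "R \<le> real l" "real l \<le> R + 1" unfolding l_def by linarith+
    then have l1: "l \<ge> 1" using R1 by linarith
    have "real n / \<epsilon> = 2 powr (log 2 (real n / \<epsilon>))" using n \<epsilon> by simp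
    also have "\<dots> \<le> 2 powr real l" using Rl R by (intro powr_mono) auto
    also have "\<dots> = 2 ^ l" by (simp add: powr_realpow)
    finally have ne: "real n \<le> \<epsilon> * 2 ^ l" using \<epsilon> by (simp add: field_simps)
    also have "\<dots> \<le> 1 * 2 ^ l" using \<epsilon> by (intro mult_right_mono) auto
    finally have "real n \<le> real (2 ^ l)" by simp
    then have n2: "n \<le> 2 ^ l" by (simp only: of_nat_le_iff)
    \<comment> \<open>For \<open>n < l\<close> one would otherwise pay for a window longer than the
      number of bits; the minimum keeps the cost \<open>O(n * l)\<close>.\<close>
    define h where "h = min n l"
    have h: "h \<ge> 1" "h \<le> n" "h \<le> l" using n l1 by (auto simp: h_def)
    define L where "L = c * h"
    have L: "c \<le> L" "L \<noteq> 0" using h c by (simp_all add: L_def)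
    obtain g where g: "256 ^ g \<le> L" "L < 256 ^ (g + 1)"
      using ex_power_ivl1[of 256 L] L by auto
    have "(256::nat) ^ 12 < 256 ^ (g + 1)" using g L c by linarith
    then have "12 < g + 1" by (rule power_less_imp_less_exp[rotated]) simp
    then have g12: "g \<ge> 12" by simp
    \<comment> \<open>One window more than \<open>n div h\<close>, so that all positions are
      covered; \<open>h \<le> n\<close> keeps the excess within a factor 2.\<close>
    define J where "J = Suc (n div h)"
    have nJ: "n \<le> J * h" using dividend_less_div_times[of h n] h by (simp add: J_def less_imp_le)
    have "n div h * h \<le> n" by simp
    moreover have "J * h = h + n div h * h" by (simp add: J_def)
    ultimately have Jh: "J * h \<le> 2 * n" using h(2) by linarith
    have Jn: "J \<le> 2 * n" using Jh mult_left_mono[OF h(1), of J] by linarith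
    have hL: "2 * h + 100 \<le> L"
    proof -
      have "102 * h \<le> c * h" using c by (intro mult_right_mono) auto
      then show ?thesis using h unfolding L_def by linarith
    qed
    have cs: "n \<le> L \<or> real J * 4 \<le> \<epsilon> * (16 * 4 ^ h)"
    proof (cases "n \<le> l")
      case True
      then have "h = n" by (simp add: h_def)
      then show ?thesis using hL by simp
    next
      case False
      then have hl: "h = l" by (simp add: h_def)
      have "real J * 4 \<le> 8 * real n" using Jn by simp
      also have "\<dots> \<le> 8 * (\<epsilon> * 2 ^ l)" using ne by simp
      also have "\<dots> \<le> 16 * (\<epsilon> * 4 ^ l)" using \<epsilon> by (intro mult_mono mult_left_mono power_mono) auto
      finally show ?thesis by (simp add: hl)
    qed
    define \<tau> where "\<tau> = 2 * lg l"
    have "blk n \<tau> \<le> 2 ^ lg (blk n \<tau>)" using lg_less[of "blk n \<tau>"] by simp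
    from determines_exists[OF g12 g n h(1) nJ hL this \<epsilon> cs]
    obtain N outs C where C: "determines n \<epsilon> N outs C" "depth C \<le> 2656"
      "circuit_size C \<le> J * (4000000 * (L * L)) + (200000000 * n + 31000 * (n * (\<tau> + 2) ^ 3 + blk n \<tau> * (lg (blk n \<tau>) + 2) ^ 3))"
      "black_uses C \<le> J * (15 * L)" by blast
    have nl: "n \<le> n * l" using l1 by simp
    have "J * h * h \<le> 2 * n * l" by (rule mult_mono[OF Jh h(3)]) auto
    then have "4000000 * (c * c) * (J * h * h) \<le> 4000000 * (c * c) * (2 * n * l)" by (rule mult_left_mono) simp
    then have 1: "J * (4000000 * (L * L)) \<le> 8000000 * (c * c) * (n * l)" by (simp add: L_def mult_ac)
    have 2: "n * (\<tau> + 2) ^ 3 + blk n \<tau> * (lg (blk n \<tau>) + 2) ^ 3 \<le> 320 * (n * l)"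
      unfolding \<tau>_def by (rule two_level_cost[OF n l1 n2])
    have sz: "circuit_size C \<le> K0 * (n * l)"
    proof -
      have "circuit_size C \<le> 8000000 * (c * c) * (n * l) + (200000000 * (n * l) + 31000 * (320 * (n * l)))"
        by (rule order_trans[OF C(3)]) (intro add_mono mult_left_mono 1 2 nl; simp)
      also have "\<dots> = K0 * (n * l)" by (simp add: K0_def add_mult_distrib)
      finally show ?thesis .
    qed
    have "J * (15 * L) = 15 * c * (J * h)" by (simp add: L_def)
    also have "\<dots> \<le> 15 * c * (2 * n)" using Jh by (rule mult_left_mono) simp
    also have "\<dots> \<le> K0 * (n * l)"
    proof -
      have "30 * c \<le> c * c" using c by (intro mult_right_mono) auto
      then have "30 * c \<le> K0" unfolding K0_def by linarith
      then have "30 * c * n \<le> K0 * (n * l)" using nl by (rule mult_mono) auto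
      then show ?thesis by simp
    qed
    finally have bk: "black_uses C \<le> K0 * (n * l)" using C(4) by linarith
    have "real l \<le> 2 * R" using Rl R1 by linarith
    then have "real K0 * (real n * real l) \<le> real K0 * (real n * (2 * R))" by (intro mult_left_mono) auto
    then have fin: "real (K0 * (n * l)) \<le> real (2 * K0) * (real n * R)" by (simp add: mult_ac)
    have "real (circuit_size C) \<le> real (K0 * (n * l))" "real (black_uses C) \<le> real (K0 * (n * l))"
      using sz bk by (simp_all only: of_nat_le_iff)
    then show ?thesis using C(1,2) fin order_trans by blast
  qed
  show ?thesis
  proof (rule exI[of _ 2656], rule exI[of _ "real (2 * K0)"], intro allI impI)
    fix n :: nat and \<epsilon> :: real
    assume a: "n \<ge> 1 \<and> 0 < \<epsilon> \<and> \<epsilon> < 1"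
    show "\<exists>N outs C. determines n \<epsilon> N outs C \<and> depth C \<le> 2656
       \<and> real (circuit_size C) \<le> real (2 * K0) * (real n * max 1 (log 2 (real n / \<epsilon>)))
       \<and> real (black_uses C) \<le> real (2 * K0) * (real n * max 1 (log 2 (real n / \<epsilon>)))"
      by (rule main[OF _ _ _ refl]) (simp_all only: a)
  qed
qed

end
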